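(* Let $N\in\{2,3\}$. For every $c\in(0,\sqrt2)$ there exist $\bar T(c)>0$ and $M(c)>0$ such that for every $T>\bar T(c)$ there exists a non-constant $T$-periodic solution $\tilde\psi_T:\mathbb{R}^N\to\mathbb{C}$ of $$ ic\,\partial_{x_1}\psi+\Delta\psi+(1-|\psi|^2)\psi=0 $$ which is a mountain-pass solution for the functional $I_T^c: H^1_T(\mathbb{R}^N)\to\mathbb{R}$ and satisfies $$ 0<I_T^c(\tilde\psi_T)\le M(c), $$ where $M(c)$ is independent of $T$.
   Context: $T$-periodic means $T$-periodic in each of the variables $x_1,\dots,x_N$. $\mathbb{T}(T)=[0,T]^N$. For $z,w\in\mathbb{C}$ write $z\cdot w=\mathrm{Re}(z)\mathrm{Re}(w)+\mathrm{Im}(z)\mathrm{Im}(w)$. $H^1_T(\mathbb{R}^N)$ is the Sobolev space of complex-valued functions on $\mathbb{R}^N$ that are $T$-periodic in each variable and of class $H^1_{loc}$, regarded as a real Hilbert space with scalar product $\langle\phi,\psi\rangle=\int_{\mathbb{T}(T)}\left(\sum_{k=1}^N(\partial_{x_k}\phi)\cdot(\partial_{x_k}\psi)+\phi\cdot\psi\right)dx$. The action functional is $$ I_T^c(\psi)=\frac12\int_{\mathbb{T}(T)}|\nabla\psi|^2\,dx+\frac14\int_{\mathbb{T}(T)}(1-|\psi|^2)^2\,dx-\frac c2\int_{\mathbb{T}(T)}(i\,\partial_{x_1}\psi)\cdot\psi\,dx . $$ $T$-periodic (weak) solutions of the equation are the critical points of $I_T^c$ in $H^1_T(\mathbb{R}^N)$.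 The constant function $1$ satisfies $I_T^c(1)=0$. A solution $\psi$ is called a mountain-pass solution for $I_T^c$ if there is $e\in H^1_T(\mathbb{R}^N)$ with $I_T^c(e)<0$ such that $$ I_T^c(\psi)=\inf_{\alpha\in\Gamma}\max_{t\in[0,1]}I_T^c(\alpha(t))>\max\{I_T^c(1),I_T^c(e)\}, $$ where $\Gamma=\{\alpha:[0,1]\to H^1_T(\mathbb{R}^N)\text{ continuous}:\ \alpha(0)=1,\ \alpha(1)=e\}$. *)

theory Defs
  imports "HOL-Analysis.Analysis"
begin

text \<open>
  \<open>\<real>\<^sup>N\<close> is \<open>real ^ 'n\<close> with \<open>N = CARD('n)\<close>. Where the coordinate \<open>x\<^sub>1\<close> plays a special role it is
  passed as an index \<open>j :: 'n\<close>, since a general finite type has no distinguished first element.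
  Elements of Sobolev spaces are represented by functions; two functions are the same element if
  they agree almost everywhere.
\<close>

subsection \<open>Test functions and weak derivatives\<close>

definition partial :: "'n \<Rightarrow> (real ^ 'n \<Rightarrow> real) \<Rightarrow> real ^ 'n \<Rightarrow> real" where
  "partial k f x = frechet_derivative f (at x) (axis k 1)"

primrec times_differentiable :: "nat \<Rightarrow> (real ^ 'n \<Rightarrow> real) \<Rightarrow> bool" where
  "times_differentiable 0 f \<longleftrightarrow> continuous_on UNIV f"
| "times_differentiable (Suc m) f \<longleftrightarrow>
     f differentiable_on UNIV \<and> (\<forall>k. times_differentiable m (partial k f))"

definition test_function :: "(real ^ 'n \<Rightarrow> real) \<Rightarrow> bool" where
  "test_function \<phi> \<longleftrightarrow> (\<forall>m. times_differentiable m \<phi>) \<and> compact (closure {x. \<phi> x \<noteq> 0})"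

definition L1_loc :: "(real ^ 'n \<Rightarrow> complex) set" where
  "L1_loc = {f. \<forall>K. compact K \<longrightarrow> set_integrable lebesgue K f}"

definition L2_loc :: "(real ^ 'n \<Rightarrow> complex) set" where
  "L2_loc = {f \<in> borel_measurable lebesgue.
     \<forall>K. compact K \<longrightarrow> set_integrable lebesgue K (\<lambda>x. (cmod (f x))\<^sup>2)}"

definition is_weak_partial ::
    "'n \<Rightarrow> (real ^ 'n \<Rightarrow> complex) \<Rightarrow> (real ^ 'n \<Rightarrow> complex) \<Rightarrow> bool" where
  "is_weak_partial k f g \<longleftrightarrow> f \<in> L1_loc \<and> g \<in> L1_loc \<and>
     (\<forall>\<phi>. test_function \<phi> \<longrightarrow>
        (\<integral>x. partial k \<phi> x *\<^sub>R f x \<partial>lebesgue) = - (\<integral>x. \<phi> x *\<^sub>R g x \<partial>lebesgue))"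

text \<open>The weak derivative is unique only up to null sets; an arbitrary representative is chosen.\<close>

definition weak_partial :: "'n \<Rightarrow> (real ^ 'n \<Rightarrow> complex) \<Rightarrow> real ^ 'n \<Rightarrow> complex" where
  "weak_partial k f = (SOME g. is_weak_partial k f g)"

definition H1_loc :: "(real ^ 'n \<Rightarrow> complex) set" where
  "H1_loc = {f \<in> L2_loc. \<forall>k. \<exists>g \<in> L2_loc. is_weak_partial k f g}"

subsection \<open>The space \<open>H\<^sup>1\<^sub>T\<close>\<close>

definition periodic :: "real \<Rightarrow> (real ^ 'n \<Rightarrow> complex) \<Rightarrow> bool" where
  "periodic T f \<longleftrightarrow> (\<forall>k x. f (x + axis k T) = f x)"

text \<open>
  Periodicity is required everywhere: an almost everywhere periodic function
  has an everywhere periodic representative.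
\<close>

definition H1_per :: "real \<Rightarrow> (real ^ 'n \<Rightarrow> complex) set" where
  "H1_per T = {f \<in> H1_loc. periodic T f}"

definition cell :: "real \<Rightarrow> (real ^ 'n) set" where
  "cell T = {x. \<forall>k. 0 \<le> x $ k \<and> x $ k \<le> T}"

text \<open>
  The library's inner product on \<^typ>\<open>complex\<close> is \<open>Re z * Re w + Im z * Im w\<close>.
\<close>

definition H1_inner :: "real \<Rightarrow> (real ^ 'n \<Rightarrow> complex) \<Rightarrow> (real ^ 'n \<Rightarrow> complex) \<Rightarrow> real" where
  "H1_inner T \<phi> \<psi> = set_lebesgue_integral lebesgue (cell T)
     (\<lambda>x. (\<Sum>k\<in>UNIV. weak_partial k \<phi> x \<bullet> weak_partial k \<psi> x) + \<phi> x \<bullet> \<psi> x)"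

definition H1_norm :: "real \<Rightarrow> (real ^ 'n \<Rightarrow> complex) \<Rightarrow> real" where
  "H1_norm T \<psi> = sqrt (H1_inner T \<psi> \<psi>)"

subsection \<open>The action functional, its critical points, and the equation\<close>

definition action :: "'n \<Rightarrow> real \<Rightarrow> real \<Rightarrow> (real ^ 'n \<Rightarrow> complex) \<Rightarrow> real" where
  "action j T c \<psi> =
     1/2 * set_lebesgue_integral lebesgue (cell T) (\<lambda>x. \<Sum>k\<in>UNIV. (cmod (weak_partial k \<psi> x))\<^sup>2)
   + 1/4 * set_lebesgue_integral lebesgue (cell T) (\<lambda>x. (1 - (cmod (\<psi> x))\<^sup>2)\<^sup>2)
   - c/2 * set_lebesgue_integral lebesgue (cell T) (\<lambda>x. (\<i> * weak_partial j \<psi> x) \<bullet> \<psi> x)"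

text \<open>
  \<open>\<psi>\<close> is a critical point of \<open>J\<close> on \<open>H\<^sup>1\<^sub>T\<close> if \<open>J\<close> is Frechet differentiable at \<open>\<psi>\<close>
  with derivative zero: \<open>J (\<psi> + h) - J \<psi> = o(\<parallel>h\<parallel>)\<close>.
\<close>

definition critical_point ::
    "real \<Rightarrow> ((real ^ 'n \<Rightarrow> complex) \<Rightarrow> real) \<Rightarrow> (real ^ 'n \<Rightarrow> complex) \<Rightarrow> bool" where
  "critical_point T J \<psi> \<longleftrightarrow> \<psi> \<in> H1_per T \<and>
     (\<forall>\<epsilon>>0. \<exists>\<delta>>0. \<forall>h \<in> H1_per T. H1_norm T h < \<delta> \<longrightarrow>
        \<bar>J (\<lambda>x. \<psi> x + h x) - J \<psi>\<bar> \<le> \<epsilon> * H1_norm T h)"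

text \<open>
  The equation \<open>i c \<partial>\<^sub>j \<psi> + \<Delta> \<psi> + (1 - |\<psi>|\<^sup>2) \<psi> = 0\<close> in the sense of distributions on \<open>\<real>\<^sup>N\<close>,
  with the Laplacian integrated by parts once. Since the identity is complex valued,
  real test functions suffice.
\<close>

definition solves_equation :: "'n \<Rightarrow> real \<Rightarrow> (real ^ 'n \<Rightarrow> complex) \<Rightarrow> bool" where
  "solves_equation j c \<psi> \<longleftrightarrow> \<psi> \<in> H1_loc \<and>
     (\<lambda>x. of_real (1 - (cmod (\<psi> x))\<^sup>2) * \<psi> x) \<in> L1_loc \<and>
     (\<forall>\<phi>. test_function \<phi> \<longrightarrow>
        (\<integral>x. \<phi> x *\<^sub>R (\<i> * of_real c * weak_partial j \<psi> x)
             - (\<Sum>k\<in>UNIV. partial k \<phi> x *\<^sub>R weak_partial k \<psi> x)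
             + \<phi> x *\<^sub>R (of_real (1 - (cmod (\<psi> x))\<^sup>2) * \<psi> x) \<partial>lebesgue) = 0)"

text \<open>
  Periodic solutions are the critical points of the action on \<open>H\<^sup>1\<^sub>T\<close>; the equation itself is
  recorded as well, so that the notion does not rest on the Euler-Lagrange correspondence.
\<close>

definition periodic_solution :: "'n \<Rightarrow> real \<Rightarrow> real \<Rightarrow> (real ^ 'n \<Rightarrow> complex) \<Rightarrow> bool" where
  "periodic_solution j T c \<psi> \<longleftrightarrow> critical_point T (action j T c) \<psi> \<and> solves_equation j c \<psi>"

subsection \<open>Mountain-pass solutions\<close>

definition paths ::
    "real \<Rightarrow> (real ^ 'n \<Rightarrow> complex) \<Rightarrow> (real ^ 'n \<Rightarrow> complex) \<Rightarrow> (real \<Rightarrow> real ^ 'n \<Rightarrow> complex) set" where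
  "paths T a e = {\<alpha>. (\<forall>t\<in>{0..1}. \<alpha> t \<in> H1_per T) \<and>
     (\<forall>t\<in>{0..1}. ((\<lambda>s. H1_norm T (\<lambda>x. \<alpha> s x - \<alpha> t x)) \<longlongrightarrow> 0) (at t within {0..1})) \<and>
     (AE x in lebesgue. \<alpha> 0 x = a x) \<and> (AE x in lebesgue. \<alpha> 1 x = e x)}"

text \<open>
  The inner supremum is a maximum when \<open>N \<le> 4\<close>, because the action is then continuous on \<open>H\<^sup>1\<^sub>T\<close>.
\<close>

definition mountain_pass :: "'n \<Rightarrow> real \<Rightarrow> real \<Rightarrow> (real ^ 'n \<Rightarrow> complex) \<Rightarrow> bool" where
  "mountain_pass j T c \<psi> \<longleftrightarrow> (\<exists>e \<in> H1_per T. action j T c e < 0 \<and>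
     action j T c \<psi> = (INF \<alpha>\<in>paths T (\<lambda>x. 1) e. SUP t\<in>{0..1}. action j T c (\<alpha> t)) \<and>
     action j T c \<psi> > max (action j T c (\<lambda>x. 1)) (action j T c e))"

end

theory Submission
 imports Defs "HOL-Library.Function_Algebras" "HOL-Library.Diagonal_Subsequence"
  "HOL-Computational_Algebra.Polynomial"
begin

text \<open>
The action is bounded from below on \<open>H\<^sup>1\<^sub>T\<close> and coercive, because the quartic potential dominates the momentum
term: \<open>c/2 |<i \<partial>\<^sub>j u, u>|\<close> is at most a quarter of the Dirichlet integral plus \<open>c\<^sup>2/4\<close> times the squared \<open>L\<^sup>2\<close>
norm. The whole difficulty is therefore the mountain-pass geometry around the constant \<open>1\<close>, with constants that
do not depend on \<open>T\<close> where the theorem asks for it.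

\<^emph>\<open>The wall.\<close> The action is invariant under multiplication by unimodular constants, so \<open>1\<close> is not a strict local
minimum; but near the circle of these constants the action is positive off the circle. Put \<open>w = a (1 + h)\<close> with \<open>|a| = 1\<close> chosen such that
\<open>h\<close> has real mean. The second variation at \<open>1\<close> is the Dirichlet integral minus a momentum term, plus twice the squared norm
of \<open>Re h\<close>; after an integration by parts the momentum is a multiple of the pairing of \<open>Re h\<close> with \<open>\<partial>\<^sub>j Im h\<close>, and Young's
inequality shows that the form controls \<open>grad h\<close> and \<open>Re h\<close> for \<open>c < sqrt 2\<close>, the speed of sound. The Poincare
inequality controls \<open>Im h\<close>, whose mean vanishes, and the \<open>L\<^sup>4\<close> embedding absorbs the higher-order terms. Every path
from \<open>1\<close> to a point of negative action has to cross a sphere around the circle on which the action has a positive lower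
bound (\<open>path_crosses_barrier\<close>).

\<^emph>\<open>The low path.\<close> Slow plane waves \<open>exp (- i c x\<^sub>j / 2)\<close> have the negative action density \<open>- c\<^sup>2/8\<close>. One full turn of such a wave
returns to the value at which it began, so it can be glued to the constant \<open>1\<close> in the direction \<open>j\<close>; in the other
directions it is cut off at a large distance \<open>R\<close>. The gain grows like the volume \<open>R\<^sup>N\<^sup>-\<^sup>1\<close>, the cost of the
cut-off only like its boundary, so a large \<open>R\<close> gives negative action. The perturbation has compact support, fits into every
large cell, and the segment that joins it to \<open>1\<close> has an action bounded independently of \<open>T\<close>
(\<open>test_path\<close>). This is the number \<open>M\<close>.

\<^emph>\<open>The critical point.\<close> The mountain-pass theorem (\<open>mountain_pass_abstract\<close>) needs bounded Palais-Smale sequences to be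
precompact. They are bounded by coercivity; Rellich's theorem gives convergence in \<open>L\<^sup>2\<close>, interpolation with the
subcritical embedding (\<open>N \<le> 3\<close>) convergence in \<open>L\<^sup>4\<close>, and then the equation satisfied up to a small error gives
convergence of the gradients (\<open>palais_smale\<close>). Testing a critical point with periodized test functions gives the
equation on the whole space. Constants are excluded because a constant critical point has modulus \<open>1\<close> and action \<open>0\<close>,
or is \<open>0\<close> and has action \<open>T\<^sup>N/4\<close>, which exceeds \<open>M\<close> for large \<open>T\<close>.

The embeddings come from averages over small cubes. The function and its average over a cube of side
\<open>s\<close> differ in \<open>L\<^sup>2\<close> by at most \<open>s\<close> times the gradient norm (\<open>avg_error\<close>). With \<open>s = T\<close> this is Poincare's inequality;
with \<open>s\<close> tending to zero along a geometric sequence it gives the \<open>L\<^sup>4\<close> embedding; and since averages of a bounded sequence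
are equicontinuous it gives Rellich's theorem.
\<close>

abbreviation wp where "wp == weak_partial"

abbreviation bmeas where "bmeas == borel_measurable"

abbreviation ind where "ind == indicat_real"

abbreviation leb where "leb == lebesgue"

abbreviation seq_lim (infix "--->" 60) where "X ---> L == X \<longlonglongrightarrow> L"

notation scaleR (infixr "*R" 75)

section \<open>The mountain-pass theorem in a semi-Hilbert space\<close>

instantiation "fun" :: (type, real_vector) real_vector
begin
definition scaleR_fun :: "real => ('a => 'b) => 'a => 'b" where
 "scaleR_fun r f = (%x. r *R f x)"
instance
 by standard (auto simp: scaleR_fun_def plus_fun_def fun_eq_iff scaleR_add_right scaleR_add_left)
end

text \<open>
Elements of \<open>H\<^sup>1\<^sub>T\<close> are functions rather than classes, so the form is only semidefinite and limits are unique only up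
to distance zero. The set \<open>S\<close> sits inside a vector space of functions whose other members have no norm; this is why the
hypotheses are relative to \<open>S\<close>.
\<close>

locale semi_hilbert =
 fixes S :: "'a::real_vector set" and ip :: "'a => 'a => real" and nrm :: "'a => real"
 assumes sub: "subspace S"
  and ip_add: "!!u v w. u \<in> S ==> v \<in> S ==> w \<in> S ==> ip (u + v) w = ip u w + ip v w"
  and ip_scale: "!!u w r. u \<in> S ==> w \<in> S ==> ip (r *R u) w = r * ip u w"
  and ip_sym: "!!u v. u \<in> S ==> v \<in> S ==> ip u v = ip v u"
  and ip_nonneg: "!!u. u \<in> S ==> 0 <= ip u u"
  and nrm_def: "!!u. nrm u = sqrt (ip u u)"
  and complete: "!!f. (!!n::nat. f n \<in> S) ==>
   (!!e. e > 0 ==> EX N. ALL m>=N. ALL n>=N. nrm (f m - f n) < e) ==>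
   EX u:S. (%n. nrm (f n - u)) ---> 0"
begin

lemma S_add [intro]: "u \<in> S ==> v \<in> S ==> u + v \<in> S"
 and S_diff [intro]: "u \<in> S ==> v \<in> S ==> u - v \<in> S"
 and S_scale [intro]: "u \<in> S ==> r *R u \<in> S"
 using sub by (auto simp: subspace_add subspace_diff subspace_scale)

lemma ip_add_right: "u \<in> S ==> v \<in> S ==> w \<in> S ==> ip w (u + v) = ip w u + ip w v"
 using ip_add[of u v w] ip_sym[of w "u+v"] ip_sym[of w u] ip_sym[of w v] by auto

lemma ip_scale_right: "u \<in> S ==> w \<in> S ==> ip w (r *R u) = r * ip w u"
 using ip_scale[of u w r] ip_sym[of w "r *R u"] ip_sym[of w u] by auto

lemma ip_diff: "u \<in> S ==> v \<in> S ==> w \<in> S ==> ip (u - v) w = ip u w - ip v w"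
 using ip_add[of u "(-1) *R v" w] ip_scale[of v w "-1"] S_scale[of v "-1"] by simp

lemma nrm_nonneg [simp]: "u \<in> S ==> 0 <= nrm u"
 by (simp add: nrm_def ip_nonneg)

lemma nrm_sq: "u \<in> S ==> (nrm u)^2 = ip u u"
 by (simp add: nrm_def ip_nonneg)

lemma nrm_scale: "u \<in> S ==> nrm (r *R u) = \<bar>r\<bar> * nrm u"
 using ip_scale[of u "r *R u" r] ip_scale_right[of u u r] S_scale[of u r]
 by (simp add: nrm_def real_sqrt_mult power2_eq_square[symmetric] mult.assoc[symmetric])

lemma ip_quadratic:
 assumes "u \<in> S" "v \<in> S"
 shows "ip (u + t *R v) (u + t *R v) = ip u u + 2 * t * ip u v + t^2 * ip v v"
proof -
 have "ip (u + t *R v) (u + t *R v) = ip u u + t * ip u v + t * ip v u + t * t * ip v v"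
  using assms S_scale[of v t]
  by (simp add: ip_add ip_add_right ip_scale ip_scale_right S_add algebra_simps)
 thus ?thesis using ip_sym[OF assms] by (simp add: power2_eq_square)
qed

text \<open>
The discriminant argument in the form that is used to pass from a minimizer to its Euler-Lagrange equation.
\<close>

lemma quadratic_nonneg_imp_zero:
 fixes a b :: real
 assumes "!!t. 0 <= t * a + t^2 * b" "b >= 0"
 shows "a = 0"
proof (rule ccontr)
 assume a: "a ~= 0"
 define t where "t = - a / (2 * (b + 1))"
 have b1: "b + 1 > 0" using assms by simp
 have "t * a + t^2 * b = a^2 * (b / (4 * (b+1)^2) - 1 / (2 * (b+1)))"
  using b1 by (simp add: t_def field_simps power2_eq_square)
 also have "b / (4 * (b+1)^2) - 1 / (2 * (b+1)) = - (b + 2) / (4 * (b+1)^2)"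
  using b1 by (simp add: divide_simps power2_eq_square) (simp add: algebra_simps)
 also have "a^2 * (- (b + 2) / (4 * (b+1)^2)) < 0"
  using a assms b1 by (intro mult_pos_neg) (auto simp: divide_neg_pos)
 finally show False using assms(1)[of t] by simp
qed

lemma cauchy_schwarz:
 assumes "u \<in> S" "v \<in> S"
 shows "\<bar>ip u v\<bar> <= nrm u * nrm v"
proof -
 have q: "0 <= ip u u + 2 * t * ip u v + t^2 * ip v v" for t
  using ip_quadratic[OF assms, of t] ip_nonneg[of "u + t *R v"] assms by auto
 have "(ip u v)^2 <= ip u u * ip v v"
 proof (cases "ip v v = 0")
  case True
  have "ip u v = 0"
  proof (rule ccontr)
   assume "ip u v ~= 0"
   then have "2 * (- (ip u u + 1) / (2 * ip u v)) * ip u v = - (ip u u + 1)" by (simp add: field_simps)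
   with q[of "- (ip u u + 1) / (2 * ip u v)"] True show False by simp
  qed
  with True show ?thesis by simp
 next
  case False
  then have p: "ip v v > 0" using ip_nonneg[OF assms(2)] by simp
  have "0 <= ip u u + 2 * (- ip u v / ip v v) * ip u v + (- ip u v / ip v v)^2 * ip v v" by (rule q)
  also have "... = ip u u - (ip u v)^2 / ip v v" using p by (simp add: field_simps power2_eq_square)
  finally show ?thesis using p by (simp add: field_simps)
 qed
 then have "sqrt ((ip u v)^2) <= sqrt (ip u u * ip v v)" by (rule real_sqrt_le_mono)
 thus ?thesis by (simp add: nrm_def real_sqrt_mult)
qed

lemma nrm_triangle:
 assumes "u \<in> S" "v \<in> S"
 shows "nrm (u + v) <= nrm u + nrm v"
proof -
 have "(nrm (u + v))^2 = ip u u + 2 * ip u v + ip v v"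
  using ip_quadratic[OF assms, of 1] assms by (simp add: nrm_sq S_add)
 also have "... <= ip u u + 2 * (nrm u * nrm v) + ip v v"
  using cauchy_schwarz[OF assms] by simp
 also have "... = (nrm u + nrm v)^2"
  unfolding nrm_sq[OF assms(1), symmetric] nrm_sq[OF assms(2), symmetric]
  by (simp add: power2_eq_square algebra_simps)
 finally show ?thesis
  by (rule power2_le_imp_le) (simp add: assms)
qed

lemma nrm_minus: "u \<in> S ==> v \<in> S ==> nrm (u - v) = nrm (v - u)"
 using nrm_scale[OF S_diff, of v u "-1"] by simp

lemma nrm_triangle': assumes "u \<in> S" "v \<in> S" shows "nrm (u - v) <= nrm u + nrm v"
 using nrm_triangle[OF assms(1) S_scale[OF assms(2), of "-1"]] nrm_scale[OF assms(2), of "-1"] by simp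

lemma nrm_zero [simp]: "nrm 0 = 0"
 using nrm_scale[of 0 0] subspace_0[OF sub] by simp

lemma ip_tendsto:
 assumes "!!n. f n \<in> S" "u \<in> S" "v \<in> S" "(%n. nrm (f n - u)) ---> 0"
 shows "(%n. ip (f n) v) ---> ip u v"
proof (rule LIM_zero_cancel, rule Lim_null_comparison)
 show "\<forall>\<^sub>F n in sequentially. norm (ip (f n) v - ip u v) <= nrm (f n - u) * nrm v"
  using cauchy_schwarz[of "f _ - u" v] assms by (auto simp: ip_diff S_diff)
 show "(%n. nrm (f n - u) * nrm v) ---> 0"
  using tendsto_mult_right[OF assms(4), of "nrm v"] by simp
qed

text \<open>
The functional \<open>ip v v / 2 - l v\<close> is bounded from below, the parallelogram identity makes its minimizing sequences Cauchy,
and the limit represents \<open>l\<close>. Its only role is to turn derivatives into gradients.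
\<close>

lemma riesz:
 assumes add: "!!u v. u \<in> S ==> v \<in> S ==> l (u + v) = l u + l v"
  and sc: "!!u r. u \<in> S ==> l (r *R u) = r * l u"
  and bd: "!!u. u \<in> S ==> \<bar>l u\<bar> <= K * nrm u"
 shows "EX w:S. ALL v:S. ip w v = l v"
proof -
 define J where "J v = ip v v / 2 - l v" for v
 have lower: "- (K^2) / 2 <= J v" if "v \<in> S" for v
 proof -
  have "0 <= (nrm v - K)^2" by simp
  then have "- (K^2) / 2 <= (nrm v)^2 / 2 - K * nrm v" by (simp add: power2_eq_square algebra_simps)
  also have "... <= J v" using bd[OF that] by (simp add: J_def nrm_sq that)
  finally show ?thesis .
 qed
 define m where "m = Inf (J ` S)"
 have bb: "bdd_below (J ` S)" using lower by (intro bdd_belowI2)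
 have ne: "J ` S ~= {}" using subspace_0[OF sub] by auto
 have m: "m <= J v" if "v \<in> S" for v unfolding m_def by (rule cInf_lower) (use that bb in auto)
 have "EX v:S. J v < m + 1 / Suc n" for n
  using cInf_lessD[OF ne, of "m + 1 / Suc n"] by (auto simp: m_def)
 then obtain f where f: "!!n. f n \<in> S" "!!n. J (f n) < m + 1 / Suc n" by metis
 have par: "ip (u - v) (u - v) <= 4 * (J u - m) + 4 * (J v - m)" if "u \<in> S" "v \<in> S" for u v
 proof -
  have i1: "ip (u - v) (u - v) = ip u u - 2 * ip u v + ip v v"
   using ip_quadratic[OF that, of "-1"] by simp
  define z where "z = (1/2) *R (u + 1 *R v)"
  have z: "z \<in> S" using that by (auto simp: z_def)
  have "ip z z = (1/4) * (ip u u + 2 * ip u v + ip v v)"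
   using ip_quadratic[OF that, of 1] that
   unfolding z_def by (simp add: ip_scale ip_scale_right S_add S_scale)
  moreover have "l z = (l u + l v) / 2"
   unfolding z_def using that by (simp add: sc add S_add)
  moreover have "m <= J z" by (rule m[OF z])
  ultimately show ?thesis using i1 by (simp add: J_def)
 qed
 have cau: "EX N. ALL m>=N. ALL n>=N. nrm (f m - f n) < e" if "e > 0" for e
 proof -
  obtain N where N: "real N > 8 / e^2" using reals_Archimedean2 by blast
  { fix p q assume pq: "p >= N" "q >= N"
   have s: "1 / Suc k < e^2 / 8" if "k >= N" for k
   proof -
    have "8 / e^2 < real (Suc k)" using N that by simp
    thus ?thesis using \<open>e > 0\<close> by (simp add: field_simps)
   qed
   have "ip (f p - f q) (f p - f q) <= 4 * (J (f p) - m) + 4 * (J (f q) - m)" by (rule par) (rule f)+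
   also have "... < 4 * (e^2/8) + 4 * (e^2/8)"
    using less_trans[OF f(2)[of p] add_strict_left_mono[OF s[OF pq(1)]]]
     less_trans[OF f(2)[of q] add_strict_left_mono[OF s[OF pq(2)]]] by simp
   finally have "(nrm (f p - f q))^2 < e^2" using f by (simp add: nrm_sq S_diff)
   then have "nrm (f p - f q) < e" using \<open>e > 0\<close> by (simp add: power_less_imp_less_base) }
  thus ?thesis by blast
 qed
 obtain w where w: "w \<in> S" "(%n. nrm (f n - w)) ---> 0" using complete[OF f(1) cau] by blast
 have "ip w v = l v" if v: "v \<in> S" for v
 proof -
  have "0 <= t * (ip w v - l v) + t^2 * (ip v v / 2)" for t
  proof (rule LIMSEQ_le_const)
   have "(%n. t * (ip (f n) v - l v) + t^2 * (ip v v / 2) + 1 / Suc n) ---> t * (ip w v - l v) + t^2 * (ip v v / 2) + 0"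
    by (intro tendsto_intros ip_tendsto f w v LIMSEQ_Suc[OF lim_1_over_n])
   thus "(%n. t * (ip (f n) v - l v) + t^2 * (ip v v / 2) + 1 / Suc n) ---> t * (ip w v - l v) + t^2 * (ip v v / 2)" by simp
   have "0 <= t * (ip (f n) v - l v) + t^2 * (ip v v / 2) + 1 / Suc n" for n
   proof -
    have "m <= J (f n + t *R v)" using f v by (intro m) auto
    also have "... = J (f n) + t * (ip (f n) v - l v) + t^2 * (ip v v / 2)"
     using ip_quadratic[OF f(1) v, of n t] f v by (simp add: J_def add sc S_scale algebra_simps add_divide_distrib)
    finally show ?thesis using f(2)[of n] by simp
   qed
   thus "EX N. ALL n>=N. 0 <= t * (ip (f n) v - l v) + t^2 * (ip v v / 2) + 1 / Suc n" by blast
  qed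
  from quadratic_nonneg_imp_zero[OF this] show ?thesis using ip_nonneg[OF v] by simp
 qed
 with w show ?thesis by blast
qed

text \<open>
Continuity with respect to the seminorm cannot be expressed by the topology of the function type.
\<close>

definition cpath :: "(real => 'a) => bool" where
 "cpath \<alpha> \<longleftrightarrow> (ALL t:{0..1}. \<alpha> t \<in> S) \<and>
   (ALL t:{0..1}. ((%s. nrm (\<alpha> s - \<alpha> t)) \<longlongrightarrow> 0) (at t within {0..1}))"

lemma cpath_continuous:
 assumes "cpath \<alpha>"
  and F: "!!u. u \<in> S ==> EX L. ALL h:S. nrm h <= 1 --> \<bar>F (u + h) - F u\<bar> <= L * nrm h"
 shows "continuous_on {0..1} (%t. F (\<alpha> t) :: real)"
 unfolding continuous_on_def
proof
 fix t :: real assume t: "t \<in> {0..1}"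
 have S: "\<alpha> s \<in> S" if "s \<in> {0..1}" for s using assms(1) that by (auto simp: cpath_def)
 obtain L where L: "!!h. h \<in> S ==> nrm h <= 1 ==> \<bar>F (\<alpha> t + h) - F (\<alpha> t)\<bar> <= L * nrm h" using F[OF S[OF t]] by blast
 have lim: "((%s. nrm (\<alpha> s - \<alpha> t)) \<longlongrightarrow> 0) (at t within {0..1})" using assms(1) t by (auto simp: cpath_def)
 have ev: "\<forall>\<^sub>F s in at t within {0..1}. nrm (\<alpha> s - \<alpha> t) < 1" using lim by (rule order_tendstoD) simp
 have "((%s. F (\<alpha> s) - F (\<alpha> t)) \<longlongrightarrow> 0) (at t within {0..1})"
 proof (rule Lim_null_comparison)
  show "\<forall>\<^sub>F s in at t within {0..1}. norm (F (\<alpha> s) - F (\<alpha> t)) <= L * nrm (\<alpha> s - \<alpha> t)"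
   using ev unfolding eventually_at_filter
  proof eventually_elim
   case (elim s)
   show ?case
   proof (intro impI)
    assume "s ~= t" "s \<in> {0..1}"
    then show "norm (F (\<alpha> s) - F (\<alpha> t)) <= L * nrm (\<alpha> s - \<alpha> t)"
     using elim L[of "\<alpha> s - \<alpha> t"] S[of s] S[OF t] by (simp add: S_diff)
   qed
  qed
  show "((%s. L * nrm (\<alpha> s - \<alpha> t)) \<longlongrightarrow> 0) (at t within {0..1})" using tendsto_mult_left[OF lim, of L] by simp
 qed
 thus "((%s. F (\<alpha> s)) \<longlongrightarrow> F (\<alpha> t)) (at t within {0..1})" by (rule LIM_zero_cancel)
qed

lemma le_if_sq_le_mult: "a^2 <= b * a ==> 0 <= a ==> 0 <= b ==> a <= (b::real)"
 by (cases "a = 0") (auto simp: power2_eq_square)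

text \<open>
The classical deformation argument, with a single explicit Euler step along the gradient instead of a flow: since the derivative is
Lipschitz on bounded sets, a step of fixed length \<open>\<tau>\<close> already decreases \<open>I\<close> by a definite amount wherever the gradient
exceeds \<open>\<delta>\<close>. If there were no almost critical point near level \<open>c\<close>, the step would push a nearly optimal path below \<open>c\<close>.
The end points are prescribed by predicates because in \<open>H\<^sup>1\<^sub>T\<close> they are known only almost everywhere.
\<close>

theorem mountain_pass_abstract:
 fixes I :: "'a => real" and dI :: "'a => 'a => real"
 assumes add: "!!u v w. u \<in> S ==> v \<in> S ==> w \<in> S ==> dI u (v + w) = dI u v + dI u w"
  and sc: "!!u v r. u \<in> S ==> v \<in> S ==> dI u (r *R v) = r * dI u v"
  and reg: "!!R. EX L>=0. ALL u:S. nrm u <= R -->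
    (ALL v:S. \<bar>dI u v\<bar> <= L * nrm v) \<and>
    (ALL w:S. nrm w <= R --> (ALL v:S. \<bar>dI u v - dI w v\<bar> <= L * nrm (u - w) * nrm v)) \<and>
    (ALL h:S. nrm h <= 1 --> \<bar>I (u + h) - I u - dI u h\<bar> <= L * (nrm h)^2)"
  and coercive: "!!K. EX R. ALL u:S. I u <= K --> nrm u <= R"
  and ps: "!!f R. (!!n::nat. f n \<in> S) ==> (!!n. nrm (f n) <= R) ==>
    (!!n v. v \<in> S ==> \<bar>dI (f n) v\<bar> <= 1 / Suc n * nrm v) ==>
    EX r u. strict_mono r \<and> u \<in> S \<and> (%n. nrm (f (r n) - u)) ---> 0"
  and \<Gamma>: "\<Gamma> = {\<alpha>. cpath \<alpha> \<and> Q0 (\<alpha> 0) \<and> Q1 (\<alpha> 1)}" "\<Gamma> ~= {}"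
  and ends: "!!u. u \<in> S ==> Q0 u \<or> Q1 u ==> I u <= \<kappa>'"
  and barrier: "!!\<alpha>. \<alpha> \<in> \<Gamma> ==> EX t:{0..1}. \<kappa> <= I (\<alpha> t)" "\<kappa>' < \<kappa>"
 defines "c \<equiv> (INF \<alpha>\<in>\<Gamma>. SUP t\<in>{0..1}. I (\<alpha> t))"
 shows "\<kappa> <= c \<and> (ALL \<alpha>:\<Gamma>. c <= (SUP t\<in>{0..1}. I (\<alpha> t))) \<and> (EX u:S. I u = c \<and> (ALL v:S. dI u v = 0))"
proof -
 have Icont: "EX L. ALL h:S. nrm h <= 1 --> \<bar>I (u + h) - I u\<bar> <= L * nrm h" if u: "u \<in> S" for u
 proof -
  obtain L where L: "L >= 0" "!!v. v \<in> S ==> \<bar>dI u v\<bar> <= L * nrm v"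
   "!!h. h \<in> S ==> nrm h <= 1 ==> \<bar>I (u + h) - I u - dI u h\<bar> <= L * (nrm h)^2"
   using reg[of "nrm u"] u by blast
  have "\<bar>I (u + h) - I u\<bar> <= 2 * L * nrm h" if h: "h \<in> S" "nrm h <= 1" for h
  proof -
   have "(nrm h)^2 <= nrm h" using h by (simp add: power2_eq_square mult_left_le)
   then have "L * (nrm h)^2 <= L * nrm h" using L by (intro mult_left_mono) auto
   with L(2)[OF h(1)] L(3)[OF h] show ?thesis by linarith
  qed
  thus ?thesis by blast
 qed
 have cont: "continuous_on {0..1} (%t. I (\<alpha> t))" if "cpath \<alpha>" for \<alpha>
  by (rule cpath_continuous[OF that Icont])
 have bdd: "bdd_above ((%t. I (\<alpha> t)) ` {0..1})" if "cpath \<alpha>" for \<alpha>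
  by (intro bounded_imp_bdd_above compact_imp_bounded compact_continuous_image cont that) auto
 have SUP_lower: "I (\<alpha> t) <= (SUP t\<in>{0..1}. I (\<alpha> t))" if "cpath \<alpha>" "t \<in> {0..1}" for \<alpha> t
  by (rule cSUP_upper[OF that(2) bdd[OF that(1)]])
 have SUP_ge: "\<kappa> <= (SUP t\<in>{0..1}. I (\<alpha> t))" if "\<alpha> \<in> \<Gamma>" for \<alpha>
  using barrier(1)[OF that] SUP_lower[of \<alpha>] that \<Gamma>(1) by (auto intro: order_trans)
 have bddb: "bdd_below ((%\<alpha>. SUP t\<in>{0..1}. I (\<alpha> t)) ` \<Gamma>)" using SUP_ge by (intro bdd_belowI2)
 have \<kappa>c: "\<kappa> <= c" unfolding c_def by (intro cINF_greatest \<Gamma>(2) SUP_ge)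
 have c_le: "c <= (SUP t\<in>{0..1}. I (\<alpha> t))" if "\<alpha> \<in> \<Gamma>" for \<alpha>
  unfolding c_def by (rule cINF_lower[OF bddb that])
 have key: "EX u:S. \<bar>I u - c\<bar> <= \<delta> \<and> (ALL v:S. \<bar>dI u v\<bar> <= \<delta> * nrm v)" if \<delta>: "0 < \<delta>" "\<delta> <= 1" for \<delta>
 proof (rule ccontr)
  assume neg: "\<not> ?thesis"
  obtain R where R: "!!u. u \<in> S ==> I u <= c + 1 ==> nrm u <= R" using coercive[of "c+1"] by blast
  obtain L where L: "L >= 0" and L1: "!!u v. u \<in> S ==> nrm u <= R ==> v \<in> S ==> \<bar>dI u v\<bar> <= L * nrm v"
   and L2: "!!u v w. u \<in> S ==> nrm u <= R ==> w \<in> S ==> nrm w <= R ==> v \<in> S ==> \<bar>dI u v - dI w v\<bar> <= L * nrm (u - w) * nrm v"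
   and L3: "!!u h. u \<in> S ==> nrm u <= R ==> h \<in> S ==> nrm h <= 1 ==> \<bar>I (u + h) - I u - dI u h\<bar> <= L * (nrm h)^2"
   using reg[of R] by blast
  define G where "G u = (SOME g. g \<in> S \<and> (ALL v:S. ip g v = dI u v))" for u
  have G0: "G u \<in> S \<and> (ALL v:S. ip (G u) v = dI u v)" if u: "u \<in> S" "nrm u <= R" for u
  proof -
   have "EX g:S. ALL v:S. ip g v = dI u v"
    by (rule riesz[of "dI u" L], erule (1) add[OF u(1)], erule sc[OF u(1)], erule L1[OF u])
   then have "EX g. g \<in> S \<and> (ALL v:S. ip g v = dI u v)" by blast
   from someI_ex[OF this] show ?thesis unfolding G_def .
  qed
  have G1: "G u \<in> S" if "u \<in> S" "nrm u <= R" for u using G0[OF that] by blast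
  have G2: "ip (G u) v = dI u v" if "u \<in> S" "nrm u <= R" "v \<in> S" for u v using G0[OF that(1,2)] that(3) by blast
  note G = G1 G2
  have Gbd: "nrm (G u) <= L" if "u \<in> S" "nrm u <= R" for u
  proof -
   have "(nrm (G u))^2 = dI u (G u)"
    using nrm_sq[OF G(1)[OF that]] G(2)[OF that G(1)[OF that]] by simp
   also have "... <= L * nrm (G u)" using L1[OF that G(1)[OF that]] by linarith
   finally show ?thesis using nrm_nonneg[OF G(1)[OF that]] L by (rule le_if_sq_le_mult)
  qed
  have Glip: "nrm (G u - G w) <= L * nrm (u - w)" if "u \<in> S" "nrm u <= R" "w \<in> S" "nrm w <= R" for u w
  proof -
   have Guw: "G u - G w \<in> S" "G u \<in> S" "G w \<in> S" using G that by auto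
   have "(nrm (G u - G w))^2 = dI u (G u - G w) - dI w (G u - G w)"
    using nrm_sq[OF Guw(1)] ip_diff[OF Guw(2,3,1)] G(2)[OF that(1,2) Guw(1)] G(2)[OF that(3,4) Guw(1)] by linarith
   also have "... <= L * nrm (u - w) * nrm (G u - G w)" using L2[OF that Guw(1)] by linarith
   finally show ?thesis
    using nrm_nonneg[OF Guw(1)] L nrm_nonneg[OF S_diff[OF that(1,3)]]
    by (intro le_if_sq_le_mult[of "nrm (G u - G w)" "L * nrm (u - w)"]) auto
  qed
  have Glow: "\<delta> < nrm (G u)" if "u \<in> S" "\<bar>I u - c\<bar> <= \<delta>" for u
  proof (rule ccontr)
   assume "\<not> \<delta> < nrm (G u)"
   have "nrm u <= R" using that \<delta> by (intro R) auto
   have "\<bar>dI u v\<bar> <= \<delta> * nrm v" if v: "v \<in> S" for v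
   proof -
    have "\<bar>dI u v\<bar> <= nrm (G u) * nrm v" using cauchy_schwarz[of "G u" v] G[of u] v that \<open>u \<in> S\<close> \<open>nrm u <= R\<close> by simp
    also have "... <= \<delta> * nrm v" using \<open>\<not> \<delta> < nrm (G u)\<close> v by (intro mult_right_mono) auto
    finally show ?thesis .
   qed
   thus False using neg that by blast
  qed
  define \<epsilon> where "\<epsilon> = min (\<delta> / 2) ((c - \<kappa>') / 2)"
  have \<epsilon>: "\<epsilon> > 0" "2 * \<epsilon> <= \<delta>" "\<kappa>' <= c - 2 * \<epsilon>"
   using \<delta> \<kappa>c barrier(2) by (auto simp: \<epsilon>_def min_def field_simps)
  \<comment> \<open>With this step length the second-order error is at most half of the first-order decrease.\<close>
  define \<tau> where "\<tau> = 1 / (2 * (L + 1))"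
  have \<tau>: "\<tau> > 0" "\<tau> * L <= 1 / 2" using L by (auto simp: \<tau>_def field_simps)
  \<comment> \<open>The step is switched off below the level \<open>c - 2 \<epsilon>\<close>: there the gradient may be small, and the end points must stay fixed.\<close>
  define cut where "cut s = max 0 (min 1 ((s - (c - 2 * \<epsilon>)) / \<epsilon>))" for s :: real
  have cut01: "0 <= cut s" "cut s <= 1" for s by (auto simp: cut_def)
  have cut0: "cut s = 0" if "s <= c - 2 * \<epsilon>" for s using that \<epsilon> by (auto simp: cut_def max_def min_def field_simps)
  have cut1: "cut s = 1" if "s >= c - \<epsilon>" for s using that \<epsilon> by (auto simp: cut_def max_def min_def field_simps)
  \<comment> \<open>The path is optimal up to \<open>\<sigma>\<close>, less than the decrease \<open>\<tau> \<delta>\<^sup>2 / 2\<close> that one step achieves.\<close>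
  define \<sigma> where "\<sigma> = min \<delta> (\<tau> * \<delta>^2 / 4)"
  have \<sigma>: "\<sigma> > 0" "\<sigma> <= \<delta>" "\<sigma> <= \<tau> * \<delta>^2 / 4" using \<delta> \<tau> by (auto simp: \<sigma>_def)
  obtain \<alpha> where \<alpha>: "\<alpha> \<in> \<Gamma>" "(SUP t\<in>{0..1}. I (\<alpha> t)) < c + \<sigma>"
   using cINF_less_iff[OF \<Gamma>(2) bddb, of "c + \<sigma>"] \<sigma> unfolding c_def by auto
  have cp: "cpath \<alpha>" and P01: "Q0 (\<alpha> 0)" "Q1 (\<alpha> 1)" using \<alpha> \<Gamma> by auto
  have aS: "\<alpha> t \<in> S" if "t \<in> {0..1}" for t using cp that by (auto simp: cpath_def)
  have aI: "I (\<alpha> t) <= c + \<sigma>" if "t \<in> {0..1}" for t using SUP_lower[OF cp that] \<alpha>(2) by simp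
  have aR: "nrm (\<alpha> t) <= R" if "t \<in> {0..1}" for t using aI[OF that] \<sigma> \<delta> by (intro R aS that) auto
  define \<beta> where "\<beta> t = \<alpha> t - (\<tau> * cut (I (\<alpha> t))) *R G (\<alpha> t)" for t
  have bS: "\<beta> t \<in> S" if "t \<in> {0..1}" for t unfolding \<beta>_def by (intro S_diff S_scale G1 aS aR that)
  have bI: "I (\<beta> t) <= max (c - \<epsilon>) (c + \<sigma> - \<tau> * \<delta>^2 / 2)" if t: "t \<in> {0..1}" for t
  proof (cases "I (\<alpha> t) <= c - 2 * \<epsilon>")
   case True
   then show ?thesis using \<epsilon> by (auto simp: \<beta>_def cut0)
  next
   case False
   define u where "u = \<alpha> t"
   define s where "s = \<tau> * cut (I u)"
   have u: "u \<in> S" "nrm u <= R" "I u <= c + \<sigma>" using aS aR aI t by (auto simp: u_def)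
   have Gu: "G u \<in> S" "nrm (G u) <= L" using G(1) Gbd u by auto
   have s: "0 <= s" "s <= \<tau>" using \<tau> cut01[of "I u"] by (auto simp: s_def mult_left_le)
   have "s * L <= \<tau> * L" using s L by (intro mult_right_mono)
   then have sL: "s * L <= 1 / 2" using \<tau> by simp
   define h where "h = (- s) *R G u"
   have h: "h \<in> S" "nrm h = s * nrm (G u)" using Gu s nrm_scale[of "G u" "-s"] S_scale[of "G u" "-s"] by (auto simp: h_def)
   have "nrm h <= s * L" using h Gu s by (auto intro: mult_left_mono)
   then have h1: "nrm h <= 1" using sL by simp
   have dh: "dI u h = - s * (nrm (G u))^2" unfolding h_def using Gu u sc[OF u(1) Gu(1), of "-s"] G(2)[OF u(1,2) Gu(1)] by (simp add: nrm_sq)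
   have "I (u + h) <= I u - s * (nrm (G u))^2 + L * (nrm h)^2" using L3[OF u(1,2) h(1) h1] dh by simp
   also have "L * (nrm h)^2 = (s * L) * (s * (nrm (G u))^2)" using h by (simp add: power2_eq_square)
   also have "... <= (1/2) * (s * (nrm (G u))^2)" using sL s by (intro mult_right_mono) auto
   finally have dec: "I (u + h) <= I u - s * (nrm (G u))^2 / 2" by simp
   have "\<delta> < nrm (G u)" using False u \<epsilon> \<sigma> by (intro Glow) (auto simp: u_def abs_le_iff)
   then have "\<delta>^2 <= (nrm (G u))^2" using \<delta> by (intro power_mono) auto
   then have "s * \<delta>^2 <= s * (nrm (G u))^2" using s by (intro mult_left_mono) auto
   with dec have dec2: "I (u + h) <= I u - s * \<delta>^2 / 2" by linarith
   have bu: "\<beta> t = u + h" by (simp add: \<beta>_def u_def h_def s_def)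
   show ?thesis
   proof (cases "I u <= c - \<epsilon>")
    case True
    have "0 <= s * \<delta>^2" using s by simp
    then have "I (\<beta> t) <= I u" using dec2 bu by simp
    with True show ?thesis by auto
   next
    case False
    then have "s = \<tau>" by (simp add: s_def cut1)
    with dec2 bu u show ?thesis by simp
   qed
  qed
  have cpb: "cpath \<beta>"
   unfolding cpath_def
  proof (intro conjI ballI)
   fix t :: real assume t: "t \<in> {0..1}"
   show "\<beta> t \<in> S" by (rule bS[OF t])
   have lim: "((%s. nrm (\<alpha> s - \<alpha> t)) \<longlongrightarrow> 0) (at t within {0..1})" using cp t by (auto simp: cpath_def)
   have "continuous_on {0..1} (%t. cut (I (\<alpha> t)))"
    unfolding cut_def using \<epsilon> by (intro continuous_intros cont[OF cp]) auto
   then have limcut: "((%s. cut (I (\<alpha> s))) \<longlongrightarrow> cut (I (\<alpha> t))) (at t within {0..1})" using t by (auto simp: continuous_on_def)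
   show "((%s. nrm (\<beta> s - \<beta> t)) \<longlongrightarrow> 0) (at t within {0..1})"
   proof (rule Lim_null_comparison)
    show "\<forall>\<^sub>F s in at t within {0..1}. norm (nrm (\<beta> s - \<beta> t)) <=
     nrm (\<alpha> s - \<alpha> t) + (\<tau> * \<bar>cut (I (\<alpha> s)) - cut (I (\<alpha> t))\<bar> * L + \<tau> * (L * nrm (\<alpha> s - \<alpha> t)))"
     unfolding eventually_at_filter
    proof (rule always_eventually, intro allI impI)
     fix s :: real assume s: "s \<in> {0..1}"
     define a b where "a = cut (I (\<alpha> s))" and "b = cut (I (\<alpha> t))"
     have GS: "G (\<alpha> s) \<in> S" "G (\<alpha> t) \<in> S" "\<alpha> s \<in> S" "\<alpha> t \<in> S" using G(1) aS aR s t by auto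
     have b01: "0 <= b" "b <= 1" using cut01 by (auto simp: b_def)
     have eq: "\<beta> s - \<beta> t = (\<alpha> s - \<alpha> t) - (((\<tau> * (a - b)) *R G (\<alpha> s)) + (\<tau> * b) *R (G (\<alpha> s) - G (\<alpha> t)))"
      by (simp add: \<beta>_def a_def b_def algebra_simps)
     have "nrm (\<beta> s - \<beta> t) <= nrm (\<alpha> s - \<alpha> t) + (nrm ((\<tau> * (a - b)) *R G (\<alpha> s)) + nrm ((\<tau> * b) *R (G (\<alpha> s) - G (\<alpha> t))))"
      unfolding eq
      by (rule order_trans[OF nrm_triangle'], use GS in auto)
       (rule nrm_triangle, use GS in auto)
     also have "nrm ((\<tau> * (a - b)) *R G (\<alpha> s)) <= \<tau> * \<bar>a - b\<bar> * L"
      using GS \<tau> Gbd[OF aS[OF s] aR[OF s]] by (auto simp: nrm_scale abs_mult intro!: mult_left_mono)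
     also have "nrm ((\<tau> * b) *R (G (\<alpha> s) - G (\<alpha> t))) = \<tau> * (b * nrm (G (\<alpha> s) - G (\<alpha> t)))"
      using GS \<tau> b01 by (simp add: nrm_scale S_diff)
     also have "... <= \<tau> * (1 * (L * nrm (\<alpha> s - \<alpha> t)))"
      using GS \<tau> b01 Glip[OF aS[OF s] aR[OF s] aS[OF t] aR[OF t]]
      nrm_nonneg[OF S_diff[OF GS(1,2)]] by (intro mult_left_mono mult_mono) auto
     finally show "norm (nrm (\<beta> s - \<beta> t)) <=
      nrm (\<alpha> s - \<alpha> t) + (\<tau> * \<bar>cut (I (\<alpha> s)) - cut (I (\<alpha> t))\<bar> * L + \<tau> * (L * nrm (\<alpha> s - \<alpha> t)))"
      using bS[OF s] bS[OF t] by (simp add: a_def b_def S_diff)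
    qed
    show "((%s. nrm (\<alpha> s - \<alpha> t) + (\<tau> * \<bar>cut (I (\<alpha> s)) - cut (I (\<alpha> t))\<bar> * L + \<tau> * (L * nrm (\<alpha> s - \<alpha> t)))) \<longlongrightarrow> 0) (at t within {0..1})"
     using limcut by (auto intro!: tendsto_eq_intros lim)
   qed
  qed
  have fix_ends: "\<beta> t = \<alpha> t" if "t = 0 \<or> t = 1" for t
  proof -
   have "I (\<alpha> t) <= \<kappa>'" using that P01 aS by (intro ends) auto
   then show ?thesis using \<epsilon> by (simp add: \<beta>_def cut0)
  qed
  have "\<beta> \<in> \<Gamma>" unfolding \<Gamma>(1) using cpb P01 fix_ends[of 0] fix_ends[of 1] by simp
  from c_le[OF this] have "c <= max (c - \<epsilon>) (c + \<sigma> - \<tau> * \<delta>^2 / 2)"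
   by (rule order_trans) (intro cSUP_least bI, auto)
  moreover have "c + \<sigma> - \<tau> * \<delta>^2 / 2 < c" using \<sigma> by linarith
  ultimately show False using \<epsilon> by auto
 qed
 have "EX u:S. \<bar>I u - c\<bar> <= 1 / Suc n \<and> (ALL v:S. \<bar>dI u v\<bar> <= 1 / Suc n * nrm v)" for n by (rule key) auto
 then obtain f where f: "!!n. f n \<in> S" "!!n. \<bar>I (f n) - c\<bar> <= 1 / Suc n" "!!n v. v \<in> S ==> \<bar>dI (f n) v\<bar> <= 1 / Suc n * nrm v"
  by metis
 obtain R where R: "!!u. u \<in> S ==> I u <= c + 1 ==> nrm u <= R" using coercive[of "c+1"] by blast
 have "I (f n) <= c + 1" for n
 proof -
  have "1 / real (Suc n) <= 1" by simp
  with f(2)[of n] show ?thesis by linarith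
 qed
 then have fR: "nrm (f n) <= R" for n using R f(1) by blast
 obtain r u where r: "strict_mono r" and u: "u \<in> S" and lim: "(%n. nrm (f (r n) - u)) ---> 0"
  using ps[OF f(1) fR f(3)] by blast
 have small: "(%n. 1 / real (Suc (r n))) ---> 0"
  using LIMSEQ_subseq_LIMSEQ[OF LIMSEQ_Suc[OF lim_1_over_n] r] by (simp add: o_def)
 obtain L where L: "!!h. h \<in> S ==> nrm h <= 1 ==> \<bar>I (u + h) - I u\<bar> <= L * nrm h" using Icont[OF u] by blast
 have "(%n. I (f (r n)) - I u) ---> 0"
 proof (rule Lim_null_comparison)
  have "\<forall>\<^sub>F n in sequentially. nrm (f (r n) - u) < 1" by (rule order_tendstoD(2)[OF lim]) simp
  thus "\<forall>\<^sub>F n in sequentially. norm (I (f (r n)) - I u) <= L * nrm (f (r n) - u)"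
   by eventually_elim (use L[of "f (r _) - u"] f u in "auto simp: S_diff")
  show "(%n. L * nrm (f (r n) - u)) ---> 0" using tendsto_mult_left[OF lim, of L] by simp
 qed
 then have l1: "(%n. I (f (r n))) ---> I u" by (rule LIM_zero_cancel)
 have "(%n. I (f (r n)) - c) ---> 0"
  by (rule Lim_null_comparison[OF _ small]) (use f(2) in auto)
 then have l2: "(%n. I (f (r n))) ---> c" by (rule LIM_zero_cancel)
 have Iu: "I u = c" by (rule LIMSEQ_unique[OF l1 l2])
 obtain L' where L': "!!w v. w \<in> S ==> nrm w <= max R (nrm u) ==> v \<in> S ==> \<bar>dI u v - dI w v\<bar> <= L' * nrm (u - w) * nrm v"
  using reg[of "max R (nrm u)"] u by (meson max.cobounded2)
 have "dI u v = 0" if v: "v \<in> S" for v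
 proof -
  have "(%n. dI u v) ---> 0"
  proof (rule Lim_null_comparison)
   show "\<forall>\<^sub>F n in sequentially. norm (dI u v) <= L' * nrm (f (r n) - u) * nrm v + 1 / Suc (r n) * nrm v"
   proof (rule always_eventually, rule allI)
    fix n
    have "\<bar>dI u v - dI (f (r n)) v\<bar> <= L' * nrm (u - f (r n)) * nrm v"
     using fR[of "r n"] by (intro L' f v) auto
    moreover have "nrm (u - f (r n)) = nrm (f (r n) - u)" by (rule nrm_minus[OF u f(1)])
    moreover have "\<bar>dI (f (r n)) v\<bar> <= 1 / Suc (r n) * nrm v" by (rule f(3)[OF v])
    ultimately have "\<bar>dI u v - dI (f (r n)) v\<bar> + \<bar>dI (f (r n)) v\<bar>
      <= L' * nrm (f (r n) - u) * nrm v + 1 / Suc (r n) * nrm v" by (intro add_mono) simp_all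
    moreover have "\<bar>dI u v\<bar> <= \<bar>dI u v - dI (f (r n)) v\<bar> + \<bar>dI (f (r n)) v\<bar>" by arith
    ultimately show "norm (dI u v) <= L' * nrm (f (r n) - u) * nrm v + 1 / Suc (r n) * nrm v" by simp
   qed
   have "(%n. L' * nrm (f (r n) - u) * nrm v + 1 / Suc (r n) * nrm v) ---> L' * 0 * nrm v + 0 * nrm v"
    by (intro tendsto_intros lim small)
   thus "(%n. L' * nrm (f (r n) - u) * nrm v + 1 / Suc (r n) * nrm v) ---> 0" by simp
  qed
  thus ?thesis by (simp add: LIMSEQ_const_iff)
 qed
 with Iu u have "EX u:S. I u = c \<and> (ALL v:S. dI u v = 0)" by blast
 with \<kappa>c c_le show ?thesis by (intro conjI ballI)
qed

end

section \<open>Seminorms of p-integrable functions\<close>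

text \<open>
Only the exponents 2 and 4 occur. A concrete seminorm on functions fits the representation of Sobolev functions better than a quotient space.
\<close>

definition Lp :: "nat => 'a measure => ('a => 'b::{banach, second_countable_topology}) => bool" where
 "Lp p M f \<longleftrightarrow> f \<in> bmeas M \<and> integrable M (%x. norm (f x) ^ p)"

definition lpn :: "nat => 'a measure => ('a => 'b::{banach, second_countable_topology}) => real" where
 "lpn p M f = root p (LINT x|M. norm (f x) ^ p)"

lemma Lp_measurable [simp, measurable_dest]: "Lp p M f ==> f \<in> bmeas M"
 by (simp add: Lp_def)

lemma Lp_integrable: "Lp p M f ==> integrable M (%x. norm (f x) ^ p)"
 by (simp add: Lp_def)

lemma lpn_nonneg [simp]: "0 < p ==> 0 <= lpn p M f"
 by (simp add: lpn_def real_root_ge_zero)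

lemma lpn_power: "0 < p ==> lpn p M f ^ p = (LINT x|M. norm (f x) ^ p)"
 by (simp add: lpn_def real_root_pow_pos2)

lemma lpn_le_iff: "0 < p ==> 0 <= B ==> lpn p M f <= B \<longleftrightarrow> (LINT x|M. norm (f x) ^ p) <= B ^ p"
 by (metis lpn_nonneg lpn_power power_mono_iff)

lemma Lp_cong_AE:
 assumes "AE x in M. f x = g x" "g \<in> bmeas M" "f \<in> bmeas M"
 shows "Lp p M f \<longleftrightarrow> Lp p M g"
proof -
 have "integrable M (%x. norm (f x) ^ p) = integrable M (%x. norm (g x) ^ p)"
  by (rule integrable_cong_AE) (use assms in auto)
 thus ?thesis using assms by (simp add: Lp_def)
qed

lemma lpn_cong_AE:
 assumes "AE x in M. f x = g x" "g \<in> bmeas M" "f \<in> bmeas M"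
 shows "lpn p M f = lpn p M g"
 unfolding lpn_def by (intro arg_cong[where f = "root p"] integral_cong_AE) (use assms in auto)

lemma Lp_dominated:
 assumes "Lp p M g" "f \<in> bmeas M" "AE x in M. norm (f x) <= norm (g x)"
 shows "Lp p M f"
proof -
 have "integrable M (%x. norm (f x) ^ p)"
  by (rule Bochner_Integration.integrable_bound[OF Lp_integrable[OF assms(1)]])
   (use assms in "auto elim!: eventually_mono simp: power_mono")
 thus ?thesis using assms by (simp add: Lp_def)
qed

lemma lpn_mono:
 assumes "0 < p" "Lp p M g" "f \<in> bmeas M" "AE x in M. norm (f x) <= norm (g x)"
 shows "lpn p M f <= lpn p M g"
 unfolding lpn_def
 by (rule real_root_le_mono[OF assms(1)], rule integral_mono_AE[OF Lp_integrable Lp_integrable])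
  (use assms Lp_dominated[OF assms(2-4)] in "auto elim!: eventually_mono simp: power_mono")

lemma lpn_norm [simp]: "lpn p M (%x. norm (f x)) = lpn p M f"
 by (simp add: lpn_def)

lemma Lp_norm: "Lp p M f ==> Lp p M (%x. norm (f x))"
 by (auto simp: Lp_def)

lemma Lp_add:
 assumes "Lp p M f" "Lp p M g"
 shows "Lp p M (%x. f x + g x)"
proof -
 have "integrable M (%x. norm (f x + g x) ^ p)"
 proof (rule Bochner_Integration.integrable_bound)
  show "integrable M (%x. 2 ^ p * (norm (f x) ^ p + norm (g x) ^ p))"
   using assms by (auto simp: Lp_def)
  show "AE x in M. norm (norm (f x + g x) ^ p) <= norm (2 ^ p * (norm (f x) ^ p + norm (g x) ^ p))"
  proof (rule AE_I2)
   fix x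
   define m where "m = max (norm (f x)) (norm (g x))"
   have "norm (f x + g x) <= 2 * m" using norm_triangle_ineq[of "f x" "g x"] by (auto simp: m_def)
   then have "norm (f x + g x) ^ p <= (2 * m) ^ p" by (intro power_mono) auto
   also have "... = 2 ^ p * m ^ p" by (simp add: power_mult_distrib)
   also have "m ^ p <= norm (f x) ^ p + norm (g x) ^ p" by (auto simp: m_def max_def)
   finally show "norm (norm (f x + g x) ^ p) <= norm (2 ^ p * (norm (f x) ^ p + norm (g x) ^ p))" by simp
  qed
 qed (use assms in auto)
 thus ?thesis using assms by (auto simp: Lp_def)
qed

lemma Lp_mult: "Lp p M f ==> Lp p M (%x. c * f x)" for c :: complex
 by (auto simp: Lp_def power_mult_distrib norm_mult)

lemma lpn_mult: "0 < p ==> lpn p M (%x. c * f x) = cmod c * lpn p M f" for c :: complex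
 by (simp add: lpn_def power_mult_distrib real_root_mult norm_mult real_root_power_cancel)

lemma Lp_minus: "Lp p M f ==> Lp p M (%x. - f x)"
 by (auto simp: Lp_def)

lemma Lp_diff: "Lp p M f ==> Lp p M g ==> Lp p M (%x. f x - g x)"
 using Lp_add[of p M f "%x. - g x"] Lp_minus[of p M g] by simp

lemma lpn_minus: "lpn p M (%x. f x - g x) = lpn p M (%x. g x - f x)"
 by (simp add: lpn_def norm_minus_commute)

text \<open>
Minkowski's inequality by convexity: with \<open>A\<close> and \<open>B\<close> slightly larger than the two norms, \<open>(f + g) / (A + B)\<close> is pointwise a convex combination of \<open>f / A\<close> and \<open>g / B\<close>.
\<close>

lemma lpn_triangle:
 assumes p: "even p" "0 < p" and f: "Lp p M f" and g: "Lp p M g"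
 shows "lpn p M (%x. f x + g x) <= lpn p M f + lpn p M g"
proof (rule field_le_epsilon)
 fix e :: real assume e: "0 < e"
 define A B where "A = lpn p M f + e / 2" and "B = lpn p M g + e / 2"
 have A: "A > 0" "lpn p M f <= A" and B: "B > 0" "lpn p M g <= B"
  using e p lpn_nonneg[of p M f] lpn_nonneg[of p M g] by (auto simp: A_def B_def intro: add_nonneg_pos)
 define l where "l = A / (A + B)"
 have l: "0 < l" "l < 1" "A / l = A + B" "B / (1 - l) = A + B"
  using A B by (auto simp: l_def field_simps)
 have conv: "(x + y) ^ p <= l * (x / l) ^ p + (1 - l) * (y / (1 - l)) ^ p" for x y :: real
 proof -
  have "(1 - l) * (y / (1 - l)) = y" "l * (x / l) = x" using l by auto
  then show ?thesis
   using convex_onD[OF convex_power_even[OF p(1)], of l "y / (1 - l)" "x / l"] l by (simp only: real_scaleR_def) (simp add: add.commute)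
 qed
 have "(LINT x|M. norm (f x + g x) ^ p) <= (LINT x|M. l * (norm (f x) / l) ^ p + (1 - l) * (norm (g x) / (1 - l)) ^ p)"
 proof (rule integral_mono[OF Lp_integrable[OF Lp_add[OF f g]]])
  show "integrable M (%x. l * (norm (f x) / l) ^ p + (1 - l) * (norm (g x) / (1 - l)) ^ p)"
   using Lp_integrable[OF f] Lp_integrable[OF g] by (simp add: power_divide)
  show "norm (f x + g x) ^ p <= l * (norm (f x) / l) ^ p + (1 - l) * (norm (g x) / (1 - l)) ^ p" for x
   by (rule order_trans[OF power_mono[OF norm_triangle_ineq] conv]) simp
 qed
 also have "... = l * (lpn p M f ^ p / l ^ p) + (1 - l) * (lpn p M g ^ p / (1 - l) ^ p)"
  using Lp_integrable[OF f] Lp_integrable[OF g] by (simp add: power_divide lpn_power p)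
 also have "... <= l * (A ^ p / l ^ p) + (1 - l) * (B ^ p / (1 - l) ^ p)"
  using A B l p by (intro add_mono mult_left_mono divide_right_mono power_mono) auto
 also have "... = (A + B) ^ p" unfolding power_divide[symmetric] l by (simp add: algebra_simps)
 finally have "lpn p M (%x. f x + g x) <= A + B" using A B p by (subst lpn_le_iff) auto
 thus "lpn p M (%x. f x + g x) <= lpn p M f + lpn p M g + e" by (simp add: A_def B_def)
qed

lemma lpn_triangle_diff:
 assumes p: "even p" "0 < p" and f: "Lp p M f" and g: "Lp p M g"
 shows "lpn p M (%x. f x - g x) <= lpn p M f + lpn p M g"
 using lpn_triangle[OF p f Lp_minus[OF g]] by (simp add: lpn_def)

lemma integral_mult_L2:
 assumes f: "Lp 2 M f" and g: "Lp 2 M g"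
 shows "integrable M (%x. norm (f x) * norm (g x))"
  and "(LINT x|M. norm (f x) * norm (g x)) <= lpn 2 M f * lpn 2 M g"
proof -
 note ff = Lp_integrable[OF f] and gg = Lp_integrable[OF g]
 show int: "integrable M (%x. norm (f x) * norm (g x))"
 proof (rule Bochner_Integration.integrable_bound)
  show "integrable M (%x. norm (f x) ^ 2 + norm (g x) ^ 2)" using ff gg by simp
  show "AE x in M. norm (norm (f x) * norm (g x)) <= norm (norm (f x) ^ 2 + norm (g x) ^ 2)"
  proof (rule AE_I2)
   fix x
   have "0 <= (norm (f x) - norm (g x))^2 + norm (f x) ^ 2 + norm (g x) ^ 2" by simp
   then show "norm (norm (f x) * norm (g x)) <= norm (norm (f x) ^ 2 + norm (g x) ^ 2)"
    by (simp add: power2_eq_square algebra_simps)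
  qed
 qed (use f g in auto)
 have "(lpn 2 M (%x. norm (f x) + norm (g x)))^2 <= (lpn 2 M f + lpn 2 M g)^2"
  using lpn_triangle[OF _ _ Lp_norm[OF f] Lp_norm[OF g]] by (intro power_mono) auto
 also have "(lpn 2 M (%x. norm (f x) + norm (g x)))^2 = (LINT x|M. norm (f x) ^ 2 + norm (g x) ^ 2 + 2 * (norm (f x) * norm (g x)))"
  by (subst lpn_power) (auto intro!: Bochner_Integration.integral_cong simp: power2_eq_square algebra_simps)
 also have "... = (lpn 2 M f)^2 + (lpn 2 M g)^2 + 2 * (LINT x|M. norm (f x) * norm (g x))"
  using ff gg int by (simp add: lpn_power)
 finally show "(LINT x|M. norm (f x) * norm (g x)) <= lpn 2 M f * lpn 2 M g"
  by (simp add: power2_eq_square algebra_simps)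
qed

lemma lpn_2_square:
 "Lp 4 M f ==> Lp 2 M (%x. (norm (f x))^2)" "lpn 2 M (%x. (norm (f x))^2) = (lpn 4 M f)^2"
proof -
 show "Lp 4 M f ==> Lp 2 M (%x. (norm (f x))^2)" by (auto simp: Lp_def power_mult[symmetric])
 have "(lpn 2 M (%x. (norm (f x))^2))^2 = ((lpn 4 M f)^2)^2"
  by (simp add: lpn_power power_mult[symmetric])
 thus "lpn 2 M (%x. (norm (f x))^2) = (lpn 4 M f)^2"
  by (rule power2_eq_imp_eq) auto
qed

lemma L4_mult_L2:
 assumes f: "Lp 4 M f" and g: "Lp 4 M g"
 shows "Lp 2 M (%x. norm (f x) * norm (g x))"
  and "lpn 2 M (%x. norm (f x) * norm (g x)) <= lpn 4 M f * lpn 4 M g"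
proof -
 have "integrable M (%x. norm ((norm (f x))^2) * norm ((norm (g x))^2))"
  and le: "(LINT x|M. norm ((norm (f x))^2) * norm ((norm (g x))^2)) <= (lpn 4 M f)^2 * (lpn 4 M g)^2"
  using integral_mult_L2[OF lpn_2_square(1)[OF f] lpn_2_square(1)[OF g]] by (simp_all add: lpn_2_square(2))
 then show "Lp 2 M (%x. norm (f x) * norm (g x))"
  using f g by (auto simp: Lp_def power_mult_distrib)
 show "lpn 2 M (%x. norm (f x) * norm (g x)) <= lpn 4 M f * lpn 4 M g"
  using le by (subst lpn_le_iff) (auto simp: power_mult_distrib)
qed

lemma integral_mult_L4:
 assumes f: "Lp 4 M f" and g: "Lp 4 M g" and h: "Lp 4 M h" and k: "Lp 4 M k"
 shows "integrable M (%x. norm (f x) * norm (g x) * norm (h x) * norm (k x))"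
  and "(LINT x|M. norm (f x) * norm (g x) * norm (h x) * norm (k x)) <= lpn 4 M f * lpn 4 M g * lpn 4 M h * lpn 4 M k"
proof -
 note A = L4_mult_L2[OF f g] and B = L4_mult_L2[OF h k]
 show "integrable M (%x. norm (f x) * norm (g x) * norm (h x) * norm (k x))"
  using integral_mult_L2(1)[OF A(1) B(1)] by (simp add: mult.assoc)
 have "(LINT x|M. norm (f x) * norm (g x) * norm (h x) * norm (k x)) <= lpn 2 M (%x. norm (f x) * norm (g x)) * lpn 2 M (%x. norm (h x) * norm (k x))"
  using integral_mult_L2(2)[OF A(1) B(1)] by (simp add: mult.assoc)
 also have "... <= (lpn 4 M f * lpn 4 M g) * (lpn 4 M h * lpn 4 M k)"
  using A(2) B(2) by (intro mult_mono) auto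
 finally show "(LINT x|M. norm (f x) * norm (g x) * norm (h x) * norm (k x)) <= lpn 4 M f * lpn 4 M g * lpn 4 M h * lpn 4 M k"
  by (simp add: mult.assoc)
qed

lemma lpn_Fatou:
 assumes p: "0 < p" and f: "!!n. Lp p M (f n)" and g: "g \<in> bmeas M"
  and lim: "AE x in M. (%n. f n x) ---> g x"
  and B: "!!n. n >= N ==> lpn p M (f n) <= B" "0 <= B"
 shows "Lp p M g" "lpn p M g <= B"
proof -
 have [measurable]: "!!n. f n \<in> bmeas M" using f by auto
 note [measurable] = g
 have "(\<integral>\<^sup>+x. ennreal (norm (g x) ^ p) \<partial>M) = (\<integral>\<^sup>+x. liminf (%n. ennreal (norm (f n x) ^ p)) \<partial>M)"
 proof (rule nn_integral_cong_AE, use lim in eventually_elim)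
  case (elim x)
  have "(%n. ennreal (norm (f n x) ^ p)) ---> ennreal (norm (g x) ^ p)"
   by (intro tendsto_intros elim)
  then show ?case by (metis lim_imp_Liminf sequentially_bot)
 qed
 also have "... <= liminf (%n. \<integral>\<^sup>+x. ennreal (norm (f n x) ^ p) \<partial>M)"
  by (rule nn_integral_liminf) auto
 also have "... <= ennreal (B ^ p)"
 proof (rule Liminf_le)
  show "\<forall>\<^sub>F n in sequentially. (\<integral>\<^sup>+x. ennreal (norm (f n x) ^ p) \<partial>M) <= ennreal (B ^ p)"
   unfolding eventually_sequentially
  proof (intro exI[of _ N] allI impI)
   fix n assume n: "n >= N"
   have "(\<integral>\<^sup>+x. ennreal (norm (f n x) ^ p) \<partial>M) = ennreal (LINT x|M. norm (f n x) ^ p)"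
    by (rule nn_integral_eq_integral[OF Lp_integrable[OF f]]) auto
   also have "... <= ennreal (B ^ p)" using B(1)[OF n] B(2) p by (intro ennreal_leI) (simp add: lpn_le_iff)
   finally show "(\<integral>\<^sup>+x. ennreal (norm (f n x) ^ p) \<partial>M) <= ennreal (B ^ p)" .
  qed
 qed simp
 finally have le: "(\<integral>\<^sup>+x. ennreal (norm (g x) ^ p) \<partial>M) <= ennreal (B ^ p)" .
 have int: "integrable M (%x. norm (g x) ^ p)"
  using le by (intro integrableI_bounded) (auto simp: ennreal_power[symmetric] intro: le_less_trans)
 then show L: "Lp p M g" using g by (simp add: Lp_def)
 have "ennreal (LINT x|M. norm (g x) ^ p) <= ennreal (B ^ p)"
  using le nn_integral_eq_integral[OF int] by simp
 then have "(LINT x|M. norm (g x) ^ p) <= B ^ p" using B(2) by (subst (asm) ennreal_le_iff) auto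
 with B(2) p show "lpn p M g <= B" by (simp add: lpn_le_iff)
qed

text \<open>
The weights \<open>2\<^sup>n\<close> are harmless against the geometric decay of the squared norms, and finiteness of \<open>\<Sum> 2\<^sup>n |d n x|\<^sup>2\<close> bounds \<open>|d n x|\<close> by a geometric sequence.
\<close>

lemma summable_L2_imp_AE:
 assumes d: "!!n. Lp 2 M (d n)" and bd: "!!n. lpn 2 M (d n) <= C * (1/2) ^ n" and C: "0 <= C"
 shows "AE x in M. summable (%n. norm (d n x))"
proof -
 have [measurable]: "!!n. d n \<in> bmeas M" using d by auto
 define F where "F n x = ennreal (2 ^ n * (norm (d n x))^2)" for n x
 have "(\<integral>\<^sup>+x. (\<Sum>n. F n x) \<partial>M) = (\<Sum>n. \<integral>\<^sup>+x. F n x \<partial>M)"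
  unfolding F_def by (rule nn_integral_suminf) auto
 also have "... <= (\<Sum>n. ennreal (C^2 * (1/2) ^ n))"
 proof (rule suminf_le)
  fix n
  have "(\<integral>\<^sup>+x. F n x \<partial>M) = ennreal (LINT x|M. 2 ^ n * (norm (d n x))^2)"
   unfolding F_def by (rule nn_integral_eq_integral) (use Lp_integrable[OF d] in auto)
  also have "(LINT x|M. 2 ^ n * (norm (d n x))^2) = 2 ^ n * (lpn 2 M (d n))^2" by (simp add: lpn_power)
  also have "... <= 2 ^ n * (C * (1/2) ^ n)^2" using bd[of n] C by (intro mult_left_mono power_mono) auto
  also have "... = C^2 * (1/2) ^ n" by (simp add: power_mult_distrib power2_eq_square power_divide)
  finally show "(\<integral>\<^sup>+x. F n x \<partial>M) <= ennreal (C^2 * (1/2) ^ n)" by (simp add: ennreal_leI)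
 qed auto
 also have "... = ennreal (\<Sum>n. C^2 * (1/2) ^ n)"
  by (rule suminf_ennreal2) (auto intro!: summable_mult summable_geometric)
 also have "... < \<infinity>" by simp
 finally have "(\<integral>\<^sup>+x. (\<Sum>n. F n x) \<partial>M) ~= \<infinity>" by simp
 then have "AE x in M. (\<Sum>n. F n x) ~= \<infinity>" by (intro nn_integral_noteq_infinite) (auto simp: F_def)
 then show ?thesis
 proof eventually_elim
  case (elim x)
  have "summable (%n. 2 ^ n * (norm (d n x))^2)"
   by (rule summable_suminf_not_top) (use elim in "auto simp: F_def")
  then have "summable (%n. (1/2) ^ n + 2 ^ n * (norm (d n x))^2)"
   by (intro summable_add summable_geometric) auto
  then show ?case
  proof (rule summable_comparison_test')
   fix n :: nat
   have "0 <= ((1/2) ^ n - norm (d n x))^2 * 2 ^ n + norm (d n x)" by simp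
   also have "... = ((1/2) ^ n * (1/2)^n) * 2 ^ n - 2 * ((1/2)^n * 2^n) * norm (d n x) + 2 ^ n * (norm (d n x))^2 + norm (d n x)"
    by (simp add: power2_eq_square algebra_simps)
   also have "((1/2::real) ^ n * (1/2)^n) * 2 ^ n = (1/2)^n" by (simp add: power_divide)
   also have "((1/2::real)^n * 2^n) = 1" by (simp add: power_divide)
   finally show "norm (norm (d n x)) <= (1/2) ^ n + 2 ^ n * (norm (d n x))^2" by simp
  qed
 qed
qed

lemma L2_telescope_bound:
 assumes f: "!!n. Lp 2 M (f n)" and bd: "!!n. lpn 2 M (%x. f (Suc n) x - f n x) <= C * (1/2) ^ n" and C: "0 <= C"
  and "n <= m"
 shows "lpn 2 M (%x. f m x - f n x) <= C * 2 * (1/2) ^ n - C * 2 * (1/2) ^ m"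
 using \<open>n <= m\<close>
proof (induction m rule: dec_induct)
 case base show ?case by (simp add: lpn_def)
next
 case (step m)
 have "lpn 2 M (%x. f (Suc m) x - f n x) <= lpn 2 M (%x. f (Suc m) x - f m x) + lpn 2 M (%x. f m x - f n x)"
  using lpn_triangle[OF _ _ Lp_diff[OF f[of "Suc m"] f[of m]] Lp_diff[OF f[of m] f[of n]]] by simp
 with step bd[of m] show ?case by simp
qed

text \<open>
The Riesz-Fischer theorem along a fast subsequence, which is all that completeness requires.
\<close>

lemma L2_fast_cauchy:
 assumes f: "!!n. Lp 2 M (f n)" and bd: "!!n. lpn 2 M (%x. f (Suc n) x - f n x) <= C * (1/2) ^ n" and C: "0 <= C"
 shows "AE x in M. convergent (%n. f n x)"
  and "!!g. g \<in> bmeas M ==> AE x in M. (%n. f n x) ---> g x ==>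
   Lp 2 M g \<and> (ALL n. lpn 2 M (%x. f n x - g x) <= C * 2 * (1/2) ^ n)"
proof -
 show "AE x in M. convergent (%n. f n x)"
  using summable_L2_imp_AE[OF Lp_diff[OF f f] bd C]
 proof eventually_elim
  case (elim x)
  have "convergent (%n. \<Sum>i<n. f (Suc i) x - f i x)"
   using summable_norm_cancel[OF elim] by (simp add: summable_iff_convergent)
  then have "convergent (%n. (f n x - f 0 x) + f 0 x)"
   unfolding sum_lessThan_telescope[of "%i. f i x"] by (intro convergent_add convergent_const)
  then show ?case by simp
 qed
 fix g assume g: "g \<in> bmeas M" "AE x in M. (%n. f n x) ---> g x"
 have *: "Lp 2 M (%x. g x - f n x) \<and> lpn 2 M (%x. g x - f n x) <= C * 2 * (1/2) ^ n" for n
 proof -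
  have m: "(%x. g x - f n x) \<in> bmeas M" using g f by auto
  have lim: "AE x in M. (%m. f m x - f n x) ---> g x - f n x"
   using g(2) by eventually_elim (intro tendsto_intros)
  have le: "lpn 2 M (%x. f m x - f n x) <= C * 2 * (1/2) ^ n" if "m >= n" for m
  proof -
   have "0 <= C * 2 * (1/2) ^ m" using C by simp
   with L2_telescope_bound[OF f bd C that] show ?thesis by simp
  qed
  have "0 <= C * 2 * (1/2) ^ n" using C by simp
  from lpn_Fatou[OF _ Lp_diff[OF f f[of n]] m lim le this] show ?thesis by simp
 qed
 have "Lp 2 M (%x. (g x - f 0 x) + f 0 x)" by (rule Lp_add[OF conjunct1[OF *] f])
 moreover have "lpn 2 M (%x. f n x - g x) <= C * 2 * (1/2) ^ n" for n
  using conjunct2[OF *] by (subst lpn_minus) simp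
 ultimately show "Lp 2 M g \<and> (ALL n. lpn 2 M (%x. f n x - g x) <= C * 2 * (1/2) ^ n)" by simp
qed

lemma lpn_bounded:
 assumes "finite_measure M" and p: "0 < p" and f: "f \<in> bmeas M"
  and B: "!!x. x \<in> space M ==> norm (f x) <= B" "0 <= B"
 shows "Lp p M f" "lpn p M f <= B * root p (measure M (space M))"
proof -
 interpret finite_measure M by fact
 have i: "integrable M (%x. norm (f x) ^ p)"
  by (rule integrable_const_bound[of _ "B ^ p"]) (use f B in "auto intro!: AE_I2 power_mono")
 then show "Lp p M f" using f by (simp add: Lp_def)
 have "(LINT x|M. norm (f x) ^ p) <= (LINT x|M. B ^ p)" by (rule integral_mono[OF i]) (use B in "auto intro!: power_mono")
 then have "(LINT x|M. norm (f x) ^ p) <= B ^ p * measure M (space M)" by (simp add: mult.commute)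
 then show "lpn p M f <= B * root p (measure M (space M))"
  using p B(2) by (subst lpn_le_iff) (auto simp: power_mult_distrib real_root_ge_zero)
qed

text \<open>
Interpolation between \<open>L\<^sup>2\<close> and a uniform bound; applied to the dyadic pieces in \<open>L4_estimate\<close>.
\<close>

lemma L4_interpolation:
 assumes f: "Lp 2 M f" and B: "!!x. x \<in> space M ==> norm (f x) <= B" "0 <= B"
 shows "Lp 4 M f" "lpn 4 M f ^ 4 <= B^2 * (lpn 2 M f)^2"
proof -
 have le: "norm (f x) ^ 4 <= B^2 * (norm (f x))^2" if "x \<in> space M" for x
 proof -
  have "(norm (f x))^2 * (norm (f x))^2 <= B^2 * (norm (f x))^2"
   using B that by (intro mult_right_mono power_mono) auto
  then show ?thesis by (simp add: power2_eq_square power4_eq_xxxx mult.assoc)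
 qed
 have i: "integrable M (%x. norm (f x) ^ 4)"
  by (rule Bochner_Integration.integrable_bound[of _ "%x. B^2 * (norm (f x))^2"])
   (use f le in "auto simp: Lp_def")
 then show "Lp 4 M f" using f by (auto simp: Lp_def)
 have "(LINT x|M. norm (f x) ^ 4) <= (LINT x|M. B^2 * (norm (f x))^2)"
  by (rule integral_mono[OF i]) (use f le in "auto simp: Lp_def")
 then show "lpn 4 M f ^ 4 <= B^2 * (lpn 2 M f)^2" by (simp add: lpn_power)
qed

section \<open>Bump functions and locally integrable functions\<close>

text \<open>
The functions \<open>p (1/x) exp (- 1/x)\<close>, continued by zero, form a class that is closed under differentiation. This makes \<open>exp (- 1/x)\<close> smooth without computing its derivatives.
\<close>

definition flat :: "real poly => real => real" where
 "flat p x = (if x <= 0 then 0 else poly p (1 / x) * exp (- (1 / x)))"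

lemma poly_times_exp_tendsto_0: "((%y. poly p y * exp (- y)) \<longlongrightarrow> 0) at_top" for p :: "real poly"
proof -
 have "((%y. \<Sum>i\<le>degree p. coeff p i * (y ^ i / exp y)) \<longlongrightarrow> (\<Sum>i\<le>degree p. coeff p i * 0)) at_top"
  by (intro tendsto_intros tendsto_power_div_exp_0)
 then show ?thesis by (simp add: poly_altdef sum_distrib_right exp_minus divide_inverse mult.assoc)
qed

lemma flat_has_derivative:
 "(flat p has_real_derivative flat ([:0, 0, 1:] * (p - pderiv p)) x) (at x)"
proof (cases "x = 0")
 case True
 have L: "((%h. (flat p (0 + h) - flat p 0) / h) \<longlongrightarrow> 0) (at 0)"
  unfolding filterlim_at_split
 proof (rule conjI)
  show "((%h. (flat p (0 + h) - flat p 0) / h) \<longlongrightarrow> 0) (at_left 0)"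
   by (rule tendsto_eventually) (auto simp: eventually_at_filter flat_def)
  have "((%h. poly ([:0, 1:] * p) (inverse h) * exp (- inverse h)) \<longlongrightarrow> 0) (at_right 0)"
   by (rule filterlim_compose[OF poly_times_exp_tendsto_0 filterlim_inverse_at_top_right])
  then show "((%h. (flat p (0 + h) - flat p 0) / h) \<longlongrightarrow> 0) (at_right 0)"
   by (rule Lim_transform_eventually)
     (auto simp: eventually_at_filter flat_def inverse_eq_divide)
 qed
 then show ?thesis using True by (simp add: DERIV_def flat_def)
next
 case False
 show ?thesis
 proof (cases "x < 0")
  case True
  have "((%_. 0) has_real_derivative 0) (at x)" by simp
  then have "(flat p has_real_derivative 0) (at x)"
   by (rule has_field_derivative_transform_within_open[of _ _ _ "{..<0}"]) (use True in "auto simp: flat_def")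
  then show ?thesis using True by (simp add: flat_def)
 next
  case f: False
  with False have x: "x > 0" by simp
  have "((%x. poly p (1 / x) * exp (- (1 / x))) has_real_derivative
    (poly (pderiv p) (1/x) * (- (1 / x^2))) * exp (-(1/x)) + exp (- (1/x)) * (1 / x^2) * poly p (1/x)) (at x)"
   using x by (auto intro!: derivative_eq_intros DERIV_chain2[OF poly_DERIV] simp: power2_eq_square)
  then have "(flat p has_real_derivative
    (poly (pderiv p) (1/x) * (- (1 / x^2))) * exp (-(1/x)) + exp (- (1/x)) * (1 / x^2) * poly p (1/x)) (at x)"
   by (rule has_field_derivative_transform_within_open[of _ _ _ "{0<..}"]) (use x in "auto simp: flat_def")
  moreover have "(poly (pderiv p) (1/x) * (- (1 / x^2))) * exp (-(1/x)) + exp (- (1/x)) * (1 / x^2) * poly p (1/x)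
    = flat ([:0, 0, 1:] * (p - pderiv p)) x"
   using x by (simp add: flat_def power2_eq_square field_simps)
  ultimately show ?thesis by simp
 qed
qed

inductive_set smooth :: "(real ^ 'n => real) set" where
 "(%x. a) \<in> smooth"
| "(%x. flat p (a * x $ k + b)) \<in> smooth"
| "f \<in> smooth ==> g \<in> smooth ==> (%x. f x + g x) \<in> smooth"
| "f \<in> smooth ==> g \<in> smooth ==> (%x. f x * g x) \<in> smooth"

lemma smooth_derivative:
 fixes f :: "real ^ 'n => real"
 assumes "f \<in> smooth"
 shows "EX f'. (ALL x. (f has_derivative f' x) (at x)) \<and> (ALL k. (%x. f' x (axis k 1)) \<in> smooth)"
 using assms
proof induction
 case (1 a)
 show ?case by (intro exI[of _ "%_ _. 0"]) (auto intro: smooth.intros)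
next
 case (2 p a k b)
 let ?q = "[:0, 0, 1:] * (p - pderiv p)"
 let ?f' = "%x v. flat ?q (a * x $ k + b) * (a * v $ k)"
 have "((%x. flat p (a * x $ k + b)) has_derivative ?f' x) (at x)" for x :: "real ^ 'n"
 proof -
  have "((%x::real^'n. a * x $ k + b) has_derivative (%v. a * v $ k)) (at x)"
   by (auto intro!: derivative_eq_intros bounded_linear_imp_has_derivative bounded_linear_vec_nth)
  from has_derivative_compose[OF this flat_has_derivative[unfolded has_field_derivative_def]]
  show ?thesis by simp
 qed
 moreover have "(%x. ?f' x (axis l 1)) \<in> smooth" for l
  by (intro smooth.intros)
 ultimately show ?case by (intro exI[of _ ?f']) blast
next
 case (3 f g)
 then obtain f' g' where *: "!!x. (f has_derivative f' x) (at x)" "!!k. (%x. f' x (axis k 1)) \<in> smooth"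
  "!!x. (g has_derivative g' x) (at x)" "!!k. (%x. g' x (axis k 1)) \<in> smooth" by blast
 show ?case
  by (intro exI[of _ "%x v. f' x v + g' x v"] conjI allI smooth.intros * has_derivative_add)
next
 case (4 f g)
 then obtain f' g' where *: "!!x. (f has_derivative f' x) (at x)" "!!k. (%x. f' x (axis k 1)) \<in> smooth"
  "!!x. (g has_derivative g' x) (at x)" "!!k. (%x. g' x (axis k 1)) \<in> smooth" by blast
 show ?case
  by (intro exI[of _ "%x v. f x * g' x v + f' x v * g x"] conjI allI smooth.intros * has_derivative_mult 4)
qed

lemma smooth_times_differentiable: "f \<in> smooth ==> times_differentiable m f"
proof (induction m arbitrary: f)
 case 0
 then obtain f' where "!!x. (f has_derivative f' x) (at x)" using smooth_derivative by blast
 then show ?case by (auto intro!: continuous_at_imp_continuous_on has_derivative_continuous)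
next
 case (Suc m)
 obtain f' where f': "!!x. (f has_derivative f' x) (at x)" "!!k. (%x. f' x (axis k 1)) \<in> smooth"
  using smooth_derivative[OF Suc.prems] by blast
 have "partial k f = (%x. f' x (axis k 1))" for k
  unfolding partial_def using frechet_derivative_at[OF f'(1)] by (metis (no_types))
 with Suc.IH f' show ?case
  by (auto intro!: differentiable_at_imp_differentiable_on differentiableI)
qed

lemma smooth_prod: "finite A ==> (!!i. i \<in> A ==> f i \<in> smooth) ==> (%x. \<Prod>i\<in>A. f i x) \<in> smooth"
 by (induction A rule: finite_induct) (auto intro: smooth.intros)

text \<open>
Smooth functions that increase to the indicator of the open box as \<open>m\<close> grows.
\<close>

definition bump :: "real ^ 'n => real ^ 'n => nat => real ^ 'n => real" where
 "bump a b m x = (\<Prod>k\<in>UNIV. flat 1 (real m * (x $ k - a $ k)) * flat 1 (real m * (b $ k - x $ k)))"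

lemma flat_1_bounds: "0 <= flat 1 x" "flat 1 x <= 1"
 by (auto simp: flat_def)

lemma bump_bounds: "0 <= bump a b m x" "bump a b m x <= 1"
 by (auto simp: bump_def intro!: prod_nonneg prod_le_1 mult_nonneg_nonneg mult_le_one flat_1_bounds)

lemma bump_outside: "x \<notin> box a b ==> bump a b m x = 0"
 by (auto simp: bump_def mem_box_cart flat_def not_less mult_le_0_iff intro!: prod_zero)

lemma bump_tendsto: "(%m. bump a b m x) ---> indicator (box a b) x"
proof (cases "x \<in> box a b")
 case True
 have *: "(%m. flat 1 (real m * y)) ---> 1" if "y > 0" for y
 proof -
  have "(%m. exp (- (inverse (real m) * inverse y))) ---> exp (- (0 * inverse y))"
   by (intro tendsto_intros lim_inverse_n)
  then have "(%m. exp (- (inverse (real m) * inverse y))) ---> 1" by simp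
  then show ?thesis
   by (rule Lim_transform_eventually)
    (use that in "auto intro!: eventually_sequentiallyI[of 1] simp: flat_def field_simps mult_le_0_iff")
 qed
 have "(%m. bump a b m x) ---> (\<Prod>k\<in>(UNIV::'a set). 1 * 1)"
  unfolding bump_def using True by (intro tendsto_intros *) (auto simp: mem_box_cart)
 with True show ?thesis by simp
qed (simp add: bump_outside)

lemma bump_test_function: "test_function (bump a b m)"
proof -
 have "(%x. flat 1 (real m * (x $ k - a $ k)) * flat 1 (real m * (b $ k - x $ k))) \<in> smooth" for k
  using smooth.intros(4)[OF smooth.intros(2)[of 1 "real m" k "- real m * a $ k"] smooth.intros(2)[of 1 "- real m" k "real m * b $ k"]]
  by (simp add: algebra_simps)
 then have "bump a b m \<in> smooth" unfolding bump_def[abs_def] by (intro smooth_prod) auto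
 moreover have "closure {x. bump a b m x ~= 0} \<subseteq> cbox a b"
  by (rule closure_minimal) (use bump_outside[of _ a b m] box_subset_cbox[of a b] in auto)
 then have "compact (closure {x. bump a b m x ~= 0})"
  by (meson bounded_cbox bounded_subset closed_closure compact_eq_bounded_closed)
 ultimately show ?thesis by (simp add: test_function_def smooth_times_differentiable)
qed

lemma L1_loc_measurable: "f \<in> L1_loc ==> f \<in> bmeas leb"
proof -
 assume f: "f \<in> L1_loc"
 have m: "(%x. indicator (cball 0 (real n)) x *R f x) \<in> bmeas leb" for n
  using f by (intro borel_measurable_integrable) (auto simp: L1_loc_def set_integrable_def)
 show ?thesis
 proof (rule borel_measurable_LIMSEQ_metric[OF m])
  fix x :: "real ^ 'a"
  obtain N where N: "norm x <= real N" using real_arch_simple by blast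
  show "(%n. indicator (cball 0 (real n)) x *R f x) ---> f x"
   by (rule tendsto_eventually) (use N in "auto intro!: eventually_sequentiallyI[of N]")
 qed
qed

lemma L1_loc_integrable_mult:
 fixes \<phi> :: "real ^ 'n => real"
 assumes f: "f \<in> L1_loc" and \<phi>: "\<phi> \<in> bmeas leb" "!!x. \<bar>\<phi> x\<bar> <= B"
  and K: "compact K" "!!x. x \<notin> K ==> \<phi> x = 0"
 shows "integrable leb (%x. \<phi> x *R f x)"
proof (rule Bochner_Integration.integrable_bound)
 have "set_integrable leb K f" using f K by (auto simp: L1_loc_def)
 then show "integrable leb (%x. B *R (indicator K x *R f x))"
  unfolding set_integrable_def by (intro integrable_scaleR_right)
 show "(%x. \<phi> x *R f x) \<in> bmeas leb" using L1_loc_measurable[OF f] \<phi>(1) by simp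
 have "0 <= B" using \<phi>(2)[of 0] by simp
 then show "AE x in leb. norm (\<phi> x *R f x) <= norm (B *R (indicator K x *R f x))"
  using \<phi>(2) K(2) by (intro AE_I2) (auto simp: indicator_def intro!: mult_right_mono)
qed

lemma L1_loc_add: "f \<in> L1_loc ==> g \<in> L1_loc ==> (%x. f x + g x) \<in> L1_loc"
 by (auto simp: L1_loc_def intro: set_integral_add)

lemma L1_loc_mult: "f \<in> L1_loc ==> (%x. c * f x) \<in> L1_loc"
 by (auto simp: L1_loc_def)

lemma L1_loc_cong_AE:
 assumes "AE x in leb. f x = g x" "f \<in> L1_loc"
 shows "g \<in> L1_loc"
proof -
 have fm: "f \<in> bmeas leb" by (rule L1_loc_measurable[OF assms(2)])
 have gm: "g \<in> bmeas leb" by (rule borel_measurable_AE[OF fm assms(1)])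
 show ?thesis unfolding L1_loc_def
 proof (intro CollectI allI impI)
  fix K :: "(real ^ 'a) set" assume K: "compact K"
  then have "set_integrable leb K f" using assms by (auto simp: L1_loc_def)
  then show "set_integrable leb K g"
   unfolding set_integrable_def
   by (rule integrable_cong_AE_imp)
    (use gm K assms(1) in "auto elim!: eventually_mono intro!: borel_measurable_scaleR borel_measurable_indicator sets_completionI_sets simp: borel_compact")
 qed
qed

lemma sigma_finite_lebesgue: "sigma_finite_measure (leb :: 'a::euclidean_space measure)"
proof (rule sigma_finite_measure.intro)
 obtain A where A: "countable A" "A \<subseteq> sets (lborel::'a measure)" "\<Union>A = space (lborel::'a measure)"
   "ALL a:A. emeasure lborel a ~= \<infinity>"
  using lborel.sigma_finite_countable by blast
 then show "EX A. countable A \<and> A \<subseteq> sets (leb :: 'a measure) \<and> \<Union>A = space (leb :: 'a measure) \<and> (ALL a:A. emeasure leb a ~= \<infinity>)"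
  by (intro exI[of _ A]) auto
qed

text \<open>
Boxes form an intersection-stable generator of the Borel sets, so the vanishing of the integral extends to all of them by a monotone class argument.
\<close>

lemma AE_zero_if_box_integrals_zero:
 fixes h :: "'a::euclidean_space => complex"
 assumes h: "integrable leb h" "(LINT x|leb. h x) = 0"
  and box0: "!!a b. (LINT x|leb. indicator (box a b) x *R h x) = 0"
 shows "AE x in leb. h x = 0"
proof (rule sigma_finite_measure.density_zero[OF sigma_finite_lebesgue h(1)])
 have ih: "integrable leb (%x. indicator A x *R h x)" if "A \<in> sets leb" for A
  using integrable_mult_indicator[OF that h(1)] .
 have Bor: "(LINT x|leb. indicator A x *R h x) = 0" if "A \<in> sets borel" for A
 proof -
  have "A \<in> sigma_sets UNIV (range (%(a, b). box a b))"
   using that unfolding borel_eq_box by simp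
  then show ?thesis
  proof (induction A rule: sigma_sets_induct_disjoint[rotated 2, consumes 1, case_names basic empty compl union Int closed])
   case (basic A) then show ?case using box0 by auto
  next
   case empty show ?case by simp
  next
   case (compl A)
   then have "A \<in> sets borel" unfolding borel_eq_box by simp
   then have A: "A \<in> sets leb" by (simp add: sets_completionI_sets)
   have "(LINT x|leb. indicator (UNIV - A) x *R h x) = (LINT x|leb. h x - indicator A x *R h x)"
    by (intro Bochner_Integration.integral_cong) (auto simp: indicator_def)
   also have "... = 0" using h compl ih[OF A] by simp
   finally show ?case .
  next
   case (union A)
   then have "A i \<in> sets borel" for i unfolding borel_eq_box by auto
   then have A: "A i \<in> sets leb" for i by (simp add: sets_completionI_sets)
   have "(LINT x:(\<Union>i. A i)|leb. h x) = (\<Sum>i. (LINT x:(A i)|leb. h x))"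
    by (rule lebesgue_integral_countable_add)
     (use A union in "auto simp: disjoint_family_on_def set_integrable_def intro!: ih sets.countable_UN")
   with union show ?case by (simp add: set_lebesgue_integral_def)
  next
   case Int show ?case by (auto simp: Int_stable_def box_Int_box)
  next
   case closed show ?case by auto
  qed
 qed
 fix A :: "'a set" assume "A \<in> sets leb"
 then obtain S N N' where A: "A = S \<union> N" "N \<subseteq> N'" "N' \<in> null_sets lborel" "S \<in> sets lborel"
  by (rule sets_completionE)
 have "AE x in lborel. x \<notin> N'" by (rule AE_not_in[OF A(3)])
 then have ae: "AE x in leb. x \<notin> N'" by (rule AE_completion)
 have S: "S \<in> sets borel" using A by simp
 have "set_lebesgue_integral leb A h = (LINT x|leb. indicator S x *R h x)"
  unfolding set_lebesgue_integral_def
 proof (rule integral_cong_AE)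
  show "AE x in leb. indicator A x *R h x = indicator S x *R h x"
   using ae by eventually_elim (use A in "auto simp: indicator_def")
 qed (use ih[OF \<open>A \<in> sets leb\<close>] ih[of S] S in "auto simp: sets_completionI_sets")
 with Bor[OF S] show "set_lebesgue_integral leb A h = 0" by simp
qed

lemma lebesgue_translation: "distr leb leb (%x. a + x) = (leb :: 'a::euclidean_space measure)"
 and lebesgue_translation_measurable: "(%x. a + x) \<in> leb \<rightarrow>\<^sub>M (leb :: 'a::euclidean_space measure)"
proof -
 have T: "a + (\<Sum>j\<in>Basis. (1 * (x \<bullet> j)) *R j) = a + x" for x by (simp add: euclidean_representation)
 have "leb = density (distr leb leb (%x. a + x)) (%_::'a. 1)"
  using lebesgue_affine_euclidean[of "%_. 1" a] unfolding T by simp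
 then show "distr leb leb (%x. a + x) = (leb :: 'a::euclidean_space measure)"
  by (simp add: density_1)
 have "(%x. a + (\<Sum>j\<in>Basis. (1 * (x \<bullet> j)) *R j)) \<in> leb \<rightarrow>\<^sub>M leb"
  by (rule lebesgue_affine_measurable) auto
 then show "(%x. a + x) \<in> leb \<rightarrow>\<^sub>M (leb :: 'a::euclidean_space measure)" unfolding T .
qed

section \<open>Test functions and weak derivatives\<close>

lemma set_integrable_compact_bound:
 assumes "compact K" "f \<in> bmeas leb" "!!x. norm (f x) <= B"
 shows "set_integrable leb K (f :: 'a::euclidean_space => 'b::{banach, second_countable_topology})"
 unfolding set_integrable_def
proof (rule Bochner_Integration.integrable_bound)
 have K: "K \<in> sets leb" using assms(1) by (simp add: borel_compact sets_completionI_sets)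
 have "emeasure leb K < \<infinity>" using assms(1) emeasure_compact_finite[OF assms(1)]
  by (simp add: borel_compact)
 then show "integrable leb (%x. ind K x *R B)"
  using K by (intro integrable_scaleR_left integrable_real_indicator)
 show "(%x. ind K x *R f x) \<in> bmeas leb" using K assms(2) by simp
 show "AE x in leb. norm (ind K x *R f x) <= norm (ind K x *R B)"
  using order_trans[OF assms(3) abs_ge_self] by (intro AE_I2) (auto simp: indicator_def)
qed

lemma L1_locI_bounded:
 assumes "f \<in> bmeas leb" "AE x in leb. cmod (f x) <= B" "0 <= B"
 shows "f \<in> L1_loc"
proof -
 define g where "g x = (if cmod (f x) <= B then f x else 0)" for x
 have g: "g \<in> bmeas leb" unfolding g_def using assms(1) by measurable
 have "g \<in> L1_loc" unfolding L1_loc_def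
  using assms(3) by (auto intro!: set_integrable_compact_bound[where B = B] g simp: g_def)
 moreover have "AE x in leb. g x = f x" using assms(2) by eventually_elim (simp add: g_def)
 ultimately show ?thesis by (rule L1_loc_cong_AE[rotated])
qed

lemma lebesgue_integral_translation:
 fixes f :: "'a::euclidean_space => 'b::{banach, second_countable_topology}"
 assumes [measurable]: "f \<in> bmeas leb"
 shows "(LINT x|leb. f (x + a)) = (LINT x|leb. f x)"
  and "integrable leb f ==> integrable leb (%x. f (x + a))"
  and "(%x. f (x + a)) \<in> bmeas leb"
proof -
 have [measurable]: "(%x. a + x) \<in> leb \<rightarrow>\<^sub>M (leb :: 'a measure)" by (rule lebesgue_translation_measurable)
 have "(LINT x|leb. f x) = (LINT x|distr leb leb (%x. a + x). f x)" by (simp add: lebesgue_translation)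
 also have "... = (LINT x|leb. f (a + x))" by (rule integral_distr) auto
 finally show "(LINT x|leb. f (x + a)) = (LINT x|leb. f x)" by (simp add: add.commute)
 show "(%x. f (x + a)) \<in> bmeas leb"
  using measurable_compose[OF lebesgue_translation_measurable assms, of a] by (simp add: add.commute)
 assume "integrable leb f"
 then have "integrable (distr leb leb (%x. a + x)) f" by (simp add: lebesgue_translation)
 then have "integrable leb (%x. f (a + x))" by (subst (asm) integrable_distr_eq) auto
 then show "integrable leb (%x. f (x + a))" by (simp add: add.commute)
qed

lemma AE_lebesgue_translation:
 fixes a :: "'a::euclidean_space"
 assumes "AE x in leb. P x"
 shows "AE x in leb. P (x + a)"
proof -
 have "AE x in distr leb leb (%x. a + x). P x" unfolding lebesgue_translation by (rule assms)
 from AE_distrD[OF lebesgue_translation_measurable this] show ?thesis by (simp add: add.commute)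
qed

lemma test_function_times: "test_function \<phi> ==> times_differentiable m \<phi>"
 by (simp add: test_function_def)

lemma test_function_continuous: "test_function \<phi> ==> continuous_on UNIV \<phi>"
 using test_function_times[of \<phi> 0] by simp

lemma test_function_has_derivative:
 "test_function \<phi> ==> (\<phi> has_derivative frechet_derivative \<phi> (at x)) (at x)"
 using test_function_times[of \<phi> 1] by (simp add: differentiable_on_def frechet_derivative_works)

lemma test_function_partial_continuous: "test_function \<phi> ==> continuous_on UNIV (partial k \<phi>)"
 using test_function_times[of \<phi> 1] by simp

lemma test_function_support:
 assumes "test_function \<phi>"
 shows "EX K. compact K \<and> (ALL x. x \<notin> K --> \<phi> x = 0) \<and> (ALL x k. x \<notin> K --> partial k \<phi> x = 0)"
proof (intro exI conjI allI impI)
 let ?K = "closure {x. \<phi> x ~= 0}"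
 show "compact ?K" using assms by (simp add: test_function_def)
 have 0: "\<phi> x = 0" if "x \<notin> ?K" for x using that closure_subset[of "{x. \<phi> x ~= 0}"] by auto
 show "\<phi> x = 0" if "x \<notin> ?K" for x using that by (rule 0)
 fix x k assume x: "x \<notin> ?K"
 have "(\<phi> has_derivative (%_. 0)) (at x)"
 proof (rule has_derivative_transform_within_open[OF has_derivative_const])
  show "open (- ?K)" by (rule open_Compl[OF closed_closure])
  show "x \<in> - ?K" using x by simp
  show "0 = \<phi> y" if "y \<in> - ?K" for y using 0[of y] that by simp
 qed
 from frechet_derivative_at[OF this, symmetric] show "partial k \<phi> x = 0" by (simp add: partial_def)
qed

lemma continuous_compact_support_bounded:
 fixes \<phi> :: "'a::euclidean_space => real"
 assumes "continuous_on UNIV \<phi>" "compact K" "!!x. x \<notin> K ==> \<phi> x = 0"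
 shows "EX B>=0. ALL x. \<bar>\<phi> x\<bar> <= B"
proof -
 have "bounded (\<phi> ` K)" using assms by (intro compact_imp_bounded compact_continuous_image) (auto intro: continuous_on_subset)
 then obtain B where B: "!!x. x \<in> K ==> \<bar>\<phi> x\<bar> <= B" by (auto simp: bounded_iff)
 have "\<bar>\<phi> x\<bar> <= max 0 B" for x
  using B[of x] assms(3)[of x] by (cases "x \<in> K") auto
 then show ?thesis by (intro exI[of _ "max 0 B"]) auto
qed

lemma test_function_bounded:
 assumes "test_function \<phi>"
 shows "EX B>=0. (ALL x. \<bar>\<phi> x\<bar> <= B) \<and> (ALL x. \<bar>partial k \<phi> x\<bar> <= B)"
proof -
 obtain K where K: "compact K" "!!x. x \<notin> K ==> \<phi> x = 0"
   "!!x k. x \<notin> K ==> partial k \<phi> x = 0"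
  using test_function_support[OF assms] by blast
 obtain B where B: "0 <= B" "!!x. \<bar>\<phi> x\<bar> <= B"
  using continuous_compact_support_bounded[OF test_function_continuous[OF assms] K(1,2)] by blast
 obtain B' where B': "0 <= B'" "!!x. \<bar>partial k \<phi> x\<bar> <= B'"
  using continuous_compact_support_bounded[OF test_function_partial_continuous[OF assms] K(1,3)] by blast
 show ?thesis
 proof (intro exI[of _ "max B B'"] conjI allI)
  show "0 <= max B B'" using B(1) by simp
  show "\<bar>\<phi> x\<bar> <= max B B'" for x using B(2)[of x] by simp
  show "\<bar>partial k \<phi> x\<bar> <= max B B'" for x using B'(2)[of x] by simp
 qed
qed

lemma test_function_line:
 assumes "test_function \<phi>"
 shows "((%t. \<phi> (x + t *R axis k 1)) has_real_derivative partial k \<phi> (x + t *R axis k 1)) (at t)"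
proof -
 let ?y = "x + t *R axis k 1"
 note d = test_function_has_derivative[OF assms, of ?y]
 have "((%t. x + t *R axis k 1) has_derivative (%s. s *R axis k 1)) (at t)"
  by (auto intro!: derivative_eq_intros)
 from has_derivative_compose[OF this d]
 have "((%t. \<phi> (x + t *R axis k 1)) has_derivative (%s. frechet_derivative \<phi> (at ?y) (s *R axis k 1))) (at t)" .
 moreover have "(%s. frechet_derivative \<phi> (at ?y) (s *R axis k 1)) = (*) (partial k \<phi> ?y)"
  using linear_scale[OF has_derivative_linear[OF d]] by (auto simp: partial_def fun_eq_iff)
 ultimately show ?thesis by (simp add: has_field_derivative_def)
qed

lemma test_function_line_lipschitz:
 assumes "test_function \<phi>" and B: "!!x. \<bar>partial k \<phi> x\<bar> <= B"
 shows "\<bar>\<phi> (x + t *R axis k 1) - \<phi> x\<bar> <= B * \<bar>t\<bar>"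
proof -
 have "norm (\<phi> (x + t *R axis k 1) - \<phi> (x + 0 *R axis k 1)) <= B * norm (t - 0)"
  by (rule field_differentiable_bound[of UNIV "%t. \<phi> (x + t *R axis k 1)" "%t. partial k \<phi> (x + t *R axis k 1)"])
   (use test_function_line[OF assms(1)] B in "auto intro: DERIV_subset")
 then show ?thesis by simp
qed

lemma partial_translation:
 assumes "f differentiable (at (x + a))"
 shows "partial k (%x. f (x + a)) x = partial k f (x + a)"
proof -
 have "(f has_derivative frechet_derivative f (at (x + a))) (at (x + a))" using assms by (simp add: frechet_derivative_works)
 moreover have "((%x. x + a) has_derivative (%v. v)) (at x)" by (auto intro!: derivative_eq_intros)
 ultimately have "((%x. f (x + a)) has_derivative frechet_derivative f (at (x + a))) (at x)"
  using has_derivative_compose by fastforce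
 from frechet_derivative_at[OF this] show ?thesis by (simp add: partial_def)
qed

lemma times_differentiable_translation:
 "times_differentiable m f ==> times_differentiable m (%x. f (x + a))"
proof (induction m arbitrary: f)
 case 0
 then show ?case by (auto intro!: continuous_on_compose2[of UNIV f] continuous_intros)
next
 case (Suc m)
 then have d: "f differentiable (at x)" for x by (simp add: differentiable_on_def)
 have "(%x. f (x + a)) differentiable (at x)" for x
  using differentiable_compose[of f "%x. x + a" x UNIV] d by (simp add: differentiable_add)
 moreover have "partial k (%x. f (x + a)) = (%x. partial k f (x + a))" for k
  using partial_translation[OF d] by auto
 ultimately show ?case using Suc by (simp add: differentiable_on_def)
qed

lemma test_function_translation:
 assumes "test_function \<phi>"
 shows "test_function (%x. \<phi> (x + a))" "partial k (%x. \<phi> (x + a)) x = partial k \<phi> (x + a)"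
proof -
 obtain K where K: "compact K" "!!x. x \<notin> K ==> \<phi> x = 0"
   "!!x k. x \<notin> K ==> partial k \<phi> x = 0"
  using test_function_support[OF assms] by blast
 have c: "compact ((%x. - a + x) ` K)" using K by (intro compact_translation)
 have "{x. \<phi> (x + a) ~= 0} \<subseteq> (%x. - a + x) ` K"
 proof
  fix x assume "x \<in> {x. \<phi> (x + a) ~= 0}"
  then have "x + a \<in> K" using K by blast
  moreover have "x = - a + (x + a)" by simp
  ultimately show "x \<in> (%x. - a + x) ` K" by blast
 qed
 then have "closure {x. \<phi> (x + a) ~= 0} \<subseteq> (%x. - a + x) ` K"
  by (intro closure_minimal compact_imp_closed c)
 then have "compact (closure {x. \<phi> (x + a) ~= 0})"
  using bounded_subset[OF compact_imp_bounded[OF c]] by (simp add: compact_eq_bounded_closed)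
 then show "test_function (%x. \<phi> (x + a))"
  using assms by (simp add: test_function_def times_differentiable_translation)
 show "partial k (%x. \<phi> (x + a)) x = partial k \<phi> (x + a)"
  using test_function_has_derivative[OF assms] by (intro partial_translation) (rule differentiableI)
qed

lemma test_integrable:
 assumes "test_function \<phi>" "f \<in> L1_loc"
 shows "integrable leb (%x. \<phi> x *R f x)" "integrable leb (%x. partial k \<phi> x *R f x)"
proof -
 obtain K where K: "compact K" "!!x. x \<notin> K ==> \<phi> x = 0"
   "!!x k. x \<notin> K ==> partial k \<phi> x = 0"
  using test_function_support[OF assms(1)] by blast
 obtain B where B: "0 <= B" "!!x. \<bar>\<phi> x\<bar> <= B" "!!x. \<bar>partial k \<phi> x\<bar> <= B"
  using test_function_bounded[OF assms(1), of k] by blast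
 have m: "\<phi> \<in> bmeas leb" "partial k \<phi> \<in> bmeas leb"
  using test_function_continuous[OF assms(1)] test_function_partial_continuous[OF assms(1)]
  by (auto intro!: measurable_completion borel_measurable_continuous_onI)
 show "integrable leb (%x. \<phi> x *R f x)" by (rule L1_loc_integrable_mult[OF assms(2) m(1) B(2) K(1,2)])
 show "integrable leb (%x. partial k \<phi> x *R f x)" by (rule L1_loc_integrable_mult[OF assms(2) m(2) B(3) K(1,3)])
qed

text \<open>
Testing with the bumps of a box and passing to the limit shows that the integral over every box vanishes. Uniqueness of weak derivatives, and every later identification of a weak derivative, rests on this.
\<close>

lemma du_bois_reymond:
 assumes f: "f \<in> L1_loc" and z: "!!\<phi>. test_function \<phi> ==> (LINT x|leb. \<phi> x *R f x) = 0"
 shows "AE x in leb. f x = 0"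
proof -
 have fm: "f \<in> bmeas leb" by (rule L1_loc_measurable[OF f])
 have iK: "integrable leb (%x. ind (cbox a b) x *R f x)" for a b
  using f by (auto simp: L1_loc_def set_integrable_def)
 have bm: "box a b \<in> sets leb" for a b :: "real ^ 'a" by (simp add: sets_completionI_sets)
 have ib: "integrable leb (%x. ind (box a b) x *R f x)" for a b
 proof (rule Bochner_Integration.integrable_bound[OF iK[of a b]])
  show "(%x. ind (box a b) x *R f x) \<in> bmeas leb"
   by (intro borel_measurable_scaleR borel_measurable_indicator bm fm)
 qed (use box_subset_cbox[of a b] in "auto intro!: AE_I2 simp: indicator_def")
 have box0: "(LINT x|leb. ind (box a b) x *R f x) = 0" for a b
 proof -
  have "(%m. \<integral>x. bump a b m x *R f x \<partial>leb) ---> (LINT x|leb. ind (box a b) x *R f x)"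
  proof (rule integral_dominated_convergence)
   show "integrable leb (%x. norm (ind (cbox a b) x *R f x))" by (intro integrable_norm iK)
   show "AE x in leb. (%m. bump a b m x *R f x) ---> ind (box a b) x *R f x"
    by (intro AE_I2 tendsto_intros bump_tendsto)
   show "AE x in leb. norm (bump a b m x *R f x) <= norm (ind (cbox a b) x *R f x)" for m
   proof (rule AE_I2)
    fix x
    show "norm (bump a b m x *R f x) <= norm (ind (cbox a b) x *R f x)"
     using bump_bounds[of a b m x] bump_outside[of x a b m] subsetD[OF box_subset_cbox[of a b], of x]
     by (cases "x \<in> cbox a b"; cases "x \<in> box a b") (auto intro: mult_left_le_one_le)
   qed
   show "(%x. bump a b m x *R f x) \<in> bmeas leb" for m
    by (rule borel_measurable_integrable[OF test_integrable(1)[OF bump_test_function f]])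
   show "(%x. ind (box a b) x *R f x) \<in> bmeas leb" by (rule borel_measurable_integrable[OF ib])
  qed
  then show ?thesis using z[OF bump_test_function] by (simp add: LIMSEQ_const_iff)
 qed
 define u :: "nat => real ^ 'a" where "u N = (\<chi> i. real N)" for N
 have "AE x in leb. ind (box (- u N :: real ^ 'a) (u N)) x *R f x = 0" for N
 proof (rule AE_zero_if_box_integrals_zero[OF ib box0])
  fix a b :: "real ^ 'a"
  let ?a = "\<Sum>i\<in>Basis. max (a \<bullet> i) (- u N \<bullet> i) *R i" and ?b = "\<Sum>i\<in>Basis. min (b \<bullet> i) (u N \<bullet> i) *R i"
  have "(LINT x|leb. ind (box a b) x *R (ind (box (- u N) (u N)) x *R f x))
    = (LINT x|leb. ind (box ?a ?b) x *R f x)"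
   unfolding box_Int_box[symmetric] by (intro Bochner_Integration.integral_cong) (auto simp: indicator_def)
  then show "(LINT x|leb. ind (box a b) x *R (ind (box (- u N) (u N)) x *R f x)) = 0"
   using box0 by simp
 qed
 then have "AE x in leb. ALL N. ind (box (- u N :: real ^ 'a) (u N)) x *R f x = 0"
  unfolding AE_all_countable by blast
 then show ?thesis
 proof eventually_elim
  case (elim x)
  obtain N where N: "norm x < real N" using reals_Archimedean2 by blast
  have "\<bar>x $ i\<bar> < real N" for i using component_le_norm_cart[of x i] N by simp
  then have "x \<in> box (- u N) (u N)" by (auto simp: mem_box_cart u_def abs_less_iff minus_less_iff)
  with elim[rule_format, of N] show ?case by simp
 qed
qed

lemma weak_partial_unique_AE:
 assumes "is_weak_partial k f g" "is_weak_partial k f h"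
 shows "AE x in leb. g x = h x"
proof -
 have L: "g \<in> L1_loc" "h \<in> L1_loc" using assms by (auto simp: is_weak_partial_def)
 have d: "(%x. g x + (-1) * h x) \<in> L1_loc" by (intro L1_loc_add L1_loc_mult L)
 have "AE x in leb. g x + (-1) * h x = 0"
 proof (rule du_bois_reymond[OF d])
  fix \<phi> :: "real ^ 'a => real" assume \<phi>: "test_function \<phi>"
  have "(LINT x|leb. \<phi> x *R (g x + (-1) * h x)) = (LINT x|leb. \<phi> x *R g x - \<phi> x *R h x)"
   by (simp add: algebra_simps)
  also have "... = (LINT x|leb. \<phi> x *R g x) - (LINT x|leb. \<phi> x *R h x)"
   by (intro Bochner_Integration.integral_diff test_integrable \<phi> L)
  also have "... = 0"
   using assms \<phi> by (simp add: is_weak_partial_def)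
  finally show "(LINT x|leb. \<phi> x *R (g x + (-1) * h x)) = 0" .
 qed
 then show ?thesis by eventually_elim simp
qed

lemma is_weak_partial_cong:
 assumes "is_weak_partial k f g" "AE x in leb. f x = f' x" "AE x in leb. g x = g' x"
 shows "is_weak_partial k f' g'"
proof -
 have L: "f \<in> L1_loc" "g \<in> L1_loc" using assms by (auto simp: is_weak_partial_def)
 have L': "f' \<in> L1_loc" "g' \<in> L1_loc" using L1_loc_cong_AE[OF assms(2) L(1)] L1_loc_cong_AE[OF assms(3) L(2)] .
 show ?thesis unfolding is_weak_partial_def
 proof (intro conjI allI impI L')
  fix \<phi> :: "real ^ 'a => real" assume \<phi>: "test_function \<phi>"
  have "(LINT x|leb. partial k \<phi> x *R f' x) = (LINT x|leb. partial k \<phi> x *R f x)"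
   by (rule integral_cong_AE)
    (use assms(2) test_integrable[OF \<phi> L(1)] test_integrable[OF \<phi> L'(1)] in "auto elim!: eventually_mono")
  moreover have "(LINT x|leb. \<phi> x *R g' x) = (LINT x|leb. \<phi> x *R g x)"
   by (rule integral_cong_AE)
    (use assms(3) test_integrable[OF \<phi> L(2)] test_integrable[OF \<phi> L'(2)] in "auto elim!: eventually_mono")
  ultimately show "(LINT x|leb. partial k \<phi> x *R f' x) = - (LINT x|leb. \<phi> x *R g' x)"
   using assms(1) \<phi> by (simp add: is_weak_partial_def)
 qed
qed

lemma weak_partial_cong_AE:
 assumes "AE x in leb. f x = f' x"
 shows "wp k f = wp k f'"
proof -
 have "AE x in leb. f' x = f x" using assms by eventually_elim simp
 then have "is_weak_partial k f g \<longleftrightarrow> is_weak_partial k f' g" for g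
  using is_weak_partial_cong[of k f g f' g] is_weak_partial_cong[of k f' g f g] assms by auto
 then show ?thesis by (simp add: weak_partial_def)
qed

lemma is_weak_partial_weak_partial: "is_weak_partial k f g ==> is_weak_partial k f (wp k f)"
 unfolding weak_partial_def by (rule someI[of "is_weak_partial k f"])

lemma weak_partial_eq_AE: "is_weak_partial k f g ==> AE x in leb. wp k f x = g x"
 by (rule weak_partial_unique_AE[OF is_weak_partial_weak_partial])

lemma is_weak_partial_add:
 assumes "is_weak_partial k f g" "is_weak_partial k f' g'"
 shows "is_weak_partial k (%x. f x + f' x) (%x. g x + g' x)"
proof -
 have L: "f \<in> L1_loc" "g \<in> L1_loc" "f' \<in> L1_loc" "g' \<in> L1_loc" using assms by (auto simp: is_weak_partial_def)
 then show ?thesis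
  using assms unfolding is_weak_partial_def by (auto intro!: L1_loc_add simp: scaleR_add_right test_integrable)
qed

lemma is_weak_partial_mult:
 assumes "is_weak_partial k f g"
 shows "is_weak_partial k (%x. c * f x) (%x. c * g x)"
 using assms unfolding is_weak_partial_def by (auto intro!: L1_loc_mult simp: mult_scaleR_right[symmetric] simp del: mult_scaleR_right)

lemma norm_divideR_le: "norm y <= L * d ==> 0 < d ==> norm (y /\<^sub>R d) <= L"
 by (simp add: field_simps)

text \<open>
Explicit functions enter through this criterion. The integral of \<open>\<phi> f\<close> does not change under a translation along axis \<open>k\<close>; dividing by the length of the translation and
letting it tend to zero gives the product rule under the integral, where the Lipschitz bound provides the dominating function.
\<close>

lemma is_weak_partialI_difference:
 fixes f :: "real ^ 'n => complex"
 assumes fm: "f \<in> bmeas leb" and gm: "g \<in> bmeas leb"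
  and B: "!!x. cmod (f x) <= B"
  and L: "!!x t. cmod (f (x + t *R axis k 1) - f x) <= L * \<bar>t\<bar>"
  and D: "AE x in leb. ((%t. f (x + t *R axis k 1)) has_vector_derivative g x) (at 0)"
 shows "is_weak_partial k f g"
proof -
 have B0: "0 <= B" by (rule order_trans[OF norm_ge_zero B[of 0]])
 have L0: "0 <= L" using order_trans[OF norm_ge_zero L[of 0 1]] by simp
 define d where "d n = inverse (real (Suc n))" for n
 have d: "d n > 0" "d n <= 1" for n by (auto simp: d_def field_simps)
 have d0: "d ---> 0" unfolding d_def by (rule LIMSEQ_inverse_real_of_nat)
 have quot: "(%n. (h (d n) - h 0) /\<^sub>R d n) ---> h'" if "(h has_vector_derivative h') (at 0)" for h :: "real => complex" and h'
 proof -
  have "((%t. norm (h t - h 0 - (t - 0) *R h') / norm (t - 0)) \<longlongrightarrow> 0) (at 0)"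
   using that unfolding has_vector_derivative_def has_derivative_iff_norm by simp
  then have "((%t. norm ((h t - h 0) /\<^sub>R t - h')) \<longlongrightarrow> 0) (at 0)"
  proof (rule Lim_transform_eventually)
   have eq: "norm (h t - h 0 - (t - 0) *R h') / norm (t - 0) = norm ((h t - h 0) /\<^sub>R t - h')" if "t ~= 0" for t
   proof -
    have "h t - h 0 - (t - 0) *R h' = t *R ((h t - h 0) /\<^sub>R t - h')"
     using that by (simp add: scaleR_diff_right)
    then show ?thesis using that by simp
   qed
   show "\<forall>\<^sub>F t in at 0. norm (h t - h 0 - (t - 0) *R h') / norm (t - 0) = norm ((h t - h 0) /\<^sub>R t - h')"
    unfolding eventually_at_filter by (rule always_eventually) (use eq in simp)
  qed
  then have "((%t. (h t - h 0) /\<^sub>R t) \<longlongrightarrow> h') (at 0)"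
   by (simp only: tendsto_norm_zero_iff LIM_zero_iff)
  moreover have "filterlim d (at 0) sequentially" using d0 d by (auto simp: filterlim_at less_le)
  ultimately show ?thesis by (rule filterlim_compose)
 qed
 have AEg: "AE x in leb. cmod (g x) <= L" using D
 proof eventually_elim
  case (elim x)
  show ?case
  proof (rule LIMSEQ_le_const2[OF tendsto_norm[OF quot[OF elim]]], intro exI allI impI)
   fix n
   show "cmod ((f (x + d n *R axis k 1) - f (x + 0 *R axis k 1)) /\<^sub>R d n) <= L"
    using L[of x "d n"] d(1)[of n] by (intro norm_divideR_le) auto
  qed
 qed
 have fL: "f \<in> L1_loc" by (rule L1_locI_bounded[OF fm _ B0]) (use B in auto)
 have gL: "g \<in> L1_loc" by (rule L1_locI_bounded[OF gm AEg L0])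
 have "(LINT x|leb. partial k \<phi> x *R f x) = - (LINT x|leb. \<phi> x *R g x)" if \<phi>: "test_function \<phi>" for \<phi>
 proof -
  obtain K where K: "compact K" "!!x. x \<notin> K ==> \<phi> x = 0"
   "!!x k. x \<notin> K ==> partial k \<phi> x = 0"
  using test_function_support[OF \<phi>] by blast
  obtain r where r: "!!x. x \<in> K ==> norm x <= r" using compact_imp_bounded[OF K(1)] by (auto simp: bounded_iff)
  obtain C where C: "0 <= C" "!!x. \<bar>\<phi> x\<bar> <= C" "!!x. \<bar>partial k \<phi> x\<bar> <= C" using test_function_bounded[OF \<phi>, of k] by blast
  define F where "F x = \<phi> x *R f x" for x
  have iF: "integrable leb F" unfolding F_def by (rule test_integrable[OF \<phi> fL])
  define Q where "Q n x = (F (x + d n *R axis k 1) - F x) /\<^sub>R d n" for n x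
  have iQ: "integrable leb (Q n)" for n
   unfolding Q_def using iF lebesgue_integral_translation(2)[OF _ iF] by (intro integrable_scaleR_right Bochner_Integration.integrable_diff) auto
  have Q0: "(LINT x|leb. Q n x) = 0" for n
   unfolding Q_def using iF lebesgue_integral_translation(1,2)[of F "d n *R axis k 1"] by simp
  have Qle: "cmod (Q n x) <= (C * L + C * B) * ind (cball 0 (r + 1)) x" for n x
  proof (cases "x \<in> cball 0 (r + 1)")
   case True
   let ?y = "x + d n *R axis k 1"
   have "F ?y - F x = \<phi> ?y *R (f ?y - f x) + (\<phi> ?y - \<phi> x) *R f x" by (simp add: F_def algebra_simps)
   then have "cmod (F ?y - F x) <= \<bar>\<phi> ?y\<bar> * cmod (f ?y - f x) + \<bar>\<phi> ?y - \<phi> x\<bar> * cmod (f x)"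
    using norm_triangle_ineq[of "\<phi> ?y *R (f ?y - f x)" "(\<phi> ?y - \<phi> x) *R f x"] by simp
   also have "... <= C * (L * \<bar>d n\<bar>) + (C * \<bar>d n\<bar>) * B"
    using C(2)[of ?y] L[of x "d n"] test_function_line_lipschitz[OF \<phi> C(3), of x "d n"] B[of x] C(1) L0 B0
    by (intro add_mono mult_mono) auto
   also have "... = (C * L + C * B) * d n" using d(1)[of n] by (simp add: algebra_simps)
   finally have "cmod ((F ?y - F x) /\<^sub>R d n) <= C * L + C * B" using d(1) by (rule norm_divideR_le)
   then show ?thesis using True by (simp add: Q_def)
  next
   case False
   have "norm x <= norm (x + d n *R axis k 1) + norm (d n *R axis k (1::real))"
    using norm_triangle_ineq4[of "x + d n *R axis k 1" "d n *R axis k 1"] by simp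
   then have "r < norm (x + d n *R axis k 1)" "r < norm x" using False d[of n] by (auto simp: norm_axis_1)
   then have "x + d n *R axis k 1 \<notin> K" "x \<notin> K" using r by (auto simp: not_le[symmetric])
   then show ?thesis using False K(2) by (simp add: Q_def F_def)
  qed
  have "(%n. \<integral>x. Q n x \<partial>leb) ---> (LINT x|leb. partial k \<phi> x *R f x + \<phi> x *R g x)"
  proof (rule integral_dominated_convergence)
   show "integrable leb (%x. (C * L + C * B) * ind (cball 0 (r + 1)) x)"
    using emeasure_compact_finite[OF compact_cball, of 0 "r+1"]
    by (intro integrable_mult_right integrable_real_indicator) (auto simp: sets_completionI_sets)
   show "AE x in leb. norm (Q n x) <= (C * L + C * B) * ind (cball 0 (r + 1)) x" for n
    by (intro AE_I2 Qle)
   show "AE x in leb. (%n. Q n x) ---> partial k \<phi> x *R f x + \<phi> x *R g x" using D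
   proof eventually_elim
    case (elim x)
    have "((%t. \<phi> (x + t *R axis k 1)) has_real_derivative partial k \<phi> (x + 0 *R axis k 1)) (at 0)"
     by (rule test_function_line[OF \<phi>])
    from has_vector_derivative_scaleR[OF this elim]
    have "((%t. F (x + t *R axis k 1)) has_vector_derivative (\<phi> x *R g x + partial k \<phi> x *R f x)) (at 0)" by (simp add: F_def)
    from quot[OF this] show ?case by (simp add: Q_def add.commute)
   qed
  qed (use iQ test_integrable[OF \<phi> fL] test_integrable[OF \<phi> gL] in auto)
  then have "(LINT x|leb. partial k \<phi> x *R f x + \<phi> x *R g x) = 0" by (simp add: Q0 LIMSEQ_const_iff)
  then show ?thesis using test_integrable[OF \<phi> fL] test_integrable[OF \<phi> gL] by (simp add: add_eq_0_iff)
 qed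
 with fL gL show ?thesis by (simp add: is_weak_partial_def)
qed

section \<open>Lattices, cells and periodic functions\<close>

text \<open>
The point of the lattice of periods with integer coordinates \<open>m\<close>.
\<close>

definition lat :: "real => int ^ 'n => real ^ 'n" where
 "lat T m = (\<chi> i. T * of_int (m $ i))"

text \<open>
The half-open cell: its lattice translates are a partition of the whole space, so each point has a unique representative \<open>red T x\<close> in it.
\<close>

definition hcell :: "real => (real ^ 'n) set" where
 "hcell T = {x. ALL i. 0 <= x $ i \<and> x $ i < T}"

definition flo :: "real => real ^ 'n => int ^ 'n" where
 "flo T x = (\<chi> i. \<lfloor>x $ i / T\<rfloor>)"

definition red :: "real => real ^ 'n => real ^ 'n" where
 "red T x = x - lat T (flo T x)"

lemma lat_nth [simp]: "lat T m $ i = T * of_int (m $ i)" by (simp add: lat_def)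
lemma flo_nth [simp]: "flo T x $ i = \<lfloor>x $ i / T\<rfloor>" by (simp add: flo_def)
lemma lat_add: "lat T (m + n) = lat T m + lat T n" by (simp add: vec_eq_iff algebra_simps)
lemma lat_zero [simp]: "lat T 0 = 0" by (simp add: vec_eq_iff)
lemma lat_minus: "lat T (- m) = - lat T m" by (simp add: vec_eq_iff)

lemma add_lat_mem_hcell_iff:
 assumes "T > 0"
 shows "x + lat T m \<in> hcell T \<longleftrightarrow> m = - flo T x"
proof -
 have "0 <= x $ i + T * of_int (m $ i) \<and> x $ i + T * of_int (m $ i) < T \<longleftrightarrow> m $ i = - \<lfloor>x $ i / T\<rfloor>" for i
 proof -
  have "0 <= x $ i + T * of_int (m $ i) \<and> x $ i + T * of_int (m $ i) < T \<longleftrightarrow>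
    of_int (- (m $ i)) <= x $ i / T \<and> x $ i / T < of_int (- (m $ i)) + 1"
   using assms by (simp add: field_simps) (auto simp: algebra_simps)
  also have "... \<longleftrightarrow> \<lfloor>x $ i / T\<rfloor> = - (m $ i)" by (simp only: floor_eq_iff)
  finally show ?thesis by auto
 qed
 then show ?thesis by (simp add: hcell_def vec_eq_iff)
qed

lemma red_mem: "T > 0 ==> red T x \<in> hcell T"
 using add_lat_mem_hcell_iff[of T x "- flo T x"] by (simp add: red_def lat_minus)

lemma flo_add_lat: "T > 0 ==> flo T (x + lat T m) = flo T x + m"
 by (simp add: vec_eq_iff add_divide_distrib)

lemma red_add_lat: "T > 0 ==> red T (x + lat T m) = red T x"
 by (simp add: red_def flo_add_lat lat_add)

text \<open>
Invariance under all lattice translations at once; it is equivalent to \<open>periodic\<close> and is the form in which lattice sums use it.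
\<close>

definition lper :: "real => (real ^ 'n => 'b) => bool" where
 "lper T f \<longleftrightarrow> (ALL m x. f (x + lat T m) = f x)"

lemma lper_red: "lper T f ==> f (red T x) = f x"
 using lper_def[of T f] by (metis diff_add_cancel red_def)

lemma lper_compose_red: "T > 0 ==> lper T (%x. f (red T x))"
 by (simp add: lper_def red_add_lat)

lemma lper_shift: "lper T f ==> lper T (%x. f (x + h))"
 unfolding lper_def by (metis add.assoc add.commute)

lemma periodic_imp_lper:
 assumes "periodic T f"
 shows "lper T f"
proof -
 have nat: "f (x + real n *R axis k T) = f x" for n k x
 proof (induction n arbitrary: x)
  case (Suc n)
  have "f (x + real (Suc n) *R axis k T) = f ((x + axis k T) + real n *R axis k T)"
   by (simp add: algebra_simps)
  also have "... = f x" using Suc assms by (simp add: periodic_def)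
  finally show ?case .
 qed simp
 have int: "f (x + of_int m *R axis k T) = f x" for m k x
 proof (cases m rule: int_cases2)
  case (nonneg n) then show ?thesis using nat by simp
 next
  case (nonpos n)
  then show ?thesis using nat[of "x + of_int m *R axis k T" n k] by simp
 qed
 have *: "finite A ==> f (x + (\<Sum>k\<in>A. of_int (m $ k) *R axis k T)) = f x" for A x and m :: "int ^ 'a"
 proof (induction A arbitrary: x rule: finite_induct)
  case (insert a A)
  then show ?case using int[of x "m $ a" a] by (simp add: add.assoc[symmetric])
 qed simp
 have "lat T m = (\<Sum>k\<in>UNIV. of_int (m $ k) *R axis k T)" for m :: "int ^ 'a"
  by (simp add: vec_eq_iff axis_def if_distrib cong: if_cong)
 then show ?thesis using *[of UNIV] by (simp add: lper_def)
qed

lemma lper_imp_periodic: "lper T f ==> periodic T f"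
 unfolding periodic_def lper_def
proof (intro allI)
 fix k :: 'a and x :: "real ^ 'a" assume "ALL m x. f (x + lat T m) = f x"
 moreover have "lat T (axis k 1) = axis k T" by (simp add: vec_eq_iff axis_def)
 ultimately show "f (x + axis k T) = f x" by metis
qed

lemma vec_nth_borel [measurable]: "(%x :: real ^ 'n. x $ i) \<in> bmeas borel"
 by (intro borel_measurable_continuous_onI continuous_intros)

lemma hcell_borel [measurable]: "hcell T \<in> sets borel"
proof -
 have "hcell T = {x \<in> space borel. ALL i. 0 <= x $ i \<and> x $ i < T}" by (simp add: hcell_def)
 also have "... \<in> sets borel" by measurable
 finally show ?thesis .
qed

lemma red_borel [measurable]: "red T \<in> bmeas borel"
proof -
 have "red T = (%x. x - (\<Sum>k\<in>UNIV. (T * of_int \<lfloor>x $ k / T\<rfloor>) *R axis k 1))"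
  by (simp add: fun_eq_iff vec_eq_iff red_def axis_def if_distrib cong: if_cong)
 also have "... \<in> bmeas borel" by measurable
 finally show ?thesis .
qed

lemma cell_eq_cbox: "cell T = cbox 0 (\<chi> i. T)"
 by (auto simp: cell_def mem_box_cart)

lemma cell_borel [measurable]: "cell T \<in> sets borel"
 by (simp add: cell_eq_cbox)

lemma hcell_subset_cell: "hcell T \<subseteq> cell T"
 by (auto simp: cell_def hcell_def less_imp_le)

lemma AE_cell_iff_hcell: "AE x in lborel. x \<in> cell T \<longleftrightarrow> x \<in> hcell (T :: real)"
proof -
 have "AE x in lborel. x $ i ~= T" for i :: 'a
 proof -
  have "{x :: real ^ 'a. x $ i = T} = {x. axis i 1 \<bullet> x = T}" by (simp add: inner_axis')
  then have "negligible {x :: real ^ 'a. x $ i = T}" using negligible_hyperplane[of "axis i 1 :: real ^ 'a" T] by (simp add: axis_eq_0_iff)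
  then have "{x :: real ^ 'a. x $ i = T} \<in> null_sets leb" by (simp add: negligible_iff_null_sets)
  then have "AE x in leb. \<not> (x :: real ^ 'a) \<in> {x. x $ i = T}" by (rule AE_not_in)
  then show ?thesis by (simp add: AE_completion_iff)
 qed
 then have "AE x in lborel. ALL i. (x :: real ^ 'a) $ i ~= T" by (simp add: AE_all_countable)
 then show ?thesis by eventually_elim (auto simp: cell_def hcell_def less_le)
qed

lemma nn_integral_lborel_translation:
 fixes a :: "'a::euclidean_space"
 assumes [measurable]: "F \<in> bmeas borel"
 shows "(\<integral>\<^sup>+x. F (x + a) \<partial>lborel) = (\<integral>\<^sup>+x. F x \<partial>lborel)"
proof -
 have "(\<integral>\<^sup>+x. F x \<partial>lborel) = (\<integral>\<^sup>+x. F x \<partial>distr lborel borel ((+) a))" by (simp add: lborel_distr_plus)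
 also have "... = (\<integral>\<^sup>+x. F (a + x) \<partial>lborel)" by (subst nn_integral_distr) auto
 finally show ?thesis by (simp add: add.commute)
qed

definition enum :: "nat => int ^ 'n" where "enum = from_nat_into UNIV"

lemma infinite_lattice: "infinite (UNIV :: (int ^ 'n) set)"
proof
 assume "finite (UNIV :: (int ^ 'n) set)"
 then have "finite ((%m :: int ^ 'n. m $ undefined) ` UNIV)" by (rule finite_imageI)
 moreover have "(%m :: int ^ 'n. m $ undefined) ` UNIV = (UNIV :: int set)"
 proof -
  have "z \<in> (%m :: int ^ 'n. m $ undefined) ` UNIV" for z
   by (rule image_eqI[of _ _ "\<chi> i. z"]) simp_all
  then show ?thesis by blast
 qed
 ultimately show False using infinite_UNIV_int by simp
qed

lemma enum_bij: "bij (enum :: nat => int ^ 'n)"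
 unfolding enum_def by (rule bij_betw_from_nat_into[OF _ infinite_lattice]) auto

lemma enum_eq_iff: "enum n = enum k \<longleftrightarrow> n = k"
 using inj_eq[OF bij_is_inj[OF enum_bij]] .

lemma suminf_single_ennreal:
 fixes f :: "nat => ennreal"
 assumes "!!n. n ~= k ==> f n = 0"
 shows "(\<Sum>n. f n) = f k"
 using suminf_finite[of "{k}" f] assms by auto

text \<open>
The integral over the whole space, sorted by lattice translates of one cell.
\<close>

lemma unfold_lattice:
 fixes F :: "real ^ 'n => ennreal"
 assumes T: "T > 0" and [measurable]: "F \<in> bmeas borel"
 shows "(\<integral>\<^sup>+x. F x \<partial>lborel) = (\<integral>\<^sup>+x. (\<Sum>n. F (x + lat T (enum n))) * indicator (hcell T) x \<partial>lborel)"
proof -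
 have *: "(\<Sum>n. F x * indicator (hcell T) (x + lat T (- enum n))) = F x" for x
 proof -
  obtain k where k: "enum k = flo T x" using enum_bij by (metis bij_pointE)
  have "(\<Sum>n. F x * indicator (hcell T) (x + lat T (- enum n))) = F x * indicator (hcell T) (x + lat T (- enum k))"
   by (rule suminf_single_ennreal)
    (simp add: add_lat_mem_hcell_iff[OF T] indicator_def k[symmetric] enum_eq_iff)
  also have "... = F x" using T k by (simp add: add_lat_mem_hcell_iff)
  finally show ?thesis .
 qed
 have "(\<integral>\<^sup>+x. F x \<partial>lborel) = (\<integral>\<^sup>+x. (\<Sum>n. F x * indicator (hcell T) (x + lat T (- enum n))) \<partial>lborel)"
  by (intro nn_integral_cong *[symmetric])
 also have "... = (\<Sum>n. \<integral>\<^sup>+x. F x * indicator (hcell T) (x + lat T (- enum n)) \<partial>lborel)"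
  by (intro nn_integral_suminf) measurable
 also have "... = (\<Sum>n. \<integral>\<^sup>+x. F (x + lat T (enum n)) * indicator (hcell T) x \<partial>lborel)"
 proof (rule suminf_cong)
  fix n
  have "(\<integral>\<^sup>+x. F (x + lat T (enum n)) * indicator (hcell T) ((x + lat T (enum n)) + lat T (- enum n)) \<partial>lborel)
    = (\<integral>\<^sup>+x. F x * indicator (hcell T) (x + lat T (- enum n)) \<partial>lborel)"
   by (rule nn_integral_lborel_translation) measurable
  then show "(\<integral>\<^sup>+x. F x * indicator (hcell T) (x + lat T (- enum n)) \<partial>lborel) = (\<integral>\<^sup>+x. F (x + lat T (enum n)) * indicator (hcell T) x \<partial>lborel)"
   by (simp add: lat_minus)
 qed
 also have "... = (\<integral>\<^sup>+x. (\<Sum>n. F (x + lat T (enum n)) * indicator (hcell T) x) \<partial>lborel)"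
  by (intro nn_integral_suminf[symmetric]) measurable
 finally show ?thesis by simp
qed

text \<open>
Unfolding the shifted cell over the lattice and exchanging sum and integral: the translates of the shifted cell also cover each point exactly once.
\<close>

lemma nn_integral_hcell_translation:
 fixes F :: "real ^ 'n => ennreal"
 assumes T: "T > 0" and [measurable]: "F \<in> bmeas borel" and per: "lper T F"
 shows "(\<integral>\<^sup>+x. F (x + h) * indicator (hcell T) x \<partial>lborel) = (\<integral>\<^sup>+x. F x * indicator (hcell T) x \<partial>lborel)"
proof -
 have "(\<integral>\<^sup>+x. F (x + h) * indicator (hcell T) x \<partial>lborel) = (\<integral>\<^sup>+x. F (x + h) * indicator (hcell T) ((x + h) + (- h)) \<partial>lborel)" by simp
 also have "... = (\<integral>\<^sup>+x. F x * indicator (hcell T) (x + (- h)) \<partial>lborel)"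
  by (rule nn_integral_lborel_translation) measurable
 also have "... = (\<integral>\<^sup>+x. (\<Sum>n. F (x + lat T (enum n)) * indicator (hcell T) (x + lat T (enum n) + (- h))) * indicator (hcell T) x \<partial>lborel)"
  by (rule unfold_lattice[OF T]) measurable
 also have "... = (\<integral>\<^sup>+x. F x * indicator (hcell T) x \<partial>lborel)"
 proof (rule nn_integral_cong)
  fix x
  have *: "x + lat T m + (- h) \<in> hcell T \<longleftrightarrow> m = - flo T (x - h)" for m
   using add_lat_mem_hcell_iff[OF T, of "x - h" m] by (simp add: algebra_simps)
  obtain k where k: "enum k = - flo T (x - h)" using enum_bij by (metis bij_pointE)
  have "(\<Sum>n. F (x + lat T (enum n)) * indicator (hcell T) (x + lat T (enum n) + (- h)))
    = F (x + lat T (enum k)) * indicator (hcell T) (x + lat T (enum k) + (- h))"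
   by (rule suminf_single_ennreal)
    (simp add: * indicator_def k[symmetric] enum_eq_iff del: add_uminus_conv_diff)
  also have "... = F x" using * k per by (simp add: lper_def del: add_uminus_conv_diff)
  finally show "(\<Sum>n. F (x + lat T (enum n)) * indicator (hcell T) (x + lat T (enum n) + (- h))) * indicator (hcell T) x = F x * indicator (hcell T) x" by simp
 qed
 finally show ?thesis .
qed

text \<open>
A bounded set meets only finitely many cells. Their number serves as the constant, which is independent of the function.
\<close>

lemma nn_integral_bounded_set_le:
 fixes K :: "(real ^ 'n) set"
 assumes T: "T > 0" and K: "bounded K" "K \<in> sets borel"
 shows "EX C::nat. ALL F. F \<in> bmeas borel --> lper T F -->
   (\<integral>\<^sup>+x. F x * indicator K x \<partial>lborel) <= of_nat C * (\<integral>\<^sup>+x. F x * indicator (hcell T) x \<partial>lborel)"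
proof -
 obtain r where r: "!!x. x \<in> K ==> norm x <= r" using K by (auto simp: bounded_iff)
 define R where "R = \<lceil>(r + T) / T\<rceil>"
 define S where "S = {m :: int ^ 'n. ALL i. m $ i \<in> {-R..R}}"
 have "S \<subseteq> (%f. vec_lambda f) ` (UNIV \<rightarrow>\<^sub>E {-R..R})"
  by (auto simp: S_def image_iff PiE_def extensional_def intro!: bexI[of _ "vec_nth _"])
 then have fin: "finite S" by (rule finite_subset) (intro finite_imageI finite_PiE, auto)
 have mS: "m \<in> S" if x: "x \<in> hcell T" "x + lat T m \<in> K" for x m
 proof -
  have "\<bar>m $ i\<bar> <= R" for i
  proof -
   have "\<bar>x $ i + T * of_int (m $ i)\<bar> <= r" using component_le_norm_cart[of "x + lat T m" i] r[OF x(2)] by simp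
   moreover have "0 <= x $ i" "x $ i < T" using x by (auto simp: hcell_def)
   ultimately have "\<bar>T * of_int (m $ i)\<bar> <= r + T" by linarith
   then have "of_int \<bar>m $ i\<bar> <= (r + T) / T" using T by (simp add: abs_mult field_simps)
   then show ?thesis unfolding R_def by linarith
  qed
  then show ?thesis by (auto simp: S_def abs_le_iff minus_le_iff)
 qed
 have finN: "finite (enum -` S)" using fin bij_is_inj[OF enum_bij] by (rule finite_vimageI)
 show ?thesis
 proof (intro exI[of _ "card (enum -` S)"] allI impI)
  fix F :: "real ^ 'n => ennreal" assume [measurable]: "F \<in> bmeas borel" and per: "lper T F"
  note [measurable] = K(2)
  have "(\<integral>\<^sup>+x. F x * indicator K x \<partial>lborel) = (\<integral>\<^sup>+x. (\<Sum>n. F (x + lat T (enum n)) * indicator K (x + lat T (enum n))) * indicator (hcell T) x \<partial>lborel)"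
   by (rule unfold_lattice[OF T]) measurable
  also have "... <= (\<integral>\<^sup>+x. of_nat (card (enum -` S)) * (F x * indicator (hcell T) x) \<partial>lborel)"
  proof (rule nn_integral_mono)
   fix x
   show "(\<Sum>n. F (x + lat T (enum n)) * indicator K (x + lat T (enum n))) * indicator (hcell T) x
     <= of_nat (card (enum -` S)) * (F x * indicator (hcell T) x)"
   proof (cases "x \<in> hcell T")
    case True
    have "(\<Sum>n. F (x + lat T (enum n)) * indicator K (x + lat T (enum n))) = (\<Sum>n\<in>enum -` S. F (x + lat T (enum n)) * indicator K (x + lat T (enum n)))"
     by (rule suminf_finite[OF finN]) (use mS[OF True] in "auto simp: indicator_def")
    also have "... <= (\<Sum>n\<in>enum -` S. F x)"
     using per by (intro sum_mono) (auto simp: lper_def indicator_def)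
    finally show ?thesis using True by simp
   qed simp
  qed
  also have "... = of_nat (card (enum -` S)) * (\<integral>\<^sup>+x. F x * indicator (hcell T) x \<partial>lborel)"
   by (rule nn_integral_cmult) measurable
  finally show "(\<integral>\<^sup>+x. F x * indicator K x \<partial>lborel) <= of_nat (card (enum -` S)) * (\<integral>\<^sup>+x. F x * indicator (hcell T) x \<partial>lborel)" .
 qed
qed

text \<open>
The torus as a measure space: on it translations of periodic functions preserve integrals.
\<close>

abbreviation tor :: "real => (real ^ 'n) measure" where
 "tor T \<equiv> restrict_space lborel (hcell T)"

lemma space_tor [simp]: "space (tor T) = hcell T" by (simp add: space_restrict_space)

lemma borel_tor: "f \<in> bmeas borel ==> f \<in> bmeas (tor T)"
 by (intro measurable_restrict_space1) simp

lemma borel_tor': "f \<in> borel \<rightarrow>\<^sub>M borel ==> f \<in> tor T \<rightarrow>\<^sub>M borel"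
 by (intro measurable_restrict_space1) simp

lemma nn_integral_tor: "(\<integral>\<^sup>+x. F x \<partial>tor T) = (\<integral>\<^sup>+x. F x * indicator (hcell T) x \<partial>lborel)"
 by (rule nn_integral_restrict_space) simp

lemma finite_measure_tor: "finite_measure (tor T)"
proof (rule finite_measureI)
 have "emeasure lborel (hcell T :: (real ^ 'a) set) <= emeasure lborel (cbox 0 (\<chi> i. T) :: (real ^ 'a) set)"
  unfolding cell_eq_cbox[symmetric] by (rule emeasure_mono[OF hcell_subset_cell]) simp
 also have "... < \<infinity>" by (rule emeasure_lborel_cbox_finite)
 finally show "emeasure (tor T :: (real ^ 'a) measure) (space (tor T)) ~= \<infinity>"
  by (simp add: emeasure_restrict_space)
qed

lemma tor_translation_distr:
 assumes T: "T > 0"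
 shows "distr (tor T) borel (%x. red T (x + h)) = distr (tor T) borel (red T)"
proof (rule measure_eqI)
 fix A assume "A \<in> sets (distr (tor T) borel (%x. red T (x + h)))"
 then have A [measurable]: "A \<in> sets borel" by simp
 have [measurable]: "(%x. red T (x + h)) \<in> tor T \<rightarrow>\<^sub>M borel" "red T \<in> tor T \<rightarrow>\<^sub>M borel"
  by (intro borel_tor'; measurable)+
 have "emeasure (distr (tor T) borel (%x. red T (x + h))) A = (\<integral>\<^sup>+x. indicator A x \<partial>distr (tor T) borel (%x. red T (x + h)))" by simp
 also have "... = (\<integral>\<^sup>+x. indicator A (red T (x + h)) \<partial>tor T)" by (rule nn_integral_distr) auto
 also have "... = (\<integral>\<^sup>+x. indicator A (red T x) \<partial>tor T)"
  unfolding nn_integral_tor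
  by (rule nn_integral_hcell_translation[OF T, of "%x. indicator A (red T x)" h]) (measurable, rule lper_compose_red[OF T])
 also have "... = (\<integral>\<^sup>+x. indicator A x \<partial>distr (tor T) borel (red T))" by (rule nn_integral_distr[symmetric]) auto
 also have "... = emeasure (distr (tor T) borel (red T)) A" by simp
 finally show "emeasure (distr (tor T) borel (%x. red T (x + h))) A = emeasure (distr (tor T) borel (red T)) A" .
qed simp

lemma tor_translation:
 fixes f :: "real ^ 'n => 'b::{banach, second_countable_topology}"
 assumes T: "T > 0" and f [measurable]: "f \<in> bmeas borel" and per: "lper T f"
 shows "(LINT x|tor T. f (x + h)) = (LINT x|tor T. f x)"
  and "integrable (tor T) (%x. f (x + h)) \<longleftrightarrow> integrable (tor T) f"
proof -
 have m [measurable]: "(%x. red T (x + h)) \<in> tor T \<rightarrow>\<^sub>M borel" "red T \<in> tor T \<rightarrow>\<^sub>M borel"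
  by (intro borel_tor'; measurable)+
 note p = lper_red[OF per]
 show "(LINT x|tor T. f (x + h)) = (LINT x|tor T. f x)"
  using integral_distr[OF m(1) f] integral_distr[OF m(2) f] unfolding tor_translation_distr[OF T, of h] p by metis
 show "integrable (tor T) (%x. f (x + h)) \<longleftrightarrow> integrable (tor T) f"
  using integrable_distr_eq[OF m(1) f] integrable_distr_eq[OF m(2) f] unfolding tor_translation_distr[OF T, of h] p by metis
qed

lemma Lp_tor_translation:
 assumes T: "T > 0" and f: "f \<in> bmeas borel" and per: "lper T f"
 shows "Lp p (tor T) (%x. f (x + h)) \<longleftrightarrow> Lp p (tor T) f" "lpn p (tor T) (%x. f (x + h)) = lpn p (tor T) f"
proof -
 have *: "(%x. norm (f x) ^ p) \<in> bmeas borel" "lper T (%x. norm (f x) ^ p)"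
  using f per by (auto simp: lper_def)
 have "(%x. f (x + h)) \<in> bmeas borel" using f by measurable
 then show "Lp p (tor T) (%x. f (x + h)) \<longleftrightarrow> Lp p (tor T) f"
  using tor_translation(2)[OF T *, of h] borel_tor[OF f] borel_tor[of "%x. f (x + h)" T] unfolding Lp_def by blast
 show "lpn p (tor T) (%x. f (x + h)) = lpn p (tor T) f"
  unfolding lpn_def tor_translation(1)[OF T *, of h] ..
qed

text \<open>
The measure behind the integrals over the closed cell in the action. It differs from \<open>tor T\<close> by a null set, and it is a Lebesgue rather than a Borel measure.
\<close>

abbreviation cm :: "real => (real ^ 'n) measure" where
 "cm T \<equiv> lebesgue_on (cell T)"

lemma space_cm [simp]: "space (cm T) = cell T" by simp

lemma cell_lebesgue [simp, measurable]: "cell T \<in> sets leb" by (simp add: sets_completionI_sets)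

lemma measurable_cm: "f \<in> bmeas leb ==> f \<in> bmeas (cm T)"
 by (rule measurable_restrict_space1)

lemma set_integral_cell:
 fixes f :: "real ^ 'n => 'b::{banach, second_countable_topology}"
 shows "set_lebesgue_integral leb (cell T) f = (LINT x|cm T. f x)"
 unfolding set_lebesgue_integral_def by (subst integral_restrict_space) auto

lemma AE_cm: "AE x in leb. P x ==> AE x in cm T. P x"
 by (subst AE_restrict_space_iff) (auto elim: eventually_mono)

lemma nn_integral_cm:
 assumes "F \<in> bmeas borel"
 shows "(\<integral>\<^sup>+x. F x \<partial>cm T) = (\<integral>\<^sup>+x. F x \<partial>tor T)"
proof -
 have "(\<integral>\<^sup>+x. F x \<partial>cm T) = (\<integral>\<^sup>+x. F x * indicator (cell T) x \<partial>lborel)"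
  by (subst nn_integral_restrict_space) (auto simp: nn_integral_completion)
 also have "... = (\<integral>\<^sup>+x. F x * indicator (hcell T) x \<partial>lborel)"
  by (rule nn_integral_cong_AE, use AE_cell_iff_hcell[of T] in eventually_elim) (simp add: indicator_def)
 finally show ?thesis by (simp add: nn_integral_tor)
qed

lemma integral_cm:
 fixes f :: "real ^ 'n => 'b::{banach, second_countable_topology}"
 assumes f: "f \<in> bmeas borel"
 shows "(LINT x|cm T. f x) = (LINT x|tor T. f x)" "integrable (cm T) f \<longleftrightarrow> integrable (tor T) f"
proof -
 have c [measurable]: "(%x. ind (cell T) x *R f x) \<in> bmeas borel"
  and h [measurable]: "(%x. ind (hcell T) x *R f x) \<in> bmeas borel" using f by measurable
 have ae: "AE x in lborel. ind (cell T) x *R f x = ind (hcell T) x *R f x"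
  using AE_cell_iff_hcell[of T] by eventually_elim (simp add: indicator_def)
 have "(LINT x|cm T. f x) = (LINT x|lborel. ind (cell T) x *R f x)"
  using c by (subst integral_restrict_space) (auto simp: integral_completion)
 also have "... = (LINT x|lborel. ind (hcell T) x *R f x)"
  by (rule integral_cong_AE) (use ae in auto)
 also have "... = (LINT x|tor T. f x)" by (subst integral_restrict_space) auto
 finally show "(LINT x|cm T. f x) = (LINT x|tor T. f x)" .
 have "integrable (cm T) f \<longleftrightarrow> integrable lborel (%x. ind (cell T) x *R f x)"
  using c by (subst integrable_restrict_space) (auto simp: integrable_completion)
 also have "... \<longleftrightarrow> integrable lborel (%x. ind (hcell T) x *R f x)"
  by (rule integrable_cong_AE) (use ae in auto)
 also have "... \<longleftrightarrow> integrable (tor T) f" by (subst integrable_restrict_space) auto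
 finally show "integrable (cm T) f \<longleftrightarrow> integrable (tor T) f" .
qed

lemma Lp_cm_tor:
 assumes "f \<in> bmeas borel"
 shows "Lp p (cm T) f \<longleftrightarrow> Lp p (tor T) f" "lpn p (cm T) f = lpn p (tor T) f"
proof -
 have m: "(%x. norm (f x) ^ p) \<in> bmeas borel" using assms by measurable
 have "f \<in> bmeas (cm T)" using assms by (intro measurable_cm measurable_completion) simp
 then show "Lp p (cm T) f \<longleftrightarrow> Lp p (tor T) f"
  using integral_cm(2)[OF m] assms by (simp add: Lp_def borel_tor)
 show "lpn p (cm T) f = lpn p (tor T) f" using integral_cm(1)[OF m] by (simp add: lpn_def)
qed

lemma finite_measure_cm: "finite_measure (cm T :: (real ^ 'n) measure)"
proof (rule finite_measureI)
 have "emeasure lborel (cell T :: (real ^ 'n) set) < \<infinity>" unfolding cell_eq_cbox by (rule emeasure_lborel_cbox_finite)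
 then show "emeasure (cm T :: (real ^ 'n) measure) (space (cm T)) ~= \<infinity>" by (simp add: emeasure_restrict_space)
qed

lemma measure_cm: "0 <= T ==> measure (cm T :: (real ^ 'n) measure) (space (cm T)) = T ^ CARD('n)"
proof -
 assume T: "0 <= T"
 have "measure (cm T :: (real ^ 'n) measure) (space (cm T)) = measure lborel (cbox 0 (\<chi> i. T) :: (real ^ 'n) set)"
  by (simp add: measure_restrict_space cell_eq_cbox)
 also have "... = (\<Prod>i\<in>(UNIV :: 'n set). T)"
 proof -
  have "0 \<in> cbox 0 (\<chi> i::'n. T)" using T by (simp add: mem_box_cart)
  then show ?thesis using content_cbox_cart[of 0 "\<chi> i::'n. T"] by auto
 qed
 finally show ?thesis by simp
qed

lemma borel_representative:
 fixes f :: "real ^ 'n => complex"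
 assumes f: "f \<in> bmeas leb"
 shows "EX g : bmeas borel. AE x in leb. f x = g x"
proof -
 have "(%x. Re (f x)) \<in> bmeas leb" "(%x. Im (f x)) \<in> bmeas leb" using f by measurable
 note RI = completion_ex_borel_measurable_real[OF this(1)] completion_ex_borel_measurable_real[OF this(2)]
 obtain a where a: "a \<in> bmeas lborel" "AE x in lborel. Re (f x) = a x"
  using RI(1) by (rule bexE)
 obtain b where b: "b \<in> bmeas lborel" "AE x in lborel. Im (f x) = b x"
  using RI(2) by (rule bexE)
 have m: "(%x. Complex (a x) (b x)) \<in> bmeas borel"
  using a b by (subst borel_measurable_complex_iff) simp
 have "AE x in lborel. f x = Complex (a x) (b x)" using a(2) b(2) by eventually_elim (simp add: complex_eq_iff)
 then have "AE x in leb. f x = Complex (a x) (b x)" by (rule AE_completion)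
 then show ?thesis using m by (rule bexI)
qed

text \<open>
Fubini arguments need joint Borel measurability. Members of \<open>H\<^sup>1\<^sub>T\<close> are only Lebesgue measurable and their weak derivatives only almost everywhere periodic,
so one first passes to a Borel version and then makes it periodic by composing with the reduction to the cell.
\<close>

lemma borel_periodic_representative:
 fixes f :: "real ^ 'n => complex"
 assumes T: "T > 0" and f: "f \<in> bmeas leb" and per: "!!m. AE x in leb. f (x + lat T m) = f x"
 shows "EX g : bmeas borel. lper T g \<and> (AE x in leb. f x = g x)"
proof -
 obtain g where g [measurable]: "g \<in> bmeas borel" and ae: "AE x in leb. f x = g x"
  using borel_representative[OF f] by blast
 have "AE x in leb. ALL m. f (x + lat T m) = f x" using per by (simp add: AE_all_countable)
 moreover have "AE x in leb. ALL m. f (x + lat T m) = g (x + lat T m)"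
  using AE_lebesgue_translation[OF ae] by (simp add: AE_all_countable)
 ultimately have "AE x in leb. f x = g (red T x)"
 proof eventually_elim
  case (elim x)
  have "red T x = x + lat T (- flo T x)" by (simp add: red_def lat_minus)
  with elim show ?case by metis
 qed
 moreover have "(%x. g (red T x)) \<in> bmeas borel" by measurable
 ultimately show ?thesis using lper_compose_red[OF T, of g] by (intro bexI[of _ "%x. g (red T x)"] conjI)
qed

text \<open>
Local square integrability of a periodic function is decided on one cell.
\<close>

lemma L2_loc_periodic_iff:
 fixes f :: "real ^ 'n => complex"
 assumes T: "T > 0" and f: "f \<in> bmeas leb" and per: "!!m. AE x in leb. f (x + lat T m) = f x"
 shows "f \<in> L2_loc \<longleftrightarrow> Lp 2 (cm T) f"
proof
 assume "f \<in> L2_loc"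
 then have "set_integrable leb (cell T) (%x. (cmod (f x))^2)"
  by (simp add: L2_loc_def cell_eq_cbox)
 then have "integrable (cm T) (%x. (cmod (f x))^2)"
  by (subst integrable_restrict_space) (auto simp: set_integrable_def)
 then show "Lp 2 (cm T) f" using f by (simp add: Lp_def measurable_cm)
next
 assume L: "Lp 2 (cm T) f"
 obtain g where g [measurable]: "g \<in> bmeas borel" and pg: "lper T g" and ae: "AE x in leb. f x = g x"
  using borel_periodic_representative[OF assms] by blast
 have "Lp 2 (cm T) g"
  using L Lp_cong_AE[OF AE_cm[OF ae]] f by (simp add: measurable_cm measurable_completion)
 then have "integrable (tor T) (%x. (cmod (g x))^2)"
  unfolding Lp_cm_tor(1)[OF g] by (rule Lp_integrable)
 then have fin: "(\<integral>\<^sup>+x. ennreal ((cmod (g x))^2) * indicator (hcell T) x \<partial>lborel) < \<infinity>"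
  unfolding nn_integral_tor[symmetric] by (subst nn_integral_eq_integral) auto
 show "f \<in> L2_loc" unfolding L2_loc_def
 proof (intro CollectI conjI f allI impI)
  fix K :: "(real ^ 'n) set" assume K: "compact K"
  have Kb [measurable]: "K \<in> sets borel" using K by (rule borel_compact)
  obtain C :: nat where C: "ALL F. F \<in> bmeas borel --> lper T F -->
    (\<integral>\<^sup>+x. F x * indicator K x \<partial>lborel) <= of_nat C * (\<integral>\<^sup>+x. F x * indicator (hcell T) x \<partial>lborel)"
   using nn_integral_bounded_set_le[OF T compact_imp_bounded[OF K] Kb] by (rule exE)
  have "(\<integral>\<^sup>+x. ennreal ((cmod (g x))^2) * indicator K x \<partial>lborel) <= of_nat C * (\<integral>\<^sup>+x. ennreal ((cmod (g x))^2) * indicator (hcell T) x \<partial>lborel)"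
   by (rule C[rule_format]) (use pg in "auto simp: lper_def")
  also have "... < \<infinity>" using fin by (simp add: ennreal_mult_less_top of_nat_less_top)
  finally have fK: "(\<integral>\<^sup>+x. ennreal ((cmod (g x))^2) * indicator K x \<partial>lborel) < \<infinity>" .
  have "(\<integral>\<^sup>+x. ennreal ((cmod (g x))^2) * indicator K x \<partial>lborel) = (\<integral>\<^sup>+x. ennreal (norm (ind K x *R (cmod (g x))^2)) \<partial>lborel)"
   by (intro nn_integral_cong) (simp split: split_indicator)
  with fK have "(\<integral>\<^sup>+x. ennreal (norm (ind K x *R (cmod (g x))^2)) \<partial>lborel) < \<infinity>" by (simp only:)
  then have "integrable lborel (%x. ind K x *R (cmod (g x))^2)"
   by (intro integrableI_bounded) measurable
  then have i: "integrable leb (%x. ind K x *R (cmod (g x))^2)"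
   by (subst integrable_completion) measurable
  show "set_integrable leb K (%x. (cmod (f x))^2)"
   unfolding set_integrable_def
   by (rule integrable_cong_AE_imp[OF i])
    (use f ae Kb in "auto elim!: eventually_mono intro!: borel_measurable_times borel_measurable_indicator sets_completionI_sets")
 qed
qed

section \<open>Translation and integration by parts\<close>

lemma integral_mult_L2_complex:
 fixes f g :: "'a => complex"
 assumes f: "Lp 2 M f" and g: "Lp 2 M g"
 shows "integrable M (%x. f x * g x)" "cmod (LINT x|M. f x * g x) <= lpn 2 M f * lpn 2 M g"
proof -
 note A = integral_mult_L2[OF f g]
 show i: "integrable M (%x. f x * g x)"
  by (rule Bochner_Integration.integrable_bound[OF A(1)]) (use f g in "auto simp: norm_mult")
 have "cmod (LINT x|M. f x * g x) <= (LINT x|M. cmod (f x * g x))" by (rule integral_norm_bound)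
 also have "... <= lpn 2 M f * lpn 2 M g" using A(2) by (simp add: norm_mult)
 finally show "cmod (LINT x|M. f x * g x) <= lpn 2 M f * lpn 2 M g" .
qed

lemma integrable_strip:
 fixes F :: "'a::euclidean_space \<times> real => complex"
 assumes F [measurable]: "F \<in> bmeas (lborel \<Otimes>\<^sub>M lborel)" and t: "0 <= t"
  and C: "!!s. s \<in> {0..t} ==> (\<integral>\<^sup>+x. ennreal (norm (F (x, s))) \<partial>lborel) <= ennreal C"
  and 0: "!!x s. s \<notin> {0..t} ==> F (x, s) = 0"
 shows "integrable (lborel \<Otimes>\<^sub>M lborel) F"
proof (rule integrableI_bounded[OF F])
 have "(\<integral>\<^sup>+z. ennreal (norm (F z)) \<partial>(lborel \<Otimes>\<^sub>M lborel)) = (\<integral>\<^sup>+s. \<integral>\<^sup>+x. ennreal (norm (F (x, s))) \<partial>lborel \<partial>lborel)"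
  by (rule lborel_pair.nn_integral_snd[symmetric]) measurable
 also have "... <= (\<integral>\<^sup>+s. ennreal C * indicator {0..t} s \<partial>lborel)"
 proof (rule nn_integral_mono)
  fix s show "(\<integral>\<^sup>+x. ennreal (norm (F (x, s))) \<partial>lborel) <= ennreal C * indicator {0..t} s"
   using C[of s] 0[of s] by (cases "s \<in> {0..t}") auto
 qed
 also have "... = ennreal C * ennreal t" using t by (simp add: nn_integral_cmult_indicator)
 also have "... < \<infinity>" by (simp add: ennreal_mult_less_top)
 finally show "(\<integral>\<^sup>+z. ennreal (norm (F z)) \<partial>(lborel \<Otimes>\<^sub>M lborel)) < \<infinity>" .
qed

lemma Fubini_strip:
 fixes F :: "'a::euclidean_space \<times> real => complex"
 assumes "integrable (lborel \<Otimes>\<^sub>M lborel) F"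
 shows "(LINT x|lborel. \<integral>s. F (x, s) \<partial>lborel) = (LINT s|lborel. \<integral>x. F (x, s) \<partial>lborel)"
  and "integrable lborel (%x. \<integral>s. F (x, s) \<partial>lborel)"
 using lborel_pair.Fubini_integral[of "%x s. F (x, s)"] lborel_pair.integrable_fst'[of F] assms by auto

lemma cball_borel [measurable]: "cball a r \<in> sets borel"
 by simp

lemma L1_loc_nn_integral_ball:
 assumes "f \<in> L1_loc" "f \<in> bmeas borel"
 obtains C where "0 <= C" "(\<integral>\<^sup>+x. ennreal (norm (f x)) * indicator (cball 0 r) x \<partial>lborel) = ennreal C"
proof -
 note [measurable] = assms(2)
 have "integrable leb (%x. ind (cball 0 r) x *R f x)"
  using assms by (auto simp: L1_loc_def set_integrable_def)
 then have "integrable lborel (%x. ind (cball 0 r) x *R f x)"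
  by (subst (asm) integrable_completion) measurable
 then have i: "integrable lborel (%x. norm (ind (cball 0 r) x *R f x))" by (rule integrable_norm)
 show thesis
 proof (rule that[of "\<integral>x. norm (ind (cball 0 r) x *R f x) \<partial>lborel"])
  have "(\<integral>\<^sup>+x. ennreal (norm (f x)) * indicator (cball 0 r) x \<partial>lborel) = (\<integral>\<^sup>+x. ennreal (norm (ind (cball 0 r) x *R f x)) \<partial>lborel)"
   by (intro nn_integral_cong) (simp split: split_indicator)
  also have "... = ennreal (LINT x|lborel. norm (ind (cball 0 r) x *R f x))"
   by (rule nn_integral_eq_integral[OF i]) auto
  finally show "(\<integral>\<^sup>+x. ennreal (norm (f x)) * indicator (cball 0 r) x \<partial>lborel) = ennreal (LINT x|lborel. norm (ind (cball 0 r) x *R f x))" .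
 qed simp
qed

lemma nn_integral_shifted_product_le:
 fixes f :: "real ^ 'n => complex" and \<phi> :: "real ^ 'n => real"
 assumes [measurable]: "f \<in> bmeas borel" "\<phi> \<in> bmeas borel"
  and \<phi>: "!!x. \<bar>\<phi> x\<bar> <= B" "!!x. norm x > r ==> \<phi> x = 0" and s: "0 <= s" "s <= t"
  and C: "0 <= C" "(\<integral>\<^sup>+x. ennreal (norm (f x)) * indicator (cball 0 (r + t)) x \<partial>lborel) = ennreal C"
 shows "(\<integral>\<^sup>+x. ennreal (norm (\<phi> (x - s *R axis k 1) *R f x)) \<partial>lborel) <= ennreal (B * C)"
proof -
 have B: "0 <= B" using order_trans[OF abs_ge_zero \<phi>(1)[of 0]] .
 have "(\<integral>\<^sup>+x. ennreal (norm (\<phi> (x - s *R axis k 1) *R f x)) \<partial>lborel)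
   <= (\<integral>\<^sup>+x. ennreal B * (ennreal (norm (f x)) * indicator (cball 0 (r + t)) x) \<partial>lborel)"
 proof (rule nn_integral_mono)
  fix x
  show "ennreal (norm (\<phi> (x - s *R axis k 1) *R f x)) <= ennreal B * (ennreal (norm (f x)) * indicator (cball 0 (r + t)) x)"
  proof (cases "norm x <= r + t")
   case True
   have "\<bar>\<phi> (x - s *R axis k 1)\<bar> * norm (f x) <= B * norm (f x)" by (intro mult_right_mono \<phi>) auto
   then show ?thesis using True B by (simp add: ennreal_mult[symmetric] ennreal_leI)
  next
   case False
   have "norm x <= norm (x - s *R axis k 1) + norm (s *R axis k (1::real) :: real ^ 'n)"
    using norm_triangle_ineq[of "x - s *R axis k 1" "s *R axis k 1"] by simp
   then have "r < norm (x - s *R axis k 1)" using False s by (simp add: norm_axis_1)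
   then show ?thesis using \<phi>(2) by simp
  qed
 qed
 also have "... = ennreal B * ennreal C" by (subst nn_integral_cmult) (auto simp: C(2))
 finally show ?thesis using B C(1) by (simp add: ennreal_mult)
qed

lemma lborel_integral_translation:
 fixes f :: "'a::euclidean_space => 'b::{banach, second_countable_topology}"
 assumes f: "f \<in> bmeas borel"
 shows "(LINT x|lborel. f (x + a)) = (LINT x|lborel. f x)"
proof -
 have m: "(%x. f (x + a)) \<in> bmeas borel" using f by measurable
 show ?thesis
  using lebesgue_integral_translation(1)[of f a] f m by (simp add: integral_completion measurable_completion)
qed

text \<open>
A periodic pair consisting of a function and its weak derivative, both in the Borel measurable and exactly periodic versions to which Fubini's theorem applies.
\<close>

definition wper :: "'n => real => (real ^ 'n => complex) => (real ^ 'n => complex) => bool" where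
 "wper k T u g \<longleftrightarrow> u \<in> bmeas borel \<and> g \<in> bmeas borel \<and> lper T u \<and> lper T g \<and>
   Lp 2 (tor T) u \<and> Lp 2 (tor T) g \<and> is_weak_partial k u g"

lemma wperD:
 assumes "wper k T u g"
 shows "u \<in> bmeas borel" "g \<in> bmeas borel" "lper T u" "lper T g"
   "Lp 2 (tor T) u" "Lp 2 (tor T) g" "is_weak_partial k u g" "u \<in> L1_loc" "g \<in> L1_loc"
 using assms by (auto simp: wper_def is_weak_partial_def)

text \<open>
The fundamental theorem of calculus along axis \<open>k\<close>. Both sides are tested with \<open>\<phi>\<close>: by Fubini and the definition of the weak derivative each gives the integral of
\<open>(\<phi> (x - t e\<^sub>k) - \<phi> x) u x\<close>, and \<open>du_bois_reymond\<close> concludes.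
\<close>

lemma translation_formula:
 fixes u g :: "real ^ 'n => complex"
 assumes u [measurable]: "u \<in> bmeas borel" and g [measurable]: "g \<in> bmeas borel"
  and w: "is_weak_partial k u g" and t: "0 <= t"
 shows "AE x in lborel. u (x + t *R axis k 1) - u x = (LINT s|lborel. ind {0..t} s *R g (x + s *R axis k 1))"
proof -
 let ?e = "axis k 1 :: real ^ 'n"
 have L: "u \<in> L1_loc" "g \<in> L1_loc" using w by (auto simp: is_weak_partial_def)
 define G where "G x = (LINT s|lborel. ind {0..t} s *R g (x + s *R ?e))" for x
 have Gm [measurable]: "G \<in> bmeas borel" unfolding G_def by measurable
 have iF: "integrable (lborel \<Otimes>\<^sub>M lborel) (%(x, s). (ind {0..t} s * \<phi> x) *R g (x + s *R ?e))"
  if \<phi> [measurable]: "\<phi> \<in> bmeas borel" and B: "!!x. \<bar>\<phi> x\<bar> <= B" and r: "!!x. norm x > r ==> \<phi> x = 0" for \<phi> B r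
 proof -
  obtain C where C: "0 <= C" "(\<integral>\<^sup>+x. ennreal (norm (g x)) * indicator (cball 0 (r + t)) x \<partial>lborel) = ennreal C"
   by (rule L1_loc_nn_integral_ball[OF L(2) g])
  show ?thesis
  proof (rule integrable_strip[OF _ t, where C = "B * C"])
   fix s assume s: "s \<in> {0..t}"
   have "(\<integral>\<^sup>+x. ennreal (norm (\<phi> x *R g (x + s *R ?e))) \<partial>lborel) = (\<integral>\<^sup>+x. ennreal (norm (\<phi> ((x + s *R ?e) - s *R ?e) *R g (x + s *R ?e))) \<partial>lborel)" by simp
   also have "... = (\<integral>\<^sup>+x. ennreal (norm (\<phi> (x - s *R ?e) *R g x)) \<partial>lborel)"
    by (rule nn_integral_lborel_translation) measurable
   also have "... <= ennreal (B * C)" by (rule nn_integral_shifted_product_le[OF g \<phi> B r _ _ C]) (use s in auto)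
   finally show "(\<integral>\<^sup>+x. ennreal (norm (case (x, s) of (x, s) => (ind {0..t} s * \<phi> x) *R g (x + s *R ?e))) \<partial>lborel) <= ennreal (B * C)"
    using s by simp
  next
   show "(%(x, s). (ind {0..t} s * \<phi> x) *R g (x + s *R ?e)) \<in> bmeas (lborel \<Otimes>\<^sub>M lborel)"
    by measurable
  qed simp
 qed
 have GL: "G \<in> L1_loc" unfolding L1_loc_def
 proof (intro CollectI allI impI)
  fix K :: "(real ^ 'n) set" assume K: "compact K"
  have Kb [measurable]: "K \<in> sets borel" using K by (rule borel_compact)
  obtain r where r: "!!x. x \<in> K ==> norm x <= r" using compact_imp_bounded[OF K] by (auto simp: bounded_iff)
  have "integrable lborel (%x. \<integral>s. (case (x, s) of (x, s) => (ind {0..t} s * ind K x) *R g (x + s *R ?e)) \<partial>lborel)"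
   by (rule Fubini_strip(2), rule iF[of _ 1 r]) (use r in "force simp: indicator_def")+
  moreover have "(LINT s|lborel. (case (x, s) of (x, s) => (ind {0..t} s * ind K x) *R g (x + s *R ?e))) = ind K x *R G x" for x
   by (cases "x \<in> K") (simp_all add: G_def)
  ultimately have "integrable lborel (%x. ind K x *R G x)" by simp
  then show "set_integrable leb K G" unfolding set_integrable_def by (subst integrable_completion) measurable
 qed
 have uT: "(%x. u (x + t *R ?e)) \<in> L1_loc" unfolding L1_loc_def
 proof (intro CollectI allI impI)
  fix K :: "(real ^ 'n) set" assume K: "compact K"
  have Kb: "K \<in> sets leb" using K by (simp add: borel_compact sets_completionI_sets)
  have c: "compact ((%x. t *R ?e + x) ` K)" using K by (rule compact_translation)
  then have i: "integrable leb (%x. ind ((%x. t *R ?e + x) ` K) x *R u x)"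
   using L(1) by (simp add: L1_loc_def set_integrable_def)
  have "integrable leb (%x. ind ((%x. t *R ?e + x) ` K) (x + t *R ?e) *R u (x + t *R ?e))"
   by (rule lebesgue_integral_translation(2)[OF borel_measurable_integrable[OF i] i])
  moreover have "ind ((%x. t *R ?e + x) ` K) (x + t *R ?e) = ind K x" for x
   by (auto simp: indicator_def image_iff add.commute)
  ultimately show "set_integrable leb K (%x. u (x + t *R ?e))" by (simp add: set_integrable_def)
 qed
 define \<Delta> where "\<Delta> x = (u (x + t *R ?e) + (-1) * u x) + (-1) * G x" for x
 have \<Delta>L: "\<Delta> \<in> L1_loc" unfolding \<Delta>_def by (intro L1_loc_add L1_loc_mult uT L GL)
 have "AE x in leb. \<Delta> x = 0"
 proof (rule du_bois_reymond[OF \<Delta>L])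
  fix \<phi> :: "real ^ 'n => real" assume \<phi>: "test_function \<phi>"
  have \<phi>m [measurable]: "\<phi> \<in> bmeas borel" "partial k \<phi> \<in> bmeas borel"
   using test_function_continuous[OF \<phi>] test_function_partial_continuous[OF \<phi>] by (auto intro: borel_measurable_continuous_onI)
  obtain K where K: "compact K" "ALL x. x \<notin> K --> \<phi> x = 0" "ALL x k. x \<notin> K --> partial k \<phi> x = 0"
   using test_function_support[OF \<phi>] by (elim exE conjE)
  obtain r where r: "!!x. x \<in> K ==> norm x <= r" using compact_imp_bounded[OF K(1)] by (auto simp: bounded_iff)
  have out: "\<phi> x = 0" "partial k \<phi> x = 0" if "norm x > r" for x using K r[of x] that by auto
  obtain B where B: "0 <= B" "ALL x. \<bar>\<phi> x\<bar> <= B" "ALL x. \<bar>partial k \<phi> x\<bar> <= B"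
   using test_function_bounded[OF \<phi>, of k] by (elim exE conjE)
  have tr: "test_function (%x. \<phi> (x - a))" "partial k (%x. \<phi> (x - a)) x = partial k \<phi> (x - a)" for a x
   using test_function_translation[OF \<phi>, where a = "- a"] by simp_all
  define F2 where "F2 = (%(x, s). (ind {0..t} s * partial k \<phi> (x - s *R ?e)) *R u x)"
  have iF2: "integrable (lborel \<Otimes>\<^sub>M lborel) F2"
  proof -
   obtain C where C: "0 <= C" "(\<integral>\<^sup>+x. ennreal (norm (u x)) * indicator (cball 0 (r + t)) x \<partial>lborel) = ennreal C"
    by (rule L1_loc_nn_integral_ball[OF L(1) u])
   show ?thesis
   proof (rule integrable_strip[OF _ t, where C = "B * C"])
    fix s assume s: "s \<in> {0..t}"
    show "(\<integral>\<^sup>+x. ennreal (norm (F2 (x, s))) \<partial>lborel) <= ennreal (B * C)"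
     using nn_integral_shifted_product_le[OF u \<phi>m(2) B(3)[rule_format] out(2) _ _ C, of s] s by (simp add: F2_def)
   next
    show "F2 \<in> bmeas (lborel \<Otimes>\<^sub>M lborel)" unfolding F2_def by measurable
   qed (simp add: F2_def)
  qed
  have "(LINT x|leb. \<phi> x *R G x) = (LINT x|lborel. \<phi> x *R G x)"
   by (rule integral_completion) measurable
  also have "... = (LINT x|lborel. \<integral>s. (case (x, s) of (x, s) => (ind {0..t} s * \<phi> x) *R g (x + s *R ?e)) \<partial>lborel)"
  proof (intro Bochner_Integration.integral_cong refl)
   fix x
   have "(LINT s|lborel. (case (x, s) of (x, s) => (ind {0..t} s * \<phi> x) *R g (x + s *R ?e)))
    = (LINT s|lborel. \<phi> x *R (ind {0..t} s *R g (x + s *R ?e)))"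
    by (simp add: mult.commute)
   then show "\<phi> x *R G x = (LINT s|lborel. (case (x, s) of (x, s) => (ind {0..t} s * \<phi> x) *R g (x + s *R ?e)))"
    unfolding G_def by (simp only: integral_scaleR_right)
  qed
  also have "... = (LINT s|lborel. \<integral>x. (case (x, s) of (x, s) => (ind {0..t} s * \<phi> x) *R g (x + s *R ?e)) \<partial>lborel)"
   by (rule Fubini_strip(1), rule iF[of _ B r]) (use B out in auto)
  also have "... = (LINT s|lborel. \<integral>x. - F2 (x, s) \<partial>lborel)"
  proof (rule Bochner_Integration.integral_cong[OF refl])
   fix s
   have "(LINT x|lborel. \<phi> x *R g (x + s *R ?e)) = (LINT x|lborel. \<phi> ((x + s *R ?e) - s *R ?e) *R g (x + s *R ?e))" by simp
   also have "... = (LINT x|lborel. \<phi> (x - s *R ?e) *R g x)"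
    by (rule lborel_integral_translation[of "%x. \<phi> (x - s *R ?e) *R g x"]) measurable
   also have "... = (LINT x|leb. \<phi> (x - s *R ?e) *R g x)"
    by (rule integral_completion[symmetric]) measurable
   also have "... = - (LINT x|leb. partial k \<phi> (x - s *R ?e) *R u x)"
    using w tr(1)[of "s *R ?e"] unfolding is_weak_partial_def tr(2)[symmetric] by simp
   also have "... = - (LINT x|lborel. partial k \<phi> (x - s *R ?e) *R u x)"
    by (subst integral_completion) measurable
   finally have *: "(LINT x|lborel. \<phi> x *R g (x + s *R ?e)) = - (LINT x|lborel. partial k \<phi> (x - s *R ?e) *R u x)" .
   show "(LINT x|lborel. (case (x, s) of (x, s) => (ind {0..t} s * \<phi> x) *R g (x + s *R ?e))) = (LINT x|lborel. - F2 (x, s))"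
    using * by (cases "s \<in> {0..t}") (simp_all add: F2_def)
  qed
  also have "... = - (LINT s|lborel. \<integral>x. F2 (x, s) \<partial>lborel)" by simp
  also have "... = - (LINT x|lborel. \<integral>s. F2 (x, s) \<partial>lborel)" using Fubini_strip(1)[OF iF2] by simp
  also have "... = - (LINT x|lborel. (\<phi> x - \<phi> (x - t *R ?e)) *R u x)"
  proof (intro arg_cong[where f = uminus] Bochner_Integration.integral_cong refl)
   fix x
   have "(LINT s|lborel. ind {0..t} s *R partial k \<phi> (x - s *R ?e)) = - \<phi> (x - t *R ?e) - (- \<phi> (x - 0 *R ?e))"
   proof (rule integral_FTC_atLeastAtMost[OF t, where F = "%s. - \<phi> (x - s *R ?e)"])
    fix s
    have "((%s. \<phi> (x + s *R ?e)) has_real_derivative partial k \<phi> (x + (- s) *R ?e)) (at (- s))"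
     by (rule test_function_line[OF \<phi>])
    then have "((%s. \<phi> (x + (- s) *R ?e)) has_real_derivative - partial k \<phi> (x + (- s) *R ?e)) (at s)"
     by (simp only: DERIV_mirror)
    from DERIV_minus[OF this]
    have "((%s. - \<phi> (x - s *R ?e)) has_vector_derivative partial k \<phi> (x - s *R ?e)) (at s)"
     by (simp add: has_real_derivative_iff_has_vector_derivative)
    then show "((%s. - \<phi> (x - s *R ?e)) has_vector_derivative partial k \<phi> (x - s *R ?e)) (at s within {0..t})"
     by (rule has_vector_derivative_at_within)
   next
    show "continuous_on {0..t} (%s. partial k \<phi> (x - s *R ?e))"
     by (rule continuous_on_compose2[OF test_function_partial_continuous[OF \<phi>]]) (auto intro!: continuous_intros)
   qed
   then have I: "(LINT s|lborel. ind {0..t} s * partial k \<phi> (x - s *R ?e)) = \<phi> x - \<phi> (x - t *R ?e)" by simp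
   show "(LINT s|lborel. F2 (x, s)) = (\<phi> x - \<phi> (x - t *R ?e)) *R u x"
   proof (cases "u x = 0")
    case False
    have "set_integrable lborel {0..t} (%s. partial k \<phi> (x - s *R ?e))"
     by (rule borel_integrable_atLeastAtMost', rule continuous_on_compose2[OF test_function_partial_continuous[OF \<phi>]])
      (auto intro!: continuous_intros)
    then have "integrable lborel (%s. ind {0..t} s * partial k \<phi> (x - s *R ?e))"
     by (simp add: set_integrable_def)
    then show ?thesis unfolding I[symmetric] F2_def prod.case by (intro integral_scaleR_left)
   qed (simp add: F2_def)
  qed
  finally have GI: "(LINT x|leb. \<phi> x *R G x) = - (LINT x|leb. (\<phi> x - \<phi> (x - t *R ?e)) *R u x)"
   by (subst (2) integral_completion) (simp_all, measurable)
  have "(LINT x|leb. \<phi> x *R u (x + t *R ?e)) = (LINT x|leb. \<phi> ((x + t *R ?e) - t *R ?e) *R u (x + t *R ?e))" by simp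
  also have "... = (LINT x|leb. \<phi> (x - t *R ?e) *R u x)"
   by (rule lebesgue_integral_translation(1)[of "%x. \<phi> (x - t *R ?e) *R u x"], rule measurable_completion) measurable
  finally have UI: "(LINT x|leb. \<phi> x *R u (x + t *R ?e)) = (LINT x|leb. \<phi> (x - t *R ?e) *R u x)" .
  note int = test_integrable(1)[OF \<phi> uT] test_integrable(1)[OF \<phi> L(1)] test_integrable(1)[OF \<phi> GL] test_integrable(1)[OF tr(1) L(1)]
  have "(LINT x|leb. \<phi> x *R \<Delta> x) = (LINT x|leb. \<phi> x *R u (x + t *R ?e) - \<phi> x *R u x - \<phi> x *R G x)"
   by (simp add: \<Delta>_def algebra_simps)
  also have "... = (LINT x|leb. \<phi> x *R u (x + t *R ?e)) - (LINT x|leb. \<phi> x *R u x) - (LINT x|leb. \<phi> x *R G x)"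
   using int by simp
  also have "(LINT x|leb. \<phi> x *R G x) = (LINT x|leb. \<phi> (x - t *R ?e) *R u x) - (LINT x|leb. \<phi> x *R u x)"
   unfolding GI using int by (simp add: scaleR_diff_left)
  finally show "(LINT x|leb. \<phi> x *R \<Delta> x) = 0" using UI by simp
 qed
 then have "AE x in lborel. \<Delta> x = 0" by (simp add: AE_completion_iff)
 then show ?thesis by eventually_elim (simp add: \<Delta>_def G_def)
qed

lemma ennreal_norm_sq_strip_le:
 fixes f :: "real => complex"
 assumes [measurable]: "f \<in> bmeas borel" and t: "0 <= t"
 shows "ennreal ((norm (LINT s|lborel. ind {0..t} s *R f s))^2) <= ennreal t * (\<integral>\<^sup>+s. indicator {0..t} s * ennreal ((norm (f s))^2) \<partial>lborel)"
proof -
 have "ennreal (norm (LINT s|lborel. ind {0..t} s *R f s)) <= (\<integral>\<^sup>+s. ennreal (norm (ind {0..t} s *R f s)) \<partial>lborel)"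
 proof (cases "integrable lborel (%s. ind {0..t} s *R f s)")
  case True then show ?thesis by (rule integral_norm_bound_ennreal)
 qed (simp add: not_integrable_integral_eq)
 also have "... = (\<integral>\<^sup>+s. indicator {0..t} s * (indicator {0..t} s * ennreal (norm (f s))) \<partial>lborel)"
  by (intro nn_integral_cong) (simp split: split_indicator)
 finally have "(ennreal (norm (LINT s|lborel. ind {0..t} s *R f s)))^2 <= (\<integral>\<^sup>+s. indicator {0..t} s * (indicator {0..t} s * ennreal (norm (f s))) \<partial>lborel)^2"
  by (intro power_mono) auto
 also have "... <= (\<integral>\<^sup>+s. (indicator {0..t} s)^2 \<partial>lborel) * (\<integral>\<^sup>+s. (indicator {0..t} s * ennreal (norm (f s)))^2 \<partial>lborel)"
  by (rule Cauchy_Schwarz_nn_integral) measurable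
 also have "(\<integral>\<^sup>+s. (indicator {0..t} s)^2 \<partial>lborel) = (\<integral>\<^sup>+s. indicator {0..t} s \<partial>lborel)"
  by (intro nn_integral_cong) (simp split: split_indicator)
 also have "... = ennreal t" using t by simp
 also have "(\<integral>\<^sup>+s. (indicator {0..t} s * ennreal (norm (f s)))^2 \<partial>lborel) = (\<integral>\<^sup>+s. indicator {0..t} s * ennreal ((norm (f s))^2) \<partial>lborel)"
  by (intro nn_integral_cong) (simp add: ennreal_power split: split_indicator)
 finally show ?thesis by (simp add: ennreal_power)
qed

lemma L2_tor_nn:
 assumes [measurable]: "f \<in> bmeas borel"
 shows "Lp 2 (tor T) f ==> (\<integral>\<^sup>+x. ennreal ((norm (f x))^2) * indicator (hcell T) x \<partial>lborel) = ennreal ((lpn 2 (tor T) f)^2)"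
  and "0 <= B ==> (\<integral>\<^sup>+x. ennreal ((norm (f x))^2) * indicator (hcell T) x \<partial>lborel) <= ennreal (B^2) ==> Lp 2 (tor T) f \<and> lpn 2 (tor T) f <= B"
proof -
 have m: "f \<in> bmeas (tor T)" by (rule borel_tor) measurable
 show "(\<integral>\<^sup>+x. ennreal ((norm (f x))^2) * indicator (hcell T) x \<partial>lborel) = ennreal ((lpn 2 (tor T) f)^2)" if "Lp 2 (tor T) f"
  unfolding nn_integral_tor[symmetric] using nn_integral_eq_integral[OF Lp_integrable[OF that]] by (simp add: lpn_power)
 assume B: "0 <= B" and le: "(\<integral>\<^sup>+x. ennreal ((norm (f x))^2) * indicator (hcell T) x \<partial>lborel) <= ennreal (B^2)"
 have le': "(\<integral>\<^sup>+x. ennreal ((norm (f x))^2) \<partial>tor T) <= ennreal (B^2)" using le by (simp add: nn_integral_tor)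
 have i: "integrable (tor T) (%x. (norm (f x))^2)"
  by (rule integrableI_bounded) (use m le' in "auto intro: le_less_trans")
 have "ennreal (LINT x|tor T. (norm (f x))^2) <= ennreal (B^2)"
  using le' nn_integral_eq_integral[OF i] by simp
 then have "(LINT x|tor T. (norm (f x))^2) <= B^2" by (subst (asm) ennreal_le_iff) auto
 then show "Lp 2 (tor T) f \<and> lpn 2 (tor T) f <= B"
  using i m B by (auto simp: Lp_def lpn_le_iff)
qed

lemma translation_estimate_nonneg:
 fixes u g :: "real ^ 'n => complex"
 assumes T: "T > 0" and w: "wper k T u g" and t: "0 <= t"
 shows "lpn 2 (tor T) (%x. u (x + t *R axis k 1) - u x) <= t * lpn 2 (tor T) g"
proof -
 let ?e = "axis k 1 :: real ^ 'n"
 note D = wperD[OF w]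
 note [measurable] = D(1,2)
 have "(\<integral>\<^sup>+x. ennreal ((norm (u (x + t *R ?e) - u x))^2) * indicator (hcell T) x \<partial>lborel)
   <= (\<integral>\<^sup>+x. ennreal t * (\<integral>\<^sup>+s. indicator {0..t} s * ennreal ((norm (g (x + s *R ?e)))^2) * indicator (hcell T) x \<partial>lborel) \<partial>lborel)"
 proof (rule nn_integral_mono_AE, use translation_formula[OF D(1,2,7) t] in eventually_elim)
  case (elim x)
  have "ennreal ((norm (u (x + t *R ?e) - u x))^2) <= ennreal t * (\<integral>\<^sup>+s. indicator {0..t} s * ennreal ((norm (g (x + s *R ?e)))^2) \<partial>lborel)"
   unfolding elim by (rule ennreal_norm_sq_strip_le[OF _ t]) measurable
  then show ?case by (cases "x \<in> hcell T") simp_all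
 qed
 also have "... = ennreal t * (\<integral>\<^sup>+x. \<integral>\<^sup>+s. indicator {0..t} s * ennreal ((norm (g (x + s *R ?e)))^2) * indicator (hcell T) x \<partial>lborel \<partial>lborel)"
  by (rule nn_integral_cmult) measurable
 also have "(\<integral>\<^sup>+x. \<integral>\<^sup>+s. indicator {0..t} s * ennreal ((norm (g (x + s *R ?e)))^2) * indicator (hcell T) x \<partial>lborel \<partial>lborel)
   = (\<integral>\<^sup>+s. \<integral>\<^sup>+x. indicator {0..t} s * ennreal ((norm (g (x + s *R ?e)))^2) * indicator (hcell T) x \<partial>lborel \<partial>lborel)"
  by (rule lborel_pair.Fubini') measurable
 also have "... = (\<integral>\<^sup>+s. ennreal ((lpn 2 (tor T) g)^2) * indicator {0..t} s \<partial>lborel)"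
 proof (intro nn_integral_cong)
  fix s
  have "(\<integral>\<^sup>+x. indicator {0..t} s * ennreal ((norm (g (x + s *R ?e)))^2) * indicator (hcell T) x \<partial>lborel)
    = indicator {0..t} s * (\<integral>\<^sup>+x. ennreal ((norm (g (x + s *R ?e)))^2) * indicator (hcell T) x \<partial>lborel)"
   unfolding mult.assoc by (rule nn_integral_cmult) measurable
  also have "(\<integral>\<^sup>+x. ennreal ((norm (g (x + s *R ?e)))^2) * indicator (hcell T) x \<partial>lborel) = (\<integral>\<^sup>+x. ennreal ((norm (g x))^2) * indicator (hcell T) x \<partial>lborel)"
   by (rule nn_integral_hcell_translation[OF T, of "%x. ennreal ((norm (g x))^2)"]) (use D(4) in "measurable, simp add: lper_def")
  also have "... = ennreal ((lpn 2 (tor T) g)^2)" by (rule L2_tor_nn(1)[OF D(2,6)])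
  finally show "(\<integral>\<^sup>+x. indicator {0..t} s * ennreal ((norm (g (x + s *R ?e)))^2) * indicator (hcell T) x \<partial>lborel) = ennreal ((lpn 2 (tor T) g)^2) * indicator {0..t} s"
   by (simp add: mult.commute)
 qed
 also have "... = ennreal ((lpn 2 (tor T) g)^2) * ennreal t" using t by (simp add: nn_integral_cmult_indicator)
 also have "ennreal t * (ennreal ((lpn 2 (tor T) g)^2) * ennreal t) = ennreal ((t * lpn 2 (tor T) g)^2)"
  using t by (simp add: ennreal_mult[symmetric] power2_eq_square mult_ac)
 finally show ?thesis
  using L2_tor_nn(2)[of "%x. u (x + t *R ?e) - u x" "t * lpn 2 (tor T) g" T] t by simp
qed

lemma L2_shift_diff:
 assumes T: "T > 0" and u: "u \<in> bmeas borel" "lper T u" "Lp 2 (tor T) u"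
 shows "Lp 2 (tor T) (%x. u (x + a) - u (x + b))"
 using Lp_tor_translation(1)[OF T u(1,2)] u(3) by (intro Lp_diff) auto

lemma translation_estimate_axis:
 fixes u g :: "real ^ 'n => complex"
 assumes T: "T > 0" and w: "wper k T u g"
 shows "lpn 2 (tor T) (%x. u (x + t *R axis k 1) - u x) <= \<bar>t\<bar> * lpn 2 (tor T) g"
proof (cases "0 <= t")
 case True then show ?thesis using translation_estimate_nonneg[OF T w True] by simp
next
 case False
 let ?e = "axis k 1 :: real ^ 'n"
 note D = wperD[OF w]
 have m: "(%x. u (x + t *R ?e) - u x) \<in> bmeas borel" using D(1) by measurable
 have p: "lper T (%x. u (x + t *R ?e) - u x)" using lper_shift[OF D(3), of "t *R ?e"] D(3) by (simp add: lper_def)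
 have "lpn 2 (tor T) (%x. u (x + t *R ?e) - u x) = lpn 2 (tor T) (%x. u (x + (- t) *R ?e + t *R ?e) - u (x + (- t) *R ?e))"
  by (rule Lp_tor_translation(2)[OF T m p, symmetric])
 also have "... = lpn 2 (tor T) (%x. u x - u (x + (- t) *R ?e))" by simp
 also have "... = lpn 2 (tor T) (%x. u (x + (- t) *R ?e) - u x)" by (rule lpn_minus)
 also have "... <= (- t) * lpn 2 (tor T) g" by (rule translation_estimate_nonneg[OF T w]) (use False in simp)
 finally show ?thesis using False by simp
qed

text \<open>
Moving from \<open>x\<close> to \<open>x + h\<close> along the coordinate axes, one axis after the other.
\<close>

lemma translation_estimate:
 fixes u :: "real ^ 'n => complex"
 assumes T: "T > 0" and w: "!!k. wper k T u (g k)"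
 shows "lpn 2 (tor T) (%x. u (x + h) - u x) <= (\<Sum>k\<in>UNIV. \<bar>h $ k\<bar> * lpn 2 (tor T) (g k))"
proof -
 have D: "u \<in> bmeas borel" "lper T u" "Lp 2 (tor T) u" using wperD[OF w[of undefined]] by auto
 have "finite A ==> lpn 2 (tor T) (%x. u (x + (\<Sum>k\<in>A. (h $ k) *R axis k 1)) - u x) <= (\<Sum>k\<in>A. \<bar>h $ k\<bar> * lpn 2 (tor T) (g k))" for A
 proof (induction A rule: finite_induct)
  case empty then show ?case by (simp add: lpn_def)
 next
  case (insert a A)
  let ?s = "\<Sum>k\<in>A. (h $ k) *R axis k (1::real) :: real ^ 'n" and ?a = "(h $ a) *R axis a (1::real) :: real ^ 'n"
  have m: "(%x. u (x + ?a) - u x) \<in> bmeas borel" using D(1) by measurable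
  have p: "lper T (%x. u (x + ?a) - u x)" using lper_shift[OF D(2), of ?a] D(2) by (simp add: lper_def)
  have "lpn 2 (tor T) (%x. u (x + (\<Sum>k\<in>insert a A. (h $ k) *R axis k 1)) - u x)
   = lpn 2 (tor T) (%x. (u ((x + ?s) + ?a) - u (x + ?s)) + (u (x + ?s) - u (x + 0)))"
   using insert by (simp add: algebra_simps)
  also have "... <= lpn 2 (tor T) (%x. u ((x + ?s) + ?a) - u (x + ?s)) + lpn 2 (tor T) (%x. u (x + ?s) - u (x + 0))"
   by (rule lpn_triangle) (simp_all only: add.assoc L2_shift_diff[OF T D], simp_all)
  also have "lpn 2 (tor T) (%x. u ((x + ?s) + ?a) - u (x + ?s)) = lpn 2 (tor T) (%x. u (x + ?a) - u x)"
   by (rule Lp_tor_translation(2)[OF T m p])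
  also have "... <= \<bar>h $ a\<bar> * lpn 2 (tor T) (g a)" by (rule translation_estimate_axis[OF T w])
  finally show ?case using insert by simp
 qed
 from this[of UNIV] show ?thesis using basis_expansion[of h] by (simp add: scalar_mult_eq_scaleR)
qed

text \<open>
The difference quotient, paired with \<open>w\<close>, converges to the pairing of the weak derivative with an explicit linear rate, since \<open>w\<close> has a derivative as well.
\<close>

lemma shift_pairing:
 fixes u w :: "real ^ 'n => complex"
 assumes T: "T > 0" and u: "wper k T u g" and w: "wper k T w h" and t: "0 <= t"
 shows "cmod ((LINT x|tor T. (u (x + t *R axis k 1) - u x) * w x) - t *R (LINT x|tor T. g x * w x))
   <= t^2 * (lpn 2 (tor T) g * lpn 2 (tor T) h)"
proof -
 let ?e = "axis k 1 :: real ^ 'n"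
 note D = wperD[OF u] and W = wperD[OF w]
 note [measurable] = D(1,2) W(1)
 define F where "F = (%(x, s). ind (hcell T) x *R (ind {0..t} s *R (g (x + s *R ?e) * w x)))"
 have Fm: "F \<in> bmeas (lborel \<Otimes>\<^sub>M lborel)" unfolding F_def by measurable
 have gs: "Lp 2 (tor T) (%x. g (x + a))" "lpn 2 (tor T) (%x. g (x + a)) = lpn 2 (tor T) g" for a
  using Lp_tor_translation[OF T D(2,4)] D(6) by auto
 have iF: "integrable (lborel \<Otimes>\<^sub>M lborel) F"
 proof (rule integrable_strip[OF Fm t, where C = "lpn 2 (tor T) g * lpn 2 (tor T) w"])
  fix s assume s: "s \<in> {0..t}"
  note A = integral_mult_L2[OF gs(1)[of "s *R ?e"] W(5)]
  have "(\<integral>\<^sup>+x. ennreal (norm (F (x, s))) \<partial>lborel) = (\<integral>\<^sup>+x. ennreal (norm (g (x + s *R ?e)) * norm (w x)) \<partial>tor T)"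
   unfolding nn_integral_tor using s by (intro nn_integral_cong) (simp add: F_def norm_mult split: split_indicator)
  also have "... = ennreal (LINT x|tor T. norm (g (x + s *R ?e)) * norm (w x))"
   by (rule nn_integral_eq_integral[OF A(1)]) auto
  also have "... <= ennreal (lpn 2 (tor T) g * lpn 2 (tor T) w)" using A(2) gs(2) by (intro ennreal_leI) simp
  finally show "(\<integral>\<^sup>+x. ennreal (norm (F (x, s))) \<partial>lborel) <= ennreal (lpn 2 (tor T) g * lpn 2 (tor T) w)" .
 qed (simp add: F_def)
 define J where "J s = (LINT x|tor T. g (x + s *R ?e) * w x)" for s
 have tor_lborel: "(LINT x|tor T. f x) = (LINT x|lborel. ind (hcell T) x *R f x)" for f :: "real ^ 'n => complex"
  by (subst integral_restrict_space) auto
 have "(LINT x|tor T. (u (x + t *R ?e) - u x) * w x) = (LINT x|lborel. \<integral>s. F (x, s) \<partial>lborel)"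
  unfolding tor_lborel
 proof (rule integral_cong_AE)
  show "(%x. ind (hcell T) x *R ((u (x + t *R ?e) - u x) * w x)) \<in> bmeas lborel" by measurable
  show "(%x. \<integral>s. F (x, s) \<partial>lborel) \<in> bmeas lborel" using Fubini_strip(2)[OF iF] by (rule borel_measurable_integrable)
  show "AE x in lborel. ind (hcell T) x *R ((u (x + t *R ?e) - u x) * w x) = (LINT s|lborel. F (x, s))"
   using translation_formula[OF D(1,2,7) t]
  proof eventually_elim
   case (elim x)
   have "(LINT s|lborel. F (x, s)) = ind (hcell T) x *R ((LINT s|lborel. ind {0..t} s *R g (x + s *R ?e)) * w x)"
    unfolding F_def prod.case by (simp only: integral_scaleR_right mult_scaleR_left[symmetric] integral_mult_left_zero)
   then show ?case using elim by simp
  qed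
 qed
 also have "... = (LINT s|lborel. \<integral>x. F (x, s) \<partial>lborel)" by (rule Fubini_strip(1)[OF iF])
 also have FJ: "(%s. \<integral>x. F (x, s) \<partial>lborel) = (%s. ind {0..t} s *R J s)"
  unfolding F_def J_def tor_lborel prod.case by (rule ext) (simp only: scaleR_left_commute[of "ind (hcell T) _"] integral_scaleR_right)
 finally have main: "(LINT x|tor T. (u (x + t *R ?e) - u x) * w x) = (LINT s|lborel. ind {0..t} s *R J s)" .
 have iJ: "integrable lborel (%s. ind {0..t} s *R J s)"
  unfolding FJ[symmetric] using lborel_pair.integrable_snd[of "%x s. F (x, s)"] iF by simp
 have J_le: "cmod (J s - (LINT x|tor T. g x * w x)) <= t * (lpn 2 (tor T) g * lpn 2 (tor T) h)" if s: "s \<in> {0..t}" for s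
 proof -
  have p: "lper T (%x. g x * w (x + (- s) *R ?e))"
   using D(4) lper_shift[OF W(3), of "(- s) *R ?e"] by (simp add: lper_def)
  have "J s = (LINT x|tor T. g (x + s *R ?e) * w ((x + s *R ?e) + (- s) *R ?e))" by (simp add: J_def)
  also have "... = (LINT x|tor T. g x * w (x + (- s) *R ?e))"
   by (rule tor_translation(1)[OF T _ p]) measurable
  finally have J1: "J s = (LINT x|tor T. g x * w (x + (- s) *R ?e))" .
  have ws: "Lp 2 (tor T) (%x. w (x + a))" for a using Lp_tor_translation(1)[OF T W(1,3)] W(5) by simp
  have "J s - (LINT x|tor T. g x * w x) = (LINT x|tor T. g x * (w (x + (- s) *R ?e) - w x))"
   unfolding J1 by (subst Bochner_Integration.integral_diff[symmetric])
    (simp_all only: integral_mult_L2_complex(1)[OF D(6) ws] integral_mult_L2_complex(1)[OF D(6) W(5)] right_diff_distrib)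
  also have "cmod \<dots> <= lpn 2 (tor T) g * lpn 2 (tor T) (%x. w (x + (- s) *R ?e) - w x)"
   by (rule integral_mult_L2_complex(2)[OF D(6) Lp_diff[OF ws W(5)]])
  also have "... <= lpn 2 (tor T) g * (\<bar>- s\<bar> * lpn 2 (tor T) h)"
   by (intro mult_left_mono translation_estimate_axis[OF T w]) simp
  also have "... = s * (lpn 2 (tor T) g * lpn 2 (tor T) h)" using s by simp
  also have "... <= t * (lpn 2 (tor T) g * lpn 2 (tor T) h)" using s by (intro mult_right_mono) auto
  finally show ?thesis .
 qed
 have i1: "integrable lborel (%s. ind {0..t} s *R c)" for c :: complex
  using t by (intro integrable_scaleR_left integrable_real_indicator) simp_all
 have "(LINT s|lborel. ind {0..t} s *R J s) - t *R (LINT x|tor T. g x * w x)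
   = (LINT s|lborel. ind {0..t} s *R J s - ind {0..t} s *R (LINT x|tor T. g x * w x))"
  using iJ i1 t by simp
 also have "cmod \<dots> <= (LINT s|lborel. ind {0..t} s *R (t * (lpn 2 (tor T) g * lpn 2 (tor T) h)))"
 proof (rule order_trans[OF integral_norm_bound], rule integral_mono)
  show "integrable lborel (%s. norm (ind {0..t} s *R J s - ind {0..t} s *R (LINT x|tor T. g x * w x)))"
   by (intro integrable_norm Bochner_Integration.integrable_diff iJ i1)
  show "integrable lborel (%s. ind {0..t} s *R (t * (lpn 2 (tor T) g * lpn 2 (tor T) h)))"
   using t by (intro integrable_scaleR_left integrable_real_indicator) simp_all
  show "norm (ind {0..t} s *R J s - ind {0..t} s *R (LINT x|tor T. g x * w x)) <= ind {0..t} s *R (t * (lpn 2 (tor T) g * lpn 2 (tor T) h))" for s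
   using J_le[of s] by (simp split: split_indicator)
 qed
 also have "... = t^2 * (lpn 2 (tor T) g * lpn 2 (tor T) h)" using t by (simp add: power2_eq_square)
 finally show ?thesis unfolding main .
qed

text \<open>
The rule is obtained from difference quotients: the integral of \<open>u w\<close> over the torus is
invariant under the shift by \<open>t\<close>, its expansion has first-order part \<open>t\<close> times the claimed sum, and the error is \<open>O(t\<^sup>2)\<close>.
\<close>

lemma periodic_integration_by_parts:
 fixes u w :: "real ^ 'n => complex"
 assumes T: "T > 0" and u: "wper k T u g" and w: "wper k T w h"
 shows "(LINT x|tor T. g x * w x) + (LINT x|tor T. u x * h x) = 0"
proof -
 let ?e = "axis k 1 :: real ^ 'n"
 note D = wperD[OF u] and W = wperD[OF w]
 define A where "A = (LINT x|tor T. g x * w x) + (LINT x|tor T. u x * h x)"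
 define K where "K = lpn 2 (tor T) g * lpn 2 (tor T) h"
 have K: "0 <= K" by (simp add: K_def)
 have le: "cmod A <= 3 * K * t" if t: "t > 0" for t
 proof -
  have us: "Lp 2 (tor T) (%x. u (x + a))" for a using Lp_tor_translation(1)[OF T D(1,3)] D(5) by simp
  have ws: "Lp 2 (tor T) (%x. w (x + a))" for a using Lp_tor_translation(1)[OF T W(1,3)] W(5) by simp
  define du dw where "du x = u (x + t *R ?e) - u x" and "dw x = w (x + t *R ?e) - w x" for x
  have du: "Lp 2 (tor T) du" and dw: "Lp 2 (tor T) dw"
   unfolding du_def dw_def by (intro Lp_diff us ws D W)+
  note I = integral_mult_L2_complex(1)
  have p: "lper T (%x. u x * w x)" using D(3) W(3) by (simp add: lper_def)
  have "(LINT x|tor T. u (x + t *R ?e) * w (x + t *R ?e)) = (LINT x|tor T. u x * w x)"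
   by (rule tor_translation(1)[OF T _ p]) (use D(1) W(1) in measurable)
  moreover have "(LINT x|tor T. u (x + t *R ?e) * w (x + t *R ?e)) = (LINT x|tor T. u x * w x + du x * w x + dw x * u x + du x * dw x)"
   by (simp add: du_def dw_def algebra_simps)
  ultimately have z: "(LINT x|tor T. du x * w x) + (LINT x|tor T. dw x * u x) + (LINT x|tor T. du x * dw x) = 0"
   using I[OF D(5) W(5)] I[OF du W(5)] I[OF dw D(5)] I[OF du dw] by (simp add: add.assoc)
  have 1: "cmod ((LINT x|tor T. du x * w x) - t *R (LINT x|tor T. g x * w x)) <= t^2 * K"
   unfolding du_def K_def by (rule shift_pairing[OF T u w]) (use t in simp)
  have 2: "cmod ((LINT x|tor T. dw x * u x) - t *R (LINT x|tor T. h x * u x)) <= t^2 * K"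
   unfolding dw_def K_def using shift_pairing[OF T w u, of t] t by (simp add: mult.commute)
  have "cmod (LINT x|tor T. du x * dw x) <= lpn 2 (tor T) du * lpn 2 (tor T) dw" by (rule integral_mult_L2_complex(2)[OF du dw])
  also have "... <= (\<bar>t\<bar> * lpn 2 (tor T) g) * (\<bar>t\<bar> * lpn 2 (tor T) h)"
   unfolding du_def dw_def by (intro mult_mono translation_estimate_axis[OF T u] translation_estimate_axis[OF T w]) auto
  finally have 3: "cmod (LINT x|tor T. du x * dw x) <= t^2 * K" by (simp add: K_def power2_eq_square mult_ac)
  define P Q R G H where "P = (LINT x|tor T. du x * w x)" and "Q = (LINT x|tor T. dw x * u x)"
   and "R = (LINT x|tor T. du x * dw x)" and "G = (LINT x|tor T. g x * w x)" and "H = (LINT x|tor T. h x * u x)"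
  note defs = P_def Q_def R_def G_def H_def
  have AGH: "A = G + H" unfolding A_def defs by (simp only: mult.commute[of "u _"])
  have "P + Q + R = 0" using z unfolding defs .
  then have "R = - (P + Q)" by (simp only: add_eq_0_iff)
  then have "t *R A = - (((P - t *R G) + (Q - t *R H)) + R)"
   unfolding AGH by (simp add: scaleR_add_right)
  then have "cmod (t *R A) = cmod (((P - t *R G) + (Q - t *R H)) + R)" by (simp only: norm_minus_cancel)
  also have "... <= (t^2 * K + t^2 * K) + t^2 * K"
   by (rule norm_triangle_le, rule add_mono[OF norm_triangle_le[OF add_mono]]) (use 1 2 3 in "simp_all only: defs")
  finally show ?thesis using t by (simp add: power2_eq_square)
 qed
 have "cmod A <= 0 + e" if e: "e > 0" for e
 proof -
  have "3 * K * (e / (3 * K + 1)) <= e" using e K by (simp add: field_simps)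
  then show ?thesis using le[of "e / (3 * K + 1)"] e K by (simp add: add_nonneg_pos)
 qed
 then have "cmod A <= 0" by (rule field_le_epsilon)
 then show ?thesis by (simp add: A_def)
qed

lemma wper_const: "wper k T (%_. c) (%_. 0)"
proof -
 have "is_weak_partial k (%_. c) (%_. 0)"
  by (rule is_weak_partialI_difference[where B = "cmod c" and L = 0]) auto
 then show ?thesis
  using lpn_bounded(1)[OF finite_measure_tor, of 2 "%_. c" T "cmod c"] lpn_bounded(1)[OF finite_measure_tor, of 2 "%_. 0 :: complex" T 0]
  by (simp add: wper_def lper_def)
qed

section \<open>Averages over cubes: Poincare, Sobolev and Rellich\<close>

text \<open>
Two features of these cube means carry the estimates below: means at different scales commute, and the \<open>L\<^sup>2\<close> norm bounds their supremum.
\<close>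

definition avg :: "real => (real ^ 'n => complex) => real ^ 'n => complex" where
 "avg s f x = (LINT h|tor s. f (x + h)) /\<^sub>R s ^ CARD('n)"

lemma measure_tor: "0 <= s ==> measure (tor s :: (real ^ 'n) measure) (hcell s) = s ^ CARD('n)"
proof -
 assume s: "0 <= s"
 have "emeasure (tor s :: (real ^ 'n) measure) (hcell s) = emeasure (cm s :: (real ^ 'n) measure) (space (cm s))"
  using nn_integral_cm[of "%_ :: real ^ 'n. 1" s] by simp
 then show ?thesis using measure_cm[OF s, where 'n = 'n] by (simp add: measure_def)
qed

lemma emeasure_tor: "0 <= s ==> emeasure (tor s :: (real ^ 'n) measure) (hcell s) = ennreal (s ^ CARD('n))"
 using finite_measure.emeasure_eq_measure[OF finite_measure_tor] measure_tor by metis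

lemma nn_integral_tor_shift_le:
 fixes F :: "real ^ 'n => ennreal"
 assumes T: "T > 0" "s <= T" and F [measurable]: "F \<in> bmeas borel" and p: "lper T F"
 shows "(\<integral>\<^sup>+h. F (x + h) \<partial>tor s) <= (\<integral>\<^sup>+h. F h \<partial>tor T)"
proof -
 have "(\<integral>\<^sup>+h. F (x + h) \<partial>tor s) <= (\<integral>\<^sup>+h. F (h + x) * indicator (hcell T) h \<partial>lborel)"
  unfolding nn_integral_tor
  by (rule nn_integral_mono) (use T in "auto simp: add.commute hcell_def intro: less_le_trans split: split_indicator")
 also have "... = (\<integral>\<^sup>+h. F h * indicator (hcell T) h \<partial>lborel)" by (rule nn_integral_hcell_translation[OF T(1) F p])
 finally show ?thesis by (simp add: nn_integral_tor)
qed

lemma L2_small_cube: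
 fixes f :: "real ^ 'n => complex"
 assumes T: "0 < s" "s <= T" and f [measurable]: "f \<in> bmeas borel" and p: "lper T f" and L: "Lp 2 (tor T) f"
 shows "Lp 2 (tor s) (%h. f (x + h))" "lpn 2 (tor s) (%h. f (x + h)) <= lpn 2 (tor T) f"
proof -
 have m: "(%h. f (x + h)) \<in> bmeas borel" by measurable
 have "(\<integral>\<^sup>+h. ennreal ((norm (f (x + h)))^2) \<partial>tor s) <= (\<integral>\<^sup>+h. ennreal ((norm (f h))^2) \<partial>tor T)"
  by (rule nn_integral_tor_shift_le[of T s "%h. ennreal ((norm (f h))^2)" x]) (use T p in "auto simp: lper_def")
 also have "... = ennreal ((lpn 2 (tor T) f)^2)" using L2_tor_nn(1)[OF f L] by (simp add: nn_integral_tor)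
 finally have "Lp 2 (tor s) (%h. f (x + h)) \<and> lpn 2 (tor s) (%h. f (x + h)) <= lpn 2 (tor T) f"
  by (intro L2_tor_nn(2)[OF m]) (simp_all add: nn_integral_tor)
 then show "Lp 2 (tor s) (%h. f (x + h))" "lpn 2 (tor s) (%h. f (x + h)) <= lpn 2 (tor T) f" by auto
qed

lemma L2_integral_le:
 fixes f :: "real ^ 'n => complex"
 assumes s: "0 < s" and L: "Lp 2 (tor s) f"
 shows "integrable (tor s) f" "cmod (LINT h|tor s. f h) <= lpn 2 (tor s) f * sqrt (s ^ CARD('n))"
proof -
 have 1: "Lp 2 (tor s) (%_. 1 :: complex)" by (rule lpn_bounded(1)[OF finite_measure_tor, of 2 _ _ 1]) auto
 have n1: "lpn 2 (tor s :: (real ^ 'n) measure) (%_. 1 :: complex) = sqrt (s ^ CARD('n))"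
  using s by (simp add: lpn_def measure_tor sqrt_def)
 show "integrable (tor s) f" using integral_mult_L2_complex(1)[OF L 1] by simp
 show "cmod (LINT h|tor s. f h) <= lpn 2 (tor s) f * sqrt (s ^ CARD('n))" using integral_mult_L2_complex(2)[OF L 1] n1 by simp
qed

lemma avg_bound:
 fixes f :: "real ^ 'n => complex"
 assumes T: "0 < s" "s <= T" and f: "f \<in> bmeas borel" and p: "lper T f" and L: "Lp 2 (tor T) f"
 shows "cmod (avg s f x) <= lpn 2 (tor T) f / sqrt (s ^ CARD('n))"
proof -
 have P: "0 < s ^ CARD('n)" using T by simp
 note A = L2_small_cube[OF assms, of x]
 have "cmod (LINT h|tor s. f (x + h)) <= lpn 2 (tor T) f * sqrt (s ^ CARD('n))"
  by (rule order_trans[OF L2_integral_le(2)[OF T(1) A(1)]]) (use A(2) P in "auto intro: mult_right_mono")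
 also have "sqrt (s ^ CARD('n)) = s ^ CARD('n) / sqrt (s ^ CARD('n))"
  using P by (intro real_div_sqrt[symmetric]) simp
 also have "lpn 2 (tor T) f * (s ^ CARD('n) / sqrt (s ^ CARD('n))) = (lpn 2 (tor T) f / sqrt (s ^ CARD('n))) * s ^ CARD('n)"
  by simp
 finally show ?thesis unfolding avg_def by (rule norm_divideR_le[OF _ P])
qed

lemma avg_borel:
 assumes f [measurable]: "f \<in> bmeas borel"
 shows "avg s f \<in> bmeas borel"
proof -
 have "(%x. \<integral>h. ind (hcell s) h *R f (x + h) \<partial>lborel) \<in> bmeas borel" by measurable
 moreover have "(LINT h|tor s. f (x + h)) = (LINT h|lborel. ind (hcell s) h *R f (x + h))" for x
  by (subst integral_restrict_space) auto
 ultimately show ?thesis unfolding avg_def[abs_def] by simp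
qed

lemma avg_lper: "lper T f ==> lper T (avg s f)"
proof -
 assume p: "lper T f"
 have "f (x + lat T m + h) = f (x + h)" for x m h
  using lper_shift[OF p, of h] by (simp add: lper_def)
 then show ?thesis unfolding lper_def avg_def by simp
qed

lemma avg_Lp:
 fixes f :: "real ^ 'n => complex"
 assumes T: "0 < s" "s <= T" and f: "f \<in> bmeas borel" and p: "lper T f" and L: "Lp 2 (tor T) f" and q: "0 < q"
 shows "Lp q (tor T) (avg s f)"
  "lpn q (tor T) (avg s f) <= (lpn 2 (tor T) f / sqrt (s ^ CARD('n))) * root q (T ^ CARD('n))"
proof -
 have B: "0 <= lpn 2 (tor T) f / sqrt (s ^ CARD('n))" using T by simp
 note A = lpn_bounded[where M = "tor T", OF finite_measure_tor q borel_tor[OF avg_borel[OF f]] avg_bound[OF T f p L] B]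
 show "Lp q (tor T) (avg s f)" using A(1) .
 show "lpn q (tor T) (avg s f) <= (lpn 2 (tor T) f / sqrt (s ^ CARD('n))) * root q (T ^ CARD('n))"
  using A(2) T measure_tor[of T, where 'n = 'n] by simp
qed

lemma avg_diff:
 fixes f g :: "real ^ 'n => complex"
 assumes T: "0 < s" "s <= T" and f: "f \<in> bmeas borel" "lper T f" "Lp 2 (tor T) f"
  and g: "g \<in> bmeas borel" "lper T g" "Lp 2 (tor T) g"
 shows "avg s (%x. f x - g x) x = avg s f x - avg s g x"
 using L2_integral_le(1)[OF T(1) L2_small_cube(1)[OF T f]] L2_integral_le(1)[OF T(1) L2_small_cube(1)[OF T g]]
 by (simp add: avg_def scaleR_diff_right)

lemma avg_commute:
 fixes f :: "real ^ 'n => complex"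
 assumes T: "0 < s" "s <= T" "0 < t" "t <= T" and f [measurable]: "f \<in> bmeas borel" and p: "lper T f" and L: "Lp 2 (tor T) f"
 shows "avg s (avg t f) x = avg t (avg s f) x"
proof -
 interpret A: finite_measure "tor s :: (real ^ 'n) measure" by (rule finite_measure_tor)
 interpret B: finite_measure "tor t :: (real ^ 'n) measure" by (rule finite_measure_tor)
 interpret P: pair_sigma_finite "tor s :: (real ^ 'n) measure" "tor t :: (real ^ 'n) measure" ..
 have m: "(%(h, k). f (x + h + k)) \<in> bmeas (tor s \<Otimes>\<^sub>M tor t)"
 proof -
  have 1: "(%z :: (real ^ 'n) \<times> (real ^ 'n). f (x + fst z + snd z)) \<in> bmeas (borel \<Otimes>\<^sub>M borel)" by measurable
  have 2: "(%z. (fst z, snd z)) \<in> (tor s \<Otimes>\<^sub>M tor t) \<rightarrow>\<^sub>M (borel \<Otimes>\<^sub>M (borel :: (real ^ 'n) measure))"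
   by (intro measurable_Pair measurable_compose[OF measurable_fst] measurable_compose[OF measurable_snd] borel_tor' measurable_ident_sets) auto
  show ?thesis using measurable_compose[OF 2 1] by (simp add: case_prod_beta)
 qed
 have i: "integrable (tor s \<Otimes>\<^sub>M tor t) (%(h, k). f (x + h + k))"
 proof (rule integrableI_bounded[OF m])
  have i1: "integrable (tor T) f" by (rule L2_integral_le(1)[OF _ L]) (use T in simp)
  have "(\<integral>\<^sup>+z. ennreal (norm (case z of (h, k) => f (x + h + k))) \<partial>(tor s \<Otimes>\<^sub>M tor t))
    = (\<integral>\<^sup>+h. \<integral>\<^sup>+k. ennreal (norm (f (x + h + k))) \<partial>tor t \<partial>tor s)"
   using B.nn_integral_fst[of "%z. ennreal (norm (case z of (h, k) => f (x + h + k)))" "tor s"] m by simp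
  also have "... <= (\<integral>\<^sup>+h. (\<integral>\<^sup>+k. ennreal (norm (f k)) \<partial>tor T) \<partial>(tor s :: (real ^ 'n) measure))"
   by (intro nn_integral_mono nn_integral_tor_shift_le[of T t "%k. ennreal (norm (f k))"]) (use T p in "auto simp: lper_def")
  also have "... = (\<integral>\<^sup>+k. ennreal (norm (f k)) \<partial>tor T) * ennreal (s ^ CARD('n))"
   using T emeasure_tor[of s, where 'n = 'n] by simp
  also have "... < \<infinity>" using nn_integral_eq_integral[OF integrable_norm[OF i1]] by (simp add: ennreal_mult_less_top)
  finally show "(\<integral>\<^sup>+z. ennreal (norm (case z of (h, k) => f (x + h + k))) \<partial>(tor s \<Otimes>\<^sub>M tor t)) < \<infinity>" .
 qed
 have "(LINT k|tor t. \<integral>h. f (x + h + k) \<partial>tor s) = (LINT h|tor s. \<integral>k. f (x + h + k) \<partial>tor t)"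
  by (rule P.Fubini_integral) (use i in simp)
 then show ?thesis by (simp add: avg_def add.assoc add.commute[of _ "_ :: real ^ 'n"] add.left_commute mult.commute)
qed

text \<open>
Jensen's inequality under the average, Fubini, and \<open>translation_estimate\<close> for each shift in the cube.
\<close>

lemma avg_error:
 fixes u :: "real ^ 'n => complex"
 assumes T: "0 < s" "s <= T" and w: "!!k. wper k T u (g k)"
 shows "lpn 2 (tor T) (%x. avg s u x - u x) <= s * (\<Sum>k\<in>UNIV. lpn 2 (tor T) (g k))"
proof -
 define \<Gamma> where "\<Gamma> = (\<Sum>k\<in>UNIV. lpn 2 (tor T) (g k))"
 have \<Gamma>: "0 <= \<Gamma>" by (simp add: \<Gamma>_def sum_nonneg)
 have T0: "T > 0" using T by simp
 have u [measurable]: "u \<in> bmeas borel" and p: "lper T u" and L: "Lp 2 (tor T) u" using wperD[OF w[of undefined]] by auto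
 define N where "N = s ^ CARD('n)"
 have N: "N > 0" using T by (simp add: N_def)
 have am: "(%x. avg s u x - u x) \<in> bmeas borel" using avg_borel[OF u] by measurable
 interpret S: finite_measure "tor s :: (real ^ 'n) measure" by (rule finite_measure_tor)
 have ptw: "ennreal ((norm (avg s u x - u x))^2) <= ennreal (1 / N) * (\<integral>\<^sup>+h. ennreal ((norm (u (x + h) - u x))^2) * indicator (hcell s) h \<partial>lborel)" for x
 proof -
  have Ld: "Lp 2 (tor s) (%h. u (x + h) - u x)"
   by (rule Lp_diff[OF L2_small_cube(1)[OF T u p L] lpn_bounded(1)[OF finite_measure_tor]]) auto
  have "(LINT h|tor s. u (x + h) - u x) = N *R (avg s u x - u x)"
   using N L2_integral_le(1)[OF T(1) L2_small_cube(1)[OF T u p L]] measure_tor[of s, where 'n = 'n] T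
   by (simp add: avg_def N_def scaleR_diff_right)
  with L2_integral_le(2)[OF T(1) Ld] have "N * norm (avg s u x - u x) <= lpn 2 (tor s) (%h. u (x + h) - u x) * sqrt N"
   using N by (simp add: N_def)
  then have "(N * norm (avg s u x - u x))^2 <= (lpn 2 (tor s) (%h. u (x + h) - u x) * sqrt N)^2" using N by (intro power_mono) auto
  then have "(norm (avg s u x - u x))^2 <= 1 / N * (lpn 2 (tor s) (%h. u (x + h) - u x))^2"
   using N by (simp add: power_mult_distrib field_simps) (simp add: power2_eq_square)
  then have "ennreal ((norm (avg s u x - u x))^2) <= ennreal (1 / N) * ennreal ((lpn 2 (tor s) (%h. u (x + h) - u x))^2)"
   using N by (simp add: ennreal_mult[symmetric] ennreal_leI)
  moreover have "(\<integral>\<^sup>+h. ennreal ((norm (u (x + h) - u x))^2) * indicator (hcell s) h \<partial>lborel) = ennreal ((lpn 2 (tor s) (%h. u (x + h) - u x))^2)"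
   by (rule L2_tor_nn(1)[OF _ Ld]) measurable
  ultimately show ?thesis by (simp only:)
 qed
 have "(\<integral>\<^sup>+x. ennreal ((norm (avg s u x - u x))^2) * indicator (hcell T) x \<partial>lborel)
   <= (\<integral>\<^sup>+x. ennreal (1 / N) * (\<integral>\<^sup>+h. ennreal ((norm (u (x + h) - u x))^2) * indicator (hcell s) h * indicator (hcell T) x \<partial>lborel) \<partial>lborel)"
  using ptw by (intro nn_integral_mono) (auto split: split_indicator)
 also have "... = ennreal (1 / N) * (\<integral>\<^sup>+x. \<integral>\<^sup>+h. ennreal ((norm (u (x + h) - u x))^2) * indicator (hcell s) h * indicator (hcell T) x \<partial>lborel \<partial>lborel)"
  by (rule nn_integral_cmult) measurable
 also have "(\<integral>\<^sup>+x. \<integral>\<^sup>+h. ennreal ((norm (u (x + h) - u x))^2) * indicator (hcell s) h * indicator (hcell T) x \<partial>lborel \<partial>lborel)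
   = (\<integral>\<^sup>+h. \<integral>\<^sup>+x. ennreal ((norm (u (x + h) - u x))^2) * indicator (hcell s) h * indicator (hcell T) x \<partial>lborel \<partial>lborel)"
  by (rule lborel_pair.Fubini') measurable
 also have "... <= (\<integral>\<^sup>+h. ennreal ((s * \<Gamma>)^2) * indicator (hcell s) (h :: real ^ 'n) \<partial>lborel)"
 proof (rule nn_integral_mono)
  fix h :: "real ^ 'n"
  show "(\<integral>\<^sup>+x. ennreal ((norm (u (x + h) - u x))^2) * indicator (hcell s) h * indicator (hcell T) x \<partial>lborel) <= ennreal ((s * \<Gamma>)^2) * indicator (hcell s) h"
  proof (cases "h \<in> hcell s")
   case True
   have Ld: "Lp 2 (tor T) (%x. u (x + h) - u x)" using L2_shift_diff[OF T0 u p L, of h 0] by simp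
   have "lpn 2 (tor T) (%x. u (x + h) - u x) <= (\<Sum>k\<in>UNIV. \<bar>h $ k\<bar> * lpn 2 (tor T) (g k))" by (rule translation_estimate[OF T0 w])
   also have "... <= (\<Sum>k\<in>UNIV. s * lpn 2 (tor T) (g k))" using True by (intro sum_mono mult_right_mono) (auto simp: hcell_def less_imp_le)
   also have "... = s * \<Gamma>" by (simp add: \<Gamma>_def sum_distrib_left)
   finally have "(lpn 2 (tor T) (%x. u (x + h) - u x))^2 <= (s * \<Gamma>)^2" by (intro power_mono) auto
   moreover have "(\<integral>\<^sup>+x. ennreal ((norm (u (x + h) - u x))^2) * indicator (hcell T) x \<partial>lborel) = ennreal ((lpn 2 (tor T) (%x. u (x + h) - u x))^2)"
    by (rule L2_tor_nn(1)[OF _ Ld]) measurable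
   ultimately show ?thesis using True by (simp add: ennreal_leI)
  qed simp
 qed
 also have "... = ennreal ((s * \<Gamma>)^2) * emeasure lborel (hcell s :: (real ^ 'n) set)"
  by (rule nn_integral_cmult_indicator) simp
 also have "emeasure lborel (hcell s :: (real ^ 'n) set) = ennreal N"
  using emeasure_tor[of s, where 'n = 'n] T by (simp add: emeasure_restrict_space N_def)
 also have "ennreal (1 / N) * (ennreal ((s * \<Gamma>)^2) * ennreal N) = ennreal ((s * \<Gamma>)^2)"
  using N by (simp add: ennreal_mult[symmetric])
 finally have imp: "(!!x y. x <= y ==> ennreal (1 / N) * x <= ennreal (1 / N) * y) ==>
   (\<integral>\<^sup>+x. ennreal ((norm (avg s u x - u x))^2) * indicator (hcell T) x \<partial>lborel) <= ennreal ((s * \<Gamma>)^2)" .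
 have "(\<integral>\<^sup>+x. ennreal ((norm (avg s u x - u x))^2) * indicator (hcell T) x \<partial>lborel) <= ennreal ((s * \<Gamma>)^2)"
  by (rule imp, erule mult_left_mono) simp
 from L2_tor_nn(2)[OF am _ this] show ?thesis using T \<Gamma> by (simp add: \<Gamma>_def)
qed

text \<open>
For a periodic function the average over a whole cell does not depend on the base point, so this is \<open>avg_error\<close> with \<open>s = T\<close>.
\<close>

lemma poincare:
 fixes u :: "real ^ 'n => complex"
 assumes T: "0 < T" and w: "!!k. wper k T u (g k)"
 shows "lpn 2 (tor T) (%x. u x - (LINT y|tor T. u y) /\<^sub>R T ^ CARD('n)) <= T * (\<Sum>k\<in>UNIV. lpn 2 (tor T) (g k))"
proof -
 have D: "u \<in> bmeas borel" "lper T u" using wperD[OF w[of undefined]] by auto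
 have "avg T u x = (LINT y|tor T. u y) /\<^sub>R T ^ CARD('n)" for x
  using tor_translation(1)[OF T D, of x] by (simp add: avg_def add.commute)
 then show ?thesis using avg_error[OF T order_refl w] by (subst lpn_minus) simp
qed

text \<open>
Write \<open>u\<close> as the average at scale \<open>s\<close> plus the differences \<open>d m\<close> of the averages at the scales \<open>\<sigma> m = s / 16\<^sup>m\<close>. Each difference is small in \<open>L\<^sup>2\<close>, of order \<open>\<sigma> m\<close>, by \<open>avg_error\<close>.
Since averages commute, it is also an average of an \<open>L\<^sup>2\<close>-small function and hence of order \<open>\<sigma> m\<^sup>-\<^sup>1\<^sup>/\<^sup>2\<close> in the supremum norm when \<open>N \<le> 3\<close>. Interpolation bounds its
\<open>L\<^sup>4\<close> norm by a multiple of \<open>(\<sigma> m)\<^sup>1\<^sup>/\<^sup>4\<close>, which is summable, and Fatou's lemma passes to the limit. The free parameter \<open>s\<close> puts an arbitrarily small factor before the gradient.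
\<close>

lemma L4_estimate:
 fixes u :: "real ^ 'n => complex"
 assumes N: "CARD('n) <= 3" and s: "0 < s" "s <= T" "s <= 1" and w: "!!k. wper k T u (g k)"
 defines "\<Gamma> \<equiv> (\<Sum>k\<in>UNIV. lpn 2 (tor T) (g k))"
 shows "Lp 4 (tor T) u"
  and "lpn 4 (tor T) u <= (lpn 2 (tor T) u / sqrt (s ^ CARD('n))) * root 4 (T ^ CARD('n)) + 2 * root 4 (16900 * s) * \<Gamma>"
proof -
 have T0: "T > 0" using s by simp
 have \<Gamma>: "0 <= \<Gamma>" by (simp add: \<Gamma>_def sum_nonneg)
 have u: "u \<in> bmeas borel" and p: "lper T u" and L: "Lp 2 (tor T) u" using wperD[OF w[of undefined]] by auto
 define \<sigma> where "\<sigma> m = s / 16 ^ m" for m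
 have s0: "0 < \<sigma> m" "\<sigma> m <= s" for m using s by (auto simp: \<sigma>_def field_simps self_le_ge2_pow mult_le_cancel_left1)
 have sT: "\<sigma> m <= T" "\<sigma> m <= 1" for m using s0[of m] s by auto
 have sS: "\<sigma> (Suc m) = \<sigma> m / 16" for m by (simp add: \<sigma>_def)
 note aL = avg_Lp[OF s0(1) sT(1) u p L]
 have ab: "avg (\<sigma> m) u \<in> bmeas borel" "lper T (avg (\<sigma> m) u)" "Lp 2 (tor T) (avg (\<sigma> m) u)" for m
  using avg_borel[OF u] avg_lper[OF p] aL(1) by auto
 have e: "lpn 2 (tor T) (%x. avg (\<sigma> m) u x - u x) <= \<sigma> m * \<Gamma>" for m
  unfolding \<Gamma>_def by (rule avg_error[OF s0(1) sT(1) w])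
 have eL: "Lp 2 (tor T) (%x. avg (\<sigma> m) u x - u x)" "(%x. avg (\<sigma> m) u x - u x) \<in> bmeas borel" "lper T (%x. avg (\<sigma> m) u x - u x)" for m
  using ab[of m] u p L by (auto intro!: Lp_diff simp: lper_def)
 define d where "d m x = avg (\<sigma> (Suc m)) u x - avg (\<sigma> m) u x" for m x
 have dL: "Lp 2 (tor T) (d m)" for m unfolding d_def by (intro Lp_diff ab)
 have d2: "lpn 2 (tor T) (d m) <= 2 * \<sigma> m * \<Gamma>" for m
 proof -
  have "lpn 2 (tor T) (d m) = lpn 2 (tor T) (%x. (avg (\<sigma> (Suc m)) u x - u x) - (avg (\<sigma> m) u x - u x))" by (simp add: d_def[abs_def])
  also have "... <= lpn 2 (tor T) (%x. avg (\<sigma> (Suc m)) u x - u x) + lpn 2 (tor T) (%x. avg (\<sigma> m) u x - u x)"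
   by (rule lpn_triangle_diff) (use eL in auto)
  also have "... <= \<sigma> (Suc m) * \<Gamma> + \<sigma> m * \<Gamma>" by (intro add_mono e)
  also have "... <= 2 * \<sigma> m * \<Gamma>" using \<Gamma> s0[of m] by (simp add: sS)
  finally show ?thesis .
 qed
 have root_le: "1 / sqrt (\<sigma> m ^ CARD('n)) <= 1 / sqrt (\<sigma> m ^ 3)" for m
  using s0(1)[of m] sT(2)[of m] N by (intro divide_left_mono mult_pos_pos) (auto intro!: power_decreasing)
 \<comment> \<open>The ratio \<open>16\<close> of consecutive scales makes this factor an integer, \<open>sqrt (16\<^sup>3) = 64\<close>.\<close>
 have root_Suc: "1 / sqrt (\<sigma> (Suc m) ^ 3) = 64 * (1 / sqrt (\<sigma> m ^ 3))" for m
 proof -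
  have "sqrt (\<sigma> (Suc m) ^ 3) = sqrt (\<sigma> m ^ 3) / sqrt (64^2)" unfolding real_sqrt_divide[symmetric] by (simp add: sS power_divide)
  then show ?thesis by (simp only:) simp
 qed
 have dsup: "cmod (d m x) <= 65 * \<sigma> m * \<Gamma> * (1 / sqrt (\<sigma> m ^ 3))" for m x
 proof -
  have "d m x = (avg (\<sigma> (Suc m)) u x - avg (\<sigma> (Suc m)) (avg (\<sigma> m) u) x) + (avg (\<sigma> m) (avg (\<sigma> (Suc m)) u) x - avg (\<sigma> m) u x)"
   using avg_commute[OF s0(1) sT(1) s0(1) sT(1) u p L, of "Suc m" m x] by (simp add: d_def)
  also have "... = - avg (\<sigma> (Suc m)) (%x. avg (\<sigma> m) u x - u x) x + avg (\<sigma> m) (%x. avg (\<sigma> (Suc m)) u x - u x) x"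
   using avg_diff[OF s0(1) sT(1) ab u p L, of "Suc m" m x] avg_diff[OF s0(1) sT(1) ab u p L, of m "Suc m" x] by simp
  finally have "cmod (d m x) <= cmod (avg (\<sigma> (Suc m)) (%x. avg (\<sigma> m) u x - u x) x) + cmod (avg (\<sigma> m) (%x. avg (\<sigma> (Suc m)) u x - u x) x)"
   using norm_triangle_ineq[of "- avg (\<sigma> (Suc m)) (%x. avg (\<sigma> m) u x - u x) x"] by simp
  also have "... <= (\<sigma> m * \<Gamma>) * (1 / sqrt (\<sigma> (Suc m) ^ CARD('n))) + (\<sigma> (Suc m) * \<Gamma>) * (1 / sqrt (\<sigma> m ^ CARD('n)))"
  proof (rule add_mono)
   have "cmod (avg (\<sigma> (Suc m)) (%x. avg (\<sigma> m) u x - u x) x) <= lpn 2 (tor T) (%x. avg (\<sigma> m) u x - u x) * (1 / sqrt (\<sigma> (Suc m) ^ CARD('n)))"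
    using avg_bound[OF s0(1) sT(1) eL(2,3,1), of "Suc m" m x] by simp
   also have "... <= (\<sigma> m * \<Gamma>) * (1 / sqrt (\<sigma> (Suc m) ^ CARD('n)))" using s0(1)[of "Suc m"] by (intro mult_right_mono e) simp
   finally show "cmod (avg (\<sigma> (Suc m)) (%x. avg (\<sigma> m) u x - u x) x) <= (\<sigma> m * \<Gamma>) * (1 / sqrt (\<sigma> (Suc m) ^ CARD('n)))" .
   have "cmod (avg (\<sigma> m) (%x. avg (\<sigma> (Suc m)) u x - u x) x) <= lpn 2 (tor T) (%x. avg (\<sigma> (Suc m)) u x - u x) * (1 / sqrt (\<sigma> m ^ CARD('n)))"
    using avg_bound[OF s0(1) sT(1) eL(2,3,1), of m "Suc m" x] by simp
   also have "... <= (\<sigma> (Suc m) * \<Gamma>) * (1 / sqrt (\<sigma> m ^ CARD('n)))" using s0(1)[of m] by (intro mult_right_mono e) simp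
   finally show "cmod (avg (\<sigma> m) (%x. avg (\<sigma> (Suc m)) u x - u x) x) <= (\<sigma> (Suc m) * \<Gamma>) * (1 / sqrt (\<sigma> m ^ CARD('n)))" .
  qed
  also have "... <= (\<sigma> m * \<Gamma>) * (64 * (1 / sqrt (\<sigma> m ^ 3))) + (\<sigma> m * \<Gamma>) * (1 / sqrt (\<sigma> m ^ 3))"
   unfolding root_Suc[symmetric] using s0(1) \<Gamma> by (intro add_mono mult_mono root_le mult_right_mono) (auto simp: sS less_imp_le)
  finally show ?thesis by (simp add: algebra_simps)
 qed
 have B0: "0 <= 65 * \<sigma> m * \<Gamma> * (1 / sqrt (\<sigma> m ^ 3))" for m using s0(1)[of m] \<Gamma> by simp
 \<comment> \<open>\<open>16900 = (65 * 2)\<^sup>2\<close>: the constants of the supremum bound \<open>dsup\<close> and of the \<open>L\<^sup>2\<close> bound \<open>d2\<close>, both squared.\<close>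
 define \<kappa> where "\<kappa> = root 4 (16900 * s)"
 have \<kappa>4: "\<kappa> ^ 4 = 16900 * s" and \<kappa>0: "0 <= \<kappa>" using s by (simp_all add: \<kappa>_def)
 have dL4: "Lp 4 (tor T) (d m)" for m by (rule L4_interpolation(1)[OF dL dsup B0])
 have d4: "lpn 4 (tor T) (d m) <= \<kappa> * (1/2) ^ m * \<Gamma>" for m
 proof -
  have "lpn 4 (tor T) (d m) ^ 4 <= (65 * \<sigma> m * \<Gamma> * (1 / sqrt (\<sigma> m ^ 3)))^2 * (lpn 2 (tor T) (d m))^2"
   by (rule L4_interpolation(2)[OF dL dsup B0])
  also have "... <= (65 * \<sigma> m * \<Gamma> * (1 / sqrt (\<sigma> m ^ 3)))^2 * (2 * \<sigma> m * \<Gamma>)^2"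
   by (intro mult_left_mono power_mono d2) auto
  also have "... = 16900 * \<sigma> m * \<Gamma> ^ 4"
   using s0(1)[of m] by (simp add: power_mult_distrib power_divide field_simps power2_eq_square power3_eq_cube power4_eq_xxxx)
  also have "... = (\<kappa> * (1/2) ^ m * \<Gamma>) ^ 4"
   unfolding power_mult_distrib \<kappa>4 by (simp add: \<sigma>_def power_divide power_mult[symmetric] mult.commute[of m] power_mult[of 2 4 m])
  finally show ?thesis by (rule power_le_imp_le_base[of _ 3, simplified]) (use \<kappa>0 \<Gamma> in "auto")
 qed
 have tele: "lpn 4 (tor T) (avg (\<sigma> m) u) <= lpn 4 (tor T) (avg (\<sigma> 0) u) + 2 * \<kappa> * \<Gamma> * (1 - (1/2) ^ m)" for m
 proof (induction m)
  case (Suc m)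
  have "lpn 4 (tor T) (avg (\<sigma> (Suc m)) u) = lpn 4 (tor T) (%x. avg (\<sigma> m) u x + d m x)" by (simp add: d_def)
  also have "... <= lpn 4 (tor T) (avg (\<sigma> m) u) + lpn 4 (tor T) (d m)" by (rule lpn_triangle) (use aL(1) dL4 in auto)
  also have "... <= lpn 4 (tor T) (avg (\<sigma> 0) u) + 2 * \<kappa> * \<Gamma> * (1 - (1/2) ^ m) + \<kappa> * (1/2) ^ m * \<Gamma>" by (intro add_mono Suc d4)
  finally show ?case by (simp add: algebra_simps)
 qed simp
 have tele': "lpn 4 (tor T) (avg (\<sigma> m) u) <= lpn 4 (tor T) (avg (\<sigma> 0) u) + 2 * \<kappa> * \<Gamma>" for m
 proof -
  have "2 * \<kappa> * \<Gamma> * (1 - (1/2) ^ m) <= 2 * \<kappa> * \<Gamma> * 1" using \<kappa>0 \<Gamma> by (intro mult_left_mono) auto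
  with tele[of m] show ?thesis by simp
 qed
 have "AE x in tor T. summable (%m. norm (avg (\<sigma> m) u x - u x))"
 proof (rule summable_L2_imp_AE[OF eL(1), where C = "s * \<Gamma>"])
  show "lpn 2 (tor T) (%x. avg (\<sigma> m) u x - u x) <= s * \<Gamma> * (1/2) ^ m" for m
  proof (rule order_trans[OF e])
   have "(1/16::real) ^ m <= (1/2) ^ m" by (intro power_mono) auto
   then have "s * \<Gamma> * (1/16) ^ m <= s * \<Gamma> * (1/2) ^ m" using s \<Gamma> by (intro mult_left_mono) auto
   then show "\<sigma> m * \<Gamma> <= s * \<Gamma> * (1/2) ^ m" by (simp add: \<sigma>_def power_divide)
  qed
 qed (use s \<Gamma> in simp)
 then have lim: "AE x in tor T. (%m. avg (\<sigma> m) u x) ---> u x"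
 proof eventually_elim
  case (elim x)
  then have "(%m. avg (\<sigma> m) u x - u x) ---> 0" using summable_LIMSEQ_zero tendsto_norm_zero_iff by blast
  then show ?case by (rule LIM_zero_cancel)
 qed
 have a0: "lpn 4 (tor T) (avg (\<sigma> 0) u) <= (lpn 2 (tor T) u / sqrt (s ^ CARD('n))) * root 4 (T ^ CARD('n))"
  using aL(2)[of 4 0] by (simp add: \<sigma>_def)
 have BB: "0 <= lpn 4 (tor T) (avg (\<sigma> 0) u) + 2 * \<kappa> * \<Gamma>" using \<kappa>0 \<Gamma> by simp
 note F = lpn_Fatou[of 4 "tor T" "%m. avg (\<sigma> m) u" u 0, OF _ aL(1) borel_tor[OF u] lim tele' BB]
 show "Lp 4 (tor T) u" using F(1) by simp
 show "lpn 4 (tor T) u <= (lpn 2 (tor T) u / sqrt (s ^ CARD('n))) * root 4 (T ^ CARD('n)) + 2 * root 4 (16900 * s) * \<Gamma>"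
  using F(2) a0 by (simp add: \<kappa>_def)
qed

lemma diagonal_convergent_subsequence:
 fixes f :: "nat => nat => complex"
 assumes "!!i. bounded (range (%n. f n i))"
 shows "EX r. strict_mono r \<and> (ALL i. convergent (%n. f (r n) i))"
proof -
 interpret subseqs "%i s. convergent (%n. f (s n) i)"
 proof
  fix i and s :: "nat => nat"
  have "bounded (range (%n. f (s n) i))" using assms[of i] by (rule bounded_subset) auto
  then obtain l r where "strict_mono r" "((%n. f (s n) i) \<circ> r) ---> l"
   using bounded_imp_convergent_subsequence[of "%n. f (s n) i"] by auto
  then show "EX r'. strict_mono r' \<and> convergent (%n. f ((s \<circ> r') n) i)" by (auto simp: convergent_def o_def)
 qed
 have "convergent (%n. f (diagseq n) i)" for i
 proof -
  have "convergent (%n. f ((diagseq \<circ> ((+) (Suc i))) n) i)"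
  proof (rule diagseq_holds)
   fix r s :: "nat => nat" and n assume "strict_mono r" "convergent (%m. f (s m) n)"
   then show "convergent (%m. f ((s \<circ> r) m) n)"
    using convergent_subseq_convergent[of "%m. f (s m) n" r] by (simp add: o_def)
  qed
  then have "convergent (%n. f (diagseq (n + Suc i)) i)" by (simp add: o_def add.commute)
  then show ?thesis by (rule iffD1[OF convergent_ignore_initial_segment[of "%n. f (diagseq n) i" "Suc i"]])
 qed
 with subseq_diagseq show ?thesis by blast
qed

text \<open>
At a fixed scale the averages of the sequence are uniformly bounded and uniformly Lipschitz; a diagonal sequence converges at the points of a countable dense set for all
scales \<open>T / m\<close> simultaneously, hence uniformly. The averages approximate the sequence uniformly in \<open>L\<^sup>2\<close> by \<open>avg_error\<close>.
\<close>

lemma rellich: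
 fixes u :: "nat => real ^ 'n => complex"
 assumes T: "0 < T" and w: "!!n k. wper k T (u n) (g n k)"
  and R: "!!n. lpn 2 (tor T) (u n) <= R" "!!n. (\<Sum>k\<in>UNIV. lpn 2 (tor T) (g n k)) <= R"
 shows "EX r :: nat => nat. strict_mono r \<and> (ALL e>0. EX N. ALL m>=N. ALL n>=N. lpn 2 (tor T) (%x. u (r m) x - u (r n) x) < e)"
proof -
 have D: "u n \<in> bmeas borel" "lper T (u n)" "Lp 2 (tor T) (u n)" for n using wperD[OF w[of undefined n]] by auto
 have R0: "0 <= R" using order_trans[OF lpn_nonneg R(1)[of 0]] by simp
 obtain Q :: "(real ^ 'n) set" where Q: "countable Q" "!!X. open X ==> X ~= {} ==> EX d:Q. d \<in> X"
  using countable_dense_exists by blast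
 have "EX d:Q. d \<in> UNIV" by (rule Q(2)) auto
 then have Qne: "Q ~= {}" by auto
 define q where "q = from_nat_into Q"
 have q: "range q = Q" unfolding q_def by (rule range_from_nat_into[OF Qne Q(1)])
 define s where "s m = T / real (Suc m)" for m
 have s: "0 < s m" "s m <= T" for m using T by (auto simp: s_def field_simps)
 define f where "f n i = (case prod_decode i of (m, l) => avg (s m) (u n) (q l))" for n i
 have bdf: "bounded (range (%n. f n i))" for i
 proof -
  obtain m l where ml: "prod_decode i = (m, l)" by force
  have "cmod (f n i) <= R / sqrt (s m ^ CARD('n))" for n
   unfolding f_def ml prod.case
   by (rule order_trans[OF avg_bound[OF s D]]) (use R(1)[of n] s(1)[of m] in "auto intro: divide_right_mono")
  then show ?thesis by (auto simp: bounded_iff)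
 qed
 from diagonal_convergent_subsequence[of f, OF bdf]
 obtain r where r: "strict_mono r" "!!i. convergent (%n. f (r n) i)" by blast
 have conv: "convergent (%n. avg (s m) (u (r n)) (q l))" for m l
  using r(2)[of "prod_encode (m, l)"] by (simp add: f_def)
 have lip: "cmod (avg (s m) (u n) x - avg (s m) (u n) y) <= norm (x - y) * R / sqrt (s m ^ CARD('n))" for m n x y
 proof -
  define v where "v z = u n (z + (x - y)) - u n z" for z
  have v: "v \<in> bmeas borel" "lper T v" "Lp 2 (tor T) v"
   using D(1)[of n] L2_shift_diff[OF T D[of n], of "x - y" 0] lper_shift[OF D(2)[of n], of "x - y"] D(2)[of n]
   by (auto simp: v_def[abs_def] lper_def)
  have "(%z. u n (z + (x - y))) \<in> bmeas borel" "lper T (%z. u n (z + (x - y)))" "Lp 2 (tor T) (%z. u n (z + (x - y)))"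
   using D(1)[of n] lper_shift[OF D(2)] Lp_tor_translation(1)[OF T D(1,2)] D(3) by (auto simp del: add_diff_eq)
  from avg_diff[OF s this D, of m n y] have "avg (s m) v y = avg (s m) (%z. u n (z + (x - y))) y - avg (s m) (u n) y"
   by (simp add: v_def[abs_def])
  also have "avg (s m) (%z. u n (z + (x - y))) y = avg (s m) (u n) x" by (simp add: avg_def algebra_simps)
  finally have "cmod (avg (s m) (u n) x - avg (s m) (u n) y) <= lpn 2 (tor T) v / sqrt (s m ^ CARD('n))"
   using avg_bound[OF s v, of m y] by simp
  also have "lpn 2 (tor T) v <= norm (x - y) * R"
  proof -
   have "lpn 2 (tor T) v <= (\<Sum>k\<in>UNIV. \<bar>(x - y) $ k\<bar> * lpn 2 (tor T) (g n k))" unfolding v_def by (rule translation_estimate[OF T w])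
   also have "... <= (\<Sum>k\<in>UNIV. norm (x - y) * lpn 2 (tor T) (g n k))" by (intro sum_mono mult_right_mono component_le_norm_cart) simp
   also have "... = norm (x - y) * (\<Sum>k\<in>UNIV. lpn 2 (tor T) (g n k))" by (simp add: sum_distrib_left)
   also have "... <= norm (x - y) * R" by (intro mult_left_mono R) simp
   finally show ?thesis .
  qed
  finally show ?thesis using s(1)[of m] by (simp add: divide_right_mono)
 qed
 have cauchy: "EX N. ALL m>=N. ALL n>=N. lpn 2 (tor T) (%x. u (r m) x - u (r n) x) < e" if e: "e > 0" for e
 proof -
  obtain m where m: "4 * T * R / e < real m" using reals_Archimedean2 by blast
  have sm: "s m * R < e / 4"
  proof -
   have "4 * T * R / e < real (Suc m)" using m by simp
   then show ?thesis using e by (simp add: s_def field_simps)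
  qed
  define V where "V = sqrt (T ^ CARD('n)) + 1"
  have V: "V > 0" using T by (simp add: V_def add_nonneg_pos)
  define W where "W = sqrt (s m ^ CARD('n))"
  have W: "W > 0" using s(1)[of m] by (simp add: W_def)
  define \<eta> where "\<eta> = e / (12 * V)"
  have \<eta>: "\<eta> > 0" using e V by (simp add: \<eta>_def)
  define \<delta> where "\<delta> = \<eta> * W / (R + 1)"
  have \<delta>: "\<delta> > 0" using \<eta> W R0 by (simp add: \<delta>_def)
  have "compact (cell T :: (real ^ 'n) set)" by (simp add: cell_eq_cbox)
  moreover have "cell T \<subseteq> (\<Union>l. ball (q l) \<delta>)"
  proof
   fix x :: "real ^ 'n"
   obtain d where "d \<in> Q" "d \<in> ball x \<delta>" using Q(2)[of "ball x \<delta>"] \<delta> by auto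
   then obtain l where "q l \<in> ball x \<delta>" using q by auto
   then show "x \<in> (\<Union>l. ball (q l) \<delta>)" by (auto simp: dist_commute)
  qed
  ultimately obtain C where C: "finite C" "cell T \<subseteq> (\<Union>l\<in>C. ball (q l) \<delta>)"
   using compactE_image[of "cell T" UNIV "%l. ball (q l) \<delta>"] by auto
  have "EX N. ALL a>=N. ALL b>=N. cmod (avg (s m) (u (r a)) (q l) - avg (s m) (u (r b)) (q l)) < \<eta>" for l
   using CauchyD[OF convergent_Cauchy[OF conv[of m l]] \<eta>] .
  then obtain Nl where Nl: "!!l a b. a >= Nl l ==> b >= Nl l ==> cmod (avg (s m) (u (r a)) (q l) - avg (s m) (u (r b)) (q l)) < \<eta>" by metis
  define N where "N = Max (insert 0 (Nl ` C))"
  have N: "Nl l <= N" if "l \<in> C" for l using that C(1) by (auto simp: N_def)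
  have "lpn 2 (tor T) (%x. u (r a) x - u (r b) x) < e" if ab: "a >= N" "b >= N" for a b
  proof -
   define A where "A c x = avg (s m) (u (r c)) x" for c x
   have AL: "Lp 2 (tor T) (A c)" "A c \<in> bmeas borel" for c unfolding A_def using avg_Lp(1)[OF s D, of 2] avg_borel[OF D(1)] by auto
   have Aerr: "lpn 2 (tor T) (%x. A c x - u (r c) x) <= s m * R" for c
    unfolding A_def by (rule order_trans[OF avg_error[OF s w]]) (use R(2) s(1)[of m] in "auto intro: mult_left_mono")
   have small: "cmod (A a x - A b x) <= 3 * \<eta>" if "x \<in> hcell T" for x
   proof -
    have "x \<in> cell T" using that hcell_subset_cell by blast
    then obtain l where l: "l \<in> C" "x \<in> ball (q l) \<delta>" using C(2) by blast
    have "norm (x - q l) * R <= \<delta> * (R + 1)" using l(2) R0 \<delta> by (intro mult_mono) (auto simp: dist_norm norm_minus_commute less_imp_le)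
    also have "... = \<eta> * W" using R0 by (simp add: \<delta>_def)
    finally have "norm (x - q l) * R / W <= \<eta>" using W by (simp add: field_simps)
    then have le: "cmod (A c x - A c (q l)) <= \<eta>" for c unfolding A_def using lip[of m "r c" x "q l"] by (simp add: W_def)
    have "A a x - A b x = (A a x - A a (q l)) + ((A a (q l) - A b (q l)) - (A b x - A b (q l)))" by simp
    also have "cmod \<dots> <= \<eta> + (\<eta> + \<eta>)"
    proof (rule norm_triangle_le[OF add_mono[OF le[of a] order_trans[OF norm_triangle_ineq4 add_mono[OF _ le[of b]]]]])
     show "cmod (A a (q l) - A b (q l)) <= \<eta>"
      using Nl[of l a b] N[OF l(1)] ab by (auto simp: A_def)
    qed
    finally show ?thesis by simp
   qed
   have "lpn 2 (tor T) (%x. A a x - A b x) <= 3 * \<eta> * root 2 (measure (tor T :: (real ^ 'n) measure) (space (tor T)))"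
    by (rule lpn_bounded(2)[OF finite_measure_tor]) (use small \<eta> AL(2) in "auto intro!: borel_tor borel_measurable_diff")
   also have "... = 3 * \<eta> * sqrt (T ^ CARD('n))" using T measure_tor[of T, where 'n = 'n] by (simp add: sqrt_def)
   also have "... <= 3 * \<eta> * V" using \<eta> by (intro mult_left_mono) (auto simp: V_def)
   also have "... = e / 4" using V by (simp add: \<eta>_def)
   finally have 1: "lpn 2 (tor T) (%x. A a x - A b x) <= e / 4" .
   have "lpn 2 (tor T) (%x. u (r a) x - u (r b) x) = lpn 2 (tor T) (%x. ((A a x - A b x) - (A a x - u (r a) x)) + (A b x - u (r b) x))" by simp
   also have "... <= (lpn 2 (tor T) (%x. A a x - A b x) + lpn 2 (tor T) (%x. A a x - u (r a) x)) + lpn 2 (tor T) (%x. A b x - u (r b) x)"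
    by (rule order_trans[OF lpn_triangle add_right_mono[OF lpn_triangle_diff]]) (use AL D in "auto intro!: Lp_diff")
   also have "... < (e / 4 + e / 4) + e / 4" using 1 Aerr[of a] Aerr[of b] sm by simp
   finally show ?thesis using e by simp
  qed
  then show ?thesis by blast
 qed
 show ?thesis by (rule exI[of _ r], rule conjI[OF r(1)], intro allI impI, erule cauchy)
qed

section \<open>Periodization\<close>

text \<open>
A sum over the nonzero terms only: for \<open>f\<close> with bounded support these are finitely many, and every target monoid is allowed.
\<close>

definition per :: "real => (real ^ 'n => 'b) => real ^ 'n => 'b :: comm_monoid_add" where
 "per T f x = (\<Sum>m | f (x + lat T m) ~= 0. f (x + lat T m))"

lemma finite_lattice_hits:
 fixes A B :: "(real ^ 'n) set"
 assumes T: "T > 0" and A: "bounded A" and B: "bounded B"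
 shows "finite {m. EX x:A. x + lat T m \<in> B}"
proof -
 obtain a b where a: "ALL x:A. norm x <= a" and b: "ALL x:B. norm x <= b" using A B by (auto simp: bounded_iff)
 let ?Z = "{- \<lceil>(a + b) / T\<rceil>..\<lceil>(a + b) / T\<rceil>}"
 have "{m. EX x:A. x + lat T m \<in> B} \<subseteq> vec_lambda ` (PiE UNIV (%_. ?Z))"
 proof
  fix m :: "int ^ 'n" assume "m \<in> {m. EX x:A. x + lat T m \<in> B}"
  then obtain x where x: "x \<in> A" "x + lat T m \<in> B" by (elim CollectE bexE)
  have "m $ i \<in> ?Z" for i
  proof -
   have "norm (lat T m) <= norm (x + lat T m) + norm x" using norm_triangle_ineq4[of "x + lat T m" x] by simp
   also have "... <= b + a" using x a b by (intro add_mono) auto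
   finally have "\<bar>lat T m $ i\<bar> <= a + b" using component_le_norm_cart[of "lat T m" i] by linarith
   then have "T * \<bar>of_int (m $ i)\<bar> <= a + b" using T by (simp add: abs_mult)
   then have "\<bar>of_int (m $ i)\<bar> <= (a + b) / T" using T by (simp add: field_simps)
   then have "real_of_int \<bar>m $ i\<bar> <= real_of_int \<lceil>(a + b) / T\<rceil>" using le_of_int_ceiling[of "(a + b) / T"] by linarith
   then have "\<bar>m $ i\<bar> <= \<lceil>(a + b) / T\<rceil>" by (simp only: of_int_le_iff)
   then show ?thesis by auto
  qed
  then have "vec_nth m \<in> PiE UNIV (%_. ?Z)" by (simp add: PiE_def Pi_def)
  then show "m \<in> vec_lambda ` (PiE UNIV (%_. ?Z))" by (intro image_eqI[of _ _ "vec_nth m"]) (simp_all add: vec_nth_inverse)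
 qed
 moreover have "finite (PiE (UNIV :: 'n set) (%_. ?Z))" by (intro finite_PiE) auto
 ultimately show ?thesis by (meson finite_imageI finite_subset)
qed

lemma per_eq_sum:
 assumes M: "finite M" and "!!m. m \<notin> M ==> f (x + lat T m) = 0"
 shows "per T f x = (\<Sum>m\<in>M. f (x + lat T m))"
 unfolding per_def by (rule sum.mono_neutral_left) (use assms in auto)

lemma per_lper: "lper T (per T f)"
 unfolding lper_def
proof (intro allI)
 fix m x
 show "per T f (x + lat T m) = per T f x"
  unfolding per_def
  by (rule sum.reindex_bij_witness[of _ "%k. k - m" "%k. k + m"]) (auto simp: lat_add[symmetric] algebra_simps add.assoc)
qed

lemma per_linear:
 fixes f g :: "real ^ 'n => 'b :: comm_monoid_add"
 assumes "h 0 = 0" "!!a b. h (a + b) = h a + h b" and "finite M" "!!m. m \<notin> M ==> f (x + lat T m) = 0"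
 shows "per T (%y. h (f y)) x = h (per T f x)"
proof -
 have "h (sum g A) = (\<Sum>m\<in>A. h (g m))" if "finite A" for g and A :: "(int ^ 'n) set"
  using that by (induction A rule: finite_induct) (simp_all add: assms)
 then show ?thesis using assms by (subst (1 2) per_eq_sum[of M]) auto
qed

context
 fixes T :: real and K :: "(real ^ 'n) set"
 assumes T: "T > 0" and K: "bounded K"
begin

lemma per_on_bounded:
 assumes A: "bounded A"
 shows "EX M. finite M \<and> (ALL x:A. ALL m. m \<notin> M --> x + lat T m \<notin> K)"
 using finite_lattice_hits[OF T A K] by (intro exI[of _ "{m. EX x:A. x + lat T m \<in> K}"]) auto

lemma per_finite: "EX M. finite M \<and> (ALL m. m \<notin> M --> x + lat T m \<notin> K)"
 using per_on_bounded[of "{x}"] by auto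

lemma per_compose_red:
 fixes f :: "real ^ 'n => 'b :: comm_monoid_add"
 assumes f: "!!x. x \<notin> K ==> f x = 0"
 shows "EX M. finite M \<and> (ALL x. per T f x = (\<Sum>m\<in>M. f (red T x + lat T m)))"
proof -
 have "bounded (hcell T :: (real ^ 'n) set)" by (rule bounded_subset[OF _ hcell_subset_cell]) (simp add: cell_eq_cbox)
 from per_on_bounded[OF this] obtain M where M: "finite M" "ALL x:hcell T. ALL m. m \<notin> M --> x + lat T m \<notin> K" by (elim exE conjE)
 have "per T f x = (\<Sum>m\<in>M. f (red T x + lat T m))" for x
 proof -
  have "per T f x = per T f (red T x)" using lper_red[OF per_lper, of T f x] by simp
  also have "... = (\<Sum>m\<in>M. f (red T x + lat T m))" using M red_mem[OF T] f by (intro per_eq_sum) auto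
  finally show ?thesis .
 qed
 then show ?thesis using M(1) by blast
qed

lemma per_borel:
 fixes f :: "real ^ 'n => 'b :: {real_normed_vector, second_countable_topology}"
 assumes f: "!!x. x \<notin> K ==> f x = 0" and [measurable]: "f \<in> bmeas borel"
 shows "per T f \<in> bmeas borel"
proof -
 obtain M where M: "finite M" "ALL x. per T f x = (\<Sum>m\<in>M. f (red T x + lat T m))" using per_compose_red[of f] f by blast
 have "(%x. \<Sum>m\<in>M. f (red T x + lat T m)) \<in> bmeas borel" by measurable
 then show ?thesis using M(2) by (simp add: fun_eq_iff cong: measurable_cong)
qed

lemma per_bounded:
 fixes f :: "real ^ 'n => 'b :: real_normed_vector"
 assumes f: "!!x. x \<notin> K ==> f x = 0" and B: "!!x. norm (f x) <= B"
 shows "EX C. ALL x. norm (per T f x) <= C"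
proof -
 obtain M where M: "finite M" "ALL x. per T f x = (\<Sum>m\<in>M. f (red T x + lat T m))" using per_compose_red[of f] f by blast
 have "norm (per T f x) <= (\<Sum>m\<in>M. B)" for x
  unfolding M(2)[rule_format] by (rule order_trans[OF norm_sum sum_mono]) (rule B)
 then show ?thesis by blast
qed

text \<open>
Pairing a periodic function with a compactly supported one over the space is pairing it with the periodization over one cell. This translates between distributions on the whole space
and integrals over the cell.
\<close>

lemma per_unfold:
 fixes \<phi> :: "real ^ 'n => real" and g :: "real ^ 'n => 'b :: euclidean_space"
 assumes i: "integrable leb (%x. \<phi> x *R g x)" and \<phi>: "!!x. x \<notin> K ==> \<phi> x = 0"
  and per: "!!m. AE x in leb. g (x + lat T m) = g x"
 shows "(LINT x|leb. \<phi> x *R g x) = (LINT x|cm T. per T \<phi> x *R g x)" "integrable (cm T) (%x. per T \<phi> x *R g x)"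
proof -
 let ?F = "%x. \<phi> x *R g x"
 let ?I = "%x. ind (hcell T) x"
 have hb: "bounded (hcell T :: (real ^ 'n) set)" by (rule bounded_subset[OF _ hcell_subset_cell]) (simp add: cell_eq_cbox)
 obtain M where M: "finite M" "ALL x:hcell T. ALL m. m \<notin> M --> x + lat T m \<notin> K" using per_on_bounded[OF hb] by (elim exE conjE)
 have hs: "hcell T \<in> sets leb" using hcell_borel by (simp add: sets_completionI_sets)
 have iI: "integrable leb (%x. ?I (x + lat T (- m)) *R ?F x)" for m
 proof (rule Bochner_Integration.integrable_bound[OF i])
  have "(%x. ?I (x + lat T (- m))) \<in> bmeas leb"
   by (rule lebesgue_integral_translation(3)) (use hs in measurable)
  then show "(%x. ?I (x + lat T (- m)) *R ?F x) \<in> bmeas leb" using borel_measurable_integrable[OF i] by measurable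
 qed (auto simp: indicator_def)
 have one: "(\<Sum>m\<in>M. ?I (x + lat T (- m)) *R ?F x) = ?F x" for x
 proof (cases "x \<in> K")
  case True
  have x: "x = red T x + lat T (flo T x)" by (simp add: red_def)
  have fM: "flo T x \<in> M" using M(2) red_mem[OF T, of x] True x by metis
  have "(\<Sum>m\<in>M. ?I (x + lat T (- m)) *R ?F x) = (\<Sum>m\<in>M. if m = flo T x then ?F x else 0)"
   by (intro sum.cong refl) (auto simp: indicator_def add_lat_mem_hcell_iff[OF T])
  also have "... = ?F x" using fM M(1) by simp
  finally show ?thesis .
 qed (simp add: \<phi>)
 have tr: "integrable leb (%x. ?I x *R ?F (x + lat T m))" "(LINT x|leb. ?I x *R ?F (x + lat T m)) = (LINT x|leb. ?I (x + lat T (- m)) *R ?F x)" for m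
  using lebesgue_integral_translation(2)[OF borel_measurable_integrable[OF iI[of m]] iI[of m], of "lat T m"]
   lebesgue_integral_translation(1)[OF borel_measurable_integrable[OF iI[of m]], of "lat T m"] by (simp_all add: lat_minus)
 have ae: "AE x in leb. (\<Sum>m\<in>M. ?I x *R ?F (x + lat T m)) = ind (cell T) x *R (per T \<phi> x *R g x)"
 proof -
  have "AE x in leb. ALL m:M. g (x + lat T m) = g x" using M(1) per by (intro AE_finite_allI) auto
  moreover have "AE x in leb. x \<in> cell T \<longleftrightarrow> x \<in> (hcell T :: (real ^ 'n) set)" using AE_cell_iff_hcell[of T] by (rule AE_completion)
  ultimately show ?thesis
  proof eventually_elim
   case (elim x)
   show ?case
   proof (cases "x \<in> hcell T")
    case True
    have "per T \<phi> x = (\<Sum>m\<in>M. \<phi> (x + lat T m))" using M True \<phi> by (intro per_eq_sum) auto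
    then show ?thesis using True elim by (simp add: scaleR_sum_left)
   next
    case False
    then show ?thesis using elim by (simp add: indicator_def)
   qed
  qed
 qed
 have iS: "integrable leb (%x. \<Sum>m\<in>M. ?I x *R ?F (x + lat T m))" by (intro Bochner_Integration.integrable_sum tr)
 have m1: "(%x. \<Sum>m\<in>M. ?I x *R ?F (x + lat T m)) \<in> bmeas leb" using iS by (rule borel_measurable_integrable)
 have m2: "(%x. ind (cell T) x *R (per T \<phi> x *R g x)) \<in> bmeas leb" by (rule borel_measurable_AE[OF m1 ae])
 have "integrable leb (%x. ind (cell T) x *R (per T \<phi> x *R g x))" using iS by (simp only: integrable_cong_AE[OF m1 m2 ae])
 then show "integrable (cm T) (%x. per T \<phi> x *R g x)" by (subst integrable_restrict_space) (auto simp: cell_eq_cbox)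
 have "(LINT x|leb. ?F x) = (LINT x|leb. (\<Sum>m\<in>M. ?I (x + lat T (- m)) *R ?F x))" unfolding one ..
 also have "... = (\<Sum>m\<in>M. \<integral>x. ?I (x + lat T (- m)) *R ?F x \<partial>leb)" by (rule Bochner_Integration.integral_sum) (rule iI)
 also have "... = (LINT x|leb. (\<Sum>m\<in>M. ?I x *R ?F (x + lat T m)))"
  unfolding tr(2)[symmetric] by (rule Bochner_Integration.integral_sum[symmetric]) (rule tr)
 also have "... = (LINT x|leb. ind (cell T) x *R (per T \<phi> x *R g x))" by (rule integral_cong_AE[OF m1 m2 ae])
 also have "... = (LINT x|cm T. per T \<phi> x *R g x)" unfolding set_integral_cell[symmetric] set_lebesgue_integral_def ..
 finally show "(LINT x|leb. ?F x) = (LINT x|cm T. per T \<phi> x *R g x)" .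
qed

end

section \<open>The space of periodic Sobolev functions\<close>

lemma L2_loc_subset_L1_loc:
 fixes f :: "real ^ 'n => complex"
 assumes f: "f \<in> L2_loc"
 shows "f \<in> L1_loc"
 unfolding L1_loc_def
proof (intro CollectI allI impI)
 fix K :: "(real ^ 'n) set" assume K: "compact K"
 have fm: "f \<in> bmeas leb" and i2: "set_integrable leb K (%x. (cmod (f x))^2)"
  using f K by (auto simp: L2_loc_def)
 have i1: "set_integrable leb K (%_. 1 :: real)"
  by (rule set_integrable_compact_bound[OF K, of _ 1]) auto
 have "integrable leb (%x. ind K x *R 1 + ind K x *R (cmod (f x))^2)"
  using i1 i2 by (auto simp: set_integrable_def)
 then show "set_integrable leb K f" unfolding set_integrable_def
 proof (rule Bochner_Integration.integrable_bound)
  show "(%x. ind K x *R f x) \<in> bmeas leb"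
   by (intro borel_measurable_scaleR borel_measurable_indicator fm) (use K in "simp add: borel_compact sets_completionI_sets")
  show "AE x in leb. norm (ind K x *R f x) <= norm (ind K x *R 1 + ind K x *R (cmod (f x))^2)"
  proof (rule AE_I2)
   fix x
   have "0 <= (cmod (f x) - 1)^2 + 1 + (cmod (f x))^2" by simp
   then have "cmod (f x) <= 1 + (cmod (f x))^2" by (simp add: power2_eq_square algebra_simps)
   then show "norm (ind K x *R f x) <= norm (ind K x *R 1 + ind K x *R (cmod (f x))^2)"
    by (simp add: indicator_def)
  qed
 qed
qed

lemma L1_loc_translation:
 fixes f :: "real ^ 'n => complex"
 assumes "f \<in> L1_loc"
 shows "(%x. f (x + a)) \<in> L1_loc"
 unfolding L1_loc_def
proof (intro CollectI allI impI)
 fix K :: "(real ^ 'n) set" assume K: "compact K"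
 have c: "compact ((%x. a + x) ` K)" using K by (rule compact_translation)
 then have i: "integrable leb (%x. ind ((%x. a + x) ` K) x *R f x)"
  using assms by (simp add: L1_loc_def set_integrable_def)
 have "integrable leb (%x. ind ((%x. a + x) ` K) (x + a) *R f (x + a))"
  by (rule lebesgue_integral_translation(2)[OF borel_measurable_integrable[OF i] i])
 moreover have "ind ((%x. a + x) ` K) (x + a) = ind K x" for x
  by (auto simp: indicator_def image_iff add.commute)
 ultimately show "set_integrable leb K (%x. f (x + a))" by (simp add: set_integrable_def)
qed

lemma is_weak_partial_translation:
 assumes "is_weak_partial k f g"
 shows "is_weak_partial k (%x. f (x + a)) (%x. g (x + a))"
 unfolding is_weak_partial_def
proof (intro conjI allI impI)
 have L: "f \<in> L1_loc" "g \<in> L1_loc" using assms by (auto simp: is_weak_partial_def)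
 then show "(%x. f (x + a)) \<in> L1_loc" "(%x. g (x + a)) \<in> L1_loc" by (auto intro: L1_loc_translation)
 fix \<phi> :: "real ^ 'a => real" assume \<phi>: "test_function \<phi>"
 have tr: "test_function (%x. \<phi> (x - a))" "partial k (%x. \<phi> (x - a)) x = partial k \<phi> (x - a)" for x
  using test_function_translation[OF \<phi>, where a = "- a"] by simp_all
 have 1: "(LINT x|leb. \<phi> x *R g (x + a)) = (LINT x|leb. \<phi> (x - a) *R g x)"
  using lebesgue_integral_translation(1)[of "%x. \<phi> (x - a) *R g x" a] borel_measurable_integrable[OF test_integrable(1)[OF tr(1) L(2)]] by simp
 have 2: "(LINT x|leb. partial k \<phi> x *R f (x + a)) = (LINT x|leb. partial k \<phi> (x - a) *R f x)"
  using lebesgue_integral_translation(1)[of "%x. partial k \<phi> (x - a) *R f x" a] borel_measurable_integrable[OF test_integrable(2)[OF tr(1) L(1), of k]]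
  by (simp add: tr(2))
 show "(LINT x|leb. partial k \<phi> x *R f (x + a)) = - (LINT x|leb. \<phi> x *R g (x + a))"
  unfolding 1 2 tr(2)[symmetric] using assms tr(1) by (simp add: is_weak_partial_def)
qed

text \<open>
The translate of the derivative is a derivative of the translate, which is the function itself; uniqueness does the rest.
\<close>

lemma weak_partial_AE_periodic:
 assumes "lper T u" "is_weak_partial k u g"
 shows "AE x in leb. g (x + lat T m) = g x"
proof -
 have "is_weak_partial k u (%x. g (x + lat T m))"
  using is_weak_partial_translation[OF assms(2), of "lat T m"] assms(1) by (simp add: lper_def)
 then show ?thesis using assms(2) by (rule weak_partial_unique_AE)
qed

text \<open>
Everything later uses about a member of \<open>H\<^sup>1\<^sub>T\<close>, with \<open>L\<^sup>2\<close> conditions on one cell in place of local ones.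
\<close>

lemma H1_perD:
 fixes u :: "real ^ 'n => complex"
 assumes T: "T > 0" and u: "u \<in> H1_per T"
 shows "lper T u" "u \<in> bmeas leb" "is_weak_partial k u (wp k u)"
  "wp k u \<in> bmeas leb" "Lp 2 (cm T) u" "Lp 2 (cm T) (wp k u)"
  "AE x in leb. wp k u (x + lat T m) = wp k u x"
proof -
 show p: "lper T u" using u by (simp add: H1_per_def periodic_imp_lper)
 have L: "u \<in> L2_loc" using u by (simp add: H1_per_def H1_loc_def)
 then show um: "u \<in> bmeas leb" by (simp add: L2_loc_def)
 have "AE x in leb. u (x + lat T m) = u x" for m using p by (simp add: lper_def)
 with L2_loc_periodic_iff[OF T um] L show "Lp 2 (cm T) u" by simp
 obtain g where g: "g \<in> L2_loc" "is_weak_partial k u g" using u by (auto simp: H1_per_def H1_loc_def)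
 show w: "is_weak_partial k u (wp k u)" by (rule is_weak_partial_weak_partial[OF g(2)])
 then show wm: "wp k u \<in> bmeas leb" by (intro L1_loc_measurable) (simp add: is_weak_partial_def)
 show "AE x in leb. wp k u (x + lat T m) = wp k u x" by (rule weak_partial_AE_periodic[OF p w])
 have gm: "g \<in> bmeas leb" using g(1) by (simp add: L2_loc_def)
 have "Lp 2 (cm T) g" using L2_loc_periodic_iff[OF T gm weak_partial_AE_periodic[OF p g(2)]] g(1) by simp
 then show "Lp 2 (cm T) (wp k u)"
  using Lp_cong_AE[OF AE_cm[OF weak_partial_eq_AE[OF g(2)]] measurable_cm[OF gm] measurable_cm[OF wm]] by simp
qed

lemma H1_perI:
 fixes u :: "real ^ 'n => complex"
 assumes T: "T > 0" and p: "lper T u" and um: "u \<in> bmeas leb" and L: "Lp 2 (cm T) u"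
  and g: "!!k. is_weak_partial k u (g k)" "!!k. Lp 2 (cm T) (g k)"
 shows "u \<in> H1_per T"
proof -
 have "AE x in leb. u (x + lat T m) = u x" for m using p by (simp add: lper_def)
 then have "u \<in> L2_loc" using L2_loc_periodic_iff[OF T um] L by simp
 moreover have "g k \<in> L2_loc" for k
 proof -
  have gm: "g k \<in> bmeas leb" using g(1)[of k] by (intro L1_loc_measurable) (simp add: is_weak_partial_def)
  show ?thesis using L2_loc_periodic_iff[OF T gm weak_partial_AE_periodic[OF p g(1)]] g(2) by simp
 qed
 ultimately show ?thesis using g(1) lper_imp_periodic[OF p] by (auto simp: H1_per_def H1_loc_def)
qed

lemma H1_per_lin:
 fixes u v :: "real ^ 'n => complex"
 assumes T: "T > 0" and u: "u \<in> H1_per T" and v: "v \<in> H1_per T"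
 shows "(%x. a * u x + b * v x) \<in> H1_per T"
  and "AE x in leb. wp k (%x. a * u x + b * v x) x = a * wp k u x + b * wp k v x"
proof -
 note U = H1_perD[OF T u] and V = H1_perD[OF T v]
 have w: "is_weak_partial k (%x. a * u x + b * v x) (%x. a * wp k u x + b * wp k v x)" for k
  by (intro is_weak_partial_add is_weak_partial_mult U(3) V(3))
 then show "AE x in leb. wp k (%x. a * u x + b * v x) x = a * wp k u x + b * wp k v x"
  by (rule weak_partial_eq_AE)
 show "(%x. a * u x + b * v x) \<in> H1_per T"
 proof (rule H1_perI[OF T _ _ _ w])
  show "lper T (%x. a * u x + b * v x)" using U(1) V(1) by (simp add: lper_def)
  show "(%x. a * u x + b * v x) \<in> bmeas leb" using U(2) V(2) by measurable
  show "Lp 2 (cm T) (%x. a * u x + b * v x)" by (intro Lp_add Lp_mult U(5) V(5))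
  show "Lp 2 (cm T) (%x. a * wp k u x + b * wp k v x)" for k by (intro Lp_add Lp_mult U(6) V(6))
 qed
qed

lemma is_weak_partial_const: "is_weak_partial k (%x. c) (%x. 0)"
 using wper_const[of k 1 c] by (simp add: wper_def)

lemma weak_partial_const: "AE x in leb. wp k (%x. c) x = 0"
 by (rule weak_partial_eq_AE[OF is_weak_partial_const])

lemma H1_per_const:
 assumes T: "T > 0"
 shows "(%x :: real ^ 'n. c) \<in> H1_per T"
proof (rule H1_perI[OF T _ _ _ is_weak_partial_const])
 show "lper T (%x :: real ^ 'n. c)" by (simp add: lper_def)
 show "Lp 2 (cm T) (%x :: real ^ 'n. c)" by (rule lpn_bounded(1)[OF finite_measure_cm, of 2 _ _ "cmod c"]) auto
 show "Lp 2 (cm T) (%x :: real ^ 'n. 0 :: complex)" by (rule lpn_bounded(1)[OF finite_measure_cm, of 2 _ _ 0]) auto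
qed auto

lemma H1_per_subspace:
 assumes T: "T > 0"
 shows "subspace (H1_per T :: (real ^ 'n => complex) set)"
proof (rule subspaceI)
 show "(0 :: real ^ 'n => complex) \<in> H1_per T" using H1_per_const[OF T, of 0] by (simp add: zero_fun_def)
next
 fix u v :: "real ^ 'n => complex" assume "u \<in> H1_per T" "v \<in> H1_per T"
 from H1_per_lin(1)[OF T this, of 1 1] show "u + v \<in> H1_per T" by (simp add: plus_fun_def)
next
 fix u :: "real ^ 'n => complex" and r assume "u \<in> H1_per T"
 from H1_per_lin(1)[OF T this this, of "of_real r" 0] show "r *R u \<in> H1_per T" by (simp add: scaleR_fun_def scaleR_conv_of_real)
qed

lemma wp_add: "T > 0 ==> u \<in> H1_per T ==> v \<in> H1_per T ==> AE x in cm T. wp k (u + v) x = wp k u x + wp k v x"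
 using AE_cm[OF H1_per_lin(2)[of T u v k 1 1]] by (simp add: plus_fun_def)

lemma wp_diff: "T > 0 ==> u \<in> H1_per T ==> v \<in> H1_per T ==> AE x in cm T. wp k (u - v) x = wp k u x - wp k v x"
 using AE_cm[OF H1_per_lin(2)[of T u v k 1 "-1"]] by (simp add: fun_diff_def)

lemma wp_scaleR: "T > 0 ==> u \<in> H1_per T ==> AE x in cm T. wp k (r *R u) x = r *R wp k u x"
 using AE_cm[OF H1_per_lin(2)[of T u u k "of_real r" 0]] by (simp add: scaleR_fun_def scaleR_conv_of_real)

lemma wp_mult: "T > 0 ==> u \<in> H1_per T ==> AE x in cm T. wp k (%x. a * u x) x = a * wp k u x"
 using AE_cm[OF H1_per_lin(2)[of T u u k a 0]] by simp

lemma H1_per_add: "T > 0 ==> u \<in> H1_per T ==> v \<in> H1_per T ==> u + v \<in> H1_per T"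
 and H1_per_diff: "T > 0 ==> u \<in> H1_per T ==> v \<in> H1_per T ==> u - v \<in> H1_per T"
 and H1_per_scaleR: "T > 0 ==> u \<in> H1_per T ==> r *R u \<in> H1_per T"
 using H1_per_subspace by (auto intro: subspace_add subspace_diff subspace_scale)

lemma integrable_inner_L2:
 fixes f g :: "'a => complex"
 assumes f: "Lp 2 M f" and g: "Lp 2 M g"
 shows "integrable M (%x. f x \<bullet> g x)" "\<bar>\<integral>x. f x \<bullet> g x \<partial>M\<bar> <= lpn 2 M f * lpn 2 M g"
proof -
 note A = integral_mult_L2[OF f g]
 show i: "integrable M (%x. f x \<bullet> g x)"
  by (rule Bochner_Integration.integrable_bound[OF A(1)]) (use f g in "auto intro!: AE_I2 Cauchy_Schwarz_ineq2")
 have "\<bar>\<integral>x. f x \<bullet> g x \<partial>M\<bar> <= (LINT x|M. norm (f x) * norm (g x))"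
  using integral_abs_bound[of M "%x. f x \<bullet> g x"] integral_mono[OF integrable_abs[OF i] A(1)] Cauchy_Schwarz_ineq2
  by (meson order_trans)
 with A(2) show "\<bar>\<integral>x. f x \<bullet> g x \<partial>M\<bar> <= lpn 2 M f * lpn 2 M g" by linarith
qed

lemma H1_inner_eq:
 fixes u v :: "real ^ 'n => complex"
 assumes T: "T > 0" and u: "u \<in> H1_per T" and v: "v \<in> H1_per T"
 shows "H1_inner T u v = (\<Sum>k\<in>UNIV. \<integral>x. wp k u x \<bullet> wp k v x \<partial>cm T) + (LINT x|cm T. u x \<bullet> v x)"
proof -
 note U = H1_perD[OF T u] and V = H1_perD[OF T v]
 have "H1_inner T u v = (LINT x|cm T. (\<Sum>k\<in>UNIV. wp k u x \<bullet> wp k v x) + u x \<bullet> v x)"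
  unfolding H1_inner_def set_integral_cell ..
 also have "... = (LINT x|cm T. (\<Sum>k\<in>UNIV. wp k u x \<bullet> wp k v x)) + (LINT x|cm T. u x \<bullet> v x)"
  by (intro Bochner_Integration.integral_add Bochner_Integration.integrable_sum integrable_inner_L2 U V)
 also have "(LINT x|cm T. (\<Sum>k\<in>UNIV. wp k u x \<bullet> wp k v x)) = (\<Sum>k\<in>UNIV. \<integral>x. wp k u x \<bullet> wp k v x \<partial>cm T)"
  by (intro Bochner_Integration.integral_sum integrable_inner_L2 U V)
 finally show ?thesis .
qed

lemma H1_norm_sq:
 fixes u :: "real ^ 'n => complex"
 assumes T: "T > 0" and u: "u \<in> H1_per T"
 shows "H1_inner T u u = (\<Sum>k\<in>UNIV. (lpn 2 (cm T) (wp k u))^2) + (lpn 2 (cm T) u)^2"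
  "(H1_norm T u)^2 = (\<Sum>k\<in>UNIV. (lpn 2 (cm T) (wp k u))^2) + (lpn 2 (cm T) u)^2"
proof -
 show *: "H1_inner T u u = (\<Sum>k\<in>UNIV. (lpn 2 (cm T) (wp k u))^2) + (lpn 2 (cm T) u)^2"
  unfolding H1_inner_eq[OF T u u] by (simp add: lpn_power power2_norm_eq_inner)
 show "(H1_norm T u)^2 = (\<Sum>k\<in>UNIV. (lpn 2 (cm T) (wp k u))^2) + (lpn 2 (cm T) u)^2"
  unfolding H1_norm_def * by (simp add: sum_nonneg)
qed

lemma H1_norm_nonneg [simp]: "T > 0 ==> u \<in> H1_per T ==> 0 <= H1_norm T u"
 unfolding H1_norm_def by (simp add: H1_norm_sq sum_nonneg)

lemma lpn_le_H1_norm: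
 fixes u :: "real ^ 'n => complex"
 assumes T: "T > 0" and u: "u \<in> H1_per T"
 shows "lpn 2 (cm T) u <= H1_norm T u" "lpn 2 (cm T) (wp k u) <= H1_norm T u"
  "H1_norm T u <= (\<Sum>k\<in>UNIV. lpn 2 (cm T) (wp k u)) + lpn 2 (cm T) u"
proof -
 let ?a = "%k. lpn 2 (cm T) (wp k u)" and ?b = "lpn 2 (cm T) u"
 have s: "(?a k)^2 <= (\<Sum>k\<in>UNIV. (?a k)^2)" for k by (rule member_le_sum) auto
 have n: "0 <= (\<Sum>k\<in>UNIV. (?a k)^2)" by (simp add: sum_nonneg)
 show "?b <= H1_norm T u"
  by (rule power2_le_imp_le) (use H1_norm_sq(2)[OF T u] n T u in auto)
 have "(?a k)^2 <= (H1_norm T u)^2" unfolding H1_norm_sq(2)[OF T u] using s[of k] by (simp add: add_increasing2)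
 then show "?a k <= H1_norm T u" by (rule power2_le_imp_le) (use T u in auto)
 have sq: "(\<Sum>k\<in>A. (?a k)^2) <= (\<Sum>k\<in>A. ?a k)^2" if "finite A" for A
  using that
 proof (induction A rule: finite_induct)
  case (insert x A)
  have "0 <= 2 * (?a x * (\<Sum>k\<in>A. ?a k))" by (simp add: sum_nonneg)
  then show ?case using insert by (simp add: power2_sum)
 qed simp
 have "(H1_norm T u)^2 <= (\<Sum>k\<in>UNIV. ?a k)^2 + ?b^2" unfolding H1_norm_sq(2)[OF T u] using sq[of UNIV] by simp
 also have "... <= ((\<Sum>k\<in>UNIV. ?a k) + ?b)^2" by (simp add: power2_sum sum_nonneg)
 finally show "H1_norm T u <= (\<Sum>k\<in>UNIV. ?a k) + ?b" by (rule power2_le_imp_le) (simp add: sum_nonneg)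
qed

lemma H1_per_representative:
 fixes u :: "real ^ 'n => complex"
 assumes T: "T > 0" and u: "u \<in> H1_per T"
 shows "EX u' g. (ALL k. wper k T u' (g k)) \<and> (AE x in leb. u x = u' x) \<and> (ALL k. AE x in leb. wp k u x = g k x)
  \<and> lpn 2 (tor T) u' = lpn 2 (cm T) u \<and> (ALL k. lpn 2 (tor T) (g k) = lpn 2 (cm T) (wp k u))"
proof -
 note U = H1_perD[OF T u]
 have pu: "AE x in leb. u (x + lat T m) = u x" for m using U(1) by (simp add: lper_def)
 obtain u' where u': "u' \<in> bmeas borel" "lper T u'" "AE x in leb. u x = u' x"
  using borel_periodic_representative[OF T U(2) pu] by (elim bexE conjE)
 have "EX g. g \<in> bmeas borel \<and> lper T g \<and> (AE x in leb. wp k u x = g x)" for k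
  using borel_periodic_representative[OF T U(4)[of k] U(7)[of k]] by (elim bexE conjE) (rule exI, intro conjI)
 then have "ALL k. EX g. g \<in> bmeas borel \<and> lper T g \<and> (AE x in leb. wp k u x = g x)" by (rule allI)
 from choice[OF this] obtain g where gg: "ALL k. g k \<in> bmeas borel \<and> lper T (g k) \<and> (AE x in leb. wp k u x = g k x)"
  by (rule exE)
 have g: "g k \<in> bmeas borel" "lper T (g k)" "AE x in leb. wp k u x = g k x" for k
  by (rule conjunct1[OF gg[rule_format]], rule conjunct1[OF conjunct2[OF gg[rule_format]]], rule conjunct2[OF conjunct2[OF gg[rule_format]]])
 have m: "f \<in> bmeas borel ==> f \<in> bmeas (cm T)" for f :: "real ^ 'n => complex"
  by (intro measurable_cm measurable_completion) simp
 have L: "Lp 2 (tor T) u'" "Lp 2 (tor T) (g k)" "lpn 2 (tor T) u' = lpn 2 (cm T) u" "lpn 2 (tor T) (g k) = lpn 2 (cm T) (wp k u)" for k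
  using Lp_cong_AE[OF AE_cm[OF u'(3)] m[OF u'(1)] measurable_cm[OF U(2)], of 2] Lp_cong_AE[OF AE_cm[OF g(3)[of k]] m[OF g(1)] measurable_cm[OF U(4)], of 2]
   lpn_cong_AE[OF AE_cm[OF u'(3)] m[OF u'(1)] measurable_cm[OF U(2)], of 2] lpn_cong_AE[OF AE_cm[OF g(3)[of k]] m[OF g(1)] measurable_cm[OF U(4)], of 2]
   U(5) U(6)[of k] Lp_cm_tor[OF u'(1), of 2 T] Lp_cm_tor[OF g(1)[of k], of 2 T] by simp_all
 have "wper k T u' (g k)" for k
  unfolding wper_def using u' g L is_weak_partial_cong[OF U(3) u'(3) g(3)] by simp
 with u' g L show ?thesis by (intro exI[of _ u'] exI[of _ g] conjI allI)
qed

text \<open>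
The constant in front of the full norm is arbitrarily small. This is what turns convergence in \<open>L\<^sup>2\<close> of a bounded sequence into convergence in \<open>L\<^sup>4\<close>.
\<close>

lemma H1_per_L4:
 assumes N: "CARD('n) <= 3" and T: "T > 0" and e: "e > 0"
 shows "EX C>=0. ALL u : (H1_per T :: (real ^ 'n => complex) set). Lp 4 (cm T) u \<and> lpn 4 (cm T) u <= e * H1_norm T u + C * lpn 2 (cm T) u"
proof -
 define n where "n = real CARD('n)"
 have n: "n > 0" by (simp add: n_def)
 \<comment> \<open>The scale at which the gradient coefficient of \<open>L4_estimate\<close> becomes \<open>e / CARD('n)\<close>.\<close>
 define s where "s = min (min 1 T) ((e / (2 * n)) ^ 4 / 16900)"
 have s: "0 < s" "s <= T" "s <= 1" using T e n by (auto simp: s_def)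
 have "16900 * s <= (e / (2 * n)) ^ 4" by (simp add: s_def)
 then have "root 4 (16900 * s) <= root 4 ((e / (2 * n)) ^ 4)" by (intro real_root_le_mono) auto
 also have "... = e / (2 * n)" using e n by (simp add: real_root_power_cancel)
 finally have r: "root 4 (16900 * s) <= e / (2 * n)" .
 define C where "C = (1 / sqrt (s ^ CARD('n))) * root 4 (T ^ CARD('n))"
 have C: "C >= 0" using s T by (simp add: C_def)
 have "Lp 4 (cm T) u \<and> lpn 4 (cm T) u <= e * H1_norm T u + C * lpn 2 (cm T) u" if u: "u \<in> H1_per T" for u :: "real ^ 'n => complex"
 proof -
  obtain u' g where w: "ALL k. wper k T u' (g k)" and ae: "AE x in leb. u x = u' x"
   and l: "lpn 2 (tor T) u' = lpn 2 (cm T) u" "ALL k. lpn 2 (tor T) (g k) = lpn 2 (cm T) (wp k u)"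
   using H1_per_representative[OF T u] by (elim exE conjE)
  have ub: "u' \<in> bmeas borel" using w wperD by blast
  note A = L4_estimate[OF N s w[rule_format]]
  have um: "u \<in> bmeas (cm T)" "u' \<in> bmeas (cm T)"
   using H1_perD(2)[OF T u] ub by (auto intro!: measurable_cm measurable_completion)
  have "Lp 4 (cm T) u" using Lp_cong_AE[OF AE_cm[OF ae] um(2,1), of 4] Lp_cm_tor(1)[OF ub, of 4 T] A(1) by simp
  moreover have "lpn 4 (cm T) u <= e * H1_norm T u + C * lpn 2 (cm T) u"
  proof -
   have G: "(\<Sum>k\<in>UNIV. lpn 2 (tor T) (g k)) <= n * H1_norm T u"
    using sum_bounded_above[of UNIV "%k. lpn 2 (tor T) (g k)" "H1_norm T u"] l(2) lpn_le_H1_norm(2)[OF T u] by (simp add: n_def)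
   have "lpn 4 (cm T) u = lpn 4 (tor T) u'"
    using lpn_cong_AE[OF AE_cm[OF ae] um(2,1), of 4] Lp_cm_tor(2)[OF ub, of 4 T] by simp
   also have "... <= C * lpn 2 (cm T) u + 2 * root 4 (16900 * s) * (\<Sum>k\<in>UNIV. lpn 2 (tor T) (g k))"
    using A(2) unfolding l(1) by (simp add: C_def mult_ac)
   also have "2 * root 4 (16900 * s) * (\<Sum>k\<in>UNIV. lpn 2 (tor T) (g k)) <= 2 * (e / (2 * n)) * (n * H1_norm T u)"
    using r s e n G by (intro mult_mono) (auto intro: sum_nonneg)
   also have "... = e * H1_norm T u" using n by simp
   finally show ?thesis by simp
  qed
  ultimately show ?thesis by blast
 qed
 with C show ?thesis by blast
qed

lemma H1_per_rellich:
 fixes u :: "nat => real ^ 'n => complex"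
 assumes T: "T > 0" and u: "!!n. u n \<in> H1_per T" and R: "!!n. H1_norm T (u n) <= R"
 shows "EX r :: nat => nat. strict_mono r \<and> (ALL e>0. EX N. ALL m>=N. ALL n>=N. lpn 2 (cm T) (u (r m) - u (r n)) < e)"
proof -
 define P where "P n z \<longleftrightarrow> (ALL k. wper k T (fst z) (snd z k)) \<and> (AE x in leb. u n x = fst z x)
   \<and> lpn 2 (tor T) (fst z) = lpn 2 (cm T) (u n) \<and> (ALL k. lpn 2 (tor T) (snd z k) = lpn 2 (cm T) (wp k (u n)))"
  for n and z :: "(real ^ 'n => complex) \<times> ('n => real ^ 'n => complex)"
 have "EX z. P n z" for n
 proof -
  obtain u' g where "ALL k. wper k T u' (g k)" "AE x in leb. u n x = u' x"
   "lpn 2 (tor T) u' = lpn 2 (cm T) (u n)" "ALL k. lpn 2 (tor T) (g k) = lpn 2 (cm T) (wp k (u n))"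
   using H1_per_representative[OF T u[of n]] by (elim exE conjE)
  then have "P n (u', g)" by (simp add: P_def)
  then show ?thesis by (rule exI)
 qed
 then have "ALL n. EX z. P n z" by (rule allI)
 from choice[OF this] obtain z where z: "ALL n. P n (z n)" by (rule exE)
 note z = z[unfolded P_def]
 define n where "n = real CARD('n)"
 have n: "n >= 1" by (simp add: n_def Suc_leI)
 have R0: "0 <= R" using order_trans[OF H1_norm_nonneg[OF T u] R] .
 have b1: "lpn 2 (tor T) (fst (z m)) <= (n + 1) * R" for m
 proof -
  have "lpn 2 (tor T) (fst (z m)) <= R" using z lpn_le_H1_norm(1)[OF T u[of m]] R[of m] by simp
  also have "R <= (n + 1) * R" using n R0 by (simp add: mult_le_cancel_right1)
  finally show ?thesis .
 qed
 have b2: "(\<Sum>k\<in>UNIV. lpn 2 (tor T) (snd (z m) k)) <= (n + 1) * R" for m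
 proof -
  have "lpn 2 (tor T) (snd (z m) k) <= R" for k using z lpn_le_H1_norm(2)[OF T u[of m]] R[of m] order_trans by metis
  then have "(\<Sum>k\<in>UNIV. lpn 2 (tor T) (snd (z m) k)) <= n * R"
   using sum_bounded_above[of UNIV "%k. lpn 2 (tor T) (snd (z m) k)" R] by (simp add: n_def)
  also have "... <= (n + 1) * R" using R0 by (intro mult_right_mono) auto
  finally show ?thesis .
 qed
 have wz: "wper k T (fst (z m)) (snd (z m) k)" for m k using z by blast
 obtain r :: "nat => nat" where r: "strict_mono r" "ALL e>0. EX N. ALL a>=N. ALL b>=N. lpn 2 (tor T) (%x. fst (z (r a)) x - fst (z (r b)) x) < e"
  using rellich[of T "%m. fst (z m)" "%m. snd (z m)", OF T wz b1 b2] by (elim exE conjE)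
 have "lpn 2 (tor T) (%x. fst (z a) x - fst (z b) x) = lpn 2 (cm T) (u a - u b)" for a b
 proof -
  have zb: "fst (z a) \<in> bmeas borel" "fst (z b) \<in> bmeas borel" using wperD(1)[OF wz[of undefined]] by auto
  then have m: "(%x. fst (z a) x - fst (z b) x) \<in> bmeas borel" by measurable
  have "AE x in cm T. (u a - u b) x = fst (z a) x - fst (z b) x"
  proof -
   have "AE x in cm T. u a x = fst (z a) x" "AE x in cm T. u b x = fst (z b) x" using z AE_cm by blast+
   then show ?thesis by eventually_elim simp
  qed
  from lpn_cong_AE[OF this, of 2] have "lpn 2 (cm T) (u a - u b) = lpn 2 (cm T) (%x. fst (z a) x - fst (z b) x)"
   using m H1_perD(2)[OF T u[of a]] H1_perD(2)[OF T u[of b]] by (simp add: fun_diff_def measurable_cm measurable_completion borel_measurable_diff)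
  then show ?thesis using Lp_cm_tor(2)[OF m, of 2 T] by simp
 qed
 with r show ?thesis by (intro exI[of _ r]) simp
qed

lemma H1_per_poincare:
 fixes u :: "real ^ 'n => complex"
 assumes T: "T > 0" and u: "u \<in> H1_per T"
 shows "lpn 2 (cm T) (%x. u x - (LINT y|cm T. u y) /\<^sub>R T ^ CARD('n)) <= T * (\<Sum>k\<in>UNIV. lpn 2 (cm T) (wp k u))"
proof -
 obtain u' g where w: "ALL k. wper k T u' (g k)" and ae: "AE x in leb. u x = u' x"
  and l: "ALL k. lpn 2 (tor T) (g k) = lpn 2 (cm T) (wp k u)"
  using H1_per_representative[OF T u] by (elim exE conjE)
 have ub: "u' \<in> bmeas borel" using w wperD by blast
 have um: "u \<in> bmeas (cm T)" "u' \<in> bmeas (cm T)"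
  using H1_perD(2)[OF T u] ub by (auto intro!: measurable_cm measurable_completion)
 have I: "(LINT y|cm T. u y) = (LINT y|tor T. u' y)"
  using integral_cong_AE[OF um AE_cm[OF ae]] integral_cm(1)[OF ub] by simp
 define c where "c = (LINT y|tor T. u' y) /\<^sub>R T ^ CARD('n)"
 have m: "(%x. u' x - c) \<in> bmeas borel" using ub by measurable
 have "lpn 2 (cm T) (%x. u x - c) = lpn 2 (cm T) (%x. u' x - c)"
  by (rule lpn_cong_AE) (use AE_cm[OF ae] um in "auto elim: eventually_mono")
 also have "... = lpn 2 (tor T) (%x. u' x - c)" by (rule Lp_cm_tor(2)[OF m])
 also have "... <= T * (\<Sum>k\<in>UNIV. lpn 2 (tor T) (g k))" unfolding c_def by (rule poincare[OF T w[rule_format]])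
 finally show ?thesis unfolding I c_def using l by simp
qed

lemma H1_per_parts:
 fixes u v :: "real ^ 'n => complex"
 assumes T: "T > 0" and u: "u \<in> H1_per T" and v: "v \<in> H1_per T"
 shows "(LINT x|cm T. wp k u x * v x) + (LINT x|cm T. u x * wp k v x) = 0"
proof -
 obtain u' g where w: "ALL k. wper k T u' (g k)" and ae: "AE x in leb. u x = u' x" "ALL k. AE x in leb. wp k u x = g k x"
  using H1_per_representative[OF T u] by (elim exE conjE)
 obtain v' h where w': "ALL k. wper k T v' (h k)" and ae': "AE x in leb. v x = v' x" "ALL k. AE x in leb. wp k v x = h k x"
  using H1_per_representative[OF T v] by (elim exE conjE)
 note b = wperD(1,2)[OF w[rule_format, of k]] wperD(1,2)[OF w'[rule_format, of k]]
 have m: "f \<in> bmeas borel ==> f \<in> bmeas (cm T)" for f :: "real ^ 'n => complex"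
  by (intro measurable_cm measurable_completion) simp
 note U = measurable_cm[OF H1_perD(2)[OF T u]] measurable_cm[OF H1_perD(4)[OF T u]]
  and V = measurable_cm[OF H1_perD(2)[OF T v]] measurable_cm[OF H1_perD(4)[OF T v]]
 have ga: "AE x in cm T. wp k u x = g k x" "AE x in cm T. wp k v x = h k x"
  "AE x in cm T. u x = u' x" "AE x in cm T. v x = v' x" using ae ae' AE_cm by blast+
 have "(LINT x|cm T. wp k u x * v x) = (LINT x|cm T. g k x * v' x)"
 proof (rule integral_cong_AE)
  show "AE x in cm T. wp k u x * v x = g k x * v' x" using ga(1,4) by eventually_elim simp
 qed (intro borel_measurable_times U V m b)+
 also have "... = (LINT x|tor T. g k x * v' x)" by (rule integral_cm(1)) (intro borel_measurable_times b)
 finally have 1: "(LINT x|cm T. wp k u x * v x) = (LINT x|tor T. g k x * v' x)" .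
 have "(LINT x|cm T. u x * wp k v x) = (LINT x|cm T. u' x * h k x)"
 proof (rule integral_cong_AE)
  show "AE x in cm T. u x * wp k v x = u' x * h k x" using ga(2,3) by eventually_elim simp
 qed (intro borel_measurable_times U V m b)+
 also have "... = (LINT x|tor T. u' x * h k x)" by (rule integral_cm(1)) (intro borel_measurable_times b)
 finally show ?thesis unfolding 1 using periodic_integration_by_parts[OF T w[rule_format, of k] w'[rule_format, of k]] by simp
qed

text \<open>
By \<open>per_unfold\<close> the two sides of the defining identity are integrals over the cell against a fixed bounded function, hence continuous in \<open>L\<^sup>2\<close>.
\<close>

lemma weak_partial_limit:
 fixes U :: "nat => real ^ 'n => complex"
 assumes T: "T > 0" and U: "!!n. U n \<in> H1_per T"
  and u: "lper T u" "u \<in> bmeas leb" "Lp 2 (cm T) u" "(%n. lpn 2 (cm T) (%x. U n x - u x)) ---> 0"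
  and g: "!!m. AE x in leb. g (x + lat T m) = g x" "g \<in> bmeas leb" "Lp 2 (cm T) g"
   "(%n. lpn 2 (cm T) (%x. wp k (U n) x - g x)) ---> 0"
 shows "is_weak_partial k u g"
proof -
 have up: "AE x in leb. u (x + lat T m) = u x" for m using u(1) by (simp add: lper_def)
 have uL: "u \<in> L1_loc" by (intro L2_loc_subset_L1_loc) (use L2_loc_periodic_iff[OF T u(2) up] u(3) in simp)
 have gL: "g \<in> L1_loc" by (intro L2_loc_subset_L1_loc) (use L2_loc_periodic_iff[OF T g(2,1)] g(3) in simp)
 have lim: "(%n. \<integral>x. \<psi> x *R F n x \<partial>leb) ---> (LINT x|leb. \<psi> x *R f x)"
  if \<psi>: "continuous_on UNIV \<psi>" "!!x. \<bar>\<psi> x\<bar> <= B" and K: "compact K" "!!x. x \<notin> K ==> \<psi> x = 0"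
   and F: "!!n m. AE x in leb. F n (x + lat T m) = F n x" "!!n. F n \<in> bmeas leb" "!!n. Lp 2 (cm T) (F n)" "!!n. F n \<in> L1_loc"
   and f: "!!m. AE x in leb. f (x + lat T m) = f x" "f \<in> bmeas leb" "Lp 2 (cm T) f" "f \<in> L1_loc"
   and l: "(%n. lpn 2 (cm T) (%x. F n x - f x)) ---> 0"
  for \<psi> :: "real ^ 'n => real" and B K F f
 proof -
  have \<psi>m: "\<psi> \<in> bmeas borel" using \<psi>(1) by (rule borel_measurable_continuous_onI)
  have \<psi>l: "\<psi> \<in> bmeas leb" using \<psi>m by (simp add: measurable_completion)
  have i: "integrable leb (%x. \<psi> x *R h x)" if "h \<in> L1_loc" for h
   by (rule L1_loc_integrable_mult[OF that \<psi>l \<psi>(2) K(1)]) (rule K(2))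
  have Q: "(LINT x|leb. \<psi> x *R h x) = (LINT x|cm T. per T \<psi> x *R h x)" "integrable (cm T) (%x. per T \<psi> x *R h x)"
   if "h \<in> L1_loc" "!!m. AE x in leb. h (x + lat T m) = h x" for h
   by (rule per_unfold[OF T compact_imp_bounded[OF K(1)] i[OF that(1)]], use K(2) that(2) in auto)+
  have p: "Lp 2 (cm T) (per T \<psi>)"
  proof -
   have b: "per T \<psi> \<in> bmeas borel" by (rule per_borel[OF T compact_imp_bounded[OF K(1)] _ \<psi>m]) (rule K(2))
   have "EX C. ALL x. norm (per T \<psi> x) <= C" by (rule per_bounded[OF T compact_imp_bounded[OF K(1)]], rule K(2)) (use \<psi>(2) in auto)
   then obtain C where C: "ALL x. norm (per T \<psi> x) <= C" by (rule exE)
   have "0 <= C" using C order_trans[OF norm_ge_zero] by blast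
   then show ?thesis using C b by (intro lpn_bounded(1)[OF finite_measure_cm, of 2 _ _ C]) (auto intro!: measurable_cm measurable_completion)
  qed
  have "norm ((LINT x|leb. \<psi> x *R F n x) - (LINT x|leb. \<psi> x *R f x)) <= lpn 2 (cm T) (per T \<psi>) * lpn 2 (cm T) (%x. F n x - f x)" for n
  proof -
   have "(LINT x|leb. \<psi> x *R F n x) - (LINT x|leb. \<psi> x *R f x) = (LINT x|cm T. per T \<psi> x *R (F n x - f x))"
    unfolding Q(1)[OF F(4,1)] Q(1)[OF f(4,1)] using Q(2)[OF F(4,1)] Q(2)[OF f(4,1)] by (simp add: scaleR_diff_right)
   also have "cmod \<dots> <= (LINT x|cm T. norm (per T \<psi> x) * norm (F n x - f x))"
    using integral_norm_bound[of "cm T" "%x. per T \<psi> x *R (F n x - f x)"] by simp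
   also have "... <= lpn 2 (cm T) (per T \<psi>) * lpn 2 (cm T) (%x. F n x - f x)"
    by (rule integral_mult_L2(2)[OF p Lp_diff[OF F(3) f(3)]])
   finally show ?thesis .
  qed
  then have ev: "\<forall>\<^sub>F n in sequentially. norm ((LINT x|leb. \<psi> x *R F n x) - (LINT x|leb. \<psi> x *R f x)) <= lpn 2 (cm T) (per T \<psi>) * lpn 2 (cm T) (%x. F n x - f x)"
   by (intro always_eventually allI)
  have "(%n. lpn 2 (cm T) (per T \<psi>) * lpn 2 (cm T) (%x. F n x - f x)) ---> 0" using tendsto_mult_left[OF l] by simp
  from LIM_zero_cancel[OF Lim_null_comparison[OF ev this]] show ?thesis .
 qed
 note HU = H1_perD[OF T U]
 have UL: "U n \<in> L1_loc" "wp k (U n) \<in> L1_loc" for n using H1_perD(3)[OF T U[of n], of k] by (auto simp: is_weak_partial_def)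
 have Up: "AE x in leb. U n (x + lat T m) = U n x" for n m using HU(1)[of n] by (simp add: lper_def)
 show ?thesis unfolding is_weak_partial_def
 proof (intro conjI allI impI uL gL)
  fix \<phi> :: "real ^ 'n => real" assume \<phi>: "test_function \<phi>"
  obtain K where K: "compact K" "ALL x. x \<notin> K --> \<phi> x = 0" "ALL x k. x \<notin> K --> partial k \<phi> x = 0"
   using test_function_support[OF \<phi>] by (elim exE conjE)
  obtain B where B: "0 <= B" "ALL x. \<bar>\<phi> x\<bar> <= B" "ALL x. \<bar>partial k \<phi> x\<bar> <= B"
   using test_function_bounded[OF \<phi>, of k] by (elim exE conjE)
  have 1: "(%n. \<integral>x. partial k \<phi> x *R U n x \<partial>leb) ---> (LINT x|leb. partial k \<phi> x *R u x)"
   by (rule lim[OF test_function_partial_continuous[OF \<phi>] B(3)[rule_format] K(1) K(3)[rule_format] Up HU(2) HU(5) UL(1) up u(2,3) uL u(4)])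
  have 2: "(%n. \<integral>x. \<phi> x *R wp k (U n) x \<partial>leb) ---> (LINT x|leb. \<phi> x *R g x)"
   by (rule lim[OF test_function_continuous[OF \<phi>] B(2)[rule_format] K(1) K(2)[rule_format] HU(7) HU(4) HU(6) UL(2) g(1,2,3) gL g(4)])
  have "(LINT x|leb. partial k \<phi> x *R U n x) = - (LINT x|leb. \<phi> x *R wp k (U n) x)" for n
   using H1_perD(3)[OF T U[of n], of k] \<phi> by (simp add: is_weak_partial_def)
  then show "(LINT x|leb. partial k \<phi> x *R u x) = - (LINT x|leb. \<phi> x *R g x)"
   using LIMSEQ_unique[OF 1] tendsto_minus[OF 2] by simp
 qed
qed

lemma fast_cauchy_limit_cm:
 fixes F :: "nat => real ^ 'n => complex"
 assumes F: "!!n. F n \<in> bmeas leb" "!!n. Lp 2 (cm T) (F n)"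
  and bd: "!!n. lpn 2 (cm T) (%x. F (Suc n) x - F n x) <= (1/2) ^ n"
 defines "f \<equiv> (%x. lim (%n. F n x))"
 shows "f \<in> bmeas leb" "Lp 2 (cm T) f" "(%n. lpn 2 (cm T) (%x. F n x - f x)) ---> 0"
proof -
 show fm: "f \<in> bmeas leb" unfolding f_def by (rule borel_measurable_lim_metric[OF F(1)])
 have bd': "lpn 2 (cm T) (%x. F (Suc n) x - F n x) <= 1 * (1/2) ^ n" for n using bd by simp
 note A = L2_fast_cauchy[OF F(2) bd' zero_le_one]
 have "AE x in cm T. (%n. F n x) ---> f x" using A(1) by eventually_elim (simp add: f_def convergent_LIMSEQ_iff)
 note B = A(2)[OF measurable_cm[OF fm] this]
 show "Lp 2 (cm T) f" using B by blast
 show "(%n. lpn 2 (cm T) (%x. F n x - f x)) ---> 0"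
 proof (rule Lim_null_comparison)
  show "\<forall>\<^sub>F n in sequentially. norm (lpn 2 (cm T) (%x. F n x - f x)) <= 1 * 2 * (1/2) ^ n" using B by simp
  show "(%n. 1 * 2 * (1/2) ^ n :: real) ---> 0" by (intro tendsto_mult_right_zero LIMSEQ_realpow_zero) auto
 qed
qed

lemma H1_per_fast_complete:
 fixes U :: "nat => real ^ 'n => complex"
 assumes T: "T > 0" and U: "!!n. U n \<in> H1_per T" and bd: "!!n. H1_norm T (U (Suc n) - U n) <= (1/2) ^ n"
 shows "EX u:H1_per T. (%n. H1_norm T (U n - u)) ---> 0"
proof -
 note HU = H1_perD[OF T U]
 have Ud: "U (Suc n) - U n \<in> H1_per T" for n by (rule H1_per_diff[OF T U U])
 have b0: "lpn 2 (cm T) (%x. U (Suc n) x - U n x) <= (1/2) ^ n" for n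
  using order_trans[OF lpn_le_H1_norm(1)[OF T Ud] bd] by (simp add: fun_diff_def)
 have bk: "lpn 2 (cm T) (%x. wp k (U (Suc n)) x - wp k (U n) x) <= (1/2) ^ n" for n k
 proof -
  have "lpn 2 (cm T) (wp k (U (Suc n) - U n)) = lpn 2 (cm T) (%x. wp k (U (Suc n)) x - wp k (U n) x)"
   by (rule lpn_cong_AE[OF wp_diff[OF T U U]]) (intro borel_measurable_diff measurable_cm HU H1_perD(4)[OF T Ud])+
  then show ?thesis using order_trans[OF lpn_le_H1_norm(2)[OF T Ud[of n], of k] bd[of n]] by simp
 qed
 define u where "u = (%x. lim (%n. U n x))"
 define g where "g k = (%x. lim (%n. wp k (U n) x))" for k
 have u: "u \<in> bmeas leb" "Lp 2 (cm T) u" "(%n. lpn 2 (cm T) (%x. U n x - u x)) ---> 0"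
  unfolding u_def using fast_cauchy_limit_cm[OF HU(2) HU(5) b0] by simp_all
 note gg = fast_cauchy_limit_cm[of "%n. wp k (U n)" T for k, OF HU(4) HU(6) bk]
 have g: "g k \<in> bmeas leb" "Lp 2 (cm T) (g k)" "(%n. lpn 2 (cm T) (%x. wp k (U n) x - g k x)) ---> 0" for k
  unfolding g_def using gg[of k] by simp_all
 have up: "lper T u" using HU(1) by (simp add: lper_def u_def)
 have gp: "AE x in leb. g k (x + lat T m) = g k x" for k m
 proof -
  have "AE x in leb. ALL n. wp k (U n) (x + lat T m) = wp k (U n) x"
   unfolding AE_all_countable using HU(7) by blast
  then show ?thesis by eventually_elim (simp add: g_def)
 qed
 have w: "is_weak_partial k u (g k)" for k
  by (rule weak_partial_limit[OF T U up u(1,2,3) gp g])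
 have uH: "u \<in> H1_per T" by (rule H1_perI[OF T up u(1,2) w g(2)])
 have dH: "U n - u \<in> H1_per T" for n by (rule H1_per_diff[OF T U uH])
 have dk: "lpn 2 (cm T) (wp k (U n - u)) = lpn 2 (cm T) (%x. wp k (U n) x - g k x)" for n k
 proof (rule lpn_cong_AE)
  show "AE x in cm T. wp k (U n - u) x = wp k (U n) x - g k x"
   using wp_diff[OF T U[of n] uH, of k] AE_cm[OF weak_partial_eq_AE[OF w[of k]]] by eventually_elim simp
 qed (intro borel_measurable_diff measurable_cm HU g H1_perD(4)[OF T dH])+
 have "(%n. H1_norm T (U n - u)) ---> 0"
 proof (rule Lim_null_comparison)
  show "\<forall>\<^sub>F n in sequentially. norm (H1_norm T (U n - u)) <= (\<Sum>k\<in>UNIV. lpn 2 (cm T) (%x. wp k (U n) x - g k x)) + lpn 2 (cm T) (%x. U n x - u x)"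
  proof (intro always_eventually allI)
   fix n
   have "lpn 2 (cm T) (U n - u) = lpn 2 (cm T) (%x. U n x - u x)" by (simp add: fun_diff_def)
   with lpn_le_H1_norm(3)[OF T dH[of n]] H1_norm_nonneg[OF T dH[of n]]
   show "norm (H1_norm T (U n - u)) <= (\<Sum>k\<in>UNIV. lpn 2 (cm T) (%x. wp k (U n) x - g k x)) + lpn 2 (cm T) (%x. U n x - u x)"
    unfolding dk real_norm_def by linarith
  qed
  have "(%n. (\<Sum>k\<in>UNIV. lpn 2 (cm T) (%x. wp k (U n) x - g k x)) + lpn 2 (cm T) (%x. U n x - u x)) ---> (\<Sum>k\<in>(UNIV :: 'n set). 0) + 0"
   by (intro tendsto_intros g u)
  then show "(%n. (\<Sum>k\<in>UNIV. lpn 2 (cm T) (%x. wp k (U n) x - g k x)) + lpn 2 (cm T) (%x. U n x - u x)) ---> 0" by simp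
 qed
 with uH show ?thesis by blast
qed

section \<open>Hilbert space structure and the action\<close>

lemma wp_inner_add:
 fixes u v :: "real ^ 'n => complex"
 assumes T: "T > 0" and u: "u \<in> H1_per T" and v: "v \<in> H1_per T" and f: "Lp 2 (cm T) f"
 shows "(LINT x|cm T. wp k (u + v) x \<bullet> f x) = (LINT x|cm T. wp k u x \<bullet> f x) + (LINT x|cm T. wp k v x \<bullet> f x)"
proof -
 note U = H1_perD[OF T u] and V = H1_perD[OF T v] and UV = H1_perD[OF T H1_per_add[OF T u v]]
 have "(LINT x|cm T. wp k (u + v) x \<bullet> f x) = (LINT x|cm T. wp k u x \<bullet> f x + wp k v x \<bullet> f x)"
 proof (rule integral_cong_AE)
  show "AE x in cm T. wp k (u + v) x \<bullet> f x = wp k u x \<bullet> f x + wp k v x \<bullet> f x"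
   using wp_add[OF T u v, of k] by eventually_elim (simp add: inner_add_left)
 qed (intro borel_measurable_add borel_measurable_inner measurable_cm U V UV Lp_measurable[OF f])+
 also have "... = (LINT x|cm T. wp k u x \<bullet> f x) + (LINT x|cm T. wp k v x \<bullet> f x)"
  by (intro Bochner_Integration.integral_add integrable_inner_L2(1) U V f)
 finally show ?thesis .
qed

lemma wp_inner_scaleR:
 fixes u :: "real ^ 'n => complex"
 assumes T: "T > 0" and u: "u \<in> H1_per T" and f: "Lp 2 (cm T) f"
 shows "(LINT x|cm T. wp k (r *R u) x \<bullet> f x) = r * (LINT x|cm T. wp k u x \<bullet> f x)"
proof -
 note U = H1_perD[OF T u] and RU = H1_perD[OF T H1_per_scaleR[OF T u]]
 have "(LINT x|cm T. wp k (r *R u) x \<bullet> f x) = (LINT x|cm T. r * (wp k u x \<bullet> f x))"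
 proof (rule integral_cong_AE)
  show "AE x in cm T. wp k (r *R u) x \<bullet> f x = r * (wp k u x \<bullet> f x)"
   using wp_scaleR[OF T u, of k r] by eventually_elim simp
 qed (intro borel_measurable_times borel_measurable_const borel_measurable_inner measurable_cm U RU Lp_measurable[OF f])+
 then show ?thesis by simp
qed

lemma fun_inner_add:
 fixes u v f :: "real ^ 'n => complex"
 assumes "Lp 2 M u" "Lp 2 M v" "Lp 2 M f"
 shows "(LINT x|M. (u + v) x \<bullet> f x) = (LINT x|M. u x \<bullet> f x) + (LINT x|M. v x \<bullet> f x)"
 using integrable_inner_L2(1)[OF assms(1,3)] integrable_inner_L2(1)[OF assms(2,3)] by (simp add: inner_add_left)

text \<open>
Completeness: a Cauchy sequence has a subsequence with geometrically decreasing steps, whose limit \<open>H1_per_fast_complete\<close> provides.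
\<close>

lemma H1_semi_hilbert:
 assumes T: "T > 0"
 shows "semi_hilbert (H1_per T :: (real ^ 'n => complex) set) (H1_inner T) (H1_norm T)"
proof
 show "subspace (H1_per T :: (real ^ 'n => complex) set)" by (rule H1_per_subspace[OF T])
 fix u v w :: "real ^ 'n => complex" and r :: real
 show "H1_norm T u = sqrt (H1_inner T u u)" by (simp add: H1_norm_def)
 assume u: "u \<in> H1_per T"
 show "0 <= H1_inner T u u" unfolding H1_norm_sq(1)[OF T u] by (simp add: sum_nonneg)
 note U = H1_perD[OF T u]
 { assume v: "v \<in> H1_per T"
  show "H1_inner T u v = H1_inner T v u" by (simp add: H1_inner_def inner_commute)
  note V = H1_perD[OF T v]
  assume w: "w \<in> H1_per T"
  note W = H1_perD[OF T w]
  show "H1_inner T (u + v) w = H1_inner T u w + H1_inner T v w"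
   unfolding H1_inner_eq[OF T H1_per_add[OF T u v] w] H1_inner_eq[OF T u w] H1_inner_eq[OF T v w]
    wp_inner_add[OF T u v W(6)] fun_inner_add[OF U(5) V(5) W(5)] sum.distrib by simp }
 assume w: "w \<in> H1_per T"
 note W = H1_perD[OF T w]
 show "H1_inner T (r *R u) w = r * H1_inner T u w"
  unfolding H1_inner_eq[OF T H1_per_scaleR[OF T u] w] H1_inner_eq[OF T u w] wp_inner_scaleR[OF T u W(6)]
  by (simp add: scaleR_fun_def sum_distrib_left distrib_left)
next
 fix f :: "nat => real ^ 'n => complex"
 assume f: "!!n. f n \<in> H1_per T" and c: "!!e. e > 0 ==> EX N. ALL m>=N. ALL n>=N. H1_norm T (f m - f n) < e"
 have "EX N. ALL m>=N. ALL n>=N. H1_norm T (f m - f n) < (1/2) ^ i" for i :: nat by (rule c) simp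
 then have "ALL i. EX N. ALL m>=N. ALL n>=N. H1_norm T (f m - f n) < (1/2) ^ i" by blast
 from choice[OF this] obtain N where N: "ALL i. ALL m>=N i. ALL n>=N i. H1_norm T (f m - f n) < (1/2) ^ i" by (rule exE)
 define r where "r i = i + (\<Sum>l\<le>i. N l)" for i
 have rN: "N i <= r i" for i unfolding r_def by (rule trans_le_add2, rule member_le_sum) auto
 have "H1_norm T (f (r (Suc i)) - f (r i)) <= (1/2) ^ i" for i
  using N[rule_format, of i "r (Suc i)" "r i"] rN[of i] by (simp add: r_def less_imp_le trans_le_add1)
 from H1_per_fast_complete[OF T f this] obtain u where u: "u \<in> H1_per T" "(%n. H1_norm T (f (r n) - u)) ---> 0" by (elim bexE)
 have tri: "H1_norm T (f n - u) <= H1_norm T (f n - f m) + H1_norm T (f m - u)" for n m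
 proof -
  have a: "f n - f m \<in> H1_per T" "f m - u \<in> H1_per T" "f n - u \<in> H1_per T" by (intro H1_per_diff[OF T] f u)+
  have l: "f n - u = (f n - f m) + (f m - u)" by simp
  have H: "H1_norm T g = L2_set (%i. case i of None => lpn 2 (cm T) g | Some k => lpn 2 (cm T) (wp k g)) UNIV" if "g \<in> H1_per T" for g :: "real ^ 'n => complex"
   unfolding H1_norm_def H1_norm_sq(1)[OF T that] L2_set_def UNIV_option_conv
   by (simp add: sum.insert sum.reindex)
  note G = H1_perD[OF T a(1)] and G' = H1_perD[OF T a(2)]
  have k: "lpn 2 (cm T) (wp k (f n - u)) <= lpn 2 (cm T) (wp k (f n - f m)) + lpn 2 (cm T) (wp k (f m - u))" for k
  proof -
   have "lpn 2 (cm T) (wp k (f n - u)) = lpn 2 (cm T) (%x. wp k (f n - f m) x + wp k (f m - u) x)"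
    unfolding l by (rule lpn_cong_AE[OF wp_add[OF T a(1,2)]]) (intro borel_measurable_add measurable_cm G G' H1_perD(4)[OF T H1_per_add[OF T a(1,2)]])+
   also have "... <= lpn 2 (cm T) (wp k (f n - f m)) + lpn 2 (cm T) (wp k (f m - u))"
    by (rule lpn_triangle[OF _ _ G(6) G'(6)]) auto
   finally show ?thesis .
  qed
  have 0: "lpn 2 (cm T) (f n - u) <= lpn 2 (cm T) (f n - f m) + lpn 2 (cm T) (f m - u)"
   unfolding l using lpn_triangle[OF _ _ G(5) G'(5)] by (simp add: plus_fun_def)
  show ?thesis unfolding H[OF a(3)] H[OF a(1)] H[OF a(2)]
   by (rule order_trans[OF L2_set_mono L2_set_triangle_ineq]) (use k 0 in "auto split: option.split")
 qed
 have "(%n. H1_norm T (f n - u)) ---> 0"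
 proof (rule LIMSEQ_I)
  fix e :: real assume e: "0 < e"
  obtain M where M: "ALL m>=M. ALL n>=M. H1_norm T (f m - f n) < e / 2" using c[of "e/2"] e by auto
  obtain i where i: "ALL n>=i. norm (H1_norm T (f (r n) - u) - 0) < e / 2" using LIMSEQ_D[OF u(2), of "e/2"] e by auto
  have "norm (H1_norm T (f n - u) - 0) < e" if n: "n >= M" for n
  proof -
   have "i + M >= i" "r (i + M) >= M" by (auto simp: r_def)
   then have "H1_norm T (f n - f (r (i + M))) < e / 2" "norm (H1_norm T (f (r (i + M)) - u) - 0) < e / 2"
    using M n i by blast+
   with tri[of n "r (i + M)"] H1_norm_nonneg[OF T H1_per_diff[OF T f[of n] u(1)]] show ?thesis by simp
  qed
  then show "EX no. ALL n>=no. norm (H1_norm T (f n - u) - 0) < e" by blast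
 qed
 with u(1) show "EX u:H1_per T. (%n. H1_norm T (f n - u)) ---> 0" by (intro bexI[of _ u])
qed

definition Dir :: "real => (real ^ 'n => complex) => (real ^ 'n => complex) => real" where
 "Dir T u v = (\<Sum>k\<in>UNIV. \<integral>x. wp k u x \<bullet> wp k v x \<partial>cm T)"

text \<open>
Twice the momentum as a bilinear form; the factor \<open>i\<close> is moved to the second argument, where it does not interfere with the weak derivative.
\<close>

definition Mom :: "'n => real => (real ^ 'n => complex) => (real ^ 'n => complex) => real" where
 "Mom j T u v = (LINT x|cm T. wp j u x \<bullet> (- \<i> * v x))"

definition cub :: "complex => complex" where "cub z = (1 - (cmod z)^2) *R z"

text \<open>
The derivative of the action at \<open>u\<close> in direction \<open>v\<close>, confirmed by \<open>action_expansion\<close>.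
\<close>

definition dact :: "'n => real => real => (real ^ 'n => complex) => (real ^ 'n => complex) => real" where
 "dact j T c u v = Dir T u v - c * Mom j T u v - (LINT x|cm T. cub (u x) \<bullet> v x)"

lemma i_inner: "(\<i> * a) \<bullet> b = a \<bullet> (- \<i> * b)"
 by (simp add: inner_complex_def)

lemma Dir_self: "T > 0 ==> u \<in> H1_per T ==> Dir T u u = (\<Sum>k\<in>UNIV. (lpn 2 (cm T) (wp k u))^2)"
 by (simp add: Dir_def lpn_power power2_norm_eq_inner)

lemma H1_norm_Dir: "T > 0 ==> u \<in> H1_per T ==> (H1_norm T u)^2 = Dir T u u + (lpn 2 (cm T) u)^2"
 by (simp add: H1_norm_sq(2) Dir_self)

lemma Dir_nonneg: "T > 0 ==> u \<in> H1_per T ==> 0 <= Dir T u u"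
 by (simp add: Dir_self sum_nonneg)

lemma Dir_sym: "Dir T u v = Dir T v u"
 by (simp add: Dir_def inner_commute)

lemma Dir_add: "T > 0 ==> u \<in> H1_per T ==> v \<in> H1_per T ==> w \<in> H1_per T ==> Dir T (u + v) w = Dir T u w + Dir T v w"
 by (simp add: Dir_def wp_inner_add H1_perD(6) sum.distrib)

lemma Dir_scaleR: "T > 0 ==> u \<in> H1_per T ==> w \<in> H1_per T ==> Dir T (r *R u) w = r * Dir T u w"
 by (simp add: Dir_def wp_inner_scaleR H1_perD(6) sum_distrib_left)

lemma Mom_add: "T > 0 ==> u \<in> H1_per T ==> v \<in> H1_per T ==> w \<in> H1_per T ==> Mom j T (u + v) w = Mom j T u w + Mom j T v w"
 unfolding Mom_def by (intro wp_inner_add Lp_mult H1_perD(5))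

lemma Mom_scaleR: "T > 0 ==> u \<in> H1_per T ==> w \<in> H1_per T ==> Mom j T (r *R u) w = r * Mom j T u w"
 unfolding Mom_def by (intro wp_inner_scaleR Lp_mult H1_perD(5))

lemma Mom_le:
 assumes "T > 0" "u \<in> H1_per T" "v \<in> H1_per T"
 shows "\<bar>Mom j T u v\<bar> <= lpn 2 (cm T) (wp j u) * lpn 2 (cm T) v"
 using integrable_inner_L2(2)[OF H1_perD(6)[OF assms(1,2)] Lp_mult[OF H1_perD(5)[OF assms(1,3)], of "- \<i>"], of j]
 by (simp add: Mom_def lpn_mult[of 2 _ "- \<i>", simplified] lpn_mult)

lemma is_weak_partial_cnj:
 assumes "is_weak_partial k f g"
 shows "is_weak_partial k (%x. cnj (f x)) (%x. cnj (g x))"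
proof -
 have c: "(%x. cnj (h x)) \<in> L1_loc" if "h \<in> L1_loc" for h :: "real ^ 'a => complex"
  unfolding L1_loc_def set_integrable_def
 proof (intro CollectI allI impI)
  fix K :: "(real ^ 'a) set" assume "compact K"
  then have "integrable leb (%x. ind K x *R h x)" using that by (simp add: L1_loc_def set_integrable_def)
  then have "integrable leb (%x. cnj (ind K x *R h x))"
   by (rule integrable_bounded_linear[OF bounded_linear_cnj])
  moreover have "cnj (ind K x *R h x) = ind K x *R cnj (h x)" for x by simp
  ultimately show "integrable leb (%x. ind K x *R cnj (h x))" by (simp only:)
 qed
 have i: "(LINT x|leb. \<phi> x *R cnj (h x)) = cnj (LINT x|leb. \<phi> x *R h x)" for \<phi> :: "real ^ 'a => real" and h
  by (simp add: complex_cnj_scaleR[symmetric] del: complex_cnj_scaleR)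
 show ?thesis using assms c i unfolding is_weak_partial_def by simp
qed

lemma H1_per_cnj:
 fixes u :: "real ^ 'n => complex"
 assumes T: "T > 0" and u: "u \<in> H1_per T"
 shows "(%x. cnj (u x)) \<in> H1_per T" "AE x in leb. wp k (%x. cnj (u x)) x = cnj (wp k u x)"
proof -
 note U = H1_perD[OF T u]
 show "AE x in leb. wp k (%x. cnj (u x)) x = cnj (wp k u x)"
  by (rule weak_partial_eq_AE[OF is_weak_partial_cnj[OF U(3)]])
 have L: "Lp 2 (cm T) (%x. cnj (h x))" if "Lp 2 (cm T) h" for h :: "real ^ 'n => complex"
 proof -
  have "(%x. cnj (h x)) \<in> bmeas (cm T)"
   by (rule borel_measurable_continuous_on[OF _ Lp_measurable[OF that]]) (intro continuous_intros)
  then show ?thesis using that by (simp add: Lp_def)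
 qed
 show "(%x. cnj (u x)) \<in> H1_per T"
 proof (rule H1_perI[OF T _ _ L[OF U(5)] is_weak_partial_cnj[OF U(3)] L[OF U(6)]])
  show "lper T (%x. cnj (u x))" using U(1) by (simp add: lper_def)
  show "(%x. cnj (u x)) \<in> bmeas leb"
   by (rule borel_measurable_continuous_on[OF _ U(2)]) (intro continuous_intros)
 qed
qed

lemma inner_mult_cnj: "a \<bullet> (- \<i> * b) = Re (\<i> * (a * cnj b))"
 by (simp add: inner_complex_def)

text \<open>
Integration by parts and the skew symmetry of multiplication by \<open>i\<close> cancel each other.
\<close>

lemma Mom_sym:
 fixes u v :: "real ^ 'n => complex"
 assumes T: "T > 0" and u: "u \<in> H1_per T" and v: "v \<in> H1_per T"
 shows "Mom j T u v = Mom j T v u"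
proof -
 note U = H1_perD[OF T u] and V = H1_perD[OF T v] and C = H1_per_cnj[OF T v]
 note W = H1_perD[OF T C(1)]
 have i1: "integrable (cm T) (%x. wp j u x * cnj (v x))" by (rule integral_mult_L2_complex(1)[OF U(6) W(5)])
 have i2: "integrable (cm T) (%x. u x * wp j (%x. cnj (v x)) x)" by (rule integral_mult_L2_complex(1)[OF U(5) W(6)])
 have "Mom j T u v = Re (\<i> * (LINT x|cm T. wp j u x * cnj (v x)))"
  unfolding Mom_def inner_mult_cnj using i1 by (subst integral_mult_right_zero[symmetric], subst integral_Re) auto
 also have "(LINT x|cm T. wp j u x * cnj (v x)) = - (LINT x|cm T. u x * wp j (%x. cnj (v x)) x)"
  using H1_per_parts[OF T u C(1), of j] by (simp add: add_eq_0_iff2)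
 also have "Re (\<i> * - (LINT x|cm T. u x * wp j (%x. cnj (v x)) x)) = (LINT x|cm T. Re (- \<i> * (u x * wp j (%x. cnj (v x)) x)))"
  using i2 by (subst integral_Re) auto
 also have "... = Mom j T v u" unfolding Mom_def
 proof (rule integral_cong_AE)
  show "AE x in cm T. Re (- \<i> * (u x * wp j (%x. cnj (v x)) x)) = wp j v x \<bullet> (- \<i> * u x)"
   using AE_cm[OF C(2)[of j]] by eventually_elim (simp add: inner_complex_def algebra_simps)
  show "(%x. Re (- \<i> * (u x * wp j (%x. cnj (v x)) x))) \<in> bmeas (cm T)"
   by (intro borel_measurable_integrable integrable_Re integrable_mult_right i2)
  show "(%x. wp j v x \<bullet> (- \<i> * u x)) \<in> bmeas (cm T)"
   by (intro borel_measurable_inner borel_measurable_times borel_measurable_const measurable_cm U V)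
 qed
 finally show ?thesis .
qed

lemma action_eq:
 fixes u :: "real ^ 'n => complex"
 assumes T: "T > 0" and u: "u \<in> H1_per T"
 shows "action j T c u = 1/2 * Dir T u u + 1/4 * (LINT x|cm T. (1 - (cmod (u x))^2)^2) - c/2 * Mom j T u u"
proof -
 have "(LINT x|cm T. (\<Sum>k\<in>UNIV. (cmod (wp k u x))^2)) = Dir T u u"
  unfolding Dir_def by (subst Bochner_Integration.integral_sum) (auto simp: power2_norm_eq_inner intro!: integrable_inner_L2 H1_perD(6)[OF T u])
 then show ?thesis unfolding action_def set_integral_cell Mom_def i_inner by simp
qed

lemma L4_products:
 fixes f g :: "'a => complex"
 assumes f: "Lp 4 M f" and g: "Lp 4 M g"
 shows "integrable M (%x. (cmod (f x))^2 * (cmod (g x))^2)"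
  and "(LINT x|M. (cmod (f x))^2 * (cmod (g x))^2) <= (lpn 4 M f)^2 * (lpn 4 M g)^2"
 using integral_mult_L4[OF f f g g] by (simp_all add: power2_eq_square mult.assoc)

lemma cub_le: "cmod (cub z) <= cmod z + cmod z * cmod z * cmod z"
proof -
 have "\<bar>1 - (cmod z)^2\<bar> <= 1 + (cmod z)^2" by (simp add: abs_le_iff)
 then have "\<bar>1 - (cmod z)^2\<bar> * cmod z <= (1 + (cmod z)^2) * cmod z" by (intro mult_right_mono) auto
 then show ?thesis by (simp only: cub_def norm_scaleR) (simp add: algebra_simps power2_eq_square)
qed

lemma cub_diff_le: "cmod (cub z - cub w) <= cmod (z - w) + cmod z * cmod z * cmod (z - w) + cmod z * cmod w * cmod (z - w) + cmod w * cmod w * cmod (z - w)"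
proof -
 have "cub z - cub w = (z - w) - (cmod z)^2 *R (z - w) - ((cmod z)^2 - (cmod w)^2) *R w"
  by (simp add: cub_def algebra_simps)
 then have "cmod (cub z - cub w) <= cmod (z - w) + (cmod z)^2 * cmod (z - w) + \<bar>(cmod z)^2 - (cmod w)^2\<bar> * cmod w"
  using norm_triangle_ineq4[of "(z - w) - (cmod z)^2 *R (z - w)" "((cmod z)^2 - (cmod w)^2) *R w"]
   norm_triangle_ineq4[of "z - w" "(cmod z)^2 *R (z - w)"] by simp
 moreover have "\<bar>(cmod z)^2 - (cmod w)^2\<bar> = \<bar>cmod z - cmod w\<bar> * (cmod z + cmod w)"
  by (simp add: power2_eq_square square_diff_square_factored abs_mult)
 moreover have "\<bar>cmod z - cmod w\<bar> * (cmod z + cmod w) * cmod w <= cmod (z - w) * (cmod z + cmod w) * cmod w"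
  by (intro mult_right_mono norm_triangle_ineq3) auto
 ultimately show ?thesis by (simp add: algebra_simps power2_eq_square)
qed

lemma cub_measurable: "u \<in> bmeas M ==> (%x. cub (u x)) \<in> bmeas M"
 unfolding cub_def by measurable

lemma cub_inner_integrable:
 fixes u v :: "real ^ 'n => complex"
 assumes u: "Lp 2 M u" "Lp 4 M u" and v: "Lp 2 M v" "Lp 4 M v"
 shows "integrable M (%x. cub (u x) \<bullet> v x)"
  and "\<bar>\<integral>x. cub (u x) \<bullet> v x \<partial>M\<bar> <= lpn 2 M u * lpn 2 M v + lpn 4 M u ^ 3 * lpn 4 M v"
proof -
 note A = integral_mult_L2[OF u(1) v(1)] and B = integral_mult_L4[OF u(2) u(2) u(2) v(2)]
 have i: "integrable M (%x. norm (u x) * norm (v x) + norm (u x) * norm (u x) * norm (u x) * norm (v x))" using A(1) B(1) by simp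
 have le: "\<bar>cub (u x) \<bullet> v x\<bar> <= norm (u x) * norm (v x) + norm (u x) * norm (u x) * norm (u x) * norm (v x)" for x
 proof -
  have "\<bar>cub (u x) \<bullet> v x\<bar> <= cmod (cub (u x)) * cmod (v x)" by (rule Cauchy_Schwarz_ineq2)
  also have "... <= (norm (u x) + norm (u x) * norm (u x) * norm (u x)) * cmod (v x)" by (intro mult_right_mono cub_le) simp
  finally show ?thesis by (simp add: algebra_simps)
 qed
 have m: "(%x. cub (u x) \<bullet> v x) \<in> bmeas M" by (intro borel_measurable_inner cub_measurable Lp_measurable[OF u(1)] Lp_measurable[OF v(1)])
 show c: "integrable M (%x. cub (u x) \<bullet> v x)"
  by (rule Bochner_Integration.integrable_bound[OF i m]) (use le in "intro AE_I2, simp")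
 have "\<bar>\<integral>x. cub (u x) \<bullet> v x \<partial>M\<bar> <= (LINT x|M. \<bar>cub (u x) \<bullet> v x\<bar>)" by (rule integral_abs_bound)
 also have "... <= (LINT x|M. norm (u x) * norm (v x) + norm (u x) * norm (u x) * norm (u x) * norm (v x))"
  by (rule integral_mono[OF integrable_abs[OF c] i le])
 also have "... <= lpn 2 M u * lpn 2 M v + lpn 4 M u ^ 3 * lpn 4 M v" using A B by (simp add: power3_eq_cube mult.assoc)
 finally show "\<bar>\<integral>x. cub (u x) \<bullet> v x \<partial>M\<bar> <= lpn 2 M u * lpn 2 M v + lpn 4 M u ^ 3 * lpn 4 M v" .
qed

lemma cub_diff_inner:
 fixes u w v :: "real ^ 'n => complex"
 assumes u: "Lp 2 M u" "Lp 4 M u" and w: "Lp 2 M w" "Lp 4 M w" and v: "Lp 2 M v" "Lp 4 M v"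
 shows "\<bar>(LINT x|M. cub (u x) \<bullet> v x) - (LINT x|M. cub (w x) \<bullet> v x)\<bar> <= lpn 2 M (u - w) * lpn 2 M v
   + ((lpn 4 M u)^2 + lpn 4 M u * lpn 4 M w + (lpn 4 M w)^2) * lpn 4 M (u - w) * lpn 4 M v"
proof -
 have d: "Lp 2 M (u - w)" "Lp 4 M (u - w)" using Lp_diff[OF u(1) w(1)] Lp_diff[OF u(2) w(2)] by (simp_all add: fun_diff_def)
 note A = integral_mult_L2[OF d(1) v(1)]
 note B = integral_mult_L4[OF u(2) u(2) d(2) v(2)] integral_mult_L4[OF u(2) w(2) d(2) v(2)] integral_mult_L4[OF w(2) w(2) d(2) v(2)]
 define F where "F x = norm ((u - w) x) * norm (v x) + norm (u x) * norm (u x) * norm ((u - w) x) * norm (v x)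
   + norm (u x) * norm (w x) * norm ((u - w) x) * norm (v x) + norm (w x) * norm (w x) * norm ((u - w) x) * norm (v x)" for x
 have iF: "integrable M F" unfolding F_def using A(1) B(1,3,5) by simp
 note cu = cub_inner_integrable(1)[OF u v] and cw = cub_inner_integrable(1)[OF w v]
 have le: "\<bar>cub (u x) \<bullet> v x - cub (w x) \<bullet> v x\<bar> <= F x" for x
 proof -
  have "\<bar>cub (u x) \<bullet> v x - cub (w x) \<bullet> v x\<bar> <= cmod (cub (u x) - cub (w x)) * cmod (v x)"
   using Cauchy_Schwarz_ineq2[of "cub (u x) - cub (w x)" "v x"] by (simp add: inner_diff_left)
  also have "... <= (cmod (u x - w x) + cmod (u x) * cmod (u x) * cmod (u x - w x) + cmod (u x) * cmod (w x) * cmod (u x - w x) + cmod (w x) * cmod (w x) * cmod (u x - w x)) * cmod (v x)"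
   by (intro mult_right_mono cub_diff_le) simp
  finally show ?thesis by (simp add: F_def algebra_simps)
 qed
 have "\<bar>(LINT x|M. cub (u x) \<bullet> v x) - (LINT x|M. cub (w x) \<bullet> v x)\<bar> = \<bar>\<integral>x. cub (u x) \<bullet> v x - cub (w x) \<bullet> v x \<partial>M\<bar>"
  using cu cw by simp
 also have "... <= (LINT x|M. \<bar>cub (u x) \<bullet> v x - cub (w x) \<bullet> v x\<bar>)" by (rule integral_abs_bound)
 also have "... <= (LINT x|M. F x)" by (rule integral_mono[OF _ iF le]) (intro integrable_abs Bochner_Integration.integrable_diff cu cw)
 also have "... <= lpn 2 M (u - w) * lpn 2 M v + lpn 4 M u * lpn 4 M u * lpn 4 M (u - w) * lpn 4 M v
   + lpn 4 M u * lpn 4 M w * lpn 4 M (u - w) * lpn 4 M v + lpn 4 M w * lpn 4 M w * lpn 4 M (u - w) * lpn 4 M v"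
  unfolding F_def using A B by (simp del: fun_diff_def minus_apply)
 finally show ?thesis by (simp add: algebra_simps power2_eq_square)
qed

lemma quartic_expansion:
 fixes z k :: complex
 shows "1/4 * (1 - (cmod (z + k))^2)^2 = 1/4 * (1 - (cmod z)^2)^2 - cub z \<bullet> k
  + (1/2 * ((cmod z)^2 - 1) * (cmod k)^2 + 1/4 * (2 * (z \<bullet> k) + (cmod k)^2)^2)"
proof -
 have *: "(cmod (z + k))^2 = (cmod z)^2 + (2 * (z \<bullet> k) + (cmod k)^2)"
  by (simp add: power2_norm_eq_inner inner_add_left inner_add_right inner_commute)
 show ?thesis unfolding * cub_def by (simp add: power2_eq_square algebra_simps)
qed

lemma quartic_remainder_le:
 fixes z k :: complex
 shows "\<bar>1/2 * ((cmod z)^2 - 1) * (cmod k)^2 + 1/4 * (2 * (z \<bullet> k) + (cmod k)^2)^2\<bar>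
  <= 1/2 * (cmod k)^2 + 5/2 * ((cmod z)^2 * (cmod k)^2) + 1/2 * ((cmod k)^2 * (cmod k)^2)"
proof -
 define a b q where "a = (cmod z)^2" and "b = (cmod k)^2" and "q = z \<bullet> k"
 have ab: "0 <= a" "0 <= b" by (auto simp: a_def b_def)
 have "q^2 <= a * b" unfolding q_def a_def b_def using Cauchy_Schwarz_ineq[of z k] by (simp add: power2_norm_eq_inner)
 moreover have "(2 * q + b)^2 <= 2 * (2 * q)^2 + 2 * b^2"
 proof -
  have "0 <= (2 * q - b)^2" by simp
  then show ?thesis by (simp add: power2_eq_square algebra_simps)
 qed
 ultimately have s: "(2 * q + b)^2 <= 8 * (a * b) + 2 * (b * b)" by (simp add: power2_eq_square)
 have "0 <= (2 * q + b)^2" by simp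
 have h: "1/2 * (a - 1) * b = 1/2 * (a * b) - 1/2 * b" by (simp add: field_simps)
 have "0 <= a * b" "0 <= b * b" using ab by simp_all
 then have "\<bar>1/2 * (a - 1) * b + 1/4 * (2 * q + b)^2\<bar> <= 1/2 * b + 5/2 * (a * b) + 1/2 * (b * b)"
  unfolding h using s \<open>0 <= (2 * q + b)^2\<close> ab by (intro abs_leI) linarith+
 then show ?thesis by (simp add: a_def b_def q_def)
qed

section \<open>Regularity, coercivity and compactness\<close>

lemma H1_per_L4_bound:
 assumes N: "CARD('n) <= 3" and T: "T > 0"
 shows "EX K>=0. ALL u : (H1_per T :: (real ^ 'n => complex) set). Lp 4 (cm T) u \<and> lpn 4 (cm T) u <= K * H1_norm T u"
proof -
 obtain C where C: "C >= 0" "ALL u : (H1_per T :: (real ^ 'n => complex) set). Lp 4 (cm T) u \<and> lpn 4 (cm T) u <= 1 * H1_norm T u + C * lpn 2 (cm T) u"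
  using H1_per_L4[OF N T zero_less_one] by (elim exE conjE)
 show ?thesis
 proof (intro exI[of _ "1 + C"] conjI ballI)
  fix u :: "real ^ 'n => complex" assume u: "u \<in> H1_per T"
  show "Lp 4 (cm T) u" using C u by blast
  have "C * lpn 2 (cm T) u <= C * H1_norm T u" by (intro mult_left_mono lpn_le_H1_norm(1)[OF T u] C(1))
  then show "lpn 4 (cm T) u <= (1 + C) * H1_norm T u" using C(2)[rule_format, OF u] by (simp add: algebra_simps)
 qed (use C in simp)
qed

lemma Dir_le:
 fixes u v :: "real ^ 'n => complex"
 assumes T: "T > 0" and u: "u \<in> H1_per T" and v: "v \<in> H1_per T"
 shows "\<bar>Dir T u v\<bar> <= real CARD('n) * (H1_norm T u * H1_norm T v)"
proof -
 have "\<bar>Dir T u v\<bar> <= (\<Sum>k\<in>UNIV. \<bar>\<integral>x. wp k u x \<bullet> wp k v x \<partial>cm T\<bar>)" unfolding Dir_def by (rule sum_abs)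
 also have "... <= (\<Sum>k\<in>(UNIV :: 'n set). H1_norm T u * H1_norm T v)"
 proof (rule sum_mono)
  fix k
  have "\<bar>\<integral>x. wp k u x \<bullet> wp k v x \<partial>cm T\<bar> <= lpn 2 (cm T) (wp k u) * lpn 2 (cm T) (wp k v)"
   by (rule integrable_inner_L2(2)[OF H1_perD(6)[OF T u] H1_perD(6)[OF T v]])
  also have "... <= H1_norm T u * H1_norm T v"
   using T u v by (intro mult_mono lpn_le_H1_norm) auto
  finally show "\<bar>\<integral>x. wp k u x \<bullet> wp k v x \<partial>cm T\<bar> <= H1_norm T u * H1_norm T v" .
 qed
 finally show ?thesis by simp
qed

lemma Mom_le_H1:
 assumes "T > 0" "u \<in> H1_per T" "v \<in> H1_per T"
 shows "\<bar>Mom j T u v\<bar> <= H1_norm T u * H1_norm T v"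
 by (rule order_trans[OF Mom_le[OF assms] mult_mono]) (use assms in "auto intro: lpn_le_H1_norm")

lemma dact_add_right:
 fixes u v w :: "real ^ 'n => complex"
 assumes N: "CARD('n) <= 3" and T: "T > 0" and u: "u \<in> H1_per T" and v: "v \<in> H1_per T" and w: "w \<in> H1_per T"
 shows "dact j T c u (v + w) = dact j T c u v + dact j T c u w"
proof -
 obtain K where K: "K >= 0" "ALL u : (H1_per T :: (real ^ 'n => complex) set). Lp 4 (cm T) u \<and> lpn 4 (cm T) u <= K * H1_norm T u"
  using H1_per_L4_bound[OF N T] by (elim exE conjE)
 have L4: "Lp 4 (cm T) f" if "f \<in> H1_per T" for f :: "real ^ 'n => complex" using K(2) that by blast
 note L2 = H1_perD(5)[OF T]
 have "(LINT x|cm T. cub (u x) \<bullet> (v + w) x) = (LINT x|cm T. cub (u x) \<bullet> v x) + (LINT x|cm T. cub (u x) \<bullet> w x)"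
  using cub_inner_integrable(1)[OF L2[OF u] L4[OF u] L2[OF v] L4[OF v]] cub_inner_integrable(1)[OF L2[OF u] L4[OF u] L2[OF w] L4[OF w]]
  by (simp add: inner_add_right)
 moreover have "Dir T u (v + w) = Dir T u v + Dir T u w" using Dir_add[OF T v w u] by (simp add: Dir_sym)
 moreover have "Mom j T u (v + w) = Mom j T u v + Mom j T u w"
  using Mom_add[OF T v w u, of j] Mom_sym[OF T u H1_per_add[OF T v w], of j] Mom_sym[OF T u v, of j] Mom_sym[OF T u w, of j] by simp
 ultimately show ?thesis by (simp add: dact_def algebra_simps)
qed

lemma dact_scaleR_right:
 fixes u v :: "real ^ 'n => complex"
 assumes T: "T > 0" and u: "u \<in> H1_per T" and v: "v \<in> H1_per T"
 shows "dact j T c u (r *R v) = r * dact j T c u v"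
proof -
 have "(LINT x|cm T. cub (u x) \<bullet> (r *R v) x) = r * (LINT x|cm T. cub (u x) \<bullet> v x)" by (simp add: scaleR_fun_def)
 moreover have "Dir T u (r *R v) = r * Dir T u v" using Dir_scaleR[OF T v u] by (simp add: Dir_sym)
 moreover have "Mom j T u (r *R v) = r * Mom j T u v"
  using Mom_scaleR[OF T v u, of j r] Mom_sym[OF T u H1_per_scaleR[OF T v], of j] Mom_sym[OF T u v, of j] by simp
 ultimately show ?thesis by (simp add: dact_def algebra_simps)
qed

lemma dact_diff_left:
 fixes u w v :: "real ^ 'n => complex"
 assumes T: "T > 0" and u: "u \<in> H1_per T" and w: "w \<in> H1_per T" and v: "v \<in> H1_per T"
 shows "dact j T c u v - dact j T c w v = Dir T (u - w) v - c * Mom j T (u - w) v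
  - ((LINT x|cm T. cub (u x) \<bullet> v x) - (LINT x|cm T. cub (w x) \<bullet> v x))"
proof -
 have d: "u - w \<in> H1_per T" by (rule H1_per_diff[OF T u w])
 have "Dir T u v = Dir T (u - w) v + Dir T w v" using Dir_add[OF T d w v] by simp
 moreover have "Mom j T u v = Mom j T (u - w) v + Mom j T w v" using Mom_add[OF T d w v, of j] by simp
 ultimately show ?thesis by (simp add: dact_def algebra_simps)
qed

lemma quartic_integrable:
 fixes u :: "real ^ 'n => complex"
 assumes u: "Lp 2 (cm T) u" "Lp 4 (cm T) u"
 shows "integrable (cm T) (%x. (1 - (cmod (u x))^2)^2)"
proof -
 interpret finite_measure "cm T :: (real ^ 'n) measure" by (rule finite_measure_cm)
 have "integrable (cm T) (%x. 1 - 2 * (cmod (u x))^2 + (cmod (u x))^2 * (cmod (u x))^2)"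
  using L4_products(1)[OF u(2) u(2)] Lp_integrable[OF u(1)] by simp
 then show ?thesis by (simp add: power2_eq_square algebra_simps)
qed

text \<open>
The quadratic parts of the action expand exactly. The remainder of the potential is a quartic polynomial in \<open>h\<close> without constant and linear terms, bounded by \<open>L\<^sup>4\<close> norms.
\<close>

lemma action_expansion:
 fixes u h :: "real ^ 'n => complex"
 assumes N: "CARD('n) <= 3" and T: "T > 0" and u: "u \<in> H1_per T" and h: "h \<in> H1_per T"
  and u4: "Lp 4 (cm T) u" and h4: "Lp 4 (cm T) h"
 defines "R \<equiv> (%x. 1/2 * ((cmod (u x))^2 - 1) * (cmod (h x))^2 + 1/4 * (2 * (u x \<bullet> h x) + (cmod (h x))^2)^2)"
 shows "action j T c (u + h) = action j T c u + dact j T c u h + (1/2 * Dir T h h - c/2 * Mom j T h h + (LINT x|cm T. R x))"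
  and "integrable (cm T) R"
  and "\<bar>\<integral>x. R x \<partial>cm T\<bar> <= 1/2 * (lpn 2 (cm T) h)^2 + 5/2 * ((lpn 4 (cm T) u)^2 * (lpn 4 (cm T) h)^2) + 1/2 * ((lpn 4 (cm T) h)^2 * (lpn 4 (cm T) h)^2)"
proof -
 note U = H1_perD[OF T u] and H = H1_perD[OF T h]
 have uh: "u + h \<in> H1_per T" by (rule H1_per_add[OF T u h])
 have uh4: "Lp 4 (cm T) (u + h)" using Lp_add[OF u4 h4] by (simp add: plus_fun_def)
 define B where "B x = 1/2 * (cmod (h x))^2 + 5/2 * ((cmod (u x))^2 * (cmod (h x))^2) + 1/2 * ((cmod (h x))^2 * (cmod (h x))^2)" for x
 note P = L4_products[OF u4 h4] and Q = L4_products[OF h4 h4]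
 have iB: "integrable (cm T) B" unfolding B_def using P(1) Q(1) Lp_integrable[OF H(5)] by simp
 have le: "\<bar>R x\<bar> <= B x" for x unfolding R_def B_def by (rule quartic_remainder_le)
 have um: "u \<in> bmeas (cm T)" "h \<in> bmeas (cm T)" using measurable_cm U(2) H(2) by blast+
 have Rm: "R \<in> bmeas (cm T)" unfolding R_def using um by measurable
 show iR: "integrable (cm T) R"
  by (rule Bochner_Integration.integrable_bound[OF iB Rm]) (intro AE_I2, use le in "simp add: order_trans[OF le abs_ge_self]")
 have "\<bar>\<integral>x. R x \<partial>cm T\<bar> <= (LINT x|cm T. \<bar>R x\<bar>)" by (rule integral_abs_bound)
 also have "... <= (LINT x|cm T. B x)" by (rule integral_mono[OF integrable_abs[OF iR] iB le])
 also have "... = 1/2 * (lpn 2 (cm T) h)^2 + 5/2 * (LINT x|cm T. (cmod (u x))^2 * (cmod (h x))^2) + 1/2 * (LINT x|cm T. (cmod (h x))^2 * (cmod (h x))^2)"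
  unfolding B_def using P(1) Q(1) Lp_integrable[OF H(5)] by (simp add: lpn_power)
 also have "... <= 1/2 * (lpn 2 (cm T) h)^2 + 5/2 * ((lpn 4 (cm T) u)^2 * (lpn 4 (cm T) h)^2) + 1/2 * ((lpn 4 (cm T) h)^2 * (lpn 4 (cm T) h)^2)"
  by (intro add_mono mult_left_mono P(2) Q(2)) auto
 finally show "\<bar>\<integral>x. R x \<partial>cm T\<bar> <= 1/2 * (lpn 2 (cm T) h)^2 + 5/2 * ((lpn 4 (cm T) u)^2 * (lpn 4 (cm T) h)^2) + 1/2 * ((lpn 4 (cm T) h)^2 * (lpn 4 (cm T) h)^2)" .
 have D: "Dir T (u + h) (u + h) = Dir T u u + 2 * Dir T u h + Dir T h h"
  using Dir_add[OF T u h uh] Dir_add[OF T u h u] Dir_add[OF T u h h] Dir_sym[of T u "u + h"] Dir_sym[of T h "u + h"] Dir_sym[of T h u] by simp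
 have M: "Mom j T (u + h) (u + h) = Mom j T u u + 2 * Mom j T u h + Mom j T h h"
  using Mom_add[OF T u h uh, of j] Mom_add[OF T u h u, of j] Mom_add[OF T u h h, of j] Mom_sym[OF T u uh, of j] Mom_sym[OF T h uh, of j] Mom_sym[OF T h u, of j] by simp
 note iq = quartic_integrable[OF U(5) u4] and ic = cub_inner_integrable(1)[OF U(5) u4 H(5) h4]
 have "1/4 * (LINT x|cm T. (1 - (cmod ((u + h) x))^2)^2) = (LINT x|cm T. 1/4 * (1 - (cmod (u x + h x))^2)^2)" by simp
 also have "... = (LINT x|cm T. 1/4 * (1 - (cmod (u x))^2)^2 - cub (u x) \<bullet> h x + R x)"
  unfolding quartic_expansion R_def ..
 also have "... = 1/4 * (LINT x|cm T. (1 - (cmod (u x))^2)^2) - (LINT x|cm T. cub (u x) \<bullet> h x) + (LINT x|cm T. R x)"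
  using iq ic iR by simp
 finally have W: "1/4 * (LINT x|cm T. (1 - (cmod ((u + h) x))^2)^2) = \<dots>" .
 show "action j T c (u + h) = action j T c u + dact j T c u h + (1/2 * Dir T h h - c/2 * Mom j T h h + (LINT x|cm T. R x))"
  unfolding action_eq[OF T uh] action_eq[OF T u] dact_def D M W by (simp add: algebra_simps)
qed

lemma action_regular:
 fixes j :: "'n::finite"
 assumes N: "CARD('n) <= 3" and T: "T > 0"
 shows "EX L>=0. ALL u:H1_per T. H1_norm T u <= R -->
    (ALL v:H1_per T. \<bar>dact j T c u v\<bar> <= L * H1_norm T v) \<and>
    (ALL w:H1_per T. H1_norm T w <= R --> (ALL v:H1_per T. \<bar>dact j T c u v - dact j T c w v\<bar> <= L * H1_norm T (u - w) * H1_norm T v)) \<and>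
    (ALL h:H1_per T. H1_norm T h <= 1 --> \<bar>action j T c (u + h) - action j T c u - dact j T c u h\<bar> <= L * (H1_norm T h)^2)"
proof -
 obtain K where K: "K >= 0" "ALL u : (H1_per T :: (real ^ 'n => complex) set). Lp 4 (cm T) u \<and> lpn 4 (cm T) u <= K * H1_norm T u"
  using H1_per_L4_bound[OF N T] by (elim exE conjE)
 have L4: "Lp 4 (cm T) f" "lpn 4 (cm T) f <= K * H1_norm T f" if "f \<in> H1_per T" for f :: "real ^ 'n => complex" using K(2) that by blast+
 note L2 = H1_perD(5)[OF T] and n2 = lpn_le_H1_norm(1)[OF T] and nn = H1_norm_nonneg[OF T]
 define r where "r = max R 0"
 have r: "0 <= r" "R <= r" by (auto simp: r_def)
 define n where "n = real CARD('n)"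
 have n: "0 <= n" by (simp add: n_def)
 define L0 where "L0 = n + \<bar>c\<bar> + 2 + 3 * (K * r)^2 * K^2 + K ^ 4"
 define L where "L = L0 * (r + 1)"
 have L0: "0 <= L0" using n by (simp add: L0_def)
 then have L: "0 <= L" "L0 <= L" "L0 * r <= L" using r by (auto simp: L_def mult_le_cancel_left1 mult_left_mono intro: order_trans)
 have K4: "lpn 4 (cm T) f <= K * r" if "f \<in> H1_per T" "H1_norm T f <= R" for f :: "real ^ 'n => complex"
  by (rule order_trans[OF L4(2)[OF that(1)]]) (use that r K in "auto intro: mult_left_mono")
 have A: "\<bar>dact j T c u v\<bar> <= L * H1_norm T v" if u: "u \<in> H1_per T" "H1_norm T u <= R" and v: "v \<in> H1_per T" for u v
 proof -
  have "\<bar>dact j T c u v\<bar> <= \<bar>Dir T u v\<bar> + \<bar>c\<bar> * \<bar>Mom j T u v\<bar> + \<bar>\<integral>x. cub (u x) \<bullet> v x \<partial>cm T\<bar>"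
   unfolding dact_def abs_mult[symmetric] by linarith
  also have "... <= n * (H1_norm T u * H1_norm T v) + \<bar>c\<bar> * (H1_norm T u * H1_norm T v) + (1 * (H1_norm T u * H1_norm T v) + (K * r)^2 * K^2 * (H1_norm T u * H1_norm T v))"
  proof (intro add_mono mult_left_mono)
   show "\<bar>Dir T u v\<bar> <= n * (H1_norm T u * H1_norm T v)" unfolding n_def by (rule Dir_le[OF T u(1) v])
   show "\<bar>Mom j T u v\<bar> <= H1_norm T u * H1_norm T v" by (rule Mom_le_H1[OF T u(1) v])
   have "\<bar>\<integral>x. cub (u x) \<bullet> v x \<partial>cm T\<bar> <= lpn 2 (cm T) u * lpn 2 (cm T) v + lpn 4 (cm T) u ^ 3 * lpn 4 (cm T) v"
    by (rule cub_inner_integrable(2)[OF L2[OF u(1)] L4(1)[OF u(1)] L2[OF v] L4(1)[OF v]])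
   also have "lpn 4 (cm T) u ^ 3 * lpn 4 (cm T) v = (lpn 4 (cm T) u)^2 * (lpn 4 (cm T) u * lpn 4 (cm T) v)" by (simp add: power3_eq_cube power2_eq_square)
   also have "lpn 2 (cm T) u * lpn 2 (cm T) v + \<dots> <= H1_norm T u * H1_norm T v + (K * r)^2 * ((K * H1_norm T u) * (K * H1_norm T v))"
    using K r u v by (intro add_mono mult_mono power_mono n2 L4(2) K4) (auto intro!: mult_nonneg_nonneg nn)
   finally show "\<bar>\<integral>x. cub (u x) \<bullet> v x \<partial>cm T\<bar> <= 1 * (H1_norm T u * H1_norm T v) + (K * r)^2 * K^2 * (H1_norm T u * H1_norm T v)"
    by (simp add: power2_eq_square mult_ac)
  qed simp
  also have "... = (n + \<bar>c\<bar> + 1 + (K * r)^2 * K^2) * (H1_norm T u * H1_norm T v)" by (simp add: algebra_simps)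
  also have "... <= L0 * (H1_norm T u * H1_norm T v)"
   using u v K by (intro mult_right_mono) (auto simp: L0_def nn)
  also have "... <= L0 * (r * H1_norm T v)" using L0 u v r by (intro mult_left_mono mult_right_mono) (auto simp: nn)
  also have "... <= L * H1_norm T v" using L(3) nn[OF v] by (simp add: mult.assoc[symmetric] mult_right_mono)
  finally show ?thesis .
 qed
 have B: "\<bar>dact j T c u v - dact j T c w v\<bar> <= L * H1_norm T (u - w) * H1_norm T v"
  if u: "u \<in> H1_per T" "H1_norm T u <= R" and w: "w \<in> H1_per T" "H1_norm T w <= R" and v: "v \<in> H1_per T" for u w v
 proof -
  have d: "u - w \<in> H1_per T" by (rule H1_per_diff[OF T u(1) w(1)])
  let ?P = "H1_norm T (u - w) * H1_norm T v"
  have P0: "0 <= ?P" using nn[OF d] nn[OF v] by simp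
  have "\<bar>dact j T c u v - dact j T c w v\<bar> <= \<bar>Dir T (u - w) v\<bar> + \<bar>c\<bar> * \<bar>Mom j T (u - w) v\<bar> + \<bar>(LINT x|cm T. cub (u x) \<bullet> v x) - (LINT x|cm T. cub (w x) \<bullet> v x)\<bar>"
   unfolding dact_diff_left[OF T u(1) w(1) v] abs_mult[symmetric] by linarith
  also have "... <= n * ?P + \<bar>c\<bar> * ?P + (?P + 3 * (K * r)^2 * K^2 * ?P)"
  proof (intro add_mono mult_left_mono)
   show "\<bar>Dir T (u - w) v\<bar> <= n * ?P" unfolding n_def by (rule Dir_le[OF T d v])
   show "\<bar>Mom j T (u - w) v\<bar> <= ?P" by (rule Mom_le_H1[OF T d v])
   let ?a = "lpn 4 (cm T) u" and ?b = "lpn 4 (cm T) w"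
   have ab: "?a <= K * r" "?b <= K * r" "0 <= ?a" "0 <= ?b" using K4 u w by auto
   have "?a^2 + ?a * ?b + ?b^2 <= (K * r)^2 + (K * r) * (K * r) + (K * r)^2"
    using ab K r by (intro add_mono power_mono mult_mono) auto
   then have q: "?a^2 + ?a * ?b + ?b^2 <= 3 * (K * r)^2" unfolding power2_eq_square by linarith
   have "\<bar>(LINT x|cm T. cub (u x) \<bullet> v x) - (LINT x|cm T. cub (w x) \<bullet> v x)\<bar> <= lpn 2 (cm T) (u - w) * lpn 2 (cm T) v
     + (?a^2 + ?a * ?b + ?b^2) * lpn 4 (cm T) (u - w) * lpn 4 (cm T) v"
    by (rule cub_diff_inner[OF L2[OF u(1)] L4(1)[OF u(1)] L2[OF w(1)] L4(1)[OF w(1)] L2[OF v] L4(1)[OF v]])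
   also have "... <= H1_norm T (u - w) * H1_norm T v + (3 * (K * r)^2) * (K * H1_norm T (u - w)) * (K * H1_norm T v)"
    using K r d v q by (intro add_mono mult_mono n2 L4(2)) (auto intro!: mult_nonneg_nonneg nn)
   finally show "\<bar>(LINT x|cm T. cub (u x) \<bullet> v x) - (LINT x|cm T. cub (w x) \<bullet> v x)\<bar> <= ?P + 3 * (K * r)^2 * K^2 * ?P"
    by (simp add: power2_eq_square mult_ac)
  qed simp
  also have "... = (n + \<bar>c\<bar> + 1 + 3 * (K * r)^2 * K^2) * ?P" by (simp add: algebra_simps)
  also have "... <= L * ?P"
  proof (rule mult_right_mono[OF _ P0])
   have "0 <= K ^ 4" by simp
   then show "n + \<bar>c\<bar> + 1 + 3 * (K * r)^2 * K^2 <= L" using L(2) unfolding L0_def by linarith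
  qed
  finally show ?thesis by (simp add: mult.assoc)
 qed
 have C: "\<bar>action j T c (u + h) - action j T c u - dact j T c u h\<bar> <= L * (H1_norm T h)^2"
  if u: "u \<in> H1_per T" "H1_norm T u <= R" and h: "h \<in> H1_per T" "H1_norm T h <= 1" for u h
 proof -
  note E = action_expansion[OF N T u(1) h(1) L4(1)[OF u(1)] L4(1)[OF h(1)]]
  let ?h = "(H1_norm T h)^2"
  have h0: "0 <= H1_norm T h" by (rule nn[OF h(1)])
  have D: "\<bar>1/2 * Dir T h h\<bar> <= 1/2 * ?h" using Dir_nonneg[OF T h(1)] H1_norm_Dir[OF T h(1)] by simp
  have M: "\<bar>c/2 * Mom j T h h\<bar> <= \<bar>c\<bar> / 2 * ?h"
   using mult_left_mono[OF Mom_le_H1[OF T h(1) h(1), of j], of "\<bar>c\<bar>/2"] by (simp add: abs_mult power2_eq_square)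
  have l2: "(lpn 2 (cm T) h)^2 <= ?h" by (intro power_mono n2 h) simp
  have l4: "(lpn 4 (cm T) h)^2 <= K^2 * ?h" using power_mono[OF L4(2)[OF h(1)], of 2] by (simp add: power_mult_distrib)
  have u4: "(lpn 4 (cm T) u)^2 <= (K * r)^2" by (intro power_mono K4 u) simp
  have h1: "?h <= 1" using h h0 by (simp add: power_le_one)
  have "1/2 * (lpn 2 (cm T) h)^2 + 5/2 * ((lpn 4 (cm T) u)^2 * (lpn 4 (cm T) h)^2) + 1/2 * ((lpn 4 (cm T) h)^2 * (lpn 4 (cm T) h)^2)
    <= 1/2 * ?h + 5/2 * ((K * r)^2 * (K^2 * ?h)) + 1/2 * ((K^2 * ?h) * (K^2 * ?h))"
   by (intro add_mono mult_left_mono mult_mono l2 l4 u4) auto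
  also have "(K^2 * ?h) * (K^2 * ?h) <= (K^2 * ?h) * (K^2 * 1)" using h1 by (intro mult_left_mono) auto
  also have "(K^2 * ?h) * (K^2 * 1) = K ^ 4 * ?h" by (simp add: power2_eq_square power4_eq_xxxx)
  finally have R: "1/2 * (lpn 2 (cm T) h)^2 + 5/2 * ((lpn 4 (cm T) u)^2 * (lpn 4 (cm T) h)^2) + 1/2 * ((lpn 4 (cm T) h)^2 * (lpn 4 (cm T) h)^2)
    <= 1/2 * ?h + 5/2 * ((K * r)^2 * (K^2 * ?h)) + 1/2 * (K ^ 4 * ?h)" by simp
  have "\<bar>action j T c (u + h) - action j T c u - dact j T c u h\<bar> <= 1/2 * ?h + \<bar>c\<bar> / 2 * ?h + (1/2 * ?h + 5/2 * ((K * r)^2 * (K^2 * ?h)) + 1/2 * (K ^ 4 * ?h))"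
   using D M order_trans[OF E(3) R] unfolding E(1) by linarith
  also have "... = (1 + \<bar>c\<bar> / 2 + 5/2 * ((K * r)^2 * K^2) + 1/2 * K ^ 4) * ?h" by (simp add: algebra_simps)
  also have "... <= L * ?h"
  proof (rule mult_right_mono)
   have "0 <= (K * r)^2 * K^2" "0 <= K ^ 4" by simp_all
   then have "1 + \<bar>c\<bar> / 2 + 5/2 * ((K * r)^2 * K^2) + 1/2 * K ^ 4 <= L0" unfolding L0_def using n by linarith
   then show "1 + \<bar>c\<bar> / 2 + 5/2 * ((K * r)^2 * K^2) + 1/2 * K ^ 4 <= L" using L(2) by linarith
  qed simp
  finally show ?thesis .
 qed
 show ?thesis using L(1) A B C by (intro exI[of _ L]) auto
qed

text \<open>
Pointwise the potential lies above any line in \<open>|u|\<^sup>2\<close> of prescribed slope, up to a constant; the slope \<open>c\<^sup>2/4 + 1\<close> pays for the mass that dominates the momentum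
and leaves the \<open>L\<^sup>2\<close> part of the norm.
\<close>

lemma action_lower:
 fixes u :: "real ^ 'n => complex" and j :: 'n
 assumes N: "CARD('n) <= 3" and T: "T > 0" and u: "u \<in> H1_per T"
 shows "1/4 * (H1_norm T u)^2 <= action j T c u + (3/2 + c^2/4)^2 * T ^ CARD('n)"
proof -
 note U = H1_perD[OF T u]
 interpret F: finite_measure "cm T :: (real ^ 'n) measure" by (rule finite_measure_cm)
 obtain K where K: "K >= 0" "ALL u : (H1_per T :: (real ^ 'n => complex) set). Lp 4 (cm T) u \<and> lpn 4 (cm T) u <= K * H1_norm T u"
  using H1_per_L4_bound[OF N T] by (elim exE conjE)
 have u4: "Lp 4 (cm T) u" using K u by blast
 define a where "a = 3/2 + c^2/4"
 have ptw: "(c^2/4 + 1) * s - a^2 <= 1/4 * (1 - s)^2" for s :: real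
 proof -
  have "0 <= (s / 2 - a)^2 + 1/4" by simp
  then show ?thesis by (simp add: a_def power2_eq_square algebra_simps)
 qed
 have "(LINT x|cm T. (c^2/4 + 1) * (cmod (u x))^2 - a^2) <= (LINT x|cm T. 1/4 * (1 - (cmod (u x))^2)^2)"
  by (rule integral_mono) (use ptw Lp_integrable[OF U(5)] quartic_integrable[OF U(5) u4] in auto)
 then have W: "(c^2/4 + 1) * (lpn 2 (cm T) u)^2 - a^2 * T ^ CARD('n) <= 1/4 * (LINT x|cm T. (1 - (cmod (u x))^2)^2)"
  using Lp_integrable[OF U(5)] measure_cm[of T, where 'n = 'n] T by (simp add: lpn_power mult.commute)
 let ?d = "lpn 2 (cm T) (wp j u)" and ?m = "lpn 2 (cm T) u"
 have dD: "?d^2 <= Dir T u u" unfolding Dir_self[OF T u] by (rule member_le_sum[of j UNIV "%k. (lpn 2 (cm T) (wp k u))^2"]) auto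
 have "\<bar>c/2 * Mom j T u u\<bar> <= \<bar>c\<bar>/2 * (?d * ?m)"
  using mult_left_mono[OF Mom_le[OF T u u, of j], of "\<bar>c\<bar>/2"] by (simp add: abs_mult)
 also have "... <= 1/4 * ?d^2 + c^2/4 * ?m^2"
 proof -
  have "0 <= (?d / 2 - \<bar>c\<bar> * ?m / 2)^2" by simp
  also have "... = 1/4 * ?d^2 + c^2/4 * ?m^2 - \<bar>c\<bar>/2 * (?d * ?m)"
   by (simp add: power2_diff power_mult_distrib power_divide)
  finally show ?thesis by simp
 qed
 finally have M: "\<bar>c/2 * Mom j T u u\<bar> <= 1/4 * ?d^2 + c^2/4 * ?m^2" .
 have Wm: "c^2/4 * ?m^2 + ?m^2 - a^2 * T ^ CARD('n) <= 1/4 * (LINT x|cm T. (1 - (cmod (u x))^2)^2)" using W by (simp add: algebra_simps)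
 have "0 <= ?m^2" "0 <= Dir T u u" using Dir_nonneg[OF T u] by simp_all
 moreover have "1/4 * (D + m) <= 1/2 * D + w - o' + A" if "0 <= m" "0 <= D" "d <= D" "\<bar>o'\<bar> <= 1/4 * d + C" "C + m - A <= w" for D m w o' A d C :: real
  using that unfolding distrib_left by linarith
 ultimately show ?thesis unfolding action_eq[OF T u] H1_norm_Dir[OF T u] a_def[symmetric] using Wm M dD by blast
qed

lemma action_coercive:
 assumes N: "CARD('n) <= 3" and T: "T > 0"
 shows "EX R. ALL u : (H1_per T :: (real ^ 'n => complex) set). action j T c u <= K --> H1_norm T u <= R"
proof (intro exI ballI impI)
 fix u :: "real ^ 'n => complex" assume u: "u \<in> H1_per T" "action j T c u <= K"
 have "x <= 4 * (K + y)" if "1/4 * x <= a + y" "a <= K" for x y a :: real using that unfolding distrib_left by linarith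
 from this[OF action_lower[OF N T u(1)] u(2)]
 have "(H1_norm T u)^2 <= 4 * (K + (3/2 + c^2/4)^2 * T ^ CARD('n))" .
 then show "H1_norm T u <= sqrt (4 * (K + (3/2 + c^2/4)^2 * T ^ CARD('n)))" by (rule real_le_rsqrt)
qed

text \<open>
For two members \<open>u\<close> and \<open>w\<close> of the sequence with difference \<open>v\<close>, the Dirichlet energy of \<open>v\<close> equals the difference of the derivatives in direction \<open>v\<close>, which is small by hypothesis, plus
momentum and potential terms. Those contain at least one factor that is an \<open>L\<^sup>2\<close> or \<open>L\<^sup>4\<close> norm of \<open>v\<close>, small along a subsequence by Rellich's theorem.
\<close>

lemma palais_smale:
 fixes f :: "nat => real ^ 'n => complex" and j :: 'n
 assumes N: "CARD('n) <= 3" and T: "T > 0" and f: "!!n. f n \<in> H1_per T" and R: "!!n. H1_norm T (f n) <= R"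
  and d: "!!n v. v \<in> H1_per T ==> \<bar>dact j T c (f n) v\<bar> <= 1 / Suc n * H1_norm T v"
 shows "EX r u. strict_mono r \<and> u \<in> H1_per T \<and> (%n. H1_norm T (f (r n) - u)) ---> 0"
proof -
 interpret H: semi_hilbert "H1_per T :: (real ^ 'n => complex) set" "H1_inner T" "H1_norm T" by (rule H1_semi_hilbert[OF T])
 obtain K where K: "K >= 0" "ALL u : (H1_per T :: (real ^ 'n => complex) set). Lp 4 (cm T) u \<and> lpn 4 (cm T) u <= K * H1_norm T u"
  using H1_per_L4_bound[OF N T] by (elim exE conjE)
 have L4: "Lp 4 (cm T) f" "lpn 4 (cm T) f <= K * H1_norm T f" if "f \<in> H1_per T" for f :: "real ^ 'n => complex" using K(2) that by blast+
 note L2 = H1_perD(5)[OF T]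
 have R0: "0 <= R" using order_trans[OF H1_norm_nonneg[OF T f] R] .
 obtain r :: "nat => nat" where r: "strict_mono r" "ALL e>0. EX N. ALL m>=N. ALL n>=N. lpn 2 (cm T) (f (r m) - f (r n)) < e"
  using H1_per_rellich[of T f R, OF T f R] by (elim exE conjE)
 define \<rho> where "\<rho> = K * R"
 have \<rho>: "0 <= \<rho>" using K R0 by (simp add: \<rho>_def)
 have cauchy: "EX N. ALL m>=N. ALL n>=N. H1_norm T (f (r m) - f (r n)) < \<delta>" if \<delta>: "\<delta> > 0" for \<delta>
 proof -
  \<comment> \<open>The \<open>L\<^sup>4\<close> norm of a difference will be at most \<open>e (2 R + 1)\<close>; its product with the \<open>L\<^sup>4\<close> bound \<open>\<rho>\<close> of the sequence is then at most \<open>\<delta> / 4\<close>.\<close>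
  define e where "e = \<delta> / (4 * (\<rho> + 1) * (2 * R + 1))"
  have e: "e > 0" using \<delta> \<rho> R0 by (simp add: e_def)
  obtain C where C: "C >= 0" "ALL u : (H1_per T :: (real ^ 'n => complex) set). Lp 4 (cm T) u \<and> lpn 4 (cm T) u <= e * H1_norm T u + C * lpn 2 (cm T) u"
   using H1_per_L4[OF N T e] by (elim exE conjE)
  define \<eta> where "\<eta> = min (e / (C + 1)) (min (\<delta> / 4) (\<delta>^2 / (16 * (\<bar>c\<bar> * R + 1))))"
  have \<eta>: "\<eta> > 0" using e C \<delta> R0 by (simp add: \<eta>_def add_nonneg_pos)
  have \<eta>1: "C * \<eta> <= e"
  proof -
   have "C * \<eta> <= (C + 1) * (e / (C + 1))" using C \<eta> by (intro mult_mono) (auto simp: \<eta>_def)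
   then show ?thesis using C by simp
  qed
  have \<eta>2: "\<eta> <= \<delta> / 4" unfolding \<eta>_def by (rule order_trans[OF min.cobounded2 min.cobounded1])
  have \<eta>3: "2 * R * \<bar>c\<bar> * \<eta> <= \<delta>^2 / 8"
  proof -
   have "(\<bar>c\<bar> * R) * \<eta> <= (\<bar>c\<bar> * R + 1) * (\<delta>^2 / (16 * (\<bar>c\<bar> * R + 1)))" using R0 \<eta> by (intro mult_mono) (auto simp: \<eta>_def)
   also have "... = \<delta>^2 / 16"
   proof -
    have "D * (x / (16 * D)) = x / 16" if "D ~= 0" for D x :: real using that by simp
    moreover have "\<bar>c\<bar> * R + 1 ~= 0" using R0 by (simp add: add_nonneg_eq_0_iff)
    ultimately show ?thesis by blast
   qed
   finally show ?thesis by (simp add: mult_ac)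
  qed
  obtain N1 where N1: "ALL m>=N1. ALL n>=N1. lpn 2 (cm T) (f (r m) - f (r n)) < \<eta>" using r(2) \<eta> by blast
  obtain N2 where N2: "64 * R / \<delta>^2 < real N2" using reals_Archimedean2 by blast
  have small: "1 / real (Suc (r m)) * (2 * R) <= \<delta>^2 / 16" if "m >= N2" for m
  proof -
   have "real N2 <= real (Suc (r m))" using seq_suble[OF r(1), of m] that by simp
   then have le: "64 * R / \<delta>^2 <= real (Suc (r m))" using N2 by linarith
   then have "64 * R <= \<delta>^2 * real (Suc (r m))" using \<delta> by (simp add: field_simps)
   then have "2 * R * 16 <= \<delta>^2 * real (Suc (r m))" using R0 by linarith
   then show ?thesis by (simp add: field_simps)
  qed
  have "H1_norm T (f (r m) - f (r n)) < \<delta>" if mn: "m >= N1 + N2" "n >= N1 + N2" for m n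
  proof -
   define u w v where "u = f (r m)" and "w = f (r n)" and "v = u - w"
   have u: "u \<in> H1_per T" "H1_norm T u <= R" and w: "w \<in> H1_per T" "H1_norm T w <= R" using f R by (auto simp: u_def w_def)
   have v: "v \<in> H1_per T" unfolding v_def by (rule H1_per_diff[OF T u(1) w(1)])
   let ?V = "H1_norm T v" and ?b = "lpn 2 (cm T) v" and ?q = "lpn 4 (cm T) v"
   have V: "0 <= ?V" "?V <= 2 * R" using H.nrm_triangle'[OF u(1) w(1)] u w v T by (auto simp: v_def)
   have b: "0 <= ?b" "?b <= \<eta>" using N1 mn by (auto simp: v_def u_def w_def less_imp_le)
   have q: "0 <= ?q" "?q <= e * (2 * R + 1)"
   proof -
    have "?q <= e * ?V + C * ?b" using C(2) v by blast
    also have "... <= e * (2 * R) + C * \<eta>" using e C V b by (intro add_mono mult_left_mono) auto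
    finally show "?q <= e * (2 * R + 1)" using \<eta>1 by (simp add: algebra_simps)
   qed simp
   have d1: "\<bar>dact j T c u v\<bar> <= \<delta>^2 / 16"
   proof -
    have "\<bar>dact j T c u v\<bar> <= 1 / Suc (r m) * ?V" unfolding u_def by (rule d[OF v])
    also have "... <= 1 / Suc (r m) * (2 * R)" by (intro mult_left_mono V) simp
    also have "... <= \<delta>^2 / 16" using small mn by simp
    finally show ?thesis .
   qed
   have d2: "\<bar>dact j T c w v\<bar> <= \<delta>^2 / 16"
   proof -
    have "\<bar>dact j T c w v\<bar> <= 1 / Suc (r n) * ?V" unfolding w_def by (rule d[OF v])
    also have "... <= 1 / Suc (r n) * (2 * R)" by (intro mult_left_mono V) simp
    also have "... <= \<delta>^2 / 16" using small mn by simp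
    finally show ?thesis .
   qed
   have M: "\<bar>c * Mom j T v v\<bar> <= \<delta>^2 / 8"
   proof -
    have "\<bar>Mom j T v v\<bar> <= ?V * ?b"
     by (rule order_trans[OF Mom_le[OF T v v] mult_right_mono]) (use lpn_le_H1_norm(2)[OF T v] in auto)
    also have "... <= (2 * R) * \<eta>" using V b by (intro mult_mono) auto
    finally have "\<bar>c\<bar> * \<bar>Mom j T v v\<bar> <= \<bar>c\<bar> * ((2 * R) * \<eta>)" by (intro mult_left_mono) auto
    then show ?thesis using \<eta>3 by (simp add: abs_mult mult_ac)
   qed
   have X: "\<bar>(LINT x|cm T. cub (u x) \<bullet> v x) - (LINT x|cm T. cub (w x) \<bullet> v x)\<bar> <= \<delta>^2 / 16 + 3 * \<delta>^2 / 16"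
   proof -
    have "\<rho> * (e * (2 * R + 1)) <= \<delta> / 4"
    proof -
     have "e * (2 * R + 1) = \<delta> / (4 * (\<rho> + 1))" using R0 by (simp add: e_def add_nonneg_eq_0_iff)
     then have "\<rho> * (e * (2 * R + 1)) = (\<rho> / (\<rho> + 1)) * (\<delta> / 4)" by simp
     also have "... <= 1 * (\<delta> / 4)" using \<rho> \<delta> by (intro mult_right_mono) auto
     finally show ?thesis by simp
    qed
    then have sq: "3 * (\<rho> * (e * (2 * R + 1)))^2 <= 3 * (\<delta> / 4)^2" using \<rho> e R0 by (intro mult_left_mono power_mono) auto
    let ?a = "lpn 4 (cm T) u" and ?w = "lpn 4 (cm T) w"
    have ab: "?a <= \<rho>" "?w <= \<rho>" unfolding \<rho>_def
     using order_trans[OF L4(2)[OF u(1)] mult_left_mono[OF u(2) K(1)]] order_trans[OF L4(2)[OF w(1)] mult_left_mono[OF w(2) K(1)]] .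
    have "\<bar>(LINT x|cm T. cub (u x) \<bullet> v x) - (LINT x|cm T. cub (w x) \<bullet> v x)\<bar> <= lpn 2 (cm T) (u - w) * ?b
      + (?a^2 + ?a * ?w + ?w^2) * lpn 4 (cm T) (u - w) * ?q"
     by (rule cub_diff_inner[OF L2[OF u(1)] L4(1)[OF u(1)] L2[OF w(1)] L4(1)[OF w(1)] L2[OF v] L4(1)[OF v]])
    also have "... = ?b^2 + (?a^2 + ?a * ?w + ?w^2) * ?q^2" by (simp add: v_def[symmetric] power2_eq_square mult.assoc)
    also have "... <= (\<delta> / 4)^2 + (\<rho>^2 + \<rho> * \<rho> + \<rho>^2) * (e * (2 * R + 1))^2"
     using ab b q \<eta>2 \<rho> by (intro add_mono power_mono mult_mono) auto
    also have "... = (\<delta> / 4)^2 + 3 * (\<rho> * (e * (2 * R + 1)))^2" by (simp add: power2_eq_square algebra_simps)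
    also note add_left_mono[OF sq]
    finally show ?thesis by (simp add: power_divide)
   qed
   have "?V^2 = Dir T (u - w) v + ?b^2" using H1_norm_Dir[OF T v] by (simp add: v_def)
   also have "Dir T (u - w) v = (dact j T c u v - dact j T c w v) + c * Mom j T (u - w) v + ((LINT x|cm T. cub (u x) \<bullet> v x) - (LINT x|cm T. cub (w x) \<bullet> v x))"
    using dact_diff_left[OF T u(1) w(1) v, of j c] by simp
   also have "Mom j T (u - w) v = Mom j T v v" by (simp add: v_def)
   also have "?b^2 <= (\<delta>/4)^2" using b \<eta>2 by (intro power_mono) auto
   also have "(\<delta>/4)^2 = \<delta>^2 / 16" by (simp add: power_divide)
   finally have "?V^2 <= \<delta>^2 / 16 + \<delta>^2 / 16 + \<delta>^2 / 8 + (\<delta>^2 / 16 + 3 * \<delta>^2 / 16) + \<delta>^2 / 16"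
    using d1 d2 M X by linarith
   also have "... < \<delta>^2" using \<delta> by simp
   finally have "?V < \<delta>" using \<delta> by (simp add: power_less_imp_less_base)
   then show ?thesis by (simp add: v_def u_def w_def)
  qed
  then show ?thesis by (intro exI[of _ "N1 + N2"]) blast
 qed
 have "EX u:H1_per T. (%n. H1_norm T (f (r n) - u)) ---> 0" by (rule H.complete[OF f]) (rule cauchy)
 then obtain u where "u \<in> H1_per T" "(%n. H1_norm T (f (r n) - u)) ---> 0" by (elim bexE)
 with r(1) show ?thesis by (intro exI conjI)
qed

section \<open>The action near the unimodular constants\<close>

lemma L2_integrable:
 fixes u :: "real ^ 'n => complex"
 assumes u: "Lp 2 (cm T) u"
 shows "integrable (cm T) u"
proof (rule Bochner_Integration.integrable_bound)
 have "Lp 2 (cm T) (%x :: real ^ 'n. 1 :: real)" by (rule lpn_bounded(1)[OF finite_measure_cm, of 2 _ _ 1]) auto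
 from integral_mult_L2(1)[OF u this] show "integrable (cm T) (%x. norm (u x))" by simp
qed (use Lp_measurable[OF u] in auto)

lemma Mom_const:
 fixes h :: "real ^ 'n => complex"
 assumes T: "T > 0" and h: "h \<in> H1_per T"
 shows "Mom j T (%x. a) h = 0" "Dir T (%x. a) h = 0"
proof -
 have z: "(LINT x|cm T. wp k (%x. a) x \<bullet> f x) = 0" if "f \<in> bmeas (cm T)" for k and f :: "real ^ 'n => complex"
 proof -
  have "(LINT x|cm T. wp k (%x. a) x \<bullet> f x) = (LINT x|(cm T :: (real ^ 'n) measure). 0)"
  proof (rule integral_cong_AE)
   show "AE x in cm T. wp k (%x. a) x \<bullet> f x = 0" using AE_cm[OF weak_partial_const[of k a]] by eventually_elim simp
  qed (intro borel_measurable_inner that borel_measurable_const measurable_cm H1_perD(4)[OF T H1_per_const[OF T]])+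
  then show ?thesis by simp
 qed
 have hm: "h \<in> bmeas (cm T)" by (rule measurable_cm[OF H1_perD(2)[OF T h]])
 show "Mom j T (%x. a) h = 0" unfolding Mom_def by (rule z) (intro borel_measurable_times borel_measurable_const hm)
 show "Dir T (%x. a) h = 0" unfolding Dir_def by (intro sum.neutral ballI z measurable_cm H1_perD(4)[OF T h])
qed

lemma rotation_invariant:
 fixes w :: "real ^ 'n => complex"
 assumes T: "T > 0" and w: "w \<in> H1_per T" and a: "cmod a = 1"
 shows "Dir T (%x. a * w x) (%x. a * w x) = Dir T w w" "Mom j T (%x. a * w x) (%x. a * w x) = Mom j T w w"
  "action j T c (%x. a * w x) = action j T c w" "(%x. a * w x) \<in> H1_per T"
proof -
 show aw: "(%x. a * w x) \<in> H1_per T" using H1_per_lin(1)[OF T w w, of a 0] by simp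
 note W = H1_perD[OF T w] and A = H1_perD[OF T aw]
 have rot: "(a * z) \<bullet> (a * z') = z \<bullet> z'" for z z'
 proof -
  have "(a * z) \<bullet> (a * z') = (cmod a)^2 * (z \<bullet> z')"
   unfolding cmod_power2 inner_complex_def by (simp add: power2_eq_square algebra_simps)
  then show ?thesis using a by simp
 qed
 show d: "Dir T (%x. a * w x) (%x. a * w x) = Dir T w w"
  unfolding Dir_def
 proof (intro sum.cong refl integral_cong_AE)
  fix k show "AE x in cm T. wp k (%x. a * w x) x \<bullet> wp k (%x. a * w x) x = wp k w x \<bullet> wp k w x"
   using wp_mult[OF T w, of k a] by eventually_elim (simp add: rot)
 qed (intro borel_measurable_inner measurable_cm W A)+
 show m: "Mom j T (%x. a * w x) (%x. a * w x) = Mom j T w w"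
  unfolding Mom_def
 proof (intro integral_cong_AE)
  have l: "- \<i> * (a * z) = a * (- \<i> * z)" for z by simp
  show "AE x in cm T. wp j (%x. a * w x) x \<bullet> (- \<i> * (a * w x)) = wp j w x \<bullet> (- \<i> * w x)"
   using wp_mult[OF T w, of j a] by eventually_elim (simp only: l rot)
 qed (intro borel_measurable_inner borel_measurable_times borel_measurable_const measurable_cm W A)+
 show "action j T c (%x. a * w x) = action j T c w"
  unfolding action_eq[OF T aw] action_eq[OF T w] d m by (simp add: norm_mult a)
qed

lemma action_one:
 assumes T: "T > 0"
 shows "action j T c (%x. 1) = 0"
 unfolding action_eq[OF T H1_per_const[OF T]] Mom_const[OF T H1_per_const[OF T]] by simp

text \<open>
With \<open>h = p + i q\<close> the momentum density is \<open>q \<partial>p - p \<partial>q\<close>, and \<open>p \<partial>q + q \<partial>p\<close> integrates to zero, so only \<open>- 2 p \<partial>q\<close> remains. The norm of \<open>Re h\<close> appears, on which the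
potential is coercive; the naive bound has the norm of \<open>h\<close> itself.
\<close>

lemma Mom_real_imag:
 fixes h :: "real ^ 'n => complex"
 assumes T: "T > 0" and h: "h \<in> H1_per T"
 shows "\<bar>Mom j T h h\<bar> <= 2 * (lpn 2 (cm T) (%x. Re (h x)) * lpn 2 (cm T) (wp j h))"
proof -
 note H = H1_perD[OF T h]
 let ?g = "wp j h"
 have hm: "h \<in> bmeas (cm T)" "?g \<in> bmeas (cm T)" by (intro measurable_cm H)+
 have L: "Lp 2 (cm T) (%x. Re (h x))"
  by (rule Lp_dominated[OF H(5)]) (use hm in "auto intro!: AE_I2 abs_Re_le_cmod")
 have Lg: "Lp 2 (cm T) (%x. Im (?g x))" "lpn 2 (cm T) (%x. Im (?g x)) <= lpn 2 (cm T) ?g"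
  by (rule Lp_dominated[OF H(6)], use hm in "auto intro!: AE_I2 abs_Im_le_cmod")
   (rule lpn_mono[OF _ H(6)], use hm in "auto intro!: AE_I2 abs_Im_le_cmod")
 have i1: "integrable (cm T) (%x. ?g x * h x)" by (rule integral_mult_L2_complex(1)[OF H(6) H(5)])
 have i2: "integrable (cm T) (%x. ?g x \<bullet> (- \<i> * h x))" by (rule integrable_inner_L2(1)[OF H(6) Lp_mult[OF H(5)]])
 note i3 = integral_mult_L2[OF L Lg(1)]
 have i4: "integrable (cm T) (%x. Re (h x) * Im (?g x))"
  by (rule Bochner_Integration.integrable_bound[OF i3(1)]) (use hm in "auto simp: abs_mult")
 have "(LINT x|cm T. ?g x * h x) = 0" using H1_per_parts[OF T h h, of j] by (simp add: mult.commute)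
 then have 0: "(LINT x|cm T. Im (?g x * h x)) = 0" using i1 by (simp only: integral_Im zero_complex.sel)
 have "Mom j T h h = (LINT x|cm T. Im (?g x * h x) + (- 2) * (Re (h x) * Im (?g x)))"
  unfolding Mom_def by (rule Bochner_Integration.integral_cong) (auto simp: inner_complex_def algebra_simps)
 also have "... = (LINT x|cm T. Im (?g x * h x)) + (LINT x|cm T. (- 2) * (Re (h x) * Im (?g x)))"
  by (intro Bochner_Integration.integral_add integrable_Im i1 integrable_mult_right i4)
 also have "... = - 2 * (LINT x|cm T. Re (h x) * Im (?g x))" using 0 by (simp only: integral_mult_right_zero)
 finally have "\<bar>Mom j T h h\<bar> = 2 * \<bar>\<integral>x. Re (h x) * Im (?g x) \<partial>cm T\<bar>" by simp
 also have "\<bar>\<integral>x. Re (h x) * Im (?g x) \<partial>cm T\<bar> <= (LINT x|cm T. norm (Re (h x)) * norm (Im (?g x)))"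
  using integral_norm_bound[of "cm T" "%x. Re (h x) * Im (?g x)"] by (simp add: abs_mult)
 also have "... <= lpn 2 (cm T) (%x. Re (h x)) * lpn 2 (cm T) ?g"
  by (rule order_trans[OF i3(2) mult_left_mono[OF Lg(2)]]) simp
 finally show ?thesis by simp
qed

text \<open>
The mean of \<open>h\<close> is real, so subtracting it does not touch the imaginary part.
\<close>

lemma Im_poincare:
 fixes h :: "real ^ 'n => complex"
 assumes T: "T > 0" and h: "h \<in> H1_per T" and mean: "Im (LINT x|cm T. h x) = 0"
 shows "(lpn 2 (cm T) h)^2 <= (lpn 2 (cm T) (%x. Re (h x)))^2 + (T * CARD('n))^2 * Dir T h h"
proof -
 note H = H1_perD[OF T h]
 have hm: "h \<in> bmeas (cm T)" by (intro measurable_cm H)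
 let ?m = "(LINT y|cm T. h y) /\<^sub>R T ^ CARD('n)"
 interpret F: finite_measure "cm T :: (real ^ 'n) measure" by (rule finite_measure_cm)
 have Lc: "Lp 2 (cm T) (%x :: real ^ 'n. ?m)" by (rule lpn_bounded(1)[OF finite_measure_cm, of 2 _ _ "cmod ?m"]) auto
 have L: "Lp 2 (cm T) (%x. Re (h x))" by (rule Lp_dominated[OF H(5)]) (use hm in "auto intro!: AE_I2 abs_Re_le_cmod")
 have L': "Lp 2 (cm T) (%x. Im (h x))" by (rule Lp_dominated[OF H(5)]) (use hm in "auto intro!: AE_I2 abs_Im_le_cmod")
 have "lpn 2 (cm T) (%x. Im (h x)) <= lpn 2 (cm T) (%x. h x - ?m)"
 proof (rule lpn_mono)
  have "\<bar>Im (h x)\<bar> <= cmod (h x - ?m)" for x using abs_Im_le_cmod[of "h x - ?m"] mean by simp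
  then show "AE x in cm T. norm (Im (h x)) <= norm (h x - ?m)" by simp
 qed (use hm Lp_diff[OF H(5) Lc] in auto)
 also have "... <= T * (\<Sum>k\<in>UNIV. lpn 2 (cm T) (wp k h))" by (rule H1_per_poincare[OF T h])
 also have "... <= T * (\<Sum>k\<in>(UNIV :: 'n set). sqrt (Dir T h h))"
 proof (intro mult_left_mono sum_mono)
  fix k show "lpn 2 (cm T) (wp k h) <= sqrt (Dir T h h)"
   by (rule real_le_rsqrt, unfold Dir_self[OF T h], rule member_le_sum[of k UNIV "%k. (lpn 2 (cm T) (wp k h))^2"]) auto
 qed (use T in auto)
 finally have "lpn 2 (cm T) (%x. Im (h x)) <= (T * CARD('n)) * sqrt (Dir T h h)" by (simp add: mult.assoc)
 from power_mono[OF this, of 2] have "(lpn 2 (cm T) (%x. Im (h x)))^2 <= (T * CARD('n))^2 * Dir T h h"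
  using Dir_nonneg[OF T h] by (simp add: power_mult_distrib)
 moreover have "(lpn 2 (cm T) h)^2 = (lpn 2 (cm T) (%x. Re (h x)))^2 + (lpn 2 (cm T) (%x. Im (h x)))^2"
  using Lp_integrable[OF L] Lp_integrable[OF L'] by (simp add: lpn_power cmod_power2)
 ultimately show ?thesis by simp
qed

text \<open>
The first variation vanishes and the quadratic part is bounded below by \<open>1 - c / sqrt 2\<close> times half the Dirichlet energy plus the squared norm of \<open>Re h\<close>. Half of this margin is
spent on the cubic term \<open>Re h |h|\<^sup>2\<close>, by Young's inequality with weight \<open>\<tau>\<close>; the price is a multiple of \<open>|h|\<^sup>4\<close>.
\<close>

lemma action_near_one:
 fixes j :: "'n::finite"
 assumes N: "CARD('n) <= 3" and T: "T > 0" and c: "0 < c" "c < sqrt 2"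
 shows "EX \<delta>>0. EX C>=0. ALL h:H1_per T. Im (LINT x|cm T. h x) = 0 -->
  \<delta> * (H1_norm T h)^2 - C * (H1_norm T h) ^ 4 <= action j T c ((%x. 1) + h)"
proof -
 obtain K where K: "K >= 0" "ALL u : (H1_per T :: (real ^ 'n => complex) set). Lp 4 (cm T) u \<and> lpn 4 (cm T) u <= K * H1_norm T u"
  using H1_per_L4_bound[OF N T] by (elim exE conjE)
 define \<sigma> where "\<sigma> = c / sqrt 2"
 have \<sigma>: "0 < \<sigma>" "\<sigma> < 1" "c^2 = 2 * \<sigma>^2" using c by (auto simp: \<sigma>_def power_divide)
 define \<tau> where "\<tau> = (1 - \<sigma>) / 2"
 have \<tau>: "\<tau> > 0" "\<sigma> = 1 - 2 * \<tau>" using \<sigma> by (auto simp: \<tau>_def field_simps)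
 define P where "P = (T * CARD('n))^2"
 have P: "P >= 0" by (simp add: P_def)
 define \<delta> where "\<delta> = \<tau> / (2 * (1 + P))"
 have \<delta>: "\<delta> > 0" "\<delta> * (1 + P) = \<tau> / 2" "\<delta> <= \<tau>"
 proof -
  show "\<delta> > 0" using \<tau> P by (simp add: \<delta>_def)
  have "\<tau> / (2 * y) * y = \<tau> / 2" if "y ~= 0" for y using that by simp
  moreover have "1 + P ~= 0" using P by simp
  ultimately show e: "\<delta> * (1 + P) = \<tau> / 2" unfolding \<delta>_def .
  have "\<delta> <= \<delta> * (1 + P)" using \<open>\<delta> > 0\<close> P by simp
  then show "\<delta> <= \<tau>" using e \<tau> by linarith
 qed
 have "\<delta> * (H1_norm T h)^2 - K ^ 4 / (4 * \<tau>) * (H1_norm T h) ^ 4 <= action j T c ((%x. 1) + h)"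
  if h: "h \<in> H1_per T" and m: "Im (LINT x|cm T. h x) = 0" for h :: "real ^ 'n => complex"
 proof -
  interpret F: finite_measure "cm T :: (real ^ 'n) measure" by (rule finite_measure_cm)
  note H = H1_perD[OF T h] and c1 = H1_per_const[OF T, of 1, where 'n = 'n]
  have h4: "Lp 4 (cm T) h" "lpn 4 (cm T) h <= K * H1_norm T h" and c4: "Lp 4 (cm T) (%x :: real ^ 'n. 1 :: complex)" using K h c1 by blast+
  have hm: "h \<in> bmeas (cm T)" by (intro measurable_cm H)
  let ?p = "lpn 2 (cm T) (%x. Re (h x))"
  have L: "Lp 2 (cm T) (%x. Re (h x))" by (rule Lp_dominated[OF H(5)]) (use hm in "auto intro!: AE_I2 abs_Re_le_cmod")
  note E = action_expansion[OF N T c1 h c4 h4(1)]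
  have d0: "dact j T c (%x. 1) h = 0" unfolding dact_def Mom_const[OF T h] by (simp add: cub_def)
  have iq: "integrable (cm T) (%x. (cmod (h x))^2 * (cmod (h x))^2)" by (rule L4_products(1)[OF h4(1) h4(1)])
  have ip: "integrable (cm T) (%x. (Re (h x))^2)" using Lp_integrable[OF L] by simp
  have ptw: "(1 - \<tau>) * (Re z)^2 - 1 / (4 * \<tau>) * ((cmod z)^2 * (cmod z)^2) <= 1/2 * ((cmod (1 :: complex))^2 - 1) * (cmod z)^2 + 1/4 * (2 * (1 \<bullet> z) + (cmod z)^2)^2" for z :: complex
  proof -
   have k: "0 <= \<tau> * p^2 + p * s + 1 / (4 * \<tau>) * (s * s)" for p s :: real
   proof -
    have "0 <= \<tau> * (p + s / (2 * \<tau>))^2" using \<tau> by simp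
    also have "... = \<tau> * p^2 + p * s + 1 / (4 * \<tau>) * (s * s)" using \<tau>(1) by (simp add: power2_eq_square field_simps)
    finally show ?thesis .
   qed
   have e: "1/2 * ((cmod (1 :: complex))^2 - 1) * (cmod z)^2 + 1/4 * (2 * (1 \<bullet> z) + (cmod z)^2)^2
     = (Re z)^2 + Re z * (cmod z)^2 + 1/4 * ((cmod z)^2 * (cmod z)^2)"
    by (simp add: inner_complex_def power2_eq_square algebra_simps)
   have "0 <= 1/4 * ((cmod z)^2 * (cmod z)^2)" by simp
   then show ?thesis unfolding e left_diff_distrib using k[of "Re z" "(cmod z)^2"] by linarith
  qed
  have "(1 - \<tau>) * ?p^2 - 1 / (4 * \<tau>) * (LINT x|cm T. (cmod (h x))^2 * (cmod (h x))^2)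
    = (LINT x|cm T. (1 - \<tau>) * (Re (h x))^2 - 1 / (4 * \<tau>) * ((cmod (h x))^2 * (cmod (h x))^2))"
   using ip iq by (simp add: lpn_power)
  also have "... <= (LINT x|cm T. 1/2 * ((cmod (1 :: complex))^2 - 1) * (cmod (h x))^2 + 1/4 * (2 * (1 \<bullet> h x) + (cmod (h x))^2)^2)"
   by (rule integral_mono[OF _ E(2) ptw]) (intro Bochner_Integration.integrable_diff integrable_mult_right ip iq)
  finally have R: "(1 - \<tau>) * ?p^2 - 1 / (4 * \<tau>) * (LINT x|cm T. (cmod (h x))^2 * (cmod (h x))^2) <= \<dots>" .
  have q: "1 / (4 * \<tau>) * (LINT x|cm T. (cmod (h x))^2 * (cmod (h x))^2) <= K ^ 4 / (4 * \<tau>) * (H1_norm T h) ^ 4"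
  proof -
   have "(LINT x|cm T. (cmod (h x))^2 * (cmod (h x))^2) <= (lpn 4 (cm T) h)^2 * (lpn 4 (cm T) h)^2" by (rule L4_products(2)[OF h4(1) h4(1)])
   also have "... = lpn 4 (cm T) h ^ 4" by (simp add: power2_eq_square power4_eq_xxxx)
   also have "... <= (K * H1_norm T h) ^ 4" by (intro power_mono h4) simp
   finally have "(LINT x|cm T. (cmod (h x))^2 * (cmod (h x))^2) <= K ^ 4 * H1_norm T h ^ 4" by (simp add: power_mult_distrib)
   from mult_left_mono[OF this, of "1 / (4 * \<tau>)"] show ?thesis using \<tau> by simp
  qed
  let ?D = "Dir T h h" and ?g = "lpn 2 (cm T) (wp j h)"
  have g: "?g^2 <= ?D" unfolding Dir_self[OF T h] by (rule member_le_sum[of j UNIV "%k. (lpn 2 (cm T) (wp k h))^2"]) auto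
  have "\<bar>c/2 * Mom j T h h\<bar> <= c * (?p * ?g)"
   using mult_left_mono[OF Mom_real_imag[OF T h, of j], of "c/2"] c by (simp add: abs_mult)
  also have "... <= \<sigma> * (?p^2 + ?g^2 / 2)"
  proof -
   have "c = \<sigma> * sqrt 2" by (simp add: \<sigma>_def)
   moreover have "sqrt 2 * (p * g) <= p^2 + g^2 / 2" for p g :: real
   proof -
    have "0 <= (p - g / sqrt 2)^2" by simp
    also have "... = p^2 + g^2 / 2 - sqrt 2 * (p * g)"
     by (simp add: power2_diff power_divide real_div_sqrt field_simps)
    finally show ?thesis by simp
   qed
   ultimately show ?thesis using \<sigma>(1) by (simp add: mult.assoc)
  qed
  also have "... <= \<sigma> * (?p^2 + ?D / 2)" using g \<sigma>(1) by (intro mult_left_mono) auto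
  finally have M: "\<bar>c/2 * Mom j T h h\<bar> <= (1 - 2 * \<tau>) * (?p^2 + ?D / 2)" unfolding \<tau>(2) .
  have fin: "\<tau> * (1/2 * D + p) - Q <= 0 + 0 + (1/2 * D - mo + R)" if "(1 - \<tau>) * p - q <= R" "q <= Q" "\<bar>mo\<bar> <= (1 - 2 * \<tau>) * (p + D / 2)" "0 <= D" for D p Q mo R q :: real
  proof -
   have "0 <= \<tau> * D" using \<tau> that by simp
   then show ?thesis using that by (simp add: algebra_simps)
  qed
  have A: "\<tau> * (1/2 * ?D + ?p^2) - K ^ 4 / (4 * \<tau>) * (H1_norm T h) ^ 4 <= action j T c ((%x. 1) + h)"
   unfolding E(1) d0 action_one[OF T] by (rule fin[OF R q M Dir_nonneg[OF T h]])
  have "\<delta> * (H1_norm T h)^2 <= \<delta> * (?D + (?p^2 + P * ?D))"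
   unfolding H1_norm_Dir[OF T h] P_def using Im_poincare[OF T h m] \<delta>(1) by (intro mult_left_mono add_left_mono) auto
  also have "... = \<delta> * (1 + P) * ?D + \<delta> * ?p^2" by (simp add: algebra_simps)
  also have "... <= \<tau> / 2 * ?D + \<tau> * ?p^2" unfolding \<delta>(2) using \<delta>(3) by (intro add_left_mono mult_right_mono) auto
  also have "... = \<tau> * (1/2 * ?D + ?p^2)" by (simp add: algebra_simps)
  finally show ?thesis using A by linarith
 qed
 moreover have "0 <= K ^ 4 / (4 * \<tau>)" using \<tau> by simp
 ultimately show ?thesis using \<delta>(1) by blast
qed

text \<open>
The squared \<open>H\<^sup>1\<close> distance of \<open>w\<close> from the circle of unimodular constants: minimizing the norm of \<open>w - b\<close> over \<open>|b| = 1\<close> aligns \<open>b\<close> with the integral of \<open>w\<close>.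
\<close>

definition dist1 :: "real => (real ^ 'n => complex) => real" where
 "dist1 T w = (H1_norm T w)^2 - 2 * cmod (LINT x|cm T. w x) + T ^ CARD('n)"

text \<open>
Rotating \<open>w\<close> such that its mean becomes real and nonnegative costs nothing in the action and realizes the distance.
\<close>

lemma dist1_phase:
 fixes w :: "real ^ 'n => complex"
 assumes T: "T > 0" and w: "w \<in> H1_per T"
 shows "EX h:H1_per T. Im (LINT x|cm T. h x) = 0 \<and> (H1_norm T h)^2 = dist1 T w \<and> (ALL j c. action j T c w = action j T c ((%x. 1) + h))"
proof -
 note W = H1_perD[OF T w]
 interpret F: finite_measure "cm T :: (real ^ 'n) measure" by (rule finite_measure_cm)
 define m where "m = (LINT x|cm T. w x)"
 define a where "a = (if m = 0 then 1 else cnj (sgn m))"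
 have a: "cmod a = 1" "a * m = complex_of_real (cmod m)"
 proof -
  show "cmod a = 1" by (simp add: a_def norm_sgn)
  have "cnj (sgn m) * m = complex_of_real (cmod m)" if "m ~= 0"
   using that complex_norm_square[of m] by (simp add: sgn_div_norm scaleR_conv_of_real power2_eq_square field_simps)
  then show "a * m = complex_of_real (cmod m)" by (auto simp: a_def)
 qed
 define h where "h = (%x. a * w x - 1)"
 have h: "h \<in> H1_per T" using H1_per_lin(1)[OF T w H1_per_const[OF T, of 1], of a "-1"] by (simp add: h_def)
 have h1: "(%x. 1) + h = (%x. a * w x)" by (simp add: h_def plus_fun_def)
 have aw: "(%x. a * w x) \<in> H1_per T" by (rule rotation_invariant(4)[OF T w a(1)])
 have iw: "integrable (cm T) w" using W(5) by (rule L2_integrable)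
 have vol: "measure (cm T :: (real ^ 'n) measure) (space (cm T)) = T ^ CARD('n)" using T by (intro measure_cm) simp
 have ih: "(LINT x|cm T. h x) = complex_of_real (cmod m) - complex_of_real (T ^ CARD('n))"
  unfolding h_def using iw vol by (simp add: a(2) m_def[symmetric] scaleR_conv_of_real)
 have Dh: "Dir T h h = Dir T w w"
  unfolding rotation_invariant(1)[OF T w a(1), symmetric] unfolding Dir_def
 proof (intro sum.cong refl integral_cong_AE)
  note H = H1_perD[OF T h] and A = H1_perD[OF T aw]
  fix k show "AE x in cm T. wp k h x \<bullet> wp k h x = wp k (%x. a * w x) x \<bullet> wp k (%x. a * w x) x"
   using wp_diff[OF T aw H1_per_const[OF T, of 1], of k] AE_cm[OF weak_partial_const[of k "1 :: complex"]]
   by eventually_elim (simp add: h_def fun_diff_def)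
  show "(%x. wp k h x \<bullet> wp k h x) \<in> bmeas (cm T)"
   "(%x. wp k (%x. a * w x) x \<bullet> wp k (%x. a * w x) x) \<in> bmeas (cm T)"
   by (intro borel_measurable_inner measurable_cm H A)+
 qed
 have "(lpn 2 (cm T) h)^2 = (LINT x|cm T. (cmod (w x))^2 - 2 * Re (a * w x) + 1)"
  unfolding lpn_power[OF zero_less_numeral]
 proof (rule Bochner_Integration.integral_cong[OF refl])
  fix x
  have "(cmod (w x))^2 = (cmod (a * w x))^2" by (simp add: norm_mult a(1))
  then show "cmod (h x) ^ 2 = (cmod (w x))^2 - 2 * Re (a * w x) + 1"
   unfolding h_def by (simp only: cmod_power2 minus_complex.sel one_complex.sel) (simp add: power2_eq_square algebra_simps)
 qed
 also have "... = (LINT x|cm T. (cmod (w x))^2) - 2 * (LINT x|cm T. Re (a * w x)) + T ^ CARD('n)"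
  using Lp_integrable[OF W(5)] iw vol by (simp del: times_complex.sel)
 also have "(LINT x|cm T. Re (a * w x)) = cmod m"
  using iw a(2) by (subst integral_Re) (auto simp: m_def)
 finally have "(lpn 2 (cm T) h)^2 = (lpn 2 (cm T) w)^2 - 2 * cmod m + T ^ CARD('n)" by (simp add: lpn_power)
 then have "(H1_norm T h)^2 = dist1 T w"
  unfolding dist1_def H1_norm_Dir[OF T h] H1_norm_Dir[OF T w] Dh m_def[symmetric] by simp
 moreover have "ALL j c. action j T c w = action j T c ((%x. 1) + h)" unfolding h1 using rotation_invariant(3)[OF T w a(1)] by simp
 moreover have "Im (LINT x|cm T. h x) = 0" unfolding ih by simp
 ultimately show ?thesis using h by blast
qed

text \<open>
Inside the ball the quadratic term dominates the quartic one, so a path cannot end there at negative action; on the sphere the bound is uniform.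
\<close>

lemma action_barrier:
 fixes j :: "'n::finite"
 assumes N: "CARD('n) <= 3" and T: "T > 0" and c: "0 < c" "c < sqrt 2"
 shows "EX \<rho>>0. EX \<kappa>>0. ALL w:H1_per T. (dist1 T w <= \<rho> --> 0 <= action j T c w) \<and> (dist1 T w = \<rho> --> \<kappa> <= action j T c w)"
proof -
 obtain \<delta> C where \<delta>: "\<delta> > 0" "C >= 0" and b: "ALL h:H1_per T. Im (LINT x|cm T. h x) = 0 -->
  \<delta> * (H1_norm T h)^2 - C * (H1_norm T h) ^ 4 <= action j T c ((%x. 1) + h)"
  using action_near_one[where j = j, OF N T c] by (elim exE conjE)
 define \<rho> where "\<rho> = \<delta> / (2 * (C + 1))"
 have \<rho>: "\<rho> > 0" "C * \<rho> <= \<delta> / 2"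
 proof -
  show "\<rho> > 0" using \<delta> by (simp add: \<rho>_def)
  then have "C * \<rho> <= (C + 1) * \<rho>" by (simp add: mult_right_mono)
  also have "(C + 1) * \<rho> = \<delta> / 2"
  proof -
   have "y * (\<delta> / (2 * y)) = \<delta> / 2" if "y ~= 0" for y using that by simp
   moreover have "C + 1 ~= 0" using \<delta> by simp
   ultimately show ?thesis unfolding \<rho>_def .
  qed
  finally show "C * \<rho> <= \<delta> / 2" .
 qed
 have main: "\<delta> / 2 * dist1 T w <= action j T c w \<and> 0 <= dist1 T w" if w: "w \<in> H1_per T" and d: "dist1 T w <= \<rho>" for w
 proof -
  obtain h where h: "h \<in> H1_per T" "Im (LINT x|cm T. h x) = 0" "(H1_norm T h)^2 = dist1 T w" "ALL j c. action j T c w = action j T c ((%x. 1) + h)"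
   using dist1_phase[OF T w] by (elim bexE conjE)
  have d0: "0 <= dist1 T w" unfolding h(3)[symmetric] by simp
  have "H1_norm T h ^ 4 = dist1 T w * dist1 T w" unfolding h(3)[symmetric] by (simp add: power2_eq_square power4_eq_xxxx)
  then have "\<delta> * dist1 T w - C * (dist1 T w * dist1 T w) <= action j T c w" using b h by fastforce
  moreover have "C * dist1 T w * dist1 T w <= \<delta> / 2 * dist1 T w"
   by (rule mult_right_mono[OF order_trans[OF mult_left_mono[OF d \<delta>(2)] \<rho>(2)] d0])
  ultimately show ?thesis using d0 by (simp add: algebra_simps)
 qed
 have "0 <= action j T c w" if "w \<in> H1_per T" "dist1 T w <= \<rho>" for w
 proof -
  have "0 <= \<delta> / 2 * dist1 T w" using main[OF that] \<delta> by simp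
  then show ?thesis using main[OF that] by linarith
 qed
 moreover have "\<delta> / 2 * \<rho> <= action j T c w" if "w \<in> H1_per T" "dist1 T w = \<rho>" for w using main[OF that(1)] that(2) by simp
 moreover have "\<delta> / 2 * \<rho> > 0" using \<delta> \<rho> by simp
 ultimately show ?thesis using \<rho>(1) by blast
qed

lemma dist1_lipschitz:
 fixes u :: "real ^ 'n => complex"
 assumes T: "T > 0" and u: "u \<in> H1_per T"
 shows "EX L. ALL h:H1_per T. H1_norm T h <= 1 --> \<bar>dist1 T (u + h) - dist1 T u\<bar> <= L * H1_norm T h"
proof (intro exI ballI impI)
 interpret H: semi_hilbert "H1_per T :: (real ^ 'n => complex) set" "H1_inner T" "H1_norm T" by (rule H1_semi_hilbert[OF T])
 interpret F: finite_measure "cm T :: (real ^ 'n) measure" by (rule finite_measure_cm)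
 fix h :: "real ^ 'n => complex" assume h: "h \<in> H1_per T" and h1: "H1_norm T h <= 1"
 have uh: "u + h \<in> H1_per T" by (rule H1_per_add[OF T u h])
 have nh: "0 <= H1_norm T h" by (rule H1_norm_nonneg[OF T h])
 let ?C = "lpn 2 (cm T) (%x :: real ^ 'n. 1 :: real)"
 have L1: "Lp 2 (cm T) (%x :: real ^ 'n. 1 :: real)" by (rule lpn_bounded(1)[OF finite_measure_cm, of 2 _ _ 1]) auto
 note iu = L2_integrable[OF H1_perD(5)[OF T u]] and ih = L2_integrable[OF H1_perD(5)[OF T h]]
 have "cmod (LINT x|cm T. h x) <= (LINT x|cm T. cmod (h x))" by (rule integral_norm_bound)
 also have "... <= lpn 2 (cm T) h * ?C" using integral_mult_L2(2)[OF H1_perD(5)[OF T h] L1] by simp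
 also have "... <= H1_norm T h * ?C" by (rule mult_right_mono[OF lpn_le_H1_norm(1)[OF T h]]) simp
 finally have m: "cmod (LINT x|cm T. h x) <= H1_norm T h * ?C" .
 have mean: "\<bar>cmod (LINT x|cm T. (u + h) x) - cmod (LINT x|cm T. u x)\<bar> <= H1_norm T h * ?C"
  using iu ih norm_triangle_ineq3[of "(LINT x|cm T. (u + h) x)" "(LINT x|cm T. u x)"] m by simp
 have e: "\<bar>H1_norm T (u + h) - H1_norm T u\<bar> <= H1_norm T h"
 proof -
  have "H1_norm T u <= H1_norm T (u + h) + H1_norm T h"
   using H.nrm_triangle'[OF uh h] by simp
  then show ?thesis using H.nrm_triangle[OF u h] by linarith
 qed
 have "\<bar>(H1_norm T (u + h))^2 - (H1_norm T u)^2\<bar> = \<bar>H1_norm T (u + h) - H1_norm T u\<bar> * \<bar>H1_norm T (u + h) + H1_norm T u\<bar>"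
  unfolding abs_mult[symmetric] by (simp add: power2_eq_square algebra_simps)
 also have "... <= H1_norm T h * (2 * H1_norm T u + 1)"
  using e nh h1 H1_norm_nonneg[OF T u] H1_norm_nonneg[OF T uh] by (intro mult_mono) auto
 finally have "\<bar>dist1 T (u + h) - dist1 T u\<bar> <= H1_norm T h * (2 * H1_norm T u + 1) + 2 * (H1_norm T h * ?C)"
  using mean unfolding dist1_def by linarith
 then show "\<bar>dist1 T (u + h) - dist1 T u\<bar> <= (2 * H1_norm T u + 1 + 2 * ?C) * H1_norm T h" by (simp add: algebra_simps)
qed

lemma H1_cong_AE:
 fixes u v :: "real ^ 'n => complex"
 assumes T: "T > 0" and u: "u \<in> H1_per T" and v: "v \<in> H1_per T" and ae: "AE x in leb. u x = v x"
 shows "action j T c u = action j T c v" "dist1 T u = dist1 T v"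
proof -
 have w: "wp k u = wp k v" for k by (rule weak_partial_cong_AE[OF ae])
 note U = H1_perD[OF T u] and V = H1_perD[OF T v]
 have m: "u \<in> bmeas (cm T)" "v \<in> bmeas (cm T)" "wp k v \<in> bmeas (cm T)" for k by (intro measurable_cm U V)+
 have "(LINT x|cm T. (1 - (cmod (u x))^2)^2) = (LINT x|cm T. (1 - (cmod (v x))^2)^2)"
  by (rule integral_cong_AE, use m in measurable) (use AE_cm[OF ae] in eventually_elim, simp)
 moreover have "(LINT x|cm T. wp j v x \<bullet> (- \<i> * u x)) = (LINT x|cm T. wp j v x \<bullet> (- \<i> * v x))"
  by (rule integral_cong_AE, intro borel_measurable_inner borel_measurable_times borel_measurable_const m, intro borel_measurable_inner borel_measurable_times borel_measurable_const m)
   (use AE_cm[OF ae] in eventually_elim, simp)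
 ultimately show "action j T c u = action j T c v"
  unfolding action_eq[OF T u] action_eq[OF T v] Dir_def Mom_def w by simp
 have "(LINT x|cm T. u x) = (LINT x|cm T. v x)" by (rule integral_cong_AE[OF m(1,2) AE_cm[OF ae]])
 moreover have "lpn 2 (cm T) u = lpn 2 (cm T) v" by (rule lpn_cong_AE[OF AE_cm[OF ae] m(2,1)])
 ultimately show "dist1 T u = dist1 T v"
  unfolding dist1_def H1_norm_Dir[OF T u] H1_norm_Dir[OF T v] Dir_def w by simp
qed

lemma dist1_one:
 assumes T: "T > 0"
 shows "dist1 T (%x :: real ^ 'n. 1) = 0"
proof -
 note c = H1_per_const[OF T, of 1, where 'n = 'n]
 have vol: "measure (cm T :: (real ^ 'n) measure) (space (cm T)) = T ^ CARD('n)" using T by (intro measure_cm) simp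
 show ?thesis unfolding dist1_def H1_norm_Dir[OF T c] Mom_const[OF T c] using vol T by (simp add: lpn_power)
qed

text \<open>
The intermediate value theorem for the continuous function \<open>dist1\<close> along the path: it starts at zero and, by \<open>action_barrier\<close>, ends outside the ball.
\<close>

lemma path_crosses_barrier:
 fixes j :: "'n::finite"
 assumes N: "CARD('n) <= 3" and T: "T > 0" and c: "0 < c" "c < sqrt 2"
 shows "EX \<kappa>>0. ALL \<alpha>. semi_hilbert.cpath (H1_per T) (H1_norm T) \<alpha> --> (AE x in leb. \<alpha> 0 x = 1) --> action j T c (\<alpha> 1) < 0
  --> (EX t:{0..1}. \<kappa> <= action j T c (\<alpha> t))"
proof -
 interpret H: semi_hilbert "H1_per T :: (real ^ 'n => complex) set" "H1_inner T" "H1_norm T" by (rule H1_semi_hilbert[OF T])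
 obtain \<rho> \<kappa> where r: "\<rho> > 0" "\<kappa> > 0" "ALL w:H1_per T. (dist1 T w <= \<rho> --> 0 <= action j T c w) \<and> (dist1 T w = \<rho> --> \<kappa> <= action j T c w)"
  using action_barrier[where j = j, OF N T c] by (elim exE conjE)
 have "EX t:{0..1}. \<kappa> <= action j T c (\<alpha> t)"
  if \<alpha>: "H.cpath \<alpha>" and 0: "AE x in leb. \<alpha> 0 x = 1" and 1: "action j T c (\<alpha> 1) < 0" for \<alpha>
 proof -
  have S: "\<alpha> t \<in> H1_per T" if "t \<in> {0..1}" for t using \<alpha> that by (auto simp: H.cpath_def)
  have "continuous_on {0..1} (%t. dist1 T (\<alpha> t))" by (rule H.cpath_continuous[OF \<alpha>]) (rule dist1_lipschitz[OF T])
  moreover have "dist1 T (\<alpha> 0) <= \<rho>" using H1_cong_AE(2)[OF T S H1_per_const[OF T] 0] dist1_one[OF T, where 'n = 'n] r by simp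
  moreover have "\<rho> <= dist1 T (\<alpha> 1)"
  proof (rule ccontr)
   assume "\<not> \<rho> <= dist1 T (\<alpha> 1)"
   then have "0 <= action j T c (\<alpha> 1)" using r(3) S[of 1] by simp
   then show False using 1 by simp
  qed
  ultimately obtain t where "t >= 0" "t <= 1" "dist1 T (\<alpha> t) = \<rho>" using IVT'[of "%t. dist1 T (\<alpha> t)" 0 \<rho> 1] by auto
  then show ?thesis using r(3) S[of t] by (intro bexI[of _ t]) auto
 qed
 then show ?thesis using r(2) by blast
qed

section \<open>Critical points solve the equation\<close>

context
 fixes T :: real and K :: "(real ^ 'n) set"
 assumes T: "T > 0" and K: "bounded K"
begin

lemma per_weak_partial:
 fixes f g :: "real ^ 'n => complex"
 assumes w: "is_weak_partial k f g" and f: "!!x. x \<notin> K ==> f x = 0" and g: "!!x. x \<notin> K ==> g x = 0"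
  and L: "per T f \<in> L1_loc" "per T g \<in> L1_loc"
 shows "is_weak_partial k (per T f) (per T g)"
 unfolding is_weak_partial_def
proof (intro conjI allI impI L)
 fix \<phi> :: "real ^ 'n => real" assume \<phi>: "test_function \<phi>"
 obtain A where A: "compact A" "ALL x. x \<notin> A --> \<phi> x = 0" "ALL x k. x \<notin> A --> partial k \<phi> x = 0"
  using test_function_support[OF \<phi>] by (elim exE conjE)
 obtain M where M: "finite M" "ALL x:A. ALL m. m \<notin> M --> x + lat T m \<notin> K" using per_on_bounded[OF T K compact_imp_bounded[OF A(1)]] by (elim exE conjE)
 have sum: "is_weak_partial k (%x. \<Sum>m\<in>M. f (x + lat T m)) (%x. \<Sum>m\<in>M. g (x + lat T m))"
  using M(1)
 proof (induction M rule: finite_induct)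
  case empty show ?case using is_weak_partial_const[of k 0] by simp
 next
  case (insert m M)
  then show ?case using is_weak_partial_add[OF is_weak_partial_translation[OF w] insert.IH, of "lat T m"] by simp
 qed
 have pf: "\<psi> x *R per T h x = \<psi> x *R (\<Sum>m\<in>M. h (x + lat T m))"
  if "ALL x. x \<notin> A --> \<psi> x = 0" "!!x. x \<notin> K ==> h x = 0" for \<psi> :: "real ^ 'n => real" and h :: "real ^ 'n => complex" and x
 proof (cases "x \<in> A")
  case True
  then have "per T h x = (\<Sum>m\<in>M. h (x + lat T m))" using M that(2) by (intro per_eq_sum) auto
  then show ?thesis by simp
 qed (use that in simp)
 have p: "ALL x. x \<notin> A --> partial k \<phi> x = 0" using A(3) by simp
 have e1: "partial k \<phi> x *R per T f x = partial k \<phi> x *R (\<Sum>m\<in>M. f (x + lat T m))" for x by (rule pf[OF p]) (rule f)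
 have e2: "\<phi> x *R per T g x = \<phi> x *R (\<Sum>m\<in>M. g (x + lat T m))" for x by (rule pf[OF A(2)]) (rule g)
 show "(LINT x|leb. partial k \<phi> x *R per T f x) = - (LINT x|leb. \<phi> x *R per T g x)"
  unfolding e1 e2 using sum \<phi> by (simp add: is_weak_partial_def)
qed

lemma per_H1:
 fixes f :: "real ^ 'n => complex" and g :: "'n => real ^ 'n => complex"
 assumes w: "!!k. is_weak_partial k f (g k)" and f: "!!x. x \<notin> K ==> f x = 0" and g: "!!k x. x \<notin> K ==> g k x = 0"
  and m: "f \<in> bmeas borel" "!!k. g k \<in> bmeas borel" and B: "!!x. cmod (f x) <= B" "!!k x. cmod (g k x) <= B"
 shows "per T f \<in> H1_per T" "AE x in leb. wp k (per T f) x = per T (g k) x"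
proof -
 have P: "h' \<in> bmeas borel \<and> h' \<in> bmeas leb \<and> h' \<in> L1_loc \<and> Lp 2 (cm T) h'"
  if "h' = per T h" "!!x. x \<notin> K ==> h x = 0" "h \<in> bmeas borel" "!!x. cmod (h x) <= B" for h h' :: "real ^ 'n => complex"
 proof -
  have b: "h' \<in> bmeas borel" unfolding that(1) by (rule per_borel[OF T K]) (use that in auto)
  then have l: "h' \<in> bmeas leb" by (intro measurable_completion) simp
  have "EX C. ALL x. cmod (h' x) <= C" unfolding that(1) by (rule per_bounded[OF T K]) (use that in auto)
  then obtain C where C: "ALL x. cmod (h' x) <= C" by (rule exE)
  then have C0: "0 <= C" using order_trans[OF norm_ge_zero] by blast
  have "h' \<in> L1_loc" by (rule L1_locI_bounded[OF l _ C0]) (use C in auto)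
  moreover have "Lp 2 (cm T) h'" by (rule lpn_bounded(1)[OF finite_measure_cm, of 2 _ _ C]) (use C C0 measurable_cm[OF l] in auto)
  ultimately show ?thesis using b l by blast
 qed
 have F: "per T f \<in> bmeas leb" "per T f \<in> L1_loc" "Lp 2 (cm T) (per T f)"
  using P[OF refl _ m(1) B(1)] f by auto
 have G: "per T (g k) \<in> L1_loc" "Lp 2 (cm T) (per T (g k))" for k
  using P[OF refl _ m(2) B(2)] g by auto
 have W: "is_weak_partial k (per T f) (per T (g k))" for k by (rule per_weak_partial[OF w f g]) (use F G in auto)
 show "per T f \<in> H1_per T" by (rule H1_perI[OF T per_lper _ _ W]) (use F G in auto)
 show "AE x in leb. wp k (per T f) x = per T (g k) x" by (rule weak_partial_eq_AE[OF W])
qed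

end

lemma test_function_weak_partial:
 fixes \<phi> :: "real ^ 'n => real"
 assumes \<phi>: "test_function \<phi>"
 shows "is_weak_partial k (%x. complex_of_real (\<phi> x)) (%x. complex_of_real (partial k \<phi> x))"
proof -
 obtain B where B: "ALL x. \<bar>\<phi> x\<bar> <= B" "ALL x. \<bar>partial k \<phi> x\<bar> <= B" using test_function_bounded[OF \<phi>, of k] by (elim exE conjE)
 note c = test_function_continuous[OF \<phi>] test_function_partial_continuous[OF \<phi>, of k]
 have m: "\<phi> \<in> bmeas borel" "partial k \<phi> \<in> bmeas borel" using c by (auto intro: borel_measurable_continuous_onI)
 show ?thesis
 proof (rule is_weak_partialI_difference[where B = B and L = B])
  show "(%x. complex_of_real (\<phi> x)) \<in> bmeas leb" "(%x. complex_of_real (partial k \<phi> x)) \<in> bmeas leb"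
   using m by (auto intro!: measurable_completion)
  show "cmod (complex_of_real (\<phi> x)) <= B" for x using B by simp
  show "cmod (complex_of_real (\<phi> (x + t *R axis k 1)) - complex_of_real (\<phi> x)) <= B * \<bar>t\<bar>" for x t
   unfolding of_real_diff[symmetric] norm_of_real by (rule test_function_line_lipschitz[OF \<phi>]) (use B in simp)
  have "((%t. complex_of_real (\<phi> (x + t *R axis k 1))) has_vector_derivative complex_of_real (partial k \<phi> x)) (at 0)" for x
   using has_vector_derivative_of_real[of "%t. \<phi> (x + t *R axis k 1)" "partial k \<phi> x" "at 0"] test_function_line[OF \<phi>, of x k 0]
   by simp
  then show "AE x in leb. ((%t. complex_of_real (\<phi> (x + t *R axis k 1))) has_vector_derivative complex_of_real (partial k \<phi> x)) (at 0)" by simp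
 qed
qed

text \<open>
On one cell \<open>u\<close> and \<open>u\<^sup>2\<close> are square integrable, and \<open>|u|\<^sup>3\<close> is at most \<open>|u|\<^sup>2 + |u|\<^sup>4\<close>.
\<close>

lemma cub_L1_loc:
 fixes u :: "real ^ 'n => complex"
 assumes N: "CARD('n) <= 3" and T: "T > 0" and u: "u \<in> H1_per T"
 shows "(%x. cub (u x)) \<in> L1_loc"
proof -
 note U = H1_perD[OF T u]
 obtain K where K: "K >= 0" "ALL u : (H1_per T :: (real ^ 'n => complex) set). Lp 4 (cm T) u \<and> lpn 4 (cm T) u <= K * H1_norm T u"
  using H1_per_L4_bound[OF N T] by (elim exE conjE)
 have u4: "Lp 4 (cm T) u" using K u by blast
 define s where "s x = u x * u x" for x
 have sm: "s \<in> bmeas leb" unfolding s_def using U(2) by measurable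
 have "Lp 2 (cm T) s"
  using L4_products(1)[OF u4 u4] measurable_cm[OF sm] by (simp add: Lp_def s_def norm_mult power_mult_distrib)
 then have s2: "s \<in> L2_loc" using L2_loc_periodic_iff[OF T sm] U(1) by (simp add: lper_def s_def)
 have u2: "u \<in> L2_loc" using u by (simp add: H1_per_def H1_loc_def)
 show ?thesis unfolding L1_loc_def
 proof (intro CollectI allI impI)
  fix A :: "(real ^ 'n) set" assume A: "compact A"
  have As: "A \<in> sets leb" using A by (simp add: borel_closed compact_imp_closed)
  have i: "set_integrable leb A (%x. 1 + (cmod (u x))^2 + ((cmod (u x))^2 + (cmod (s x))^2))"
  proof (intro set_integral_add)
   show "set_integrable leb A (%x. 1 :: real)"
    using lmeasurable_compact[OF A] by (simp add: set_integrable_def lmeasurable_iff_integrable)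
   show "set_integrable leb A (%x. (cmod (u x))^2)" "set_integrable leb A (%x. (cmod (s x))^2)" "set_integrable leb A (%x. (cmod (u x))^2)"
    using u2 s2 A by (auto simp: L2_loc_def)
  qed
  have le: "cmod (cub z) <= 1 + (cmod z)^2 + ((cmod z)^2 + (cmod (z * z))^2)" for z
  proof -
   have "a <= 1 + a^2" for a :: real
   proof -
    have "0 <= (a - 1/2)^2" by simp
    then show ?thesis by (simp add: power2_eq_square algebra_simps)
   qed
   moreover have "a * a * a <= a^2 + (a * a)^2" for a :: real
   proof -
    have "0 <= (a - a * a / 2)^2 + 3/4 * (a * a)^2" by simp
    then show ?thesis by (simp add: power2_eq_square algebra_simps)
   qed
   ultimately show ?thesis using cub_le[of z] by (metis (no_types, lifting) add_mono norm_mult order_trans)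
  qed
  show "set_integrable leb A (%x. cub (u x))"
  proof (rule set_integrable_bound[OF i])
   show "set_borel_measurable leb A (%x. cub (u x))"
    unfolding set_borel_measurable_def using cub_measurable[OF U(2)] As by measurable
   show "AE x in leb. x \<in> A --> norm (cub (u x)) <= norm (1 + (cmod (u x))^2 + ((cmod (u x))^2 + (cmod (s x))^2))"
    unfolding s_def using le by (auto intro!: AE_I2 order_trans[OF le])
  qed
 qed
qed

text \<open>
The periodizations of \<open>z \<phi>\<close>, for a test function \<open>\<phi>\<close> and a complex number \<open>z\<close>, are admissible directions. By \<open>per_unfold\<close> the derivative of the action in such a direction is the
real scalar product of the weak form of the equation with \<open>z\<close>; so the weak form vanishes.
\<close>

lemma critical_imp_solves:
 fixes u :: "real ^ 'n => complex"
 assumes N: "CARD('n) <= 3" and T: "T > 0" and u: "u \<in> H1_per T" and crit: "!!v. v \<in> H1_per T ==> dact j T c u v = 0"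
 shows "solves_equation j c u"
proof -
 note U = H1_perD[OF T u]
 have cubL: "(%x. cub (u x)) \<in> L1_loc" by (rule cub_L1_loc[OF N T u])
 have cub: "of_real (1 - (cmod z)^2) * z = cub z" for z by (simp add: cub_def scaleR_conv_of_real)
 have wL: "wp k u \<in> L1_loc" for k using U(3)[of k] by (simp add: is_weak_partial_def)
 have "(LINT x|leb. \<phi> x *R (\<i> * of_real c * wp j u x) - (\<Sum>k\<in>UNIV. partial k \<phi> x *R wp k u x) + \<phi> x *R cub (u x)) = 0"
  if \<phi>: "test_function \<phi>" for \<phi>
 proof -
  obtain A where A: "compact A" "ALL x. x \<notin> A --> \<phi> x = 0" "ALL x k. x \<notin> A --> partial k \<phi> x = 0"
   using test_function_support[OF \<phi>] by (elim exE conjE)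
  have Ab: "bounded A" using A(1) by (rule compact_imp_bounded)
  have "ALL k. EX B. (ALL x. \<bar>\<phi> x\<bar> <= B) \<and> (ALL x. \<bar>partial k \<phi> x\<bar> <= B)" using test_function_bounded[OF \<phi>] by blast
  from choice[OF this] obtain B' where B': "ALL k. (ALL x. \<bar>\<phi> x\<bar> <= B' k) \<and> (ALL x. \<bar>partial k \<phi> x\<bar> <= B' k)" by (rule exE)
  define B where "B = Max (range B')"
  have BB: "B' k <= B" for k unfolding B_def by (rule Max_ge) auto
  have B: "\<bar>\<phi> x\<bar> <= B" "\<bar>partial k \<phi> x\<bar> <= B" for k x using B' BB[of k] order_trans by blast+
  note c = test_function_continuous[OF \<phi>] test_function_partial_continuous[OF \<phi>]
  have m: "\<phi> \<in> bmeas borel" "partial k \<phi> \<in> bmeas borel" for k using c by (auto intro: borel_measurable_continuous_onI)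
  define f where "f = (%x. complex_of_real (\<phi> x))"
  define g where "g k = (%x. complex_of_real (partial k \<phi> x))" for k
  have P: "per T f \<in> H1_per T" "AE x in leb. wp k (per T f) x = per T (g k) x" for k
  proof -
   have H: "!!k. is_weak_partial k f (g k)" "!!x. x \<notin> A ==> f x = 0" "!!k x. x \<notin> A ==> g k x = 0"
    "f \<in> bmeas borel" "!!k. g k \<in> bmeas borel" "!!x. cmod (f x) <= B" "!!k x. cmod (g k x) <= B"
    unfolding f_def g_def using test_function_weak_partial[OF \<phi>] A m B by auto
   show "per T f \<in> H1_per T" by (rule per_H1(1)[OF T Ab H])
   show "AE x in leb. wp k (per T f) x = per T (g k) x" by (rule per_H1(2)[OF T Ab H])
  qed
  have of: "per T (%y. complex_of_real (h y)) x = complex_of_real (per T h x)" if "!!x. x \<notin> A ==> h x = 0" for h x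
  proof -
   obtain M where M: "finite M" "ALL m. m \<notin> M --> x + lat T m \<notin> A" using per_finite[OF T Ab, of x] by (elim exE conjE)
   show ?thesis by (rule per_linear[OF _ _ M(1)]) (use M that in auto)
  qed
  have per_u: "AE x in leb. u (x + lat T m) = u x" for m using U(1) by (simp add: lper_def)
  have unf: "(LINT x|leb. \<theta> x *R w x) \<bullet> z = (LINT x|cm T. w x \<bullet> (z * of_real (per T \<theta> x)))"
   if "integrable leb (%x. \<theta> x *R w x)" "!!x. x \<notin> A ==> \<theta> x = 0" "!!m. AE x in leb. w (x + lat T m) = w x"
   for \<theta> :: "real ^ 'n => real" and w :: "real ^ 'n => complex" and z :: complex
  proof -
   have Q: "(LINT x|leb. \<theta> x *R w x) = (LINT x|cm T. per T \<theta> x *R w x)" "integrable (cm T) (%x. per T \<theta> x *R w x)"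
    by (rule per_unfold[OF T Ab that(1)], use that in auto)+
   have "(LINT x|leb. \<theta> x *R w x) \<bullet> z = (LINT x|cm T. (per T \<theta> x *R w x) \<bullet> z)" unfolding Q(1) using Q(2) by (intro integral_inner_left[symmetric])
   also have "... = (LINT x|cm T. w x \<bullet> (z * of_real (per T \<theta> x)))"
    by (rule Bochner_Integration.integral_cong) (auto simp: inner_complex_def algebra_simps)
   finally show ?thesis .
  qed
  let ?D = "%k. \<integral>x. partial k \<phi> x *R wp k u x \<partial>leb"
  let ?J = "\<integral>x. \<phi> x *R wp j u x \<partial>leb" and ?C = "\<integral>x. \<phi> x *R cub (u x) \<partial>leb"
  have key: "((\<Sum>k\<in>UNIV. ?D k) - c *R (\<i> * ?J) - ?C) \<bullet> z = 0" for z
  proof -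
   let ?v = "%x. z * per T f x"
   have v: "?v \<in> H1_per T" using H1_per_lin(1)[OF T P(1) P(1), of z 0] by simp
   have D: "?D k \<bullet> z = (LINT x|cm T. wp k u x \<bullet> wp k ?v x)" for k
   proof -
    have "?D k \<bullet> z = (LINT x|cm T. wp k u x \<bullet> (z * of_real (per T (partial k \<phi>) x)))"
     by (rule unf[OF test_integrable(2)[OF \<phi> wL] _ U(7)]) (use A in simp)
    also have "... = (LINT x|cm T. wp k u x \<bullet> wp k ?v x)"
    proof (rule integral_cong_AE)
     have gp: "per T (g k) x = of_real (per T (partial k \<phi>) x)" for x unfolding g_def by (rule of) (use A in simp)
     show "AE x in cm T. wp k u x \<bullet> (z * of_real (per T (partial k \<phi>) x)) = wp k u x \<bullet> wp k ?v x"
      using wp_mult[OF T P(1), of k z] AE_cm[OF P(2)[of k]] by eventually_elim (simp add: gp)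
     have "per T (partial k \<phi>) \<in> bmeas borel" by (rule per_borel[OF T Ab _ m(2)]) (use A in simp)
     then have pm: "(%x. complex_of_real (per T (partial k \<phi>) x)) \<in> bmeas leb" by (intro measurable_completion) simp
     show "(%x. wp k u x \<bullet> (z * of_real (per T (partial k \<phi>) x))) \<in> bmeas (cm T)"
      by (intro borel_measurable_inner borel_measurable_times borel_measurable_const borel_measurable_of_real measurable_cm U pm)
     show "(%x. wp k u x \<bullet> wp k ?v x) \<in> bmeas (cm T)"
      by (intro borel_measurable_inner measurable_cm U H1_perD(4)[OF T v])
    qed
    finally show ?thesis .
   qed
   have pf: "per T f x = of_real (per T \<phi> x)" for x unfolding f_def by (rule of) (use A in simp)
   have J: "(\<i> * ?J) \<bullet> z = Mom j T u ?v"
   proof -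
    have "(\<i> * ?J) \<bullet> z = ?J \<bullet> (- \<i> * z)" by (rule i_inner)
    also have "... = (LINT x|cm T. wp j u x \<bullet> ((- \<i> * z) * of_real (per T \<phi> x)))"
     by (rule unf[OF test_integrable(1)[OF \<phi> wL] _ U(7)]) (use A in simp)
    finally show ?thesis by (simp add: Mom_def pf mult.assoc)
   qed
   have C: "?C \<bullet> z = (LINT x|cm T. cub (u x) \<bullet> ?v x)"
    unfolding pf by (rule unf[OF test_integrable(1)[OF \<phi> cubL]]) (use A U(1) in "auto simp: lper_def")
   have "((\<Sum>k\<in>UNIV. ?D k) - c *R (\<i> * ?J) - ?C) \<bullet> z = dact j T c u ?v"
    unfolding inner_diff_left inner_sum_left inner_scaleR_left D J C dact_def Dir_def ..
   then show ?thesis using crit[OF v] by simp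
  qed
  have 0: "(\<Sum>k\<in>UNIV. ?D k) - c *R (\<i> * ?J) - ?C = 0" using key[of "(\<Sum>k\<in>UNIV. ?D k) - c *R (\<i> * ?J) - ?C"] by (simp only: inner_eq_zero_iff)
  have i1: "integrable leb (%x. \<phi> x *R (\<i> * of_real c * wp j u x))" by (rule test_integrable(1)[OF \<phi> L1_loc_mult[OF wL]])
  have i2: "integrable leb (%x. \<Sum>k\<in>UNIV. partial k \<phi> x *R wp k u x)" by (intro Bochner_Integration.integrable_sum test_integrable(2)[OF \<phi> wL])
  have i3: "integrable leb (%x. \<phi> x *R cub (u x))" by (rule test_integrable(1)[OF \<phi> cubL])
  have "(LINT x|leb. \<phi> x *R (\<i> * of_real c * wp j u x)) = (LINT x|leb. (\<i> * of_real c) * (\<phi> x *R wp j u x))" by simp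
  also have "... = c *R (\<i> * ?J)" by (simp only: integral_mult_right_zero) (simp add: scaleR_conv_of_real)
  finally have J: "(LINT x|leb. \<phi> x *R (\<i> * of_real c * wp j u x)) = c *R (\<i> * ?J)" .
  have S: "(LINT x|leb. (\<Sum>k\<in>UNIV. partial k \<phi> x *R wp k u x)) = (\<Sum>k\<in>UNIV. ?D k)"
   by (rule Bochner_Integration.integral_sum) (rule test_integrable(2)[OF \<phi> wL])
  have "(LINT x|leb. \<phi> x *R (\<i> * of_real c * wp j u x) - (\<Sum>k\<in>UNIV. partial k \<phi> x *R wp k u x) + \<phi> x *R cub (u x))
   = c *R (\<i> * ?J) - (\<Sum>k\<in>UNIV. ?D k) + ?C"
   using i1 i2 i3 by (simp only: Bochner_Integration.integral_add Bochner_Integration.integral_diff Bochner_Integration.integrable_diff J S)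
  then show ?thesis using 0 by (simp add: algebra_simps)
 qed
 then show ?thesis unfolding solves_equation_def cub using u cubL by (auto simp: H1_per_def)
qed

lemma critical_point_from_derivative:
 fixes u :: "real ^ 'n => complex"
 assumes N: "CARD('n) <= 3" and T: "T > 0" and u: "u \<in> H1_per T" and crit: "!!v. v \<in> H1_per T ==> dact j T c u v = 0"
 shows "critical_point T (action j T c) u"
 unfolding critical_point_def
proof (intro conjI u allI impI)
 fix e :: real assume e: "e > 0"
 obtain L where L: "L >= 0" "ALL h:H1_per T. H1_norm T h <= 1 --> \<bar>action j T c (u + h) - action j T c u - dact j T c u h\<bar> <= L * (H1_norm T h)^2"
  using action_regular[where j = j and R = "H1_norm T u" and c = c, OF N T] u by blast
 show "EX \<delta>>0. ALL h:H1_per T. H1_norm T h < \<delta> --> \<bar>action j T c (%x. u x + h x) - action j T c u\<bar> <= e * H1_norm T h"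
 proof (intro exI[of _ "min 1 (e / (L + 1))"] conjI ballI impI)
  fix h :: "real ^ 'n => complex" assume h: "h \<in> H1_per T" "H1_norm T h < min 1 (e / (L + 1))"
  have n: "0 <= H1_norm T h" by (rule H1_norm_nonneg[OF T h(1)])
  have "(L + 1) * H1_norm T h <= e" using h(2) L(1) by (simp add: pos_less_divide_eq mult.commute less_imp_le)
  then have le: "L * H1_norm T h <= e" using n by (simp add: algebra_simps)
  have "\<bar>action j T c (u + h) - action j T c u\<bar> <= L * (H1_norm T h)^2" using L(2) h crit[OF h(1)] by fastforce
  also have "... = (L * H1_norm T h) * H1_norm T h" by (simp add: power2_eq_square)
  also have "... <= e * H1_norm T h" by (rule mult_right_mono[OF le n])
  finally show "\<bar>action j T c (%x. u x + h x) - action j T c u\<bar> <= e * H1_norm T h" by (simp add: plus_fun_def)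
 qed (use e L in simp)
qed

section \<open>A path to negative action\<close>

definition tensor :: "('n::finite => real => complex) => real ^ 'n => complex" where
 "tensor F x = (\<Prod>i\<in>UNIV. F i (x $ i))"

definition tensor_partial :: "('n::finite => real => complex) => ('n => real => complex) => 'n => real ^ 'n => complex" where
 "tensor_partial F F' k x = F' k (x $ k) * (\<Prod>i\<in>UNIV - {k}. F i (x $ i))"

lemma tensor_remove: "tensor F x = F k (x $ k) * (\<Prod>i\<in>UNIV - {k}. F i (x $ i))"
 unfolding tensor_def by (rule prod.remove) auto

lemma AE_component_not_in:
 assumes "finite E"
 shows "AE x in leb. (x :: real ^ 'n) $ k \<notin> E"
proof -
 have "AE x in leb. (x :: real ^ 'n) $ k ~= T" for T
 proof -
  have "{x :: real ^ 'n. x $ k = T} = {x. axis k 1 \<bullet> x = T}" by (simp add: inner_axis')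
  then have "negligible {x :: real ^ 'n. x $ k = T}" using negligible_hyperplane[of "axis k 1 :: real ^ 'n" T] by (simp add: axis_eq_0_iff)
  then have "{x :: real ^ 'n. x $ k = T} \<in> null_sets leb" by (simp add: negligible_iff_null_sets)
  then have "AE x in leb. \<not> (x :: real ^ 'n) \<in> {x. x $ k = T}" by (rule AE_not_in)
  then show ?thesis by simp
 qed
 then have "AE x in leb. ALL T:E. (x :: real ^ 'n) $ k ~= T" using assms by (intro AE_finite_allI) auto
 then show ?thesis by eventually_elim auto
qed

text \<open>
Along axis \<open>k\<close> only one factor varies, and it is differentiable off a finite set; the exceptional points of the product lie on finitely many hyperplanes.
\<close>

lemma tensor_weak_partial:
 fixes F F' :: "'n::finite => real => complex"
 assumes m: "!!i. F i \<in> bmeas borel" "!!i. F' i \<in> bmeas borel"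
  and B: "!!i s. cmod (F i s) <= B i" and L: "!!i s t. cmod (F i s - F i t) <= L * \<bar>s - t\<bar>"
  and E: "finite E" and D: "!!i s. s \<notin> E ==> (F i has_vector_derivative F' i s) (at s)"
 shows "is_weak_partial k (tensor F) (tensor_partial F F' k)"
  "tensor F \<in> bmeas borel" "tensor_partial F F' k \<in> bmeas borel"
proof -
 note [measurable] = m
 show tb: "tensor F \<in> bmeas borel" unfolding tensor_def[abs_def] by measurable
 show gb: "tensor_partial F F' k \<in> bmeas borel" unfolding tensor_partial_def[abs_def] by measurable
 have B0: "0 <= B i" for i by (rule order_trans[OF norm_ge_zero B])
 have L0: "0 <= L" using order_trans[OF norm_ge_zero L[of _ 1 0]] by simp
 let ?P = "%x :: real ^ 'n. \<Prod>i\<in>UNIV - {k}. F i (x $ i)"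
 have P: "cmod (?P x) <= (\<Prod>i\<in>UNIV - {k}. B i)" for x unfolding prod_norm[symmetric] by (intro prod_mono) (auto simp: B)
 have line: "tensor F (x + t *R axis k 1) = F k (t + x $ k) * ?P x" for x t
  unfolding tensor_remove[of F _ k] by (intro arg_cong2[where f = times] prod.cong refl) (auto simp: axis_def add.commute)
 show "is_weak_partial k (tensor F) (tensor_partial F F' k)"
 proof (rule is_weak_partialI_difference[where B = "\<Prod>i\<in>UNIV. B i" and L = "L * (\<Prod>i\<in>UNIV - {k}. B i)"])
  show "tensor F \<in> bmeas leb" "tensor_partial F F' k \<in> bmeas leb"
   using tb gb by (auto intro: measurable_completion)
  show "cmod (tensor F x) <= (\<Prod>i\<in>UNIV. B i)" for x unfolding tensor_def prod_norm[symmetric] by (intro prod_mono) (auto simp: B)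
  show "cmod (tensor F (x + t *R axis k 1) - tensor F x) <= L * (\<Prod>i\<in>UNIV - {k}. B i) * \<bar>t\<bar>" for x t
  proof -
   have "tensor F (x + t *R axis k 1) - tensor F x = (F k (t + x $ k) - F k (x $ k)) * ?P x"
    unfolding line tensor_remove[of F x k] by (simp add: algebra_simps)
   then have "cmod (tensor F (x + t *R axis k 1) - tensor F x) <= (L * \<bar>t\<bar>) * (\<Prod>i\<in>UNIV - {k}. B i)"
    unfolding norm_mult using L[of k "t + x $ k" "x $ k"] P[of x] L0 by (simp add: norm_mult mult_mono)
   then show ?thesis by (simp add: mult_ac)
  qed
  show "AE x in leb. ((%t. tensor F (x + t *R axis k 1)) has_vector_derivative tensor_partial F F' k x) (at 0)"
   using AE_component_not_in[OF E, of k]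
  proof eventually_elim
   case (elim x)
   have "((%t. t + x $ k) has_vector_derivative 1) (at 0)" by (auto intro!: derivative_eq_intros)
   from vector_diff_chain_at[OF this, of "F k" "F' k (x $ k)"] have "((%t. F k (t + x $ k)) has_vector_derivative F' k (x $ k)) (at 0)"
    using D[OF elim, of k] by (simp add: o_def)
   then show ?case unfolding line tensor_partial_def by (rule has_vector_derivative_mult_left)
  qed
 qed
qed

definition clamp1 :: "real => real => real" where "clamp1 h s = max (- h) (min h s)"

definition cutoff :: "real => real => complex" where "cutoff R s = of_real (max 0 (min 1 (R - \<bar>s\<bar>)))"

definition cutoff' :: "real => real => complex" where "cutoff' R s = (if R - 1 < \<bar>s\<bar> \<and> \<bar>s\<bar> < R then of_real (- sgn s) else 0)"

text \<open>
One turn of the plane wave \<open>- exp (- i c s / 2)\<close>, continued by the constant \<open>1\<close> from the points \<open>s = 2 \<pi> / c\<close> and \<open>s = - 2 \<pi> / c\<close>, where it has this value.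
\<close>

definition wave :: "real => real => complex" where "wave c s = - cis (- (c/2) * clamp1 (2 * pi / c) s)"

definition wave' :: "real => real => complex" where "wave' c s = (if \<bar>s\<bar> <= 2 * pi / c then - \<i> * of_real (c/2) * wave c s else 0)"

lemma cmod_cis_diff_le: "cmod (cis a - cis b) <= \<bar>a - b\<bar>"
proof -
 have "norm (cis a - cis b) <= 1 * norm (a - b)"
  by (rule differentiable_bound[of UNIV cis "%s h. h *R (\<i> * cis s)"])
   (auto intro!: derivative_eq_intros onorm_le simp: norm_mult fun_eq_iff scaleR_conv_of_real)
 then show ?thesis by simp
qed

lemma clamp1_lipschitz: "\<bar>clamp1 h s - clamp1 h t\<bar> <= \<bar>s - t\<bar>"
 by (auto simp: clamp1_def max_def min_def)

lemma wave_lipschitz: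
 assumes "c > 0"
 shows "cmod (wave c s - wave c t) <= c/2 * \<bar>s - t\<bar>"
proof -
 let ?h = "2 * pi / c"
 have "cmod (wave c s - wave c t) = cmod (cis (- (c/2) * clamp1 ?h s) - cis (- (c/2) * clamp1 ?h t))"
  unfolding wave_def by (subst norm_minus_commute) simp
 also have "... <= \<bar>- (c/2) * clamp1 ?h s - - (c/2) * clamp1 ?h t\<bar>" by (rule cmod_cis_diff_le)
 also have "... = c/2 * \<bar>clamp1 ?h s - clamp1 ?h t\<bar>" using assms unfolding right_diff_distrib[symmetric] by (simp add: abs_mult)
 also have "... <= c/2 * \<bar>s - t\<bar>" using assms clamp1_lipschitz by (intro mult_left_mono) auto
 finally show ?thesis .
qed

lemma wave_outside:
 assumes c: "c > 0" and s: "2 * pi / c <= \<bar>s\<bar>"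
 shows "wave c s = 1"
proof -
 have "0 < 2 * pi / c" using c by simp
 then have "clamp1 (2 * pi / c) s = 2 * pi / c \<or> clamp1 (2 * pi / c) s = - (2 * pi / c)" using s by (auto simp: clamp1_def abs_if split: if_splits)
 then have "- (c/2) * clamp1 (2 * pi / c) s = - pi \<or> - (c/2) * clamp1 (2 * pi / c) s = pi" using c by auto
 moreover have "- cis \<theta> = 1" if "\<theta> = - pi \<or> \<theta> = pi" for \<theta> using that by (auto simp: complex_eq_iff)
 ultimately show ?thesis unfolding wave_def by blast
qed

lemma wave_cmod: "cmod (wave c s) = 1"
 by (simp add: wave_def)

lemma wave_derivative:
 assumes c: "c > 0" and s: "\<bar>s\<bar> ~= 2 * pi / c"
 shows "(wave c has_vector_derivative wave' c s) (at s)"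
proof (cases "\<bar>s\<bar> < 2 * pi / c")
 case True
 have eq: "- cis (- (c/2) * t) = wave c t" if "t \<in> {- (2 * pi / c)<..<2 * pi / c}" for t
  using that by (simp add: wave_def clamp1_def)
 have w: "wave c s = - cis (- (c/2) * s)" using eq[of s] True by (simp add: abs_less_iff)
 have "((%t. - cis (- (c/2) * t)) has_vector_derivative wave' c s) (at s)"
  using True by (auto intro!: derivative_eq_intros simp: wave'_def w has_vector_derivative_def fun_eq_iff scaleR_conv_of_real algebra_simps abs_less_iff)
 then show ?thesis
  by (rule has_vector_derivative_transform_within_open[of _ _ _ "{- (2 * pi / c)<..<2 * pi / c}"]) (use True eq in "auto simp: abs_less_iff")
next
 case False
 have "s \<in> - {- (2 * pi / c)..2 * pi / c}" using s False by auto
 moreover have "wave' c s = 0" using False s by (auto simp: wave'_def)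
 moreover have "1 = wave c y" if "y \<in> - {- (2 * pi / c)..2 * pi / c}" for y using that by (intro wave_outside[OF c, symmetric]) auto
 ultimately show ?thesis
  using has_vector_derivative_transform_within_open[OF has_vector_derivative_const[of 1 "at s"], of "- {- (2 * pi / c)..2 * pi / c}" "wave c"]
  by (simp only: open_Compl closed_atLeastAtMost)
qed

lemma cutoff_lipschitz: "cmod (cutoff R s - cutoff R t) <= \<bar>s - t\<bar>"
 unfolding cutoff_def of_real_diff[symmetric] norm_of_real by (auto simp: max_def min_def abs_if)

lemma cutoff_cmod: "cmod (cutoff R s) <= 1" "cmod (cutoff' R s) <= 1"
 by (auto simp: cutoff_def cutoff'_def sgn_if)

lemma cutoff_derivative:
 assumes R: "1 < R" and s: "\<bar>s\<bar> ~= R" "\<bar>s\<bar> ~= R - 1"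
 shows "(cutoff R has_vector_derivative cutoff' R s) (at s)"
proof -
 consider "\<bar>s\<bar> < R - 1" | "R - 1 < s" "s < R" | "- R < s" "s < 1 - R" | "R < \<bar>s\<bar>" using s by fastforce
 then show ?thesis
 proof cases
  case 1
  show ?thesis
   by (rule has_vector_derivative_transform_within_open[of "%_. 1" _ _ "{- (R - 1)<..<R - 1}"]) (use 1 in "auto simp: cutoff'_def cutoff_def abs_if split: if_splits")
 next
  case 2
  have "((%t. of_real (R - t)) has_vector_derivative cutoff' R s) (at s)"
   using 2 R by (auto intro!: derivative_eq_intros simp: cutoff'_def)
  then show ?thesis
   by (rule has_vector_derivative_transform_within_open[of _ _ _ "{R - 1<..<R}"]) (use 2 R in "auto simp: cutoff_def")
 next
  case 3
  have "((%t. of_real (R + t)) has_vector_derivative cutoff' R s) (at s)"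
   using 3 R by (auto intro!: derivative_eq_intros simp: cutoff'_def)
  then show ?thesis
   by (rule has_vector_derivative_transform_within_open[of _ _ _ "{- R<..<1 - R}"]) (use 3 R in "auto simp: cutoff_def")
 next
  case 4
  show ?thesis
   by (rule has_vector_derivative_transform_within_open[of "%_. 0" _ _ "- {- R..R}"]) (use 4 in "auto simp: cutoff'_def cutoff_def")
 qed
qed

text \<open>
The action density of \<open>1 + z\<close> with gradient \<open>p\<close>.
\<close>

definition dens :: "'n => real => complex => ('n::finite => complex) => real" where
 "dens j c z p = 1/2 * (\<Sum>k\<in>UNIV. (cmod (p k))^2) + 1/4 * (1 - (cmod (1 + z))^2)^2 - c/2 * ((\<i> * p j) \<bullet> (1 + z))"

lemma dens_zero: "dens j c 0 (%k. 0) = 0"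
 by (simp add: dens_def)

lemma dens_bound:
 fixes p :: "'n::finite => complex" and b c :: real
 assumes c: "0 <= c" and z: "cmod z <= 2" and p: "!!k. cmod (p k) <= b"
 shows "\<bar>dens j c z p\<bar> <= 1/2 * (CARD('n) * b^2) + 25 + c/2 * (b * 3)"
proof -
 have "(\<Sum>k\<in>UNIV. (cmod (p k))^2) <= (\<Sum>k\<in>(UNIV :: 'n set). b^2)" by (intro sum_mono power_mono p) simp
 then have 1: "(\<Sum>k\<in>UNIV. (cmod (p k))^2) <= CARD('n) * b^2" by simp
 have z3: "cmod (1 + z) <= 3" using norm_triangle_ineq[of 1 z] z by simp
 from power_mono[OF this, of 2] have "(cmod (1 + z))^2 <= 9" by simp
 then have "\<bar>1 - (cmod (1 + z))^2\<bar> <= 10" using zero_le_power2[of "cmod (1 + z)"] by linarith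
 from power_mono[OF this, of 2] have 2: "(1 - (cmod (1 + z))^2)^2 <= 100" by simp
 have "\<bar>(\<i> * p j) \<bullet> (1 + z)\<bar> <= cmod (\<i> * p j) * cmod (1 + z)" by (rule Cauchy_Schwarz_ineq2)
 also have "... <= b * 3" unfolding norm_mult using p[of j] z3 by (simp add: mult_mono' order_trans[OF norm_ge_zero p])
 finally have 3: "\<bar>c/2 * ((\<i> * p j) \<bullet> (1 + z))\<bar> <= c/2 * (b * 3)" using c by (simp only: abs_mult) (simp add: mult_left_mono)
 have "0 <= (\<Sum>k\<in>UNIV. (cmod (p k))^2)" "0 <= (1 - (cmod (1 + z))^2)^2" by (auto intro: sum_nonneg)
 then show ?thesis unfolding dens_def using 1 2 3 by linarith
qed

lemma action_dens:
 fixes f :: "real ^ 'n => complex" and g :: "'n => real ^ 'n => complex"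
 assumes N: "CARD('n) <= 3" and T: "T > 0" and f: "f \<in> H1_per T" and g: "!!k. AE x in leb. wp k f x = g k x"
  and gm: "!!k. g k \<in> bmeas leb"
 shows "action j T c (%x. 1 + f x) = (LINT x|cm T. dens j c (f x) (%k. g k x))"
proof -
 have u: "(%x. 1 + f x) \<in> H1_per T" using H1_per_lin(1)[OF T H1_per_const[OF T, of 1] f, of 1 1] by simp
 note U = H1_perD[OF T u] and F = H1_perD[OF T f]
 obtain K where K: "K >= 0" "ALL u : (H1_per T :: (real ^ 'n => complex) set). Lp 4 (cm T) u \<and> lpn 4 (cm T) u <= K * H1_norm T u"
  using H1_per_L4_bound[OF N T] by (elim exE conjE)
 have u4: "Lp 4 (cm T) (%x. 1 + f x)" using K u by blast
 have wg: "AE x in cm T. wp k (%x. 1 + f x) x = g k x" for k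
 proof -
  have "AE x in leb. wp k (%x. 1 + f x) x = g k x"
   using H1_per_lin(2)[OF T H1_per_const[OF T, of 1] f, of k 1 1] weak_partial_const[of k 1] g[of k] by eventually_elim simp
  then show ?thesis by (rule AE_cm)
 qed
 let ?w = "%k. wp k (%x. 1 + f x)"
 have i1: "integrable (cm T) (%x. ?w k x \<bullet> ?w k x)" for k by (rule integrable_inner_L2(1)[OF U(6) U(6)])
 have i2: "integrable (cm T) (%x. (1 - (cmod (1 + f x))^2)^2)" by (rule quartic_integrable[OF U(5) u4])
 have i3: "integrable (cm T) (%x. ?w j x \<bullet> (- \<i> * (1 + f x)))" by (rule integrable_inner_L2(1)[OF U(6) Lp_mult[OF U(5)]])
 have "action j T c (%x. 1 + f x) = 1/2 * (\<Sum>k\<in>UNIV. \<integral>x. ?w k x \<bullet> ?w k x \<partial>cm T) + 1/4 * (LINT x|cm T. (1 - (cmod (1 + f x))^2)^2)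
   - c/2 * (LINT x|cm T. ?w j x \<bullet> (- \<i> * (1 + f x)))"
  unfolding action_eq[OF T u] Dir_def Mom_def ..
 also have "... = (LINT x|cm T. 1/2 * (\<Sum>k\<in>UNIV. ?w k x \<bullet> ?w k x) + 1/4 * (1 - (cmod (1 + f x))^2)^2 - c/2 * (?w j x \<bullet> (- \<i> * (1 + f x))))"
  using i1 i2 i3
  by (simp only: Bochner_Integration.integral_add Bochner_Integration.integral_diff Bochner_Integration.integral_sum Bochner_Integration.integrable_sum
    Bochner_Integration.integrable_add integrable_mult_right integral_mult_right_zero)
 also have "... = (LINT x|cm T. dens j c (f x) (%k. g k x))"
 proof (rule integral_cong_AE)
  have "AE x in cm T. ALL k:UNIV. ?w k x = g k x" using wg by (intro AE_finite_allI) auto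
  then show "AE x in cm T. 1/2 * (\<Sum>k\<in>UNIV. ?w k x \<bullet> ?w k x) + 1/4 * (1 - (cmod (1 + f x))^2)^2 - c/2 * (?w j x \<bullet> (- \<i> * (1 + f x))) = dens j c (f x) (%k. g k x)"
   by eventually_elim (simp only: dens_def i_inner power2_norm_eq_inner UNIV_I ball_simps)
  have fm: "f \<in> bmeas (cm T)" "?w k \<in> bmeas (cm T)" "g k \<in> bmeas (cm T)" for k by (intro measurable_cm F U gm)+
  note [measurable] = fm
  show "(%x. 1/2 * (\<Sum>k\<in>UNIV. ?w k x \<bullet> ?w k x) + 1/4 * (1 - (cmod (1 + f x))^2)^2 - c/2 * (?w j x \<bullet> (- \<i> * (1 + f x)))) \<in> bmeas (cm T)" by measurable
  show "(%x. dens j c (f x) (%k. g k x)) \<in> bmeas (cm T)" unfolding dens_def by measurable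
 qed
 finally show ?thesis .
qed

lemma lat_unique:
 assumes \<rho>: "2 * \<rho> < T" and "ALL i. \<bar>(x + lat T m) $ i\<bar> <= \<rho>" "ALL i. \<bar>(x + lat T m') $ i\<bar> <= \<rho>"
 shows "m = m'"
proof -
 have "m $ i = m' $ i" for i
 proof -
  have "\<bar>T * of_int (m $ i) - T * of_int (m' $ i)\<bar> <= 2 * \<rho>" using assms(2,3)[rule_format, of i] by simp
  then have "\<bar>T\<bar> * \<bar>of_int (m $ i - m' $ i)\<bar> < T" using \<rho> by (simp only: right_diff_distrib[symmetric] abs_mult of_int_diff)
  moreover from this have T: "T > 0" using mult_nonneg_nonneg[OF abs_ge_zero[of T] abs_ge_zero[of "of_int (m $ i - m' $ i)"]] by linarith
  ultimately have "\<bar>of_int (m $ i - m' $ i) :: real\<bar> < 1" by (simp add: mult_less_cancel_left1)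
  then show ?thesis by linarith
 qed
 then show ?thesis by (simp add: vec_eq_iff)
qed

text \<open>
The support fits into one period, so its translates do not overlap and nonlinear expressions commute with periodization.
\<close>

lemma per_disjoint:
 fixes h :: "real ^ 'n => 'b :: comm_monoid_add"
 assumes h: "!!z. \<not> (ALL i. \<bar>z $ i\<bar> <= \<rho>) ==> h z = 0"
 shows "2 * \<rho> < T ==> ALL i. \<bar>(x + lat T m) $ i\<bar> <= \<rho> ==> per T h x = h (x + lat T m)"
  and "ALL m. \<not> (ALL i. \<bar>(x + lat T m) $ i\<bar> <= \<rho>) ==> per T h x = 0"
proof -
 assume \<rho>: "2 * \<rho> < T" and m: "ALL i. \<bar>(x + lat T m) $ i\<bar> <= \<rho>"
 have "per T h x = (\<Sum>m\<in>{m}. h (x + lat T m))"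
 proof (rule per_eq_sum)
  fix m' assume "m' \<notin> {m}"
  then have "\<not> (ALL i. \<bar>(x + lat T m') $ i\<bar> <= \<rho>)" using lat_unique[OF \<rho> m, of m'] by blast
  then show "h (x + lat T m') = 0" by (rule h)
 qed simp
 then show "per T h x = h (x + lat T m)" by simp
next
 assume 0: "ALL m. \<not> (ALL i. \<bar>(x + lat T m) $ i\<bar> <= \<rho>)"
 have "per T h x = (\<Sum>m\<in>{}. h (x + lat T m))" by (rule per_eq_sum) (use 0 h in auto)
 then show "per T h x = 0" by simp
qed

text \<open>
Because the density vanishes at zero, the action over one cell is an integral over the whole space that does not depend on \<open>T\<close>.
\<close>

lemma action_periodization:
 fixes f :: "real ^ 'n => complex" and g :: "'n => real ^ 'n => complex" and j :: 'n and b c t :: real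
 assumes N: "CARD('n) <= 3" and T: "T > 0" "2 * \<rho> < T" and w: "!!k. is_weak_partial k f (g k)"
  and f: "!!z. \<not> (ALL i. \<bar>z $ i\<bar> <= \<rho>) ==> f z = 0" and g: "!!k z. \<not> (ALL i. \<bar>z $ i\<bar> <= \<rho>) ==> g k z = 0"
  and m: "f \<in> bmeas borel" "!!k. g k \<in> bmeas borel"
  and B: "!!x. cmod (f x) <= 2" "!!k x. cmod (g k x) <= b" and c: "0 <= c" and t: "0 <= t" "t <= 1"
 defines "D \<equiv> %x. dens j c (of_real t * f x) (%k. of_real t * g k x)"
 shows "per T f \<in> H1_per T" "action j T c (%x. 1 + of_real t * per T f x) = (LINT x|leb. D x)" "integrable leb D"
  "\<bar>D x\<bar> <= 1/2 * (CARD('n) * b^2) + 25 + c/2 * (b * 3)"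
proof -
 define S where "S = {z :: real ^ 'n. ALL i. \<bar>z $ i\<bar> <= \<rho>}"
 have "S = cbox (\<chi> i. - \<rho>) (\<chi> i. \<rho>)" by (auto simp: S_def mem_box_cart abs_le_iff) (metis minus_le_iff)+
 then have Sb: "bounded S" and Sm: "S \<in> lmeasurable" by simp_all
 define C where "C = max 2 b"
 have B': "cmod (f x) <= C" "cmod (g k x) <= C" for k x using B(1)[of x] B(2)[of k x] by (auto simp: C_def)
 have fS: "x \<notin> S ==> f x = 0" and gS: "x \<notin> S ==> g k x = 0" for k x using f g by (auto simp: S_def)
 show P: "per T f \<in> H1_per T" by (rule per_H1(1)[OF T(1) Sb w fS gS m B'])
 have P2: "AE x in leb. wp k (per T f) x = per T (g k) x" for k by (rule per_H1(2)[OF T(1) Sb w fS gS m B'])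
 have tf: "(%x. of_real t * per T f x) \<in> H1_per T" using H1_per_lin(1)[OF T(1) P P, of "of_real t" 0] by simp
 have tg: "AE x in leb. wp k (%x. of_real t * per T f x) x = of_real t * per T (g k) x" for k
  using H1_per_lin(2)[OF T(1) P P, of k "of_real t" 0] P2[of k] by eventually_elim simp
 have gb: "per T (g k) \<in> bmeas borel" for k by (rule per_borel[OF T(1) Sb gS m(2)])
 have gl: "(%x. of_real t * per T (g k) x) \<in> bmeas leb" for k
  by (rule measurable_completion) (use gb in measurable)
 have t': "cmod (of_real t * z) <= cmod z" for z using t by (simp add: norm_mult mult_left_le_one_le)
 show Db: "\<bar>D x\<bar> <= 1/2 * (CARD('n) * b^2) + 25 + c/2 * (b * 3)" for x
  unfolding D_def by (rule dens_bound[OF c]) (rule order_trans[OF t' B(1)], rule order_trans[OF t' B(2)])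
 have D0: "D x = 0" if "x \<notin> S" for x using that fS gS by (simp add: D_def dens_zero)
 note [measurable] = m
 have "D \<in> bmeas borel" unfolding D_def dens_def by measurable
 then have Dm: "D \<in> bmeas leb" by (intro measurable_completion) simp
 show iD: "integrable leb D"
 proof (rule Bochner_Integration.integrable_bound[OF _ Dm])
  show "integrable leb (%x. (1/2 * (CARD('n) * b^2) + 25 + c/2 * (b * 3)) * indicator S x :: real)"
   using Sm by (simp add: lmeasurable_iff_integrable)
  show "AE x in leb. norm (D x) <= norm ((1/2 * (CARD('n) * b^2) + 25 + c/2 * (b * 3)) * indicator S x :: real)"
   using order_trans[OF Db abs_ge_self] D0 by (auto simp: indicator_def intro!: AE_I2)
 qed
 have pD: "dens j c (of_real t * per T f x) (%k. of_real t * per T (g k) x) = per T D x" for x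
 proof (cases "EX m. ALL i. \<bar>(x + lat T m) $ i\<bar> <= \<rho>")
  case True
  then obtain m where m: "ALL i. \<bar>(x + lat T m) $ i\<bar> <= \<rho>" by (rule exE)
  have "per T f x = f (x + lat T m)" by (rule per_disjoint(1)[OF f T(2) m])
  moreover have "per T (g k) x = g k (x + lat T m)" for k by (rule per_disjoint(1)[OF g T(2) m])
  moreover have "per T D x = D (x + lat T m)" by (rule per_disjoint(1)[OF _ T(2) m]) (use D0 in "auto simp: S_def")
  ultimately show ?thesis by (simp add: D_def)
 next
  case False
  then have n: "ALL m. \<not> (ALL i. \<bar>(x + lat T m) $ i\<bar> <= \<rho>)" by blast
  have "per T f x = 0" by (rule per_disjoint(2)[OF f n])
  moreover have "per T (g k) x = 0" for k by (rule per_disjoint(2)[OF g n])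
  moreover have "per T D x = 0" by (rule per_disjoint(2)[OF _ n]) (use D0 in "auto simp: S_def")
  ultimately show ?thesis by (simp add: dens_zero)
 qed
 have "action j T c (%x. 1 + of_real t * per T f x) = (LINT x|cm T. per T D x)"
  unfolding action_dens[OF N T(1) tf tg gl] pD ..
 also have "... = (LINT x|leb. D x)"
  using per_unfold(1)[OF T(1) Sb, of D "%_. 1 :: real"] iD D0 by simp
 finally show "action j T c (%x. 1 + of_real t * per T f x) = (LINT x|leb. D x)" .
qed

lemma measure_symmetric_box:
 fixes r :: "'n::finite => real"
 assumes "!!i. 0 <= r i"
 shows "{x :: real ^ 'n. ALL i. \<bar>x $ i\<bar> <= r i} \<in> lmeasurable" "measure leb {x :: real ^ 'n. ALL i. \<bar>x $ i\<bar> <= r i} = (\<Prod>i\<in>UNIV. 2 * r i)"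
proof -
 have "- a <= b \<longleftrightarrow> - b <= a" for a b :: real by linarith
 then have e: "{x :: real ^ 'n. ALL i. \<bar>x $ i\<bar> <= r i} = cbox (\<chi> i. - r i) (\<chi> i. r i)" by (auto simp: mem_box_cart abs_le_iff)
 show "{x :: real ^ 'n. ALL i. \<bar>x $ i\<bar> <= r i} \<in> lmeasurable" unfolding e by simp
 have "0 \<in> cbox (\<chi> i. - r i) (\<chi> i. r i)" using assms by (simp add: mem_box_cart)
 then have "cbox (\<chi> i. - r i) (\<chi> i. r i) ~= {}" by blast
 from content_cbox_cart[OF this] show "measure leb {x :: real ^ 'n. ALL i. \<bar>x $ i\<bar> <= r i} = (\<Prod>i\<in>UNIV. 2 * r i)" unfolding e by simp
qed

text \<open>
The volume of the region where the wave is undisturbed, compared with that of the whole support: their ratio tends to one.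
\<close>

lemma power_ratio:
 assumes K: "0 < K" and a: "0 < a"
 shows "EX R>1. K * R ^ n < (K + a) * (R - 1 :: real) ^ n"
proof -
 have "((%R :: real. (1 - 1 / R) ^ n) \<longlongrightarrow> (1 - 0) ^ n) at_top"
  by (intro tendsto_intros tendsto_divide_0[OF tendsto_const] filterlim_at_top_imp_at_infinity filterlim_ident)
 moreover have "K / (K + a) < (1 - 0) ^ n" using K a by simp
 ultimately have "eventually (%R :: real. K / (K + a) < (1 - 1 / R) ^ n) at_top" by (rule order_tendstoD(1))
 then have "eventually (%R :: real. K / (K + a) < (1 - 1 / R) ^ n \<and> 1 < R) at_top" using eventually_gt_at_top by (rule eventually_conj)
 then obtain R :: real where R: "K / (K + a) < (1 - 1 / R) ^ n" "1 < R" by (auto simp: eventually_at_top_linorder)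
 have "R - 1 = (1 - 1 / R) * R" using R(2) by (simp add: field_simps)
 then have e: "(R - 1) ^ n = (1 - 1 / R) ^ n * R ^ n" by (simp add: power_mult_distrib)
 have "K < (K + a) * (1 - 1 / R) ^ n" using R(1) K a by (simp add: pos_divide_less_eq mult.commute)
 then have "K * R ^ n < (K + a) * (1 - 1 / R) ^ n * R ^ n" using R(2) by (intro mult_strict_right_mono) auto
 then show ?thesis using R(2) e by (auto simp: mult.assoc)
qed

text \<open>
With the crude density bound \<open>K\<close> on the support box \<open>S\<close>, and the exact value \<open>- c\<^sup>2 / 8\<close> on the inner box \<open>I\<close>, the action at the end is at most
\<open>K |S| - (K + c\<^sup>2 / 8) |I|\<close>. Both boxes have the same extent in direction \<open>j\<close>, and \<open>power_ratio\<close> provides \<open>R\<close>. The bound along the segment is \<open>K |S|\<close>.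
\<close>

lemma test_path:
 fixes j :: "'n::finite"
 assumes N: "CARD('n) <= 3" and c: "c > 0"
 shows "EX \<rho>>0. EX M>0. ALL T>\<rho>. EX f:H1_per T. action j T c (%x. 1 + f x) < 0 \<and> (ALL t:{0..1}. action j T c (%x. 1 + of_real t * f x) <= M)"
proof -
 define b where "b = c/2 + 2"
 define K where "K = 1/2 * (CARD('n) * b^2) + 25 + c/2 * (b * 3)"
 have K: "K > 0" unfolding K_def b_def using c by (intro add_pos_nonneg add_nonneg_pos mult_nonneg_nonneg) auto
 define n where "n = CARD('n) - 1"
 obtain R where R: "R > 1" "K * R ^ n < (K + c^2 / 8) * (R - 1) ^ n" using power_ratio[OF K, of "c^2 / 8" n] c by auto
 define h where "h = 2 * pi / c"
 have h: "h > 0" using c by (simp add: h_def)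
 define F where "F i s = (if i = j then wave c s - 1 else cutoff R s)" for i s
 define F' where "F' i s = (if i = j then wave' c s else cutoff' R s)" for i s
 define r where "r i = (if i = j then h else R)" for i
 define q where "q i = (if i = j then h else R - 1)" for i
 define \<rho> where "\<rho> = max h R"
 define S where "S = {x :: real ^ 'n. ALL i. \<bar>x $ i\<bar> <= r i}"
 define I where "I = {x :: real ^ 'n. ALL i. \<bar>x $ i\<bar> <= q i}"
 have rq: "0 <= r i" "0 <= q i" "r i <= \<rho>" "q i <= r i" for i using h R by (auto simp: r_def q_def \<rho>_def)
 let ?B = "%i. if i = j then 2 else 1 :: real"
 have FB: "cmod (F i s) <= ?B i" for i s using norm_triangle_ineq4[of "wave c s" 1] cutoff_cmod by (simp add: F_def wave_cmod)
 have F'B: "cmod (F' i s) <= (if i = j then c/2 else 1)" for i s using cutoff_cmod c by (simp add: F'_def wave'_def norm_mult wave_cmod)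
 have L: "cmod (F i s - F i t) <= max 1 (c/2) * \<bar>s - t\<bar>" for i s t
 proof -
  have "cmod (F i s - F i t) <= (if i = j then c/2 else 1) * \<bar>s - t\<bar>" using wave_lipschitz[OF c] cutoff_lipschitz by (simp add: F_def)
  also have "... <= max 1 (c/2) * \<bar>s - t\<bar>" by (intro mult_right_mono) auto
  finally show ?thesis .
 qed
 have D: "(F i has_vector_derivative F' i s) (at s)" if "s \<notin> {h, - h, R, - R, R - 1, - (R - 1)}" for i s
 proof (cases "i = j")
  case True
  have "(wave c has_vector_derivative wave' c s) (at s)" using that by (intro wave_derivative[OF c]) (auto simp: h_def abs_if split: if_splits)
  then have "((%s. wave c s - 1) has_vector_derivative wave' c s) (at s)" by (auto intro!: derivative_eq_intros)
  then show ?thesis using True by (simp add: F_def[abs_def] F'_def)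
 next
  case False
  have "(cutoff R has_vector_derivative cutoff' R s) (at s)" using that by (intro cutoff_derivative[OF R(1)]) (auto simp: abs_if split: if_splits)
  moreover have "F i = cutoff R" using False by (simp add: F_def fun_eq_iff)
  ultimately show ?thesis using False by (simp add: F'_def)
 qed
 have Fm: "F i \<in> bmeas borel" "F' i \<in> bmeas borel" for i
 proof -
  have [measurable]: "cis \<in> bmeas borel" by (intro borel_measurable_continuous_onI continuous_intros)
  show "F i \<in> bmeas borel" unfolding F_def[abs_def] wave_def clamp1_def cutoff_def by measurable
  show "F' i \<in> bmeas borel" unfolding F'_def[abs_def] wave'_def cutoff'_def wave_def clamp1_def by measurable
 qed
 define f where "f = tensor F"
 define g where "g = tensor_partial F F'"
 have W: "is_weak_partial k f (g k)" "f \<in> bmeas borel" "g k \<in> bmeas borel" for k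
  unfolding f_def g_def by (rule tensor_weak_partial[where F = F and F' = F' and B = ?B and L = "max 1 (c/2)" and E = "{h, - h, R, - R, R - 1, - (R - 1)}"], use Fm FB L D in auto)+
 have F0: "F i s = 0 \<and> F' i s = 0" if "r i < \<bar>s\<bar>" for i s
  using that wave_outside[OF c, of s] by (auto simp: F_def F'_def r_def h_def wave'_def cutoff_def cutoff'_def split: if_splits)
 have S0: "f x = 0" "g k x = 0" if x: "x \<notin> S" for x k
 proof -
  obtain i where i: "r i < \<bar>x $ i\<bar>" using x by (auto simp: S_def not_le)
  show "f x = 0" unfolding f_def tensor_def using F0[OF i] by (intro prod_zero) auto
  show "g k x = 0"
  proof (cases "i = k")
   case True then show ?thesis using F0[OF i] by (simp add: g_def tensor_partial_def)
  next
   case False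
   then have "(\<Prod>i\<in>UNIV - {k}. F i (x $ i)) = 0" using F0[OF i] by (intro prod_zero) auto
   then show ?thesis by (simp add: g_def tensor_partial_def)
  qed
 qed
 have \<rho>0: "f z = 0" "g k z = 0" if z: "\<not> (ALL i. \<bar>z $ i\<bar> <= \<rho>)" for z k
 proof -
  obtain i where "\<not> \<bar>z $ i\<bar> <= \<rho>" using z by blast
  then have "\<not> \<bar>z $ i\<bar> <= r i" using rq(3)[of i] by linarith
  then have "z \<notin> S" unfolding S_def by blast
  then show "f z = 0" "g k z = 0" by (rule S0)+
 qed
 have fB: "cmod (f x) <= 2" for x
 proof -
  have "cmod (f x) <= (\<Prod>i\<in>UNIV. ?B i)" unfolding f_def tensor_def prod_norm[symmetric] by (intro prod_mono) (use FB in auto)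
  then show ?thesis by simp
 qed
 have gB: "cmod (g k x) <= b" for k x
 proof -
  have "(\<Prod>i\<in>UNIV - {k}. cmod (F i (x $ i))) <= (\<Prod>i\<in>UNIV - {k}. ?B i)" by (intro prod_mono) (use FB in auto)
  also have "... = (if k = j then 1 else 2)" by (auto simp: prod.delta)
  finally have "cmod (g k x) <= (if k = j then c/2 else 1) * (if k = j then 1 else 2)"
   unfolding g_def tensor_partial_def norm_mult prod_norm[symmetric] using F'B[of k "x $ k"] c by (intro mult_mono) (auto intro: prod_nonneg)
  then show ?thesis using c by (auto simp: b_def split: if_splits)
 qed
 have inner: "dens j c (of_real 1 * f x) (%k. of_real 1 * g k x) = - (c^2 / 8)" if x: "x \<in> I" for x
 proof -
  have xi: "F i (x $ i) = 1" "F' i (x $ i) = 0" if "i ~= j" for i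
   using x that by (auto simp: I_def q_def F_def F'_def cutoff_def cutoff'_def dest!: spec[of _ i])
  have xj: "\<bar>x $ j\<bar> <= h" using x by (auto simp: I_def q_def dest!: spec[of _ j])
  have p1: "(\<Prod>i\<in>UNIV - {j}. F i (x $ i)) = 1" by (intro prod.neutral) (use xi in auto)
  let ?w = "wave c (x $ j)"
  have fx: "f x = ?w - 1" unfolding f_def tensor_remove[of F x j] p1 by (simp add: F_def)
  have gx: "g k x = (if k = j then - \<i> * of_real (c/2) * ?w else 0)" for k
   unfolding g_def tensor_partial_def using xi p1 xj by (auto simp: F'_def wave'_def h_def)
  have s: "(\<Sum>k\<in>UNIV. (cmod (g k x))^2) = c^2 / 4"
  proof -
   have "(\<Sum>k\<in>UNIV. (cmod (g k x))^2) = (\<Sum>k\<in>UNIV. if k = j then (c/2)^2 else 0)"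
    using c by (intro sum.cong refl) (simp add: gx norm_mult wave_cmod)
   then show ?thesis by (simp add: power_divide)
  qed
  have ii: "\<i> * g j x = of_real (c/2) * ?w" by (simp add: gx complex_eq_iff)
  have "(\<i> * g j x) \<bullet> (1 + f x) = (of_real (c/2) * ?w) \<bullet> ?w" unfolding ii fx by simp
  also have "... = c/2 * (?w \<bullet> ?w)" by (simp add: inner_complex_def algebra_simps)
  also have "... = c/2" by (simp add: power2_norm_eq_inner[symmetric] wave_cmod)
  finally have m: "(\<i> * g j x) \<bullet> (1 + f x) = c/2" .
  have "cmod (1 + f x) = 1" by (simp add: fx wave_cmod)
  then show ?thesis unfolding dens_def of_real_1 mult_1 s m by (simp add: power2_eq_square)
 qed
 have Sl: "S \<in> lmeasurable" "I \<in> lmeasurable" unfolding S_def I_def by (intro measure_symmetric_box(1) rq)+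
 have vol: "measure leb S = 2 * h * 2 ^ n * R ^ n" "measure leb I = 2 * h * 2 ^ n * (R - 1) ^ n"
 proof -
  have pr: "(\<Prod>i\<in>UNIV. 2 * (if i = j then h else s)) = 2 * h * 2 ^ n * s ^ n" for s
  proof -
   have "(\<Prod>i\<in>UNIV. 2 * (if i = j then h else s)) = 2 * h * (\<Prod>i\<in>UNIV - {j}. 2 * (if i = j then h else s))" by (subst prod.remove[of _ j]) auto
   also have "(\<Prod>i\<in>UNIV - {j}. 2 * (if i = j then h else s)) = (\<Prod>i\<in>UNIV - {j}. 2 * s)" by (intro prod.cong) auto
   also have "... = (2 * s) ^ n" by (simp add: n_def)
   finally show ?thesis by (simp add: power_mult_distrib)
  qed
  show "measure leb S = 2 * h * 2 ^ n * R ^ n" unfolding S_def measure_symmetric_box(2)[of r, OF rq(1)] unfolding r_def by (rule pr)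
  show "measure leb I = 2 * h * 2 ^ n * (R - 1) ^ n" unfolding I_def measure_symmetric_box(2)[of q, OF rq(2)] unfolding q_def by (rule pr)
 qed
 define M where "M = K * measure leb S"
 have M: "M > 0" unfolding M_def vol using K h R by simp
 have iS: "integrable leb (%x. K * indicator S x :: real)" "integrable leb (%x. (K + c^2 / 8) * indicator I x :: real)"
  using Sl by (auto simp: lmeasurable_iff_integrable)
 have IS: "I \<subseteq> S" using rq(4) by (auto simp: I_def S_def intro: order_trans)
 have "per T f \<in> H1_per T \<and> action j T c (%x. 1 + per T f x) < 0 \<and> (ALL t:{0..1}. action j T c (%x. 1 + of_real t * per T f x) <= M)" if T: "T > 2 * \<rho>" for T
 proof -
  have T0: "T > 0" using T h by (auto simp: \<rho>_def)
  have c0: "0 <= c" using c by simp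
  let ?D = "%t x. dens j c (of_real t * f x) (%k. of_real t * g k x)"
  have iD: "integrable leb (?D t)" and Db: "\<bar>?D t x\<bar> <= K" and Da: "action j T c (%x. 1 + of_real t * per T f x) = (LINT x|leb. ?D t x)"
   if "t \<in> {0..1}" for t x
  proof -
   have t: "0 <= t" "t <= 1" using that by auto
   show "integrable leb (?D t)" by (rule action_periodization(3)[OF N T0 T W(1) \<rho>0 W(2,3) fB gB c0 t])
   show "\<bar>?D t x\<bar> <= K" unfolding K_def by (rule action_periodization(4)[OF N T0 T W(1) \<rho>0 W(2,3) fB gB c0 t])
   show "action j T c (%x. 1 + of_real t * per T f x) = (LINT x|leb. ?D t x)" by (rule action_periodization(2)[OF N T0 T W(1) \<rho>0 W(2,3) fB gB c0 t])
  qed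
  have D0: "?D t x = 0" if "x \<notin> S" for t x using S0[OF that] by (simp add: dens_zero)
  have "action j T c (%x. 1 + of_real t * per T f x) <= M" if t: "t \<in> {0..1}" for t
  proof -
   have "(LINT x|leb. ?D t x) <= (LINT x|leb. K * indicator S x)"
   proof (rule integral_mono[OF iD[OF t] iS(1)])
    show "?D t x <= K * indicator S x" for x using Db[OF t, of x] D0[of x t] by (auto simp: indicator_def)
   qed
   then show ?thesis unfolding Da[OF t] M_def using Sl by simp
  qed
  moreover have "action j T c (%x. 1 + of_real 1 * per T f x) < 0"
  proof -
   have t: "1 \<in> {0..1 :: real}" by simp
   have "(LINT x|leb. ?D 1 x) <= (LINT x|leb. K * indicator S x - (K + c^2 / 8) * indicator I x)"
   proof (rule integral_mono[OF iD[OF t] Bochner_Integration.integrable_diff[OF iS]])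
    show "?D 1 x <= K * indicator S x - (K + c^2 / 8) * indicator I x" for x
     using Db[OF t, of x] D0[of x 1] inner[of x] IS by (cases "x \<in> I"; cases "x \<in> S") auto
   qed
   also have "... = K * measure leb S - (K + c^2 / 8) * measure leb I"
    using iS Sl by simp
   also have "... = 2 * h * 2 ^ n * (K * R ^ n - (K + c^2 / 8) * (R - 1) ^ n)" unfolding vol by (simp add: algebra_simps)
   also have "... < 0" using R(2) h by (intro mult_pos_neg) auto
   finally show ?thesis unfolding Da[OF t] .
  qed
  moreover have "per T f \<in> H1_per T" by (rule action_periodization(1)[OF N T0 T W(1) \<rho>0 W(2,3) fB gB c0 order_refl zero_le_one])
  ultimately show ?thesis by simp
 qed
 moreover have "2 * \<rho> > 0" using h by (simp add: \<rho>_def)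
 ultimately show ?thesis using M by (intro exI[of _ "2 * \<rho>"] conjI exI[of _ M] allI impI) (auto intro!: bexI)
qed

section \<open>The mountain-pass solution\<close>

text \<open>
The constant direction \<open>cub a\<close> shows that the nonlinearity vanishes at \<open>a\<close>, so the modulus of \<open>a\<close> is \<open>0\<close> or \<open>1\<close>; both values contradict the bounds on the action.
\<close>

lemma not_constant:
 fixes u :: "real ^ 'n => complex"
 assumes N: "CARD('n) <= 3" and T: "T > 0" and u: "u \<in> H1_per T" and crit: "!!v. v \<in> H1_per T ==> dact j T c u v = 0"
  and I: "0 < action j T c u" "4 * action j T c u < T ^ CARD('n)"
 shows "\<not> (EX a. AE x in leb. u x = a)"
proof
 assume "EX a. AE x in leb. u x = a"
 then obtain a where a: "AE x in leb. u x = a" by (rule exE)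
 have ca: "(%x :: real ^ 'n. a) \<in> H1_per T" and cb: "(%x :: real ^ 'n. cub a) \<in> H1_per T" by (rule H1_per_const[OF T])+
 have vol: "measure (cm T :: (real ^ 'n) measure) (space (cm T)) = T ^ CARD('n)" using T by (intro measure_cm) simp
 have w: "wp k u = wp k (%x. a)" for k by (rule weak_partial_cong_AE[OF a])
 have m: "u \<in> bmeas (cm T)" by (rule measurable_cm[OF H1_perD(2)[OF T u]])
 have "dact j T c u (%x. cub a) = - (LINT x|cm T. cub (u x) \<bullet> cub a)"
  using Mom_const(1)[OF T cb, where a = a and j = j] Mom_const(2)[OF T cb, where a = a] unfolding dact_def Dir_def Mom_def w by simp
 also have "(LINT x|cm T. cub (u x) \<bullet> cub a) = (LINT x|(cm T :: (real ^ 'n) measure). cub a \<bullet> cub a)"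
  by (rule integral_cong_AE, intro borel_measurable_inner cub_measurable m borel_measurable_const, simp) (use AE_cm[OF a] in eventually_elim, simp)
 also have "... = T ^ CARD('n) * (cub a \<bullet> cub a)" using vol by simp
 finally have "cub a = 0" using crit[OF cb] T by simp
 then have "cmod a = 1 \<or> a = 0" using norm_ge_zero[of a] by (auto simp: cub_def power2_eq_1_iff simp del: norm_ge_zero)
 moreover have "action j T c u = T ^ CARD('n) * (1 - (cmod a)^2)^2 / 4"
  unfolding H1_cong_AE(1)[OF T u ca a] action_eq[OF T ca] Mom_const[OF T ca] using vol by simp
 ultimately show False using I by auto
qed

theorem theorem1p2:
  fixes j :: "'n::finite" and c :: real
  assumes "CARD('n) \<in> {2, 3}"
    and "0 < c" and "c < sqrt 2"
  shows "\<exists>Tbar>0. \<exists>M>0. \<forall>T>Tbar. \<exists>\<psi> :: real ^ 'n \<Rightarrow> complex.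
           periodic_solution j T c \<psi> \<and>
           \<not> (\<exists>a. AE x in lebesgue. \<psi> x = a) \<and>
           mountain_pass j T c \<psi> \<and>
           0 < action j T c \<psi> \<and> action j T c \<psi> \<le> M"
proof -
 have N: "CARD('n) <= 3" and N1: "CARD('n) ~= 0" using assms(1) by auto
 obtain \<rho> M where \<rho>: "\<rho> > 0" and M: "M > 0"
  and e: "ALL T>\<rho>. EX f:H1_per T. action j T c (%x. 1 + f x) < 0 \<and> (ALL t:{0..1}. action j T c (%x. 1 + of_real t * f x) <= M)"
  using test_path[OF N assms(2), of j] by (elim exE conjE)
 \<comment> \<open>Above \<open>4 M\<close> the zero function, with action \<open>T\<^sup>N / 4\<close>, lies above the mountain-pass level.\<close>
 define Tbar where "Tbar = max \<rho> (4 * M + 1)"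
 have "EX \<psi> :: real ^ 'n => complex. periodic_solution j T c \<psi> \<and> \<not> (EX a. AE x in leb. \<psi> x = a) \<and>
   mountain_pass j T c \<psi> \<and> 0 < action j T c \<psi> \<and> action j T c \<psi> <= M" if "T > Tbar" for T
 proof -
  have T: "T > 0" "T > \<rho>" "T > 4 * M" "T > 1" using that M \<rho> by (auto simp: Tbar_def)
  interpret H: semi_hilbert "H1_per T :: (real ^ 'n => complex) set" "H1_inner T" "H1_norm T" by (rule H1_semi_hilbert[OF T(1)])
  obtain f where f: "f \<in> H1_per T" "action j T c (%x. 1 + f x) < 0" "ALL t:{0..1}. action j T c (%x. 1 + of_real t * f x) <= M"
   using e T(2) by blast
  define e where "e = (%x. 1 + f x)"
  have c1: "(%x. 1) \<in> H1_per T" by (rule H1_per_const[OF T(1)])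
  have line: "(%x. 1 + of_real t * f x) \<in> H1_per T" for t :: real using H1_per_lin(1)[OF T(1) c1 f(1), of 1 "of_real t"] by simp
  have eH: "e \<in> H1_per T" using line[of 1] by (simp add: e_def)
  define Q0 where "Q0 = (%u :: real ^ 'n => complex. AE x in leb. u x = 1)"
  define Q1 where "Q1 = (%u. AE x in leb. u x = e x)"
  have \<Gamma>: "paths T (%x. 1) e = {\<alpha>. H.cpath \<alpha> \<and> Q0 (\<alpha> 0) \<and> Q1 (\<alpha> 1)}"
   by (simp add: paths_def H.cpath_def Q0_def Q1_def fun_diff_def conj_assoc)
  define \<alpha>0 where "\<alpha>0 = (%(t :: real) x. 1 + of_real t * f x)"
  have \<alpha>0: "\<alpha>0 \<in> paths T (%x. 1) e"
  proof -
   have d: "\<alpha>0 s - \<alpha>0 t = (s - t) *R f" for s t by (simp add: \<alpha>0_def fun_eq_iff scaleR_fun_def scaleR_conv_of_real algebra_simps)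
   have n: "H1_norm T (\<alpha>0 s - \<alpha>0 t) = \<bar>s - t\<bar> * H1_norm T f" for s t
   proof -
    have "(H1_norm T ((s - t) *R f))^2 = (\<bar>s - t\<bar> * H1_norm T f)^2"
     using H.nrm_sq[OF H1_per_scaleR[OF T(1) f(1), of "s - t"]] H.nrm_sq[OF f(1)] H.ip_scale[OF f(1) H1_per_scaleR[OF T(1) f(1)], of "s - t" "s - t"]
      H.ip_scale[OF f(1) f(1), of "s - t"] H.ip_sym[OF f(1) H1_per_scaleR[OF T(1) f(1)], of "s - t"]
     by (simp add: power_mult_distrib power2_eq_square mult_ac)
    then show ?thesis unfolding d using H1_norm_nonneg[OF T(1)] H1_per_scaleR[OF T(1) f(1)] f(1) by (simp add: power2_eq_iff_nonneg)
   qed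
   have "((%s. H1_norm T (\<alpha>0 s - \<alpha>0 t)) \<longlongrightarrow> 0) (at t within {0..1})" for t
   proof -
    have "((%s. \<bar>s - t\<bar> * H1_norm T f) \<longlongrightarrow> \<bar>t - t\<bar> * H1_norm T f) (at t within {0..1})" by (intro tendsto_intros)
    then show ?thesis unfolding n by simp
   qed
   then show ?thesis unfolding \<Gamma> using line by (simp add: H.cpath_def Q0_def Q1_def \<alpha>0_def e_def)
  qed
  have e0: "action j T c e < 0" using f(2) by (simp add: e_def)
  obtain \<kappa> where \<kappa>: "\<kappa> > 0" and cross: "ALL \<alpha>. H.cpath \<alpha> --> (AE x in leb. \<alpha> 0 x = 1) --> action j T c (\<alpha> 1) < 0 --> (EX t:{0..1}. \<kappa> <= action j T c (\<alpha> t))"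
   using path_crosses_barrier[where j = j, OF N T(1) assms(2,3)] by (elim exE conjE)
  have mem: "\<alpha> t \<in> H1_per T" if "H.cpath \<alpha>" "t \<in> {0..1}" for \<alpha> t using that by (simp add: H.cpath_def)
  let ?c = "INF \<alpha>\<in>paths T (%x. 1) e. SUP t\<in>{0..1}. action j T c (\<alpha> t)"
  have mp: "\<kappa> <= ?c \<and> (ALL \<alpha>:paths T (%x. 1) e. ?c <= (SUP t\<in>{0..1}. action j T c (\<alpha> t))) \<and> (EX u:H1_per T. action j T c u = ?c \<and> (ALL v:H1_per T. dact j T c u v = 0))"
  proof (rule H.mountain_pass_abstract[where ?Q0.0 = Q0 and ?Q1.0 = Q1 and \<kappa>' = 0])
   show "dact j T c u (v + w) = dact j T c u v + dact j T c u w" if "u \<in> H1_per T" "v \<in> H1_per T" "w \<in> H1_per T" for u v w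
    by (rule dact_add_right[OF N T(1) that])
   show "dact j T c u (r *R v) = r * dact j T c u v" if "u \<in> H1_per T" "v \<in> H1_per T" for u v r by (rule dact_scaleR_right[OF T(1) that])
   show "EX L>=0. ALL u:H1_per T. H1_norm T u <= R -->
    (ALL v:H1_per T. \<bar>dact j T c u v\<bar> <= L * H1_norm T v) \<and>
    (ALL w:H1_per T. H1_norm T w <= R --> (ALL v:H1_per T. \<bar>dact j T c u v - dact j T c w v\<bar> <= L * H1_norm T (u - w) * H1_norm T v)) \<and>
    (ALL h:H1_per T. H1_norm T h <= 1 --> \<bar>action j T c (u + h) - action j T c u - dact j T c u h\<bar> <= L * (H1_norm T h)^2)" for R
    by (rule action_regular[OF N T(1)])
   show "EX R. ALL u:H1_per T. action j T c u <= K --> H1_norm T u <= R" for K by (rule action_coercive[OF N T(1)])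
   show "EX r u. strict_mono (r :: nat => nat) \<and> u \<in> H1_per T \<and> (%n. H1_norm T (g (r n) - u)) ---> 0"
    if "!!n. g n \<in> H1_per T" "!!n. H1_norm T (g n) <= R" "!!n v. v \<in> H1_per T ==> \<bar>dact j T c (g n) v\<bar> <= 1 / real (Suc n) * H1_norm T v"
    for g :: "nat => real ^ 'n => complex" and R
    by (rule palais_smale[OF N T(1) that])
   show "paths T (%x. 1) e ~= {}" using \<alpha>0 by blast
   show "action j T c u <= 0" if "u \<in> H1_per T" "Q0 u \<or> Q1 u" for u
    using that H1_cong_AE(1)[OF T(1) that(1) c1, of j c] H1_cong_AE(1)[OF T(1) that(1) eH, of j c] e0 action_one[OF T(1), of j c] by (auto simp: Q0_def Q1_def)
   show "EX t:{0..1}. \<kappa> <= action j T c (\<alpha> t)" if "\<alpha> \<in> paths T (%x. 1) e" for \<alpha>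
   proof -
    have p: "H.cpath \<alpha>" "Q0 (\<alpha> 0)" "Q1 (\<alpha> 1)" using that unfolding \<Gamma> by auto
    have "action j T c (\<alpha> 1) < 0" using H1_cong_AE(1)[OF T(1) mem[OF p(1), of 1] eH, of j c] p(3) e0 by (simp add: Q1_def)
    then show ?thesis using cross p(1,2) by (simp add: Q0_def)
   qed
  qed (use \<Gamma> \<kappa> in auto)
  then obtain u where u: "u \<in> H1_per T" "action j T c u = ?c" "ALL v:H1_per T. dact j T c u v = 0" by blast
  have crit: "!!v. v \<in> H1_per T ==> dact j T c u v = 0" using u(3) by blast
  have pos: "0 < action j T c u" using mp \<kappa> u(2) by linarith
  have "?c <= (SUP t\<in>{0..1}. action j T c (\<alpha>0 t))" using mp \<alpha>0 by blast
  also have "... <= M" by (rule cSUP_least) (use f(3) in "auto simp: \<alpha>0_def")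
  finally have le: "action j T c u <= M" using u(2) by simp
  have "T ^ 1 <= T ^ CARD('n)" using T(4) N1 by (intro power_increasing) auto
  then have big: "4 * action j T c u < T ^ CARD('n)" using le T(3) by simp
  have "mountain_pass j T c u"
   unfolding mountain_pass_def using eH e0 u(2) pos action_one[OF T(1), of j c] by (intro bexI[of _ e]) auto
  moreover have "periodic_solution j T c u"
   unfolding periodic_solution_def using critical_point_from_derivative[OF N T(1) u(1) crit] critical_imp_solves[OF N T(1) u(1) crit] by blast
  moreover have "\<not> (EX a. AE x in leb. u x = a)" by (rule not_constant[OF N T(1) u(1) crit pos big])
  ultimately show ?thesis using pos le by blast
 qed
 then show ?thesis using \<rho> M by (intro exI[of _ Tbar] conjI exI[of _ M] allI impI) (auto simp: Tbar_def)
qed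

end
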